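(* Let $H$ be a weak Hopf algebra, $A$ a left weak $H$-module algebra, $f\colon H\otimes_kH\to A$ a convolution invertible cocycle satisfying conditions (1)–(5) of the context, $E=A\times_\rho^fH$ the associated unitary crossed product, $M$ an $E$-bimodule, and $K=A$. Then $$\mathrm H_K^*(E,M)=\mathrm H^*\bigl(H,M^K\bigr),$$ where $M^K=\{m\in M:\lambda\cdot m=m\cdot\lambda\text{ for all }\lambda\in K\}$ is considered as a right $H$-module via $m\cdot h:=\gamma^{-1}(h^{(1)})\cdot m\cdot\gamma(h^{(2)})$.
   Context: **Weak Hopf algebras.** $k$ is a field, maps are $k$-linear, Sweedler notation $\Delta(h)=h^{(1)}\otimes_k h^{(2)}$. A weak bialgebra is an algebra and coalgebra $H$ with $\Delta(hl)=\Delta(h)\Delta(l)$, $\Delta^2(1)=1^{(1)}\otimes 1^{(2)}1^{(1')}\otimes 1^{(2')}=1^{(1)}\otimes 1^{(1')}1^{(2)}\otimes 1^{(2')}$, $\epsilon(hlm)=\epsilon(hl^{(1)})\epsilon(l^{(2)}m)=\epsilon(hl^{(2)})\epsilon(l^{(1)}m)$. Put $\Pi^L(h)=\epsilon(1^{(1)}h)1^{(2)}$, $\Pi^R(h)=1^{(1)}\epsilon(h1^{(2)})$, $H^R=\mathrm{Im}\,\Pi^R$. It is a weak Hopf algebra if it has an antipode $S$: $h^{(1)}S(h^{(2)})=\Pi^L(h)$, $S(h^{(1)})h^{(2)}=\Pi^R(h)$, $S(h^{(1)})h^{(2)}S(h^{(3)})=S(h)$. $H^R$ is a right $H$-module via $l\cdot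 h=\Pi^R(lh)$, and for a right $H$-module $N$, $\mathrm H^*(H,N):=\mathrm{Ext}_H^*(H^R,N)$. **Crossed product.** $A$ is a left weak $H$-module algebra via $\rho(h\otimes a)=h\cdot a$: $1\cdot a=a$, $h\cdot(aa')=(h^{(1)}\cdot a)(h^{(2)}\cdot a')$, $h\cdot(l\cdot 1_A)=(hl)\cdot 1_A$. Put $a\times h:=a(h^{(1)}\cdot 1_A)\otimes_k h^{(2)}\in A\otimes_k H$. Conditions on $f$: (1) $f(h\otimes l)=f(h^{(1)}\otimes l^{(1)})(h^{(2)}l^{(2)}\cdot 1_A)$; (2) $h\cdot 1_A=(h^{(1)}\cdot(1^{(1)}\cdot 1_A))f(h^{(2)}\otimes 1^{(2)})$; (3) $h\cdot 1_A=(1^{(1)}\cdot 1_A)f(1^{(2)}\otimes h)$; (4) $a\times 1=1^{(1)}\cdot a\otimes_k 1^{(2)}$; (5) $f(h^{(1)}\otimes l^{(1)})(h^{(2)}l^{(2)}\cdot a)=(h^{(1)}\cdot(l^{(1)}\cdot a))f(h^{(2)}\otimes l^{(2)})$ and $f(h^{(1)}\otimes l^{(1)})f(h^{(2)}l^{(2)}\otimes m)=(h^{(1)}\cdot f(l^{(1)}\otimes m^{(1)}))f(h^{(2)}\otimes l^{(2)}m^{(2)})$. Then $E=A\times_\rho^f H$ is the span of the $a\times h$ with product $(a\times h)(b\times l)=a(h^{(1)}\cdot b)f(h^{(2)}\otimes l^{(1)})\times h^{(3)}l^{(2)}$ and unit $1_A\times 1$; it is associative. $f$ is (convolution) invertible: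 with $u_2(h\otimes l)=hl\cdot 1_A$, there is $f^{-1}$ with $u_2*f^{-1}=f^{-1}*u_2=f^{-1}$ and $f*f^{-1}=f^{-1}*f=u_2$. Put $\jmath_\nu(a)=a\times 1$ (an injective algebra map $A\to E$), $\gamma(h)=1_A\times h$, $\gamma^{-1}(h)=\jmath_\nu\bigl(f^{-1}(S(h^{(2)})\otimes h^{(3)})\bigr)\gamma(S(h^{(1)}))$. $E$-bimodules are $K$-bimodules via $\jmath_\nu$ and $K$ is regarded inside $E$ via $\jmath_\nu$. **Cohomology.** $\mathrm H_K^*(E,M)$ is the cohomology of the normalized Hochschild cochain complex $(\mathrm{Hom}_{K^e}(\overline E^{\otimes_K^*},M),b^* )$ of the $K$-algebra $E$, where $\overline E=E/\jmath_\nu(K)$. *)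

theory Defs
  imports
    Complex_Main
    "HOL-Algebra.Module"
    "HOL-Library.Function_Algebras"
    "HOL-Library.Poly_Mapping"
begin

section \<open>Linear algebra and tensor products over a field\<close>

text \<open>
  The ambient vector spaces are types of class \<open>ab_group_add\<close> with an explicit scalar
  multiplication.  The sort \<open>{ring, monoid_mult}\<close> (instead of \<open>ring_1\<close>) is a unital associative
  ring in which \<open>1 = 0\<close> is not excluded.
\<close>

definition k_algebra :: "('k::field \<Rightarrow> 'a::{ring,monoid_mult} \<Rightarrow> 'a) \<Rightarrow> bool" where
  "k_algebra sA \<longleftrightarrow> vector_space sA
     \<and> (\<forall>c x y. sA c (x * y) = sA c x * y) \<and> (\<forall>c x y. sA c (x * y) = x * sA c y)"

text \<open>Linear maps \<open>U \<otimes> V \<rightarrow> W\<close> are given as bilinear maps.\<close>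

definition bilinear_map ::
  "('k::field \<Rightarrow> 'u::ab_group_add \<Rightarrow> 'u) \<Rightarrow> ('k \<Rightarrow> 'v::ab_group_add \<Rightarrow> 'v)
    \<Rightarrow> ('k \<Rightarrow> 'w::ab_group_add \<Rightarrow> 'w) \<Rightarrow> ('u \<Rightarrow> 'v \<Rightarrow> 'w) \<Rightarrow> bool" where
  "bilinear_map sU sV sW B \<longleftrightarrow>
     (\<forall>u. Vector_Spaces.linear sV sW (B u)) \<and> (\<forall>v. Vector_Spaces.linear sU sW (\<lambda>u. B u v))"

text \<open>
  A list of pairs \<open>[(u\<^sub>1,v\<^sub>1),\<dots>,(u\<^sub>n,v\<^sub>n)]\<close> stands for the formal sum of the symbols
  \<open>u\<^sub>i \<otimes> v\<^sub>i\<close>.  The tensor product is the commutative monoid of formal sums modulo the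
  congruence generated by the relations of bilinearity; it is a vector space, the negative of
  \<open>u \<otimes> v\<close> being \<open>(-u) \<otimes> v\<close>.
\<close>

inductive sum_cong :: "('x list \<Rightarrow> 'x list \<Rightarrow> bool) \<Rightarrow> 'x list \<Rightarrow> 'x list \<Rightarrow> bool"
  for R :: "'x list \<Rightarrow> 'x list \<Rightarrow> bool" where
  base: "R s t \<Longrightarrow> sum_cong R s t"
| refl: "sum_cong R s s"
| sym: "sum_cong R s t \<Longrightarrow> sum_cong R t s"
| trans: "sum_cong R s t \<Longrightarrow> sum_cong R t u \<Longrightarrow> sum_cong R s u"
| append: "sum_cong R s s' \<Longrightarrow> sum_cong R t t' \<Longrightarrow> sum_cong R (s @ t) (s' @ t')"
| comm: "sum_cong R (s @ t) (t @ s)"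

inductive bilinear_rel ::
  "('k::field \<Rightarrow> 'u::ab_group_add \<Rightarrow> 'u) \<Rightarrow> ('k \<Rightarrow> 'v::ab_group_add \<Rightarrow> 'v)
    \<Rightarrow> ('u \<times> 'v) list \<Rightarrow> ('u \<times> 'v) list \<Rightarrow> bool"
  for sU :: "'k \<Rightarrow> 'u \<Rightarrow> 'u" and sV :: "'k \<Rightarrow> 'v \<Rightarrow> 'v" where
  "bilinear_rel sU sV [(u + u', v)] [(u, v), (u', v)]"
| "bilinear_rel sU sV [(u, v + v')] [(u, v), (u, v')]"
| "bilinear_rel sU sV [(sU c u, v)] [(u, sV c v)]"
| "bilinear_rel sU sV [(0, v)] []"

inductive trilinear_rel ::
  "('k::field \<Rightarrow> 'u::ab_group_add \<Rightarrow> 'u) \<Rightarrow> ('u \<times> 'u \<times> 'u) list \<Rightarrow> ('u \<times> 'u \<times> 'u) list \<Rightarrow> bool"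
  for s :: "'k \<Rightarrow> 'u \<Rightarrow> 'u" where
  "trilinear_rel s [(u + u', v, w)] [(u, v, w), (u', v, w)]"
| "trilinear_rel s [(u, v + v', w)] [(u, v, w), (u, v', w)]"
| "trilinear_rel s [(u, v, w + w')] [(u, v, w), (u, v, w')]"
| "trilinear_rel s [(s c u, v, w)] [(u, s c v, w)]"
| "trilinear_rel s [(u, s c v, w)] [(u, v, s c w)]"
| "trilinear_rel s [(0, v, w)] []"

text \<open>\<open>tens sU sV t\<close> is the element of \<open>U \<otimes> V\<close>, and \<open>tens3 s t\<close> the element of
  \<open>U \<otimes> U \<otimes> U\<close>, represented by the formal sum \<open>t\<close>.\<close>

definition tens ::
  "('k::field \<Rightarrow> 'u::ab_group_add \<Rightarrow> 'u) \<Rightarrow> ('k \<Rightarrow> 'v::ab_group_add \<Rightarrow> 'v)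
    \<Rightarrow> ('u \<times> 'v) list \<Rightarrow> ('u \<times> 'v) list set" where
  "tens sU sV t = {t'. sum_cong (bilinear_rel sU sV) t t'}"

definition tens3 ::
  "('k::field \<Rightarrow> 'u::ab_group_add \<Rightarrow> 'u) \<Rightarrow> ('u \<times> 'u \<times> 'u) list \<Rightarrow> ('u \<times> 'u \<times> 'u) list set" where
  "tens3 s t = {t'. sum_cong (trilinear_rel s) t t'}"

definition rep :: "'x set \<Rightarrow> 'x" where
  "rep T = (SOME t. t \<in> T)"

definition tens_add ::
  "('k::field \<Rightarrow> 'u::ab_group_add \<Rightarrow> 'u) \<Rightarrow> ('k \<Rightarrow> 'v::ab_group_add \<Rightarrow> 'v)
    \<Rightarrow> ('u \<times> 'v) list set \<Rightarrow> ('u \<times> 'v) list set \<Rightarrow> ('u \<times> 'v) list set" where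
  "tens_add sU sV S T = tens sU sV (rep S @ rep T)"

definition tens_scale ::
  "('k::field \<Rightarrow> 'u::ab_group_add \<Rightarrow> 'u) \<Rightarrow> ('k \<Rightarrow> 'v::ab_group_add \<Rightarrow> 'v)
    \<Rightarrow> 'k \<Rightarrow> ('u \<times> 'v) list set \<Rightarrow> ('u \<times> 'v) list set" where
  "tens_scale sU sV c T = tens sU sV [(sU c u, v). (u, v) \<leftarrow> rep T]"


section \<open>Weak Hopf algebras\<close>

text \<open>
  A comultiplication is a linear map \<open>\<Delta>\<close> from \<open>H\<close> to \<open>H \<otimes> H\<close>.  Sweedler notation is expressed
  by running through a formal sum \<open>sw \<Delta> h\<close> representing \<open>\<Delta> h\<close>; it is only used inside expressions
  that are linear in each of the Sweedler components, so the choice does not matter.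
\<close>

definition sw :: "('h \<Rightarrow> ('h \<times> 'h) list set) \<Rightarrow> 'h \<Rightarrow> ('h \<times> 'h) list" where
  "sw \<Delta> h = rep (\<Delta> h)"

definition sw3 :: "('h \<Rightarrow> ('h \<times> 'h) list set) \<Rightarrow> 'h \<Rightarrow> ('h \<times> 'h \<times> 'h) list" where
  "sw3 \<Delta> h = [(x, y, z). (w, z) \<leftarrow> sw \<Delta> h, (x, y) \<leftarrow> sw \<Delta> w]"

locale weak_bialgebra =
  fixes sH :: "'k::field \<Rightarrow> 'h::{ring,monoid_mult} \<Rightarrow> 'h"
    and \<Delta> :: "'h \<Rightarrow> ('h \<times> 'h) list set"
    and \<epsilon> :: "'h \<Rightarrow> 'k"
  assumes algebra: "k_algebra sH"
    and comult_in: "\<Delta> h \<in> range (tens sH sH)"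
    and comult_add: "\<Delta> (h + l) = tens_add sH sH (\<Delta> h) (\<Delta> l)"
    and comult_scale: "\<Delta> (sH c h) = tens_scale sH sH c (\<Delta> h)"
    and counit_linear: "Vector_Spaces.linear sH (*) \<epsilon>"
    and coassoc: "tens3 sH [(x, y, z). (w, z) \<leftarrow> sw \<Delta> h, (x, y) \<leftarrow> sw \<Delta> w]
                = tens3 sH [(x, y, z). (x, w) \<leftarrow> sw \<Delta> h, (y, z) \<leftarrow> sw \<Delta> w]"
    and counit_left: "(\<Sum>(x, y) \<leftarrow> sw \<Delta> h. sH (\<epsilon> x) y) = h"
    and counit_right: "(\<Sum>(x, y) \<leftarrow> sw \<Delta> h. sH (\<epsilon> y) x) = h"
    and comult_mult: "\<Delta> (h * l) = tens sH sH [(x * u, y * v). (x, y) \<leftarrow> sw \<Delta> h, (u, v) \<leftarrow> sw \<Delta> l]"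
    and comult_one1: "tens3 sH (sw3 \<Delta> 1) = tens3 sH [(x, y * u, v). (x, y) \<leftarrow> sw \<Delta> 1, (u, v) \<leftarrow> sw \<Delta> 1]"
    and comult_one2: "tens3 sH (sw3 \<Delta> 1) = tens3 sH [(x, u * y, v). (x, y) \<leftarrow> sw \<Delta> 1, (u, v) \<leftarrow> sw \<Delta> 1]"
    and counit_mult1: "\<epsilon> (h * l * m) = (\<Sum>(x, y) \<leftarrow> sw \<Delta> l. \<epsilon> (h * x) * \<epsilon> (y * m))"
    and counit_mult2: "\<epsilon> (h * l * m) = (\<Sum>(x, y) \<leftarrow> sw \<Delta> l. \<epsilon> (h * y) * \<epsilon> (x * m))"

definition PiL :: "('k::field \<Rightarrow> 'h::{ring,monoid_mult} \<Rightarrow> 'h) \<Rightarrow> ('h \<Rightarrow> ('h \<times> 'h) list set)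
    \<Rightarrow> ('h \<Rightarrow> 'k) \<Rightarrow> 'h \<Rightarrow> 'h" where
  "PiL sH \<Delta> \<epsilon> h = (\<Sum>(x, y) \<leftarrow> sw \<Delta> 1. sH (\<epsilon> (x * h)) y)"

definition PiR :: "('k::field \<Rightarrow> 'h::{ring,monoid_mult} \<Rightarrow> 'h) \<Rightarrow> ('h \<Rightarrow> ('h \<times> 'h) list set)
    \<Rightarrow> ('h \<Rightarrow> 'k) \<Rightarrow> 'h \<Rightarrow> 'h" where
  "PiR sH \<Delta> \<epsilon> h = (\<Sum>(x, y) \<leftarrow> sw \<Delta> 1. sH (\<epsilon> (h * y)) x)"

locale weak_hopf_algebra = weak_bialgebra sH \<Delta> \<epsilon>
  for sH :: "'k::field \<Rightarrow> 'h::{ring,monoid_mult} \<Rightarrow> 'h"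
    and \<Delta> :: "'h \<Rightarrow> ('h \<times> 'h) list set"
    and \<epsilon> :: "'h \<Rightarrow> 'k" +
  fixes S :: "'h \<Rightarrow> 'h"
  assumes antipode_linear: "Vector_Spaces.linear sH sH S"
    and antipode_left: "(\<Sum>(x, y) \<leftarrow> sw \<Delta> h. x * S y) = PiL sH \<Delta> \<epsilon> h"
    and antipode_right: "(\<Sum>(x, y) \<leftarrow> sw \<Delta> h. S x * y) = PiR sH \<Delta> \<epsilon> h"
    and antipode_mid: "(\<Sum>(x, y, z) \<leftarrow> sw3 \<Delta> h. S x * y * S z) = S h"


section \<open>Weak crossed products\<close>

text \<open>\<open>act h a\<close> is \<open>h \<cdot> a\<close>.\<close>

definition weak_module_algebra ::
  "('k::field \<Rightarrow> 'h::{ring,monoid_mult} \<Rightarrow> 'h) \<Rightarrow> ('h \<Rightarrow> ('h \<times> 'h) list set)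
    \<Rightarrow> ('k \<Rightarrow> 'a::{ring,monoid_mult} \<Rightarrow> 'a) \<Rightarrow> ('h \<Rightarrow> 'a \<Rightarrow> 'a) \<Rightarrow> bool" where
  "weak_module_algebra sH \<Delta> sA act \<longleftrightarrow>
     k_algebra sA \<and> bilinear_map sH sA sA act
     \<and> (\<forall>a. act 1 a = a)
     \<and> (\<forall>h a b. act h (a * b) = (\<Sum>(x, y) \<leftarrow> sw \<Delta> h. act x a * act y b))
     \<and> (\<forall>h l. act h (act l 1) = act (h * l) 1)"

text \<open>\<open>times_sum \<Delta> act [(a\<^sub>1,h\<^sub>1),\<dots>]\<close> is a formal sum representing the element
  \<open>a\<^sub>1 \<times> h\<^sub>1 + \<dots>\<close> of \<open>A \<otimes> H\<close>.\<close>

definition times_sum ::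
  "('h \<Rightarrow> ('h \<times> 'h) list set) \<Rightarrow> ('h \<Rightarrow> 'a::{ring,monoid_mult} \<Rightarrow> 'a)
    \<Rightarrow> ('a \<times> 'h) list \<Rightarrow> ('a \<times> 'h) list" where
  "times_sum \<Delta> act t = [(a * act x 1, y). (a, h) \<leftarrow> t, (x, y) \<leftarrow> sw \<Delta> h]"

definition times_elt ::
  "('k::field \<Rightarrow> 'h::{ring,monoid_mult} \<Rightarrow> 'h) \<Rightarrow> ('h \<Rightarrow> ('h \<times> 'h) list set)
    \<Rightarrow> ('k \<Rightarrow> 'a::{ring,monoid_mult} \<Rightarrow> 'a) \<Rightarrow> ('h \<Rightarrow> 'a \<Rightarrow> 'a)
    \<Rightarrow> ('a \<times> 'h) list \<Rightarrow> ('a \<times> 'h) list set" where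
  "times_elt sH \<Delta> sA act t = tens sA sH (times_sum \<Delta> act t)"

definition cocycle_conditions ::
  "('k::field \<Rightarrow> 'h::{ring,monoid_mult} \<Rightarrow> 'h) \<Rightarrow> ('h \<Rightarrow> ('h \<times> 'h) list set)
    \<Rightarrow> ('k \<Rightarrow> 'a::{ring,monoid_mult} \<Rightarrow> 'a) \<Rightarrow> ('h \<Rightarrow> 'a \<Rightarrow> 'a) \<Rightarrow> ('h \<Rightarrow> 'h \<Rightarrow> 'a) \<Rightarrow> bool" where
  "cocycle_conditions sH \<Delta> sA act f \<longleftrightarrow>
     bilinear_map sH sH sA f
     \<and> (\<forall>h l. f h l = (\<Sum>(h1, h2) \<leftarrow> sw \<Delta> h. \<Sum>(l1, l2) \<leftarrow> sw \<Delta> l. f h1 l1 * act (h2 * l2) 1))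
     \<and> (\<forall>h. act h 1 = (\<Sum>(h1, h2) \<leftarrow> sw \<Delta> h. \<Sum>(e1, e2) \<leftarrow> sw \<Delta> 1. act h1 (act e1 1) * f h2 e2))
     \<and> (\<forall>h. act h 1 = (\<Sum>(e1, e2) \<leftarrow> sw \<Delta> 1. act e1 1 * f e2 h))
     \<and> (\<forall>a. times_elt sH \<Delta> sA act [(a, 1)] = tens sA sH [(act e1 a, e2). (e1, e2) \<leftarrow> sw \<Delta> 1])
     \<and> (\<forall>h l a. (\<Sum>(h1, h2) \<leftarrow> sw \<Delta> h. \<Sum>(l1, l2) \<leftarrow> sw \<Delta> l. f h1 l1 * act (h2 * l2) a)
              = (\<Sum>(h1, h2) \<leftarrow> sw \<Delta> h. \<Sum>(l1, l2) \<leftarrow> sw \<Delta> l. act h1 (act l1 a) * f h2 l2))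
     \<and> (\<forall>h l m. (\<Sum>(h1, h2) \<leftarrow> sw \<Delta> h. \<Sum>(l1, l2) \<leftarrow> sw \<Delta> l. f h1 l1 * f (h2 * l2) m)
              = (\<Sum>(h1, h2) \<leftarrow> sw \<Delta> h. \<Sum>(l1, l2) \<leftarrow> sw \<Delta> l. \<Sum>(m1, m2) \<leftarrow> sw \<Delta> m.
                   act h1 (f l1 m1) * f h2 (l2 * m2)))"

definition convolution ::
  "('h \<Rightarrow> ('h \<times> 'h) list set) \<Rightarrow> ('h \<Rightarrow> 'h \<Rightarrow> 'a::{ring,monoid_mult}) \<Rightarrow> ('h \<Rightarrow> 'h \<Rightarrow> 'a)
    \<Rightarrow> 'h \<Rightarrow> 'h \<Rightarrow> 'a" where
  "convolution \<Delta> f g h l =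
     (\<Sum>(h1, h2) \<leftarrow> sw \<Delta> h. \<Sum>(l1, l2) \<leftarrow> sw \<Delta> l. f h1 l1 * g h2 l2)"

definition convolution_inverse ::
  "('k::field \<Rightarrow> 'h::{ring,monoid_mult} \<Rightarrow> 'h) \<Rightarrow> ('h \<Rightarrow> ('h \<times> 'h) list set)
    \<Rightarrow> ('k \<Rightarrow> 'a::{ring,monoid_mult} \<Rightarrow> 'a) \<Rightarrow> ('h \<Rightarrow> 'a \<Rightarrow> 'a)
    \<Rightarrow> ('h \<Rightarrow> 'h \<Rightarrow> 'a) \<Rightarrow> ('h \<Rightarrow> 'h \<Rightarrow> 'a) \<Rightarrow> bool" where
  "convolution_inverse sH \<Delta> sA act f finv \<longleftrightarrow>
     (let u2 = (\<lambda>h l. act (h * l) 1) in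
       bilinear_map sH sH sA finv
       \<and> convolution \<Delta> u2 finv = finv \<and> convolution \<Delta> finv u2 = finv
       \<and> convolution \<Delta> f finv = u2 \<and> convolution \<Delta> finv f = u2)"

text \<open>
  The span of the \<open>a \<times> h\<close> is the set of finite sums of such elements, since
  \<open>c (a \<times> h) = (c a) \<times> h\<close>.  The product of two such sums is computed by writing both factors
  in this form in an arbitrary way.
\<close>

definition times_rep ::
  "('k::field \<Rightarrow> 'h::{ring,monoid_mult} \<Rightarrow> 'h) \<Rightarrow> ('h \<Rightarrow> ('h \<times> 'h) list set)
    \<Rightarrow> ('k \<Rightarrow> 'a::{ring,monoid_mult} \<Rightarrow> 'a) \<Rightarrow> ('h \<Rightarrow> 'a \<Rightarrow> 'a)
    \<Rightarrow> ('a \<times> 'h) list set \<Rightarrow> ('a \<times> 'h) list" where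
  "times_rep sH \<Delta> sA act X = (SOME t. times_elt sH \<Delta> sA act t = X)"

definition crossed_product ::
  "('k::field \<Rightarrow> 'h::{ring,monoid_mult} \<Rightarrow> 'h) \<Rightarrow> ('h \<Rightarrow> ('h \<times> 'h) list set)
    \<Rightarrow> ('k \<Rightarrow> 'a::{ring,monoid_mult} \<Rightarrow> 'a) \<Rightarrow> ('h \<Rightarrow> 'a \<Rightarrow> 'a) \<Rightarrow> ('h \<Rightarrow> 'h \<Rightarrow> 'a)
    \<Rightarrow> ('k, ('a \<times> 'h) list set) module" where
  "crossed_product sH \<Delta> sA act f =
    \<lparr> carrier = range (times_elt sH \<Delta> sA act),
      mult = (\<lambda>X Y. times_elt sH \<Delta> sA act
        [(a * act h1 b * f h2 l1, h3 * l2).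
           (a, h) \<leftarrow> times_rep sH \<Delta> sA act X, (b, l) \<leftarrow> times_rep sH \<Delta> sA act Y,
           (h1, h2, h3) \<leftarrow> sw3 \<Delta> h, (l1, l2) \<leftarrow> sw \<Delta> l]),
      one = times_elt sH \<Delta> sA act [(1, 1)],
      zero = tens sA sH [],
      add = tens_add sA sH,
      smult = tens_scale sA sH \<rparr>"

definition jnu ::
  "('k::field \<Rightarrow> 'h::{ring,monoid_mult} \<Rightarrow> 'h) \<Rightarrow> ('h \<Rightarrow> ('h \<times> 'h) list set)
    \<Rightarrow> ('k \<Rightarrow> 'a::{ring,monoid_mult} \<Rightarrow> 'a) \<Rightarrow> ('h \<Rightarrow> 'a \<Rightarrow> 'a) \<Rightarrow> 'a \<Rightarrow> ('a \<times> 'h) list set" where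
  "jnu sH \<Delta> sA act a = times_elt sH \<Delta> sA act [(a, 1)]"

definition gam ::
  "('k::field \<Rightarrow> 'h::{ring,monoid_mult} \<Rightarrow> 'h) \<Rightarrow> ('h \<Rightarrow> ('h \<times> 'h) list set)
    \<Rightarrow> ('k \<Rightarrow> 'a::{ring,monoid_mult} \<Rightarrow> 'a) \<Rightarrow> ('h \<Rightarrow> 'a \<Rightarrow> 'a) \<Rightarrow> 'h \<Rightarrow> ('a \<times> 'h) list set" where
  "gam sH \<Delta> sA act h = times_elt sH \<Delta> sA act [(1, h)]"

definition gam_inv ::
  "('k::field \<Rightarrow> 'h::{ring,monoid_mult} \<Rightarrow> 'h) \<Rightarrow> ('h \<Rightarrow> ('h \<times> 'h) list set) \<Rightarrow> ('h \<Rightarrow> 'h)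
    \<Rightarrow> ('k \<Rightarrow> 'a::{ring,monoid_mult} \<Rightarrow> 'a) \<Rightarrow> ('h \<Rightarrow> 'a \<Rightarrow> 'a)
    \<Rightarrow> ('h \<Rightarrow> 'h \<Rightarrow> 'a) \<Rightarrow> ('h \<Rightarrow> 'h \<Rightarrow> 'a) \<Rightarrow> 'h \<Rightarrow> ('a \<times> 'h) list set" where
  "gam_inv sH \<Delta> S sA act f finv h =
    (let E = crossed_product sH \<Delta> sA act f in
      foldr (add E)
        [jnu sH \<Delta> sA act (finv (S h2) h3) \<otimes>\<^bsub>E\<^esub> gam sH \<Delta> sA act (S h1). (h1, h2, h3) \<leftarrow> sw3 \<Delta> h]
        \<zero>\<^bsub>E\<^esub>)"

text \<open>Unital bimodules over a \<open>k\<close>-algebra \<open>E\<close> on which \<open>k\<close> acts in the same way from both sides: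
  \<open>lm x m\<close> is \<open>x \<cdot> m\<close> and \<open>rm m x\<close> is \<open>m \<cdot> x\<close>.\<close>

definition bimodule ::
  "('k::field, 'e, 'z) module_scheme \<Rightarrow> ('k \<Rightarrow> 'm::ab_group_add \<Rightarrow> 'm)
    \<Rightarrow> ('e \<Rightarrow> 'm \<Rightarrow> 'm) \<Rightarrow> ('m \<Rightarrow> 'e \<Rightarrow> 'm) \<Rightarrow> bool" where
  "bimodule E sM lm rm \<longleftrightarrow>
     vector_space sM
     \<and> (\<forall>x\<in>carrier E. Vector_Spaces.linear sM sM (lm x)
          \<and> Vector_Spaces.linear sM sM (\<lambda>m. rm m x))
     \<and> (\<forall>x\<in>carrier E. \<forall>y\<in>carrier E. \<forall>m.
          lm (x \<oplus>\<^bsub>E\<^esub> y) m = lm x m + lm y m \<and> rm m (x \<oplus>\<^bsub>E\<^esub> y) = rm m x + rm m y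
          \<and> lm (x \<otimes>\<^bsub>E\<^esub> y) m = lm x (lm y m) \<and> rm m (x \<otimes>\<^bsub>E\<^esub> y) = rm (rm m x) y
          \<and> rm (lm x m) y = lm x (rm m y))
     \<and> (\<forall>c. \<forall>x\<in>carrier E. \<forall>m.
          lm (c \<odot>\<^bsub>E\<^esub> x) m = sM c (lm x m) \<and> rm m (c \<odot>\<^bsub>E\<^esub> x) = sM c (rm m x))
     \<and> (\<forall>m. lm \<one>\<^bsub>E\<^esub> m = m \<and> rm m \<one>\<^bsub>E\<^esub> = m)"

definition centralizer :: "'e set \<Rightarrow> ('e \<Rightarrow> 'm \<Rightarrow> 'm) \<Rightarrow> ('m \<Rightarrow> 'e \<Rightarrow> 'm) \<Rightarrow> 'm set" where
  "centralizer K lm rm = {m. \<forall>x\<in>K. lm x m = rm m x}"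


section \<open>Cohomology of cochain complexes\<close>

text \<open>
  A complex of \<open>k\<close>-spaces is given by subspaces \<open>C n\<close> of one ambient space and maps \<open>d n\<close>
  from \<open>C n\<close> to \<open>C (Suc n)\<close>.  Cohomology classes are cosets of the coboundaries.
\<close>

definition cocycles :: "(nat \<Rightarrow> 'v::ab_group_add set) \<Rightarrow> (nat \<Rightarrow> 'v \<Rightarrow> 'v) \<Rightarrow> nat \<Rightarrow> 'v set" where
  "cocycles C d n = {x \<in> C n. d n x = 0}"

definition coboundaries :: "(nat \<Rightarrow> 'v::ab_group_add set) \<Rightarrow> (nat \<Rightarrow> 'v \<Rightarrow> 'v) \<Rightarrow> nat \<Rightarrow> 'v set" where
  "coboundaries C d n = (case n of 0 \<Rightarrow> {0} | Suc i \<Rightarrow> d i ` C i)"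

definition cohomology :: "(nat \<Rightarrow> 'v::ab_group_add set) \<Rightarrow> (nat \<Rightarrow> 'v \<Rightarrow> 'v) \<Rightarrow> nat \<Rightarrow> 'v set set" where
  "cohomology C d n = (\<lambda>x. {x + b | b. b \<in> coboundaries C d n}) ` cocycles C d n"

definition coset_add :: "'v::ab_group_add set \<Rightarrow> 'v set \<Rightarrow> 'v set" where
  "coset_add X Y = {x + y | x y. x \<in> X \<and> y \<in> Y}"

text \<open>Adding the subspace \<open>B\<close> takes care of the scalar \<open>0\<close>.\<close>

definition coset_scale :: "('k \<Rightarrow> 'v::ab_group_add \<Rightarrow> 'v) \<Rightarrow> 'v set \<Rightarrow> 'k \<Rightarrow> 'v set \<Rightarrow> 'v set" where
  "coset_scale s B c X = {s c x + b | x b. x \<in> X \<and> b \<in> B}"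

definition cohomology_iso ::
  "('k::field \<Rightarrow> 'v::ab_group_add \<Rightarrow> 'v) \<Rightarrow> (nat \<Rightarrow> 'v set) \<Rightarrow> (nat \<Rightarrow> 'v \<Rightarrow> 'v)
    \<Rightarrow> ('k \<Rightarrow> 'w::ab_group_add \<Rightarrow> 'w) \<Rightarrow> (nat \<Rightarrow> 'w set) \<Rightarrow> (nat \<Rightarrow> 'w \<Rightarrow> 'w) \<Rightarrow> nat \<Rightarrow> bool" where
  "cohomology_iso s C d s' C' d' n \<longleftrightarrow>
     (\<exists>\<Phi>. bij_betw \<Phi> (cohomology C d n) (cohomology C' d' n)
        \<and> (\<forall>X\<in>cohomology C d n. \<forall>Y\<in>cohomology C d n.
              \<Phi> (coset_add X Y) = coset_add (\<Phi> X) (\<Phi> Y))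
        \<and> (\<forall>c. \<forall>X\<in>cohomology C d n.
              \<Phi> (coset_scale s (coboundaries C d n) c X)
                = coset_scale s' (coboundaries C' d' n) c (\<Phi> X)))"

definition fun_scale :: "('k \<Rightarrow> 'm \<Rightarrow> 'm) \<Rightarrow> 'k \<Rightarrow> ('x \<Rightarrow> 'm) \<Rightarrow> 'x \<Rightarrow> 'm" where
  "fun_scale s c \<phi> x = s c (\<phi> x)"


section \<open>Relative Hochschild cohomology\<close>

text \<open>
  A \<open>K\<close>-bimodule map from the \<open>n\<close>-fold tensor power over \<open>K\<close> of \<open>E/K\<close> to \<open>M\<close> is given as the
  function \<open>(x\<^sub>1,\<dots>,x\<^sub>n) \<mapsto> \<phi>([x\<^sub>1] \<otimes> \<dots> \<otimes> [x\<^sub>n])\<close>, i.e. as a multiadditive \<open>K\<close>-balanced function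
  on \<open>E\<^sup>n\<close> that is \<open>K\<close>-linear on the left in the first and on the right in the last variable and
  vanishes if some \<open>x\<^sub>i\<close> is in \<open>K\<close>; it is \<open>k\<close>-linear because \<open>K\<close> contains \<open>k 1\<close>.  For \<open>n = 0\<close> the
  tensor power is \<open>K\<close>, and a bimodule map is given by its value at \<open>1\<close>.  Functions are
  normalized to be \<open>0\<close> outside of \<open>E\<^sup>n\<close>.
\<close>

definition hochschild_cochains ::
  "('k::field, 'e, 'z) module_scheme \<Rightarrow> 'e set \<Rightarrow> ('e \<Rightarrow> 'm::ab_group_add \<Rightarrow> 'm)
    \<Rightarrow> ('m \<Rightarrow> 'e \<Rightarrow> 'm) \<Rightarrow> nat \<Rightarrow> ('e list \<Rightarrow> 'm) set" where
  "hochschild_cochains E K lm rm n = {\<phi>.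
     (\<forall>xs. \<not> (length xs = n \<and> set xs \<subseteq> carrier E) \<longrightarrow> \<phi> xs = 0)
     \<and> (\<forall>us x y vs. Suc (length us + length vs) = n \<longrightarrow> set (us @ [x, y] @ vs) \<subseteq> carrier E \<longrightarrow>
          \<phi> (us @ [x \<oplus>\<^bsub>E\<^esub> y] @ vs) = \<phi> (us @ [x] @ vs) + \<phi> (us @ [y] @ vs))
     \<and> (\<forall>us x c y vs. Suc (Suc (length us + length vs)) = n \<longrightarrow> c \<in> K \<longrightarrow>
          set (us @ [x, y] @ vs) \<subseteq> carrier E \<longrightarrow>
          \<phi> (us @ [x \<otimes>\<^bsub>E\<^esub> c, y] @ vs) = \<phi> (us @ [x, c \<otimes>\<^bsub>E\<^esub> y] @ vs))
     \<and> (\<forall>c x xs. Suc (length xs) = n \<longrightarrow> c \<in> K \<longrightarrow> set (x # xs) \<subseteq> carrier E \<longrightarrow>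
          \<phi> ((c \<otimes>\<^bsub>E\<^esub> x) # xs) = lm c (\<phi> (x # xs)))
     \<and> (\<forall>c x xs. Suc (length xs) = n \<longrightarrow> c \<in> K \<longrightarrow> set (xs @ [x]) \<subseteq> carrier E \<longrightarrow>
          \<phi> (xs @ [x \<otimes>\<^bsub>E\<^esub> c]) = rm (\<phi> (xs @ [x])) c)
     \<and> (\<forall>xs. length xs = n \<longrightarrow> set xs \<subseteq> carrier E \<longrightarrow> set xs \<inter> K \<noteq> {} \<longrightarrow> \<phi> xs = 0)
     \<and> (n = 0 \<longrightarrow> \<phi> [] \<in> centralizer K lm rm)}"

definition hochschild_diff ::
  "('k::field, 'e, 'z) module_scheme \<Rightarrow> ('k \<Rightarrow> 'm::ab_group_add \<Rightarrow> 'm) \<Rightarrow> ('e \<Rightarrow> 'm \<Rightarrow> 'm)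
    \<Rightarrow> ('m \<Rightarrow> 'e \<Rightarrow> 'm) \<Rightarrow> nat \<Rightarrow> ('e list \<Rightarrow> 'm) \<Rightarrow> 'e list \<Rightarrow> 'm" where
  "hochschild_diff E sM lm rm n \<phi> xs =
     (if length xs = Suc n \<and> set xs \<subseteq> carrier E then
        lm (hd xs) (\<phi> (tl xs))
        + (\<Sum>i<n. sM ((-1) ^ Suc i)
             (\<phi> (take i xs @ [xs ! i \<otimes>\<^bsub>E\<^esub> xs ! Suc i] @ drop (Suc (Suc i)) xs)))
        + sM ((-1) ^ Suc n) (rm (\<phi> (butlast xs)) (last xs))
      else 0)"


section \<open>Right modules and Ext\<close>

text \<open>Right \<open>H\<close>-modules with underlying set \<open>V\<close>; \<open>r v h\<close> is \<open>v \<cdot> h\<close>.\<close>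

definition right_module ::
  "('k::field \<Rightarrow> 'h::{ring,monoid_mult} \<Rightarrow> 'h) \<Rightarrow> ('k \<Rightarrow> 'v::ab_group_add \<Rightarrow> 'v)
    \<Rightarrow> 'v set \<Rightarrow> ('v \<Rightarrow> 'h \<Rightarrow> 'v) \<Rightarrow> bool" where
  "right_module sH sV V r \<longleftrightarrow>
     vector_space sV
     \<and> 0 \<in> V \<and> (\<forall>u\<in>V. \<forall>v\<in>V. u + v \<in> V) \<and> (\<forall>c. \<forall>v\<in>V. sV c v \<in> V)
     \<and> (\<forall>v\<in>V. \<forall>h. r v h \<in> V)
     \<and> (\<forall>u\<in>V. \<forall>v\<in>V. \<forall>h. r (u + v) h = r u h + r v h)
     \<and> (\<forall>v\<in>V. \<forall>h l. r v (h + l) = r v h + r v l)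
     \<and> (\<forall>c. \<forall>v\<in>V. \<forall>h. r (sV c v) h = sV c (r v h) \<and> r v (sH c h) = sV c (r v h))
     \<and> (\<forall>v\<in>V. \<forall>h l. r (r v h) l = r v (h * l))
     \<and> (\<forall>v\<in>V. r v 1 = v)"

definition right_hom ::
  "('k::field \<Rightarrow> 'v::ab_group_add \<Rightarrow> 'v) \<Rightarrow> 'v set \<Rightarrow> ('v \<Rightarrow> 'h \<Rightarrow> 'v)
    \<Rightarrow> ('k \<Rightarrow> 'w::ab_group_add \<Rightarrow> 'w) \<Rightarrow> 'w set \<Rightarrow> ('w \<Rightarrow> 'h \<Rightarrow> 'w) \<Rightarrow> ('v \<Rightarrow> 'w) \<Rightarrow> bool" where
  "right_hom sV V rV sW W rW g \<longleftrightarrow>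
     (\<forall>v\<in>V. g v \<in> W)
     \<and> (\<forall>u\<in>V. \<forall>v\<in>V. g (u + v) = g u + g v)
     \<and> (\<forall>c. \<forall>v\<in>V. g (sV c v) = sW c (g v))
     \<and> (\<forall>v\<in>V. \<forall>h. g (rV v h) = rW (g v) h)"

text \<open>
  Projective means direct summand of a free module.  It suffices to consider the free module
  of finitely supported \<open>H\<close>-valued functions on the ambient type of \<open>V\<close>, because a projective
  module is a summand of the free module on its own underlying set.
\<close>

definition projective_module ::
  "('k::field \<Rightarrow> 'h::{ring,monoid_mult} \<Rightarrow> 'h) \<Rightarrow> ('k \<Rightarrow> 'v::ab_group_add \<Rightarrow> 'v)
    \<Rightarrow> 'v set \<Rightarrow> ('v \<Rightarrow> 'h \<Rightarrow> 'v) \<Rightarrow> bool" where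
  "projective_module sH sV V r \<longleftrightarrow>
     right_module sH sV V r
     \<and> (let sF = (\<lambda>c. Poly_Mapping.map (sH c)) :: 'k \<Rightarrow> ('v \<Rightarrow>\<^sub>0 'h) \<Rightarrow> ('v \<Rightarrow>\<^sub>0 'h);
            rF = (\<lambda>F h. Poly_Mapping.map (\<lambda>x. x * h) F) in
          \<exists>i p. right_hom sV V r sF UNIV rF i \<and> right_hom sF UNIV rF sV V r p
                \<and> (\<forall>v\<in>V. p (i v) = v))"

text \<open>A resolution \<open>\<dots> \<rightarrow> P 1 \<rightarrow> P 0 \<rightarrow> V \<rightarrow> 0\<close> with differentials \<open>d n : P (Suc n) \<rightarrow> P n\<close> and
  augmentation \<open>g\<close>.  All modules are subspaces of one ambient space with one action of \<open>H\<close>; up to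
  isomorphism this is no restriction, as one can take the direct sum of the \<open>P n\<close>.\<close>

definition projective_resolution ::
  "('k::field \<Rightarrow> 'h::{ring,monoid_mult} \<Rightarrow> 'h)
    \<Rightarrow> ('k \<Rightarrow> 'p::ab_group_add \<Rightarrow> 'p) \<Rightarrow> (nat \<Rightarrow> 'p set) \<Rightarrow> ('p \<Rightarrow> 'h \<Rightarrow> 'p)
    \<Rightarrow> (nat \<Rightarrow> 'p \<Rightarrow> 'p) \<Rightarrow> ('p \<Rightarrow> 'v) \<Rightarrow> ('k \<Rightarrow> 'v::ab_group_add \<Rightarrow> 'v) \<Rightarrow> 'v set
    \<Rightarrow> ('v \<Rightarrow> 'h \<Rightarrow> 'v) \<Rightarrow> bool" where
  "projective_resolution sH sP P rP d g sV V rV \<longleftrightarrow>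
     right_module sH sV V rV
     \<and> (\<forall>n. projective_module sH sP (P n) rP)
     \<and> (\<forall>n. right_hom sP (P (Suc n)) rP sP (P n) rP (d n))
     \<and> right_hom sP (P 0) rP sV V rV g
     \<and> g ` P 0 = V
     \<and> {x \<in> P 0. g x = 0} = d 0 ` P 1
     \<and> (\<forall>n. {x \<in> P (Suc n). d n x = 0} = d (Suc n) ` P (Suc (Suc n)))"

text \<open>
  The complex \<open>Hom\<^sub>H(P\<^sub>*, N)\<close>, whose cohomology is \<open>Ext\<^sub>H\<^sup>*(V, N)\<close> if \<open>P\<close> is a projective
  resolution of \<open>V\<close>.  Homomorphisms are normalized to be \<open>0\<close> outside of \<open>P n\<close>.
\<close>

definition hom_cochains ::
  "('k::field \<Rightarrow> 'p::ab_group_add \<Rightarrow> 'p) \<Rightarrow> (nat \<Rightarrow> 'p set) \<Rightarrow> ('p \<Rightarrow> 'h \<Rightarrow> 'p)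
    \<Rightarrow> ('k \<Rightarrow> 'm::ab_group_add \<Rightarrow> 'm) \<Rightarrow> 'm set \<Rightarrow> ('m \<Rightarrow> 'h \<Rightarrow> 'm) \<Rightarrow> nat \<Rightarrow> ('p \<Rightarrow> 'm) set" where
  "hom_cochains sP P rP sN N rN n =
     {\<phi>. right_hom sP (P n) rP sN N rN \<phi> \<and> (\<forall>x. x \<notin> P n \<longrightarrow> \<phi> x = 0)}"

definition hom_diff ::
  "(nat \<Rightarrow> 'p set) \<Rightarrow> (nat \<Rightarrow> 'p \<Rightarrow> 'p) \<Rightarrow> nat \<Rightarrow> ('p \<Rightarrow> 'm::ab_group_add) \<Rightarrow> 'p \<Rightarrow> 'm" where
  "hom_diff P d n \<phi> x = (if x \<in> P (Suc n) then \<phi> (d n x) else 0)"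


section \<open>The right \<open>H\<close>-modules \<open>H\<^sup>R\<close> and \<open>M\<^sup>K\<close>\<close>

definition HR_action ::
  "('k::field \<Rightarrow> 'h::{ring,monoid_mult} \<Rightarrow> 'h) \<Rightarrow> ('h \<Rightarrow> ('h \<times> 'h) list set)
    \<Rightarrow> ('h \<Rightarrow> 'k) \<Rightarrow> 'h \<Rightarrow> 'h \<Rightarrow> 'h" where
  "HR_action sH \<Delta> \<epsilon> l h = PiR sH \<Delta> \<epsilon> (l * h)"

definition M_action ::
  "('k::field \<Rightarrow> 'h::{ring,monoid_mult} \<Rightarrow> 'h) \<Rightarrow> ('h \<Rightarrow> ('h \<times> 'h) list set) \<Rightarrow> ('h \<Rightarrow> 'h)
    \<Rightarrow> ('k \<Rightarrow> 'a::{ring,monoid_mult} \<Rightarrow> 'a) \<Rightarrow> ('h \<Rightarrow> 'a \<Rightarrow> 'a)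
    \<Rightarrow> ('h \<Rightarrow> 'h \<Rightarrow> 'a) \<Rightarrow> ('h \<Rightarrow> 'h \<Rightarrow> 'a)
    \<Rightarrow> (('a \<times> 'h) list set \<Rightarrow> 'm::ab_group_add \<Rightarrow> 'm) \<Rightarrow> ('m \<Rightarrow> ('a \<times> 'h) list set \<Rightarrow> 'm)
    \<Rightarrow> 'm \<Rightarrow> 'h \<Rightarrow> 'm" where
  "M_action sH \<Delta> S sA act f finv lm rm m h =
     (\<Sum>(h1, h2) \<leftarrow> sw \<Delta> h.
        rm (lm (gam_inv sH \<Delta> S sA act f finv h1) m) (gam sH \<Delta> sA act h2))"

end

(*
  Let X^q = Hom_H(P_q, M^K) and let Y^p be the relative Hochschild p-cochains.  Let B^{p,q} be the
  space of linear maps beta from P_q to Y^p with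
      beta(x) = gamma(e1) . beta(x e2),   where Delta(1) = e1 (x) e2;
  up to the factor gamma(e1) these are cochains with values in the bimodule Hom(P_q, M).
  Writing an element e of E as a sum of terms j(a) gamma(h), put
      e . F = j(a) gamma(h1) F(h2)   for F : H -> M.
  The horizontal differential of B is the Hochschild differential with its first term replaced by
  e . (h |-> beta(x h)), the vertical one is composition with d.

  The rows of B are resolutions of the X^q by the edge map that views M^K as a subspace of M: since P_q is
  a summand of a free module, with x = sum_w p_w k_w(x), a contraction is
      (s beta)(x)(es) = sum_w gamma^{-1}(k1) beta(p_w)(gamma(k2) # es),   k = k_w(x).
  The columns are resolutions of the Y^p by the edge map phi |-> (x |-> gamma(g x) phi): k-linear sections
  of d can be averaged over Delta(1).  So the total complex of B computes both cohomologies.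
*)

theory Submission
  imports Defs
begin

text \<open>The coaction \<open>j(a) gamma(h) |-> j(a) gamma(h1) (x) h2\<close> of H on E is
  multiplicative but, in the weak setting, not unital. In the action of E that it induces on maps
  from P_q to M, the element 1 acts as an idempotent, the averaging over Delta(1). The condition
  that defines B cuts out the part on which 1 acts as the identity.

  The resolution P is arbitrary. The bicomplex compares it with the Hochschild complex directly, so
  neither a particular resolution of H^R nor a comparison of resolutions is required.

  Exactness of the rows rests on \<open>gamma^{-1}\<close> inverting \<open>gamma\<close> on both
  sides, up to H^R and A: \<open>gamma^{-1}(h1) gamma(h2) = gamma(PiR(h))\<close> and
  \<open>gamma(h1) gamma^{-1}(h2) = j(h . 1)\<close>. Most of the Sweedler calculus serves these
  identities and the exchange rule \<open>G_G'_cocycle\<close> derived from them. The second one is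
  the harder: there h acts on values of the inverse cocycle, which is resolved by
  \<open>act_finv_f\<close>.

  Tensors are classes of formal sums. Their equality is tested on bilinear maps into one fixed type,
  because a statement cannot quantify over all target types.\<close>

text \<open>Linearity without the vector space axioms that are part of \<open>Vector_Spaces.linear\<close>, so that
  linearity goals can be decomposed by introduction rules alone.\<close>

definition klin :: "('k \<Rightarrow> 'u::plus \<Rightarrow> 'u) \<Rightarrow> ('k \<Rightarrow> 'w::plus \<Rightarrow> 'w) \<Rightarrow> ('u \<Rightarrow> 'w) \<Rightarrow> bool" where
  "klin s s' F \<longleftrightarrow> (\<forall>x y. F (x + y) = F x + F y) \<and> (\<forall>c x. F (s c x) = s' c (F x))"

lemma klinI: "(\<And>x y. F (x + y) = F x + F y) \<Longrightarrow> (\<And>c x. F (s c x) = s' c (F x)) \<Longrightarrow> klin s s' F"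
  by (auto simp: klin_def)

lemma klin_add: "klin s s' F \<Longrightarrow> F (x + y) = F x + F y"
  and klin_scale: "klin s s' F \<Longrightarrow> F (s c x) = s' c (F x)"
  by (auto simp: klin_def)

lemma klin_zero:
  fixes F :: "'u::ab_group_add \<Rightarrow> 'w::ab_group_add"
  shows "klin s s' F \<Longrightarrow> F 0 = 0"
  using klin_add[of s s' F 0 0] by simp

lemma klin_sum_list:
  fixes F :: "'u::ab_group_add \<Rightarrow> 'w::ab_group_add"
  assumes "klin s s' F"
  shows "F (\<Sum>x\<leftarrow>xs. G x) = (\<Sum>x\<leftarrow>xs. F (G x))"
  by (induction xs) (simp_all add: klin_add[OF assms] klin_zero[OF assms])

lemma klin_sum:
  fixes F :: "'u::ab_group_add \<Rightarrow> 'w::ab_group_add"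
  assumes "klin s s' F"
  shows "F (\<Sum>x\<in>A. G x) = (\<Sum>x\<in>A. F (G x))"
  by (induction A rule: infinite_finite_induct) (simp_all add: klin_add[OF assms] klin_zero[OF assms])

lemma klin_minus:
  fixes F :: "'u::ab_group_add \<Rightarrow> 'w::ab_group_add"
  assumes "klin s s' F"
  shows "F (- x) = - F x" "F (x - y) = F x - F y"
proof -
  show 1: "F (- x) = - F x" for x
    using klin_add[OF assms, of x "- x"] klin_zero[OF assms] by (simp add: eq_neg_iff_add_eq_0 add.commute)
  show "F (x - y) = F x - F y" using klin_add[OF assms, of x "- y"] 1 by simp
qed

lemma linear_iff_klin: "Vector_Spaces.linear s s' F \<longleftrightarrow> vector_space s \<and> vector_space s' \<and> klin s s' F"
  unfolding module_hom_iff_linear[symmetric] module_hom_iff module_iff_vector_space klin_def by auto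

lemma klin_linear: "Vector_Spaces.linear s s' F \<Longrightarrow> klin s s' F"
  by (simp add: linear_iff_klin)

definition klin2 where
  "klin2 s1 s2 s' B \<longleftrightarrow> (\<forall>v. klin s1 s' (\<lambda>u. B u v)) \<and> (\<forall>u. klin s2 s' (\<lambda>v. B u v))"

lemma bilinear_map_klin2: "bilinear_map s1 s2 s' B \<Longrightarrow> klin2 s1 s2 s' B"
  by (simp add: bilinear_map_def klin2_def klin_linear)

lemma klin2D:
  assumes "klin2 s1 s2 s' B"
  shows "klin s1 s' (\<lambda>u. B u v)" "klin s2 s' (\<lambda>v. B u v)"
  using assms by (auto simp: klin2_def)

section \<open>Formal sums and tensors\<close>

lemma sum_cong_eval:
  fixes B :: "'u::ab_group_add \<Rightarrow> 'v::ab_group_add \<Rightarrow> 'w::ab_group_add"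
  assumes "sum_cong (bilinear_rel sU sV) t t'" and B: "klin2 sU sV sW B"
  shows "(\<Sum>(u, v)\<leftarrow>t. B u v) = (\<Sum>(u, v)\<leftarrow>t'. B u v)"
  using assms(1)
proof (induction rule: sum_cong.induct)
  case (base s t)
  then show ?case
    by (cases rule: bilinear_rel.cases)
      (auto simp: klin_add[OF klin2D(1)[OF B]] klin_add[OF klin2D(2)[OF B]]
        klin_scale[OF klin2D(1)[OF B]] klin_scale[OF klin2D(2)[OF B]] klin_zero[OF klin2D(1)[OF B]])
qed (auto simp: add.commute)

definition klin3 where
  "klin3 s s' T \<longleftrightarrow> (\<forall>b c. klin s s' (\<lambda>a. T a b c)) \<and> (\<forall>a c. klin s s' (\<lambda>b. T a b c))
     \<and> (\<forall>a b. klin s s' (\<lambda>c. T a b c))"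

lemma klin3D:
  assumes "klin3 s s' T"
  shows "klin s s' (\<lambda>a. T a b c)" "klin s s' (\<lambda>b. T a b c)" "klin s s' (\<lambda>c. T a b c)"
  using assms by (auto simp: klin3_def)

lemma sum_cong_eval3:
  fixes T :: "'u::ab_group_add \<Rightarrow> 'u \<Rightarrow> 'u \<Rightarrow> 'w::ab_group_add"
  assumes "sum_cong (trilinear_rel s) t t'" and T: "klin3 s sW T"
  shows "(\<Sum>(u, v, w)\<leftarrow>t. T u v w) = (\<Sum>(u, v, w)\<leftarrow>t'. T u v w)"
  using assms(1)
proof (induction rule: sum_cong.induct)
  case (base s t)
  then show ?case
    by (cases rule: trilinear_rel.cases)
      (auto simp: klin_add[OF klin3D(1)[OF T]] klin_add[OF klin3D(2)[OF T]] klin_add[OF klin3D(3)[OF T]]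
        klin_scale[OF klin3D(1)[OF T]] klin_scale[OF klin3D(2)[OF T]] klin_scale[OF klin3D(3)[OF T]]
        klin_zero[OF klin3D(1)[OF T]])
qed (auto simp: add.commute)

lemma tens_self: "t \<in> tens sU sV t"
  by (simp add: tens_def sum_cong.refl)

lemma tens_eq_iff: "tens sU sV t = tens sU sV t' \<longleftrightarrow> sum_cong (bilinear_rel sU sV) t t'"
proof
  assume "tens sU sV t = tens sU sV t'"
  then have "t' \<in> tens sU sV t" using tens_self by blast
  then show "sum_cong (bilinear_rel sU sV) t t'" by (simp add: tens_def)
next
  assume "sum_cong (bilinear_rel sU sV) t t'"
  then show "tens sU sV t = tens sU sV t'"
    by (auto simp: tens_def intro: sum_cong.trans sum_cong.sym)
qed

lemma tens3_eqD: "tens3 s t = tens3 s t' \<Longrightarrow> sum_cong (trilinear_rel s) t t'"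
proof -
  assume a: "tens3 s t = tens3 s t'"
  have "t' \<in> tens3 s t'" by (simp add: tens3_def sum_cong.refl)
  then have "t' \<in> tens3 s t" by (simp only: a)
  then show ?thesis by (simp add: tens3_def)
qed

lemma rep_tens: "sum_cong (bilinear_rel sU sV) t (rep (tens sU sV t))"
proof -
  have "rep (tens sU sV t) \<in> tens sU sV t"
    unfolding rep_def by (rule someI[of _ t]) (rule tens_self)
  then show ?thesis by (simp add: tens_def)
qed

lemma tens_rep_tens: "tens sU sV (rep (tens sU sV t)) = tens sU sV t"
  using rep_tens tens_eq_iff by blast

lemma tens_add_tens: "tens_add sU sV (tens sU sV t) (tens sU sV t') = tens sU sV (t @ t')"
  unfolding tens_add_def
  by (subst tens_eq_iff) (intro sum_cong.append sum_cong.sym[OF rep_tens])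

lemma sum_list_pair_map: "(\<Sum>(u, v)\<leftarrow>[(F x y, G x y). (x, y) \<leftarrow> t]. B u v) = (\<Sum>(x, y)\<leftarrow>t. B (F x y) (G x y))"
  by (induction t) auto

lemma sum_list_concat_map: "(\<Sum>z\<leftarrow>concat (map F t). B z) = (\<Sum>x\<leftarrow>t. \<Sum>z\<leftarrow>F x. B z)"
  for B :: "'a \<Rightarrow> 'w::ab_group_add"
  by (induction t) auto

text \<open>The coordinates of \<open>h\<close> in a basis of \<open>V\<close> give an injection of \<open>U \<otimes> V\<close> into the functions
  from that basis to \<open>U\<close>, so bilinear maps into the one type \<open>'v \<Rightarrow> 'u\<close> separate tensors.\<close>

lemma tens_eqI:
  fixes sU :: "'k::field \<Rightarrow> 'u::ab_group_add \<Rightarrow> 'u" and sV :: "'k \<Rightarrow> 'v::ab_group_add \<Rightarrow> 'v"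
  assumes U: "vector_space sU" and V: "vector_space sV"
    and eq: "\<And>B :: 'u \<Rightarrow> 'v \<Rightarrow> 'v \<Rightarrow> 'u. klin2 sU sV (\<lambda>c F x. sU c (F x)) B
          \<Longrightarrow> (\<Sum>(u, v)\<leftarrow>t. B u v) = (\<Sum>(u, v)\<leftarrow>t'. B u v)"
  shows "tens sU sV t = tens sU sV t'"
proof -
  interpret U: vector_space sU by (rule U)
  interpret V: vector_space sV by (rule V)
  define Bs where "Bs = V.extend_basis {}"
  have ind: "V.independent Bs" and sp: "V.span Bs = UNIV"
    unfolding Bs_def by (simp_all add: V.independent_extend_basis V.independent_empty V.span_extend_basis)
  define R where "R = V.representation Bs"
  have R_add: "R (x + y) b = R x b + R y b" for x y b
    unfolding R_def using V.representation_add[OF ind] sp by simp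
  have R_scale: "R (sV c x) b = c * R x b" for c x b
    unfolding R_def using V.representation_scale[OF ind] sp by simp
  define B where "B u v b = sU (R v b) u" for u v b
  have B: "klin2 sU sV (\<lambda>c F x. sU c (F x)) B"
    unfolding klin2_def klin_def B_def
    by (auto simp: fun_eq_iff R_add R_scale U.scale_right_distrib U.scale_left_distrib mult.commute)
  let ?C = "sum_cong (bilinear_rel sU sV)"
  have zero2: "?C [(u, 0)] []" for u
  proof -
    have "?C [(sU 0 u, 0)] [(u, sV 0 0)]" by (intro sum_cong.base bilinear_rel.intros(3))
    then have "?C [(u, 0)] [(0, 0)]" by (simp add: sum_cong.sym)
    also have "?C [(0::'u, 0)] []" by (intro sum_cong.base bilinear_rel.intros(4))
    finally (sum_cong.trans) show ?thesis .
  qed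
  have split: "?C [(u, \<Sum>b\<leftarrow>bs. F b)] [(u, F b). b \<leftarrow> bs]" for u F and bs :: "'v list"
  proof (induction bs)
    case Nil
    then show ?case using zero2 by simp
  next
    case (Cons b bs)
    have "?C [(u, F b + (\<Sum>b\<leftarrow>bs. F b))] ([(u, F b)] @ [(u, \<Sum>b\<leftarrow>bs. F b)])"
      using sum_cong.base[where R="bilinear_rel sU sV", OF bilinear_rel.intros(2)[of sU sV u "F b" "\<Sum>b\<leftarrow>bs. F b"]] by simp
    also have "?C \<dots> ([(u, F b)] @ [(u, F b). b \<leftarrow> bs])"
      using Cons.IH sum_cong.append sum_cong.refl by blast
    finally (sum_cong.trans) show ?case by simp
  qed
  have zip: "?C ([(F b, b). b \<leftarrow> bs] @ [(G b, b). b \<leftarrow> bs]) [(F b + G b, b). b \<leftarrow> bs]"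
    for F G :: "'v \<Rightarrow> 'u" and bs
  proof (induction bs)
    case Nil
    then show ?case by (simp add: sum_cong.refl)
  next
    case (Cons b bs)
    let ?f = "[(F b, b). b \<leftarrow> bs]" and ?g = "[(G b, b). b \<leftarrow> bs]"
    have "?C (([(F b, b)] @ (?f @ [(G b, b)])) @ ?g) (([(F b, b)] @ ([(G b, b)] @ ?f)) @ ?g)"
      by (intro sum_cong.append sum_cong.refl sum_cong.comm)
    also have "\<dots> = [(F b, b), (G b, b)] @ (?f @ ?g)" by simp
    also have "?C \<dots> ([(F b + G b, b)] @ [(F b + G b, b). b \<leftarrow> bs])"
      using sum_cong.append[OF sum_cong.sym[OF sum_cong.base[where R="bilinear_rel sU sV", OF bilinear_rel.intros(1)[of sU sV "F b" "G b" b]]] Cons.IH]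
      by simp
    finally (sum_cong.trans) show ?case by simp
  qed
  have canon1: "?C [(u, v)] [(B u v b, b). b \<leftarrow> bs]" if bs: "distinct bs" "{b. R v b \<noteq> 0} \<subseteq> set bs" for u v bs
  proof -
    have "(\<Sum>b\<leftarrow>bs. sV (R v b) b) = (\<Sum>b\<in>set bs. sV (R v b) b)"
      using bs(1) by (simp add: sum_list_distinct_conv_sum_set)
    also have "\<dots> = (\<Sum>b | R v b \<noteq> 0. sV (R v b) b)"
      using bs(2) by (intro sum.mono_neutral_right) auto
    also have "\<dots> = v" unfolding R_def using V.sum_nonzero_representation_eq[OF ind] sp by simp
    finally have "v = (\<Sum>b\<leftarrow>bs. sV (R v b) b)" by simp
    then have 1: "?C [(u, v)] [(u, sV (R v b) b). b \<leftarrow> bs]" using split[of u "\<lambda>b. sV (R v b) b" bs] by simp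
    have "?C [(u, sV (R v b) b). b \<leftarrow> bs] [(sU (R v b) u, b). b \<leftarrow> bs]"
    proof (induction bs)
      case Nil
      then show ?case by (simp add: sum_cong.refl)
    next
      case (Cons b bs)
      have "?C ([(u, sV (R v b) b)] @ [(u, sV (R v b) b). b \<leftarrow> bs]) ([(sU (R v b) u, b)] @ [(sU (R v b) u, b). b \<leftarrow> bs])"
        by (intro sum_cong.append Cons.IH sum_cong.sym[OF sum_cong.base] bilinear_rel.intros(3))
      then show ?case by simp
    qed
    then show ?thesis unfolding B_def using 1 sum_cong.trans by blast
  qed
  \<comment> \<open>Normal form over any finite list \<open>bs\<close> of basis vectors that covers
    the supports in \<open>t\<close>: the coefficient at \<open>b\<close> is the value of the test
    map \<open>B\<close> at \<open>b\<close>. Two sums with equal values of \<open>B\<close> thus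
    have the same normal form.\<close>
  have canon: "?C t [((\<Sum>(u, v)\<leftarrow>t. B u v) b, b). b \<leftarrow> bs]"
    if "distinct bs" "\<And>u v. (u, v) \<in> set t \<Longrightarrow> {b. R v b \<noteq> 0} \<subseteq> set bs" for t bs
    using that(2)
  proof (induction t)
    case Nil
    have "?C [(0, b). b \<leftarrow> bs] []"
    proof (induction bs)
      case (Cons b bs)
      have "?C ([(0, b)] @ [(0, b). b \<leftarrow> bs]) ([] @ [])"
        by (intro sum_cong.append Cons.IH sum_cong.base bilinear_rel.intros(4))
      then show ?case by simp
    qed (simp add: sum_cong.refl)
    then show ?case by (simp add: sum_cong.sym)
  next
    case (Cons p t)
    obtain u v where p: "p = (u, v)" by fastforce
    have "?C ([(u, v)] @ t) ([(B u v b, b). b \<leftarrow> bs] @ [((\<Sum>(u, v)\<leftarrow>t. B u v) b, b). b \<leftarrow> bs])"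
      using Cons that(1) p by (intro sum_cong.append canon1) auto
    also have "?C \<dots> [(B u v b + (\<Sum>(u, v)\<leftarrow>t. B u v) b, b). b \<leftarrow> bs]" by (rule zip)
    finally (sum_cong.trans) show ?case by (simp add: p)
  qed
  \<comment> \<open>All basis vectors that occur in either sum, so that both have a normal form over
    one common list.\<close>
  define D where "D = (\<Union>(u, v)\<in>set (t @ t'). {b. R v b \<noteq> 0})"
  have "finite D" unfolding D_def R_def by (auto simp: V.finite_representation)
  then obtain bs where bs: "distinct bs" "set bs = D" using finite_distinct_list by blast
  have "?C t [((\<Sum>(u, v)\<leftarrow>t. B u v) b, b). b \<leftarrow> bs]" "?C t' [((\<Sum>(u, v)\<leftarrow>t'. B u v) b, b). b \<leftarrow> bs]"
    by (rule canon; use bs in \<open>auto simp: D_def\<close>)+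
  then show ?thesis unfolding tens_eq_iff using eq[OF B] sum_cong.trans[OF _ sum_cong.sym] by auto
qed

section \<open>Sweedler calculus in weak bialgebras and weak Hopf algebras\<close>

lemma klin2I: "(\<And>v. klin s1 s' (\<lambda>u. B u v)) \<Longrightarrow> (\<And>u. klin s2 s' (\<lambda>v. B u v)) \<Longrightarrow> klin2 s1 s2 s' B"
  by (simp add: klin2_def)

lemma klin3I: "(\<And>b c. klin s s' (\<lambda>a. T a b c)) \<Longrightarrow> (\<And>a c. klin s s' (\<lambda>b. T a b c))
    \<Longrightarrow> (\<And>a b. klin s s' (\<lambda>c. T a b c)) \<Longrightarrow> klin3 s s' T"
  by (simp add: klin3_def)

lemma klin_id: "klin s s (\<lambda>x. x)"
  by (simp add: klin_def)

lemma klin_comp: "klin s1 s2 T \<Longrightarrow> klin s s1 G \<Longrightarrow> klin s s2 (\<lambda>x. T (G x))"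
  by (simp add: klin_def)

lemma klin2_comp1: "klin2 s1 s2 s' B \<Longrightarrow> klin s s1 G \<Longrightarrow> klin s s' (\<lambda>x. B (G x) v)"
  and klin2_comp2: "klin2 s1 s2 s' B \<Longrightarrow> klin s s2 G' \<Longrightarrow> klin s s' (\<lambda>x. B u (G' x))"
  by (auto simp: klin2_def klin_def)

lemma klin3_comp1: "klin3 s1 s' T \<Longrightarrow> klin s s1 G \<Longrightarrow> klin s s' (\<lambda>x. T (G x) v w)"
  and klin3_comp2: "klin3 s1 s' T \<Longrightarrow> klin s s1 G \<Longrightarrow> klin s s' (\<lambda>x. T u (G x) w)"
  and klin3_comp3: "klin3 s1 s' T \<Longrightarrow> klin s s1 G \<Longrightarrow> klin s s' (\<lambda>x. T u v (G x))"
  by (auto simp: klin3_def klin_def)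

lemmas klin2_comp = klin2_comp1 klin2_comp2
lemmas klin3_comp = klin3_comp1 klin3_comp2 klin3_comp3

lemma klin_scale_left: "vector_space sW \<Longrightarrow> klin s (*) F \<Longrightarrow> klin s sW (\<lambda>x. sW (F x) w)"
  unfolding klin_def by (simp add: vector_space.vector_space_assms)

lemma klin_scale_right: "vector_space sW \<Longrightarrow> klin s sW F \<Longrightarrow> klin s sW (\<lambda>x. sW c (F x))"
  unfolding klin_def by (simp add: vector_space.vector_space_assms mult.commute)

lemma klin_mult_left: "klin s (*) F \<Longrightarrow> klin s (*) (\<lambda>x. F x * (c :: 'k::field))"
  and klin_mult_right: "klin s (*) F \<Longrightarrow> klin s (*) (\<lambda>x. c * (F x :: 'k::field))"
  unfolding klin_def by (auto simp: algebra_simps)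

lemma k_algebra_klin2:
  assumes "k_algebra sA"
  shows "klin2 sA sA sA (*)"
  using assms by (auto simp: k_algebra_def klin2_def klin_def algebra_simps)

named_theorems lin

lemmas [lin] = klin_id klin2I klin3I klin_mult_left klin_mult_right

lemma sum_list_swap: "(\<Sum>x\<leftarrow>xs. \<Sum>y\<leftarrow>ys. F x y) = (\<Sum>y\<leftarrow>ys. \<Sum>x\<leftarrow>xs. F x y)"
  for F :: "'a \<Rightarrow> 'b \<Rightarrow> 'w::ab_group_add"
  by (induction xs) (simp_all add: sum_list_addf)

context weak_bialgebra
begin

text \<open>Sweedler notation as a binder, with the legs of Delta(h) as bound variables. The value
  is independent of the chosen formal sum only for bilinear \<open>T\<close>. Hence the steps that
  use coassociativity, the counit or products leave linearity conditions, which the rules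
  \<open>lin\<close> decompose.\<close>

definition Sw :: "'h \<Rightarrow> ('h \<Rightarrow> 'h \<Rightarrow> 'w) \<Rightarrow> 'w::ab_group_add" where
  "Sw h T = (\<Sum>(x, y)\<leftarrow>sw \<Delta> h. T x y)"

lemma vs: "vector_space sH"
  using algebra by (simp add: k_algebra_def)

lemmas klin_H [lin] =
  klin2_comp[OF k_algebra_klin2[OF algebra]] klin_scale_left[OF vs] klin_scale_right[OF vs]
  klin_comp[OF klin_linear[OF counit_linear]]

lemma tens_sw: "tens sH sH (sw \<Delta> h) = \<Delta> h"
proof -
  obtain t where t: "\<Delta> h = tens sH sH t" using comult_in[of h] by blast
  show ?thesis unfolding sw_def t by (rule tens_rep_tens)
qed

lemma Sw_tens:
  assumes "\<Delta> h = tens sH sH t" and T: "klin2 sH sH sW T"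
  shows "Sw h T = (\<Sum>(x, y)\<leftarrow>t. T x y)"
proof -
  have "tens sH sH (sw \<Delta> h) = tens sH sH t" using assms(1) tens_sw by simp
  then show ?thesis unfolding Sw_def by (intro sum_cong_eval[OF _ T]) (simp add: tens_eq_iff)
qed

lemma Sw_cong: "(\<And>x y. T x y = T' x y) \<Longrightarrow> Sw h T = Sw h T'"
  by (simp add: Sw_def)

lemma Sw_add_fun: "Sw h (\<lambda>x y. T x y + T' x y) = Sw h T + Sw h T'"
  unfolding Sw_def by (simp add: case_prod_unfold sum_list_addf)

lemma Sw_pull:
  assumes "klin s s' G"
  shows "G (Sw h T) = Sw h (\<lambda>x y. G (T x y))"
  unfolding Sw_def by (simp add: klin_sum_list[OF assms] case_prod_unfold)

lemma Sw_add:
  assumes "klin2 sH sH sW T"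
  shows "Sw (h + l) T = Sw h T + Sw l T"
proof -
  have "\<Delta> (h + l) = tens sH sH (sw \<Delta> h @ sw \<Delta> l)"
    by (simp add: comult_add tens_add_def sw_def)
  from Sw_tens[OF this assms] show ?thesis by (simp add: Sw_def)
qed

lemma Sw_scale:
  assumes W: "vector_space sW" and T: "klin2 sH sH sW T"
  shows "Sw (sH c h) T = sW c (Sw h T)"
proof -
  have "\<Delta> (sH c h) = tens sH sH [(sH c u, v). (u, v) \<leftarrow> sw \<Delta> h]"
    by (simp add: comult_scale tens_scale_def sw_def)
  then have "Sw (sH c h) T = (\<Sum>(u, v)\<leftarrow>[(sH c u, v). (u, v) \<leftarrow> sw \<Delta> h]. T u v)"
    using Sw_tens T by blast
  also have "\<dots> = (\<Sum>(u, v)\<leftarrow>sw \<Delta> h. sW c (T u v))"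
    unfolding sum_list_pair_map klin_scale[OF klin2D(1)[OF T]] ..
  also have "\<dots> = sW c (Sw h T)"
    unfolding Sw_def by (subst klin_sum_list[OF klin_scale_right[OF W klin_id]]) (simp add: case_prod_unfold)
  finally show ?thesis .
qed

lemma klin_Sw_fun:
  assumes W: "vector_space sW" and "\<And>u v. klin s sW (\<lambda>x. T x u v)"
  shows "klin s sW (\<lambda>x. Sw h (T x))"
  by (rule klinI) (simp_all add: Sw_def case_prod_unfold klin_add[OF assms(2)] sum_list_addf
      klin_scale[OF assms(2)] klin_sum_list[OF klin_scale_right[OF W klin_id]])

lemma klin_Sw_arg:
  assumes "vector_space sW" "klin2 sH sH sW T" "klin s sH G"
  shows "klin s sW (\<lambda>x. Sw (G x) T)"
  by (rule klinI) (simp_all add: klin_add[OF assms(3)] klin_scale[OF assms(3)] Sw_add[OF assms(2)] Sw_scale[OF assms(1,2)])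

lemma Sw_coassoc:
  assumes "klin3 sH sW T"
  shows "Sw h (\<lambda>w z. Sw w (\<lambda>x y. T x y z)) = Sw h (\<lambda>x w. Sw w (\<lambda>y z. T x y z))"
  using sum_cong_eval3[OF tens3_eqD[OF coassoc[of h]] assms]
  unfolding Sw_def by (simp add: sum_list_concat_map case_prod_unfold o_def)

lemma Sw_swap: "Sw h (\<lambda>x y. Sw l (\<lambda>u v. T x y u v)) = Sw l (\<lambda>u v. Sw h (\<lambda>x y. T x y u v))"
  unfolding Sw_def case_prod_unfold by (rule sum_list_swap)

lemma Sw_mult:
  assumes "klin2 sH sH sW T"
  shows "Sw (h * l) T = Sw h (\<lambda>x y. Sw l (\<lambda>u v. T (x * u) (y * v)))"
  using Sw_tens[OF comult_mult assms, of h l]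
  unfolding Sw_def by (simp add: sum_list_concat_map case_prod_unfold o_def)

lemma Sw_counit_left:
  assumes "klin sH sW T"
  shows "Sw h (\<lambda>x y. sW (\<epsilon> x) (T y)) = T h"
  using arg_cong[OF counit_left[of h], of T]
  by (simp add: Sw_def klin_sum_list[OF assms] case_prod_unfold klin_scale[OF assms])

lemma Sw_counit_right:
  assumes "klin sH sW T"
  shows "Sw h (\<lambda>x y. sW (\<epsilon> y) (T x)) = T h"
  using arg_cong[OF counit_right[of h], of T]
  by (simp add: Sw_def klin_sum_list[OF assms] case_prod_unfold klin_scale[OF assms])

lemma Sw_one1:
  assumes "klin3 sH sW T"
  shows "Sw 1 (\<lambda>x w. Sw w (\<lambda>y z. T x y z)) = Sw 1 (\<lambda>x y. Sw 1 (\<lambda>u v. T x (y * u) v))"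
  using sum_cong_eval3[OF tens3_eqD[OF comult_one1] assms] Sw_coassoc[OF assms, of 1]
  unfolding Sw_def sw3_def by (simp add: sum_list_concat_map case_prod_unfold o_def)

lemma Sw_one2:
  assumes "klin3 sH sW T"
  shows "Sw 1 (\<lambda>x w. Sw w (\<lambda>y z. T x y z)) = Sw 1 (\<lambda>x y. Sw 1 (\<lambda>u v. T x (u * y) v))"
  using sum_cong_eval3[OF tens3_eqD[OF comult_one2] assms] Sw_coassoc[OF assms, of 1]
  unfolding Sw_def sw3_def by (simp add: sum_list_concat_map case_prod_unfold o_def)

lemma Sw_one_left: "klin2 sH sH sW T \<Longrightarrow> Sw 1 (\<lambda>x y. Sw h (\<lambda>u v. T (x * u) (y * v))) = Sw h T"
  using Sw_mult[of sW T 1 h] by simp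

lemma Sw_one_right: "klin2 sH sH sW T \<Longrightarrow> Sw h (\<lambda>x y. Sw 1 (\<lambda>u v. T (x * u) (y * v))) = Sw h T"
  using Sw_mult[of sW T h 1] by simp

lemma PiL_Sw: "PiL sH \<Delta> \<epsilon> h = Sw 1 (\<lambda>x y. sH (\<epsilon> (x * h)) y)"
  by (simp add: PiL_def Sw_def)

lemma PiR_Sw: "PiR sH \<Delta> \<epsilon> h = Sw 1 (\<lambda>x y. sH (\<epsilon> (h * y)) x)"
  by (simp add: PiR_def Sw_def)

lemmas [lin] = klin_Sw_fun[OF vs] klin_Sw_arg[OF vs]

section \<open>The counital maps \<open>PiL\<close> and \<open>PiR\<close>\<close>

abbreviation "\<Pi>L \<equiv> PiL sH \<Delta> \<epsilon>"
abbreviation "\<Pi>R \<equiv> PiR sH \<Delta> \<epsilon>"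

lemma klin_Pi [lin]: "klin s sH F \<Longrightarrow> klin s sH (\<lambda>x. \<Pi>L (F x))" "klin s sH F \<Longrightarrow> klin s sH (\<lambda>x. \<Pi>R (F x))"
  unfolding PiL_Sw PiR_Sw by (intro lin; assumption)+

lemma pull_PiL: "klin sH sW T \<Longrightarrow> T (\<Pi>L h) = Sw 1 (\<lambda>x y. sW (\<epsilon> (x * h)) (T y))"
  by (simp add: PiL_Sw Sw_pull[where s=sH and s'=sW] klin_scale[where s=sH and s'=sW and F=T])

lemma pull_PiR: "klin sH sW T \<Longrightarrow> T (\<Pi>R h) = Sw 1 (\<lambda>x y. sW (\<epsilon> (h * y)) (T x))"
  by (simp add: PiR_Sw Sw_pull[where s=sH and s'=sW] klin_scale[where s=sH and s'=sW and F=T])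

context
  fixes sW :: "'k \<Rightarrow> 'w::ab_group_add \<Rightarrow> 'w"
  assumes W: "vector_space sW"
begin

lemmas linW = lin klin_Sw_fun[OF W] klin_Sw_arg[OF W] klin_scale_left[OF W] klin_scale_right[OF W]

text \<open>Two copies of Delta(1) appear, one inserted in front of Delta(h) and one from the
  definition of \<open>PiL\<close>. The weak unit axiom merges them into the twofold coproduct of 1,
  after which the counit removes a leg. \<open>Sw_PiR_left\<close> is the mirror image.\<close>

lemma Sw_PiL_right:
  assumes T: "klin2 sH sH sW T"
  shows "Sw h (\<lambda>x y. T x (\<Pi>L y)) = Sw 1 (\<lambda>e1 e2. T (e1 * h) e2)"
proof -
  note lT = linW klin2_comp[OF T]
  have "Sw h (\<lambda>x y. T x (\<Pi>L y)) = Sw 1 (\<lambda>a b. Sw h (\<lambda>x y. T (a * x) (\<Pi>L (b * y))))"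
    by (rule Sw_one_left[symmetric, where sW=sW]) (intro lT)
  also have "\<dots> = Sw 1 (\<lambda>a b. Sw h (\<lambda>x y. Sw 1 (\<lambda>c d. sW (\<epsilon> (c * b * y)) (T (a * x) d))))"
    by (subst pull_PiL[where sW=sW]) (intro lT, simp add: mult.assoc)
  also have "\<dots> = Sw h (\<lambda>x y. Sw 1 (\<lambda>a b. Sw 1 (\<lambda>c d. sW (\<epsilon> (c * b * y)) (T (a * x) d))))"
    by (rule Sw_swap)
  also have "\<dots> = Sw h (\<lambda>x y. Sw 1 (\<lambda>a w. Sw w (\<lambda>b c. sW (\<epsilon> (b * y)) (T (a * x) c))))"
    by (subst Sw_one2[where sW=sW]) (intro lT, simp only: HOL.refl)
  also have "\<dots> = Sw h (\<lambda>x y. Sw 1 (\<lambda>w c. Sw w (\<lambda>a b. sW (\<epsilon> (b * y)) (T (a * x) c))))"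
    by (subst Sw_coassoc[where sW=sW]) (intro lT, simp only: HOL.refl)
  also have "\<dots> = Sw 1 (\<lambda>w c. Sw w (\<lambda>a b. Sw h (\<lambda>x y. sW (\<epsilon> (b * y)) (T (a * x) c))))"
    by (subst Sw_swap) (rule Sw_cong, rule Sw_swap)
  also have "\<dots> = Sw 1 (\<lambda>w c. Sw (w * h) (\<lambda>x y. sW (\<epsilon> y) (T x c)))"
    by (subst Sw_mult[where sW=sW]) (intro lT, simp only: HOL.refl)
  also have "\<dots> = Sw 1 (\<lambda>e1 e2. T (e1 * h) e2)"
    by (subst Sw_counit_right[where sW=sW]) (intro lT, simp only: HOL.refl)
  finally show ?thesis .
qed

lemma Sw_PiR_left:
  assumes T: "klin2 sH sH sW T"
  shows "Sw h (\<lambda>x y. T (\<Pi>R x) y) = Sw 1 (\<lambda>e1 e2. T e1 (h * e2))"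
proof -
  note lT = linW klin2_comp[OF T]
  have "Sw h (\<lambda>x y. T (\<Pi>R x) y) = Sw h (\<lambda>x y. Sw 1 (\<lambda>a b. T (\<Pi>R (x * a)) (y * b)))"
    by (rule Sw_one_right[symmetric, where sW=sW]) (intro lT)
  also have "\<dots> = Sw h (\<lambda>x y. Sw 1 (\<lambda>a b. Sw 1 (\<lambda>c d. sW (\<epsilon> (x * (a * d))) (T c (y * b)))))"
    by (subst pull_PiR[where sW=sW]) (intro lT, simp only: mult.assoc)
  also have "\<dots> = Sw h (\<lambda>x y. Sw 1 (\<lambda>c d. Sw 1 (\<lambda>a b. sW (\<epsilon> (x * (a * d))) (T c (y * b)))))"
    by (rule Sw_cong, rule Sw_swap)
  also have "\<dots> = Sw h (\<lambda>x y. Sw 1 (\<lambda>c w. Sw w (\<lambda>a b. sW (\<epsilon> (x * a)) (T c (y * b)))))"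
    by (rule Sw_cong, rule Sw_one2[symmetric, where sW=sW]) (intro lT)
  also have "\<dots> = Sw 1 (\<lambda>c w. Sw h (\<lambda>x y. Sw w (\<lambda>a b. sW (\<epsilon> (x * a)) (T c (y * b)))))"
    by (rule Sw_swap)
  also have "\<dots> = Sw 1 (\<lambda>c w. Sw (h * w) (\<lambda>x y. sW (\<epsilon> x) (T c y)))"
    by (rule Sw_cong, rule Sw_mult[symmetric, where sW=sW]) (intro lT)
  also have "\<dots> = Sw 1 (\<lambda>e1 e2. T e1 (h * e2))"
    by (rule Sw_cong, rule Sw_counit_left[where sW=sW]) (intro lT)
  finally show ?thesis .
qed

text \<open>With Delta(1) inserted on the left, the weak counit axiom splits \<epsilon>(h w y) at
  the second leg \<open>w\<close> of Delta(1). The part that meets \<open>l\<close> is removed by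
  the counit, and the other part builds \<open>PiR(h)\<close>.\<close>

lemma Sw_PiR_mult:
  assumes T: "klin sH sW T"
  shows "Sw l (\<lambda>x y. sW (\<epsilon> (h * y)) (T x)) = T (\<Pi>R h * l)"
proof -
  interpret W: vector_space sW by (rule W)
  note lT = linW klin_comp[OF T]
  have cm: "\<epsilon> (h * w * y) = Sw w (\<lambda>c d. \<epsilon> (h * d) * \<epsilon> (c * y))" for w y
    unfolding Sw_def by (rule counit_mult2)
  have "Sw l (\<lambda>x y. sW (\<epsilon> (h * y)) (T x)) = Sw 1 (\<lambda>a w. Sw l (\<lambda>x y. sW (\<epsilon> (h * (w * y))) (T (a * x))))"
    by (rule Sw_one_left[symmetric, where sW=sW]) (intro lT)
  also have "\<dots> = Sw 1 (\<lambda>a w. Sw l (\<lambda>x y. Sw w (\<lambda>c d. sW (\<epsilon> (h * d)) (sW (\<epsilon> (c * y)) (T (a * x))))))"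
    by (simp add: mult.assoc[symmetric] cm Sw_pull[where s="(*)" and s'=sW and G="\<lambda>c. sW c _", OF klin_scale_left[OF W klin_id]])
  also have "\<dots> = Sw 1 (\<lambda>a w. Sw w (\<lambda>c d. Sw l (\<lambda>x y. sW (\<epsilon> (h * d)) (sW (\<epsilon> (c * y)) (T (a * x))))))"
    by (rule Sw_cong, rule Sw_swap)
  also have "\<dots> = Sw 1 (\<lambda>w d. Sw w (\<lambda>a c. Sw l (\<lambda>x y. sW (\<epsilon> (h * d)) (sW (\<epsilon> (c * y)) (T (a * x))))))"
    by (rule Sw_coassoc[symmetric, where sW=sW]) (intro lT)
  also have "\<dots> = Sw 1 (\<lambda>w d. Sw (w * l) (\<lambda>x y. sW (\<epsilon> (h * d)) (sW (\<epsilon> y) (T x))))"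
    by (rule Sw_cong, rule Sw_mult[symmetric, where sW=sW]) (intro lT)
  also have "\<dots> = Sw 1 (\<lambda>w d. Sw (w * l) (\<lambda>x y. sW (\<epsilon> y) (sW (\<epsilon> (h * d)) (T x))))"
    by (simp add: mult.commute)
  also have "\<dots> = Sw 1 (\<lambda>w d. sW (\<epsilon> (h * d)) (T (w * l)))"
    by (rule Sw_cong, rule Sw_counit_right[where sW=sW and T="\<lambda>x. sW _ (T x)"]) (intro lT)
  also have "\<dots> = T (\<Pi>R h * l)"
    by (rule pull_PiR[symmetric, where T="\<lambda>r. T (r * l)"]) (intro lT)
  finally show ?thesis .
qed

text \<open>\<open>PiR(h)\<close> is a combination of first legs of Delta(1), so its coproduct comes
  from the twofold coproduct of 1. The two forms of the weak unit axiom give the two sides on which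
  \<open>PiR(h)\<close> can be multiplied. \<open>Sw_PiL\<close> is the analogue for H^L.\<close>

lemma Sw_PiR:
  assumes T: "klin2 sH sH sW T"
  shows "Sw (\<Pi>R h) T = Sw 1 (\<lambda>x y. T x (y * \<Pi>R h))" "Sw (\<Pi>R h) T = Sw 1 (\<lambda>x y. T x (\<Pi>R h * y))"
proof -
  note lT = linW klin2_comp[OF T]
  have 1: "Sw (\<Pi>R h) T = Sw 1 (\<lambda>w d. sW (\<epsilon> (h * d)) (Sw w (\<lambda>x y. T x y)))"
    by (rule pull_PiR) (intro lT)
  also have "\<dots> = Sw 1 (\<lambda>w d. Sw w (\<lambda>x y. sW (\<epsilon> (h * d)) (T x y)))"
    by (rule Sw_cong, rule Sw_pull[where s=sW and s'=sW]) (intro lT)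
  also have "\<dots> = Sw 1 (\<lambda>x w. Sw w (\<lambda>y d. sW (\<epsilon> (h * d)) (T x y)))"
    by (rule Sw_coassoc[where sW=sW]) (intro lT)
  finally have 2: "Sw (\<Pi>R h) T = \<dots>" .
  also have "\<dots> = Sw 1 (\<lambda>x y. Sw 1 (\<lambda>u v. sW (\<epsilon> (h * v)) (T x (y * u))))"
    by (rule Sw_one1[where sW=sW]) (intro lT)
  also have "\<dots> = Sw 1 (\<lambda>x y. T x (y * \<Pi>R h))"
    by (rule Sw_cong, rule pull_PiR[symmetric]) (intro lT)
  finally show "Sw (\<Pi>R h) T = Sw 1 (\<lambda>x y. T x (y * \<Pi>R h))" .
  note 2
  also have "Sw 1 (\<lambda>x w. Sw w (\<lambda>y d. sW (\<epsilon> (h * d)) (T x y)))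
      = Sw 1 (\<lambda>x y. Sw 1 (\<lambda>u v. sW (\<epsilon> (h * v)) (T x (u * y))))"
    by (rule Sw_one2[where sW=sW]) (intro lT)
  also have "\<dots> = Sw 1 (\<lambda>x y. T x (\<Pi>R h * y))"
    by (rule Sw_cong, rule pull_PiR[symmetric]) (intro lT)
  finally show "Sw (\<Pi>R h) T = Sw 1 (\<lambda>x y. T x (\<Pi>R h * y))" .
qed

lemma Sw_PiL:
  assumes T: "klin2 sH sH sW T"
  shows "Sw (\<Pi>L h) T = Sw 1 (\<lambda>x y. T (\<Pi>L h * x) y)" "Sw (\<Pi>L h) T = Sw 1 (\<lambda>x y. T (x * \<Pi>L h) y)"
proof -
  note lT = linW klin2_comp[OF T]
  have 1: "Sw (\<Pi>L h) T = Sw 1 (\<lambda>d w. sW (\<epsilon> (d * h)) (Sw w (\<lambda>x y. T x y)))"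
    by (rule pull_PiL) (intro lT)
  also have "\<dots> = Sw 1 (\<lambda>d w. Sw w (\<lambda>x y. sW (\<epsilon> (d * h)) (T x y)))"
    by (rule Sw_cong, rule Sw_pull[where s=sW and s'=sW]) (intro lT)
  finally have 2: "Sw (\<Pi>L h) T = \<dots>" .
  also have "\<dots> = Sw 1 (\<lambda>d y. Sw 1 (\<lambda>u v. sW (\<epsilon> (d * h)) (T (y * u) v)))"
    by (rule Sw_one1[where sW=sW]) (intro lT)
  also have "\<dots> = Sw 1 (\<lambda>u v. Sw 1 (\<lambda>d y. sW (\<epsilon> (d * h)) (T (y * u) v)))"
    by (rule Sw_swap)
  also have "\<dots> = Sw 1 (\<lambda>x y. T (\<Pi>L h * x) y)"
    by (rule Sw_cong, rule pull_PiL[symmetric, where T="\<lambda>r. T (r * _) _"]) (intro lT)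
  finally show "Sw (\<Pi>L h) T = Sw 1 (\<lambda>x y. T (\<Pi>L h * x) y)" .
  note 2
  also have "Sw 1 (\<lambda>d w. Sw w (\<lambda>x y. sW (\<epsilon> (d * h)) (T x y)))
      = Sw 1 (\<lambda>d y. Sw 1 (\<lambda>u v. sW (\<epsilon> (d * h)) (T (u * y) v)))"
    by (rule Sw_one2[where sW=sW]) (intro lT)
  also have "\<dots> = Sw 1 (\<lambda>u v. Sw 1 (\<lambda>d y. sW (\<epsilon> (d * h)) (T (u * y) v)))"
    by (rule Sw_swap)
  also have "\<dots> = Sw 1 (\<lambda>x y. T (x * \<Pi>L h) y)"
    by (rule Sw_cong, rule pull_PiL[symmetric, where T="\<lambda>r. T (_ * r) _"]) (intro lT)
  finally show "Sw (\<Pi>L h) T = Sw 1 (\<lambda>x y. T (x * \<Pi>L h) y)" .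
qed

text \<open>\<open>PiL(h1)\<close> contributes a copy of Delta(1) in front of Delta(h), which is
  absorbed, and a counit, which removes \<open>h1\<close>.\<close>

lemma Sw_PiL_absorb:
  assumes T: "klin sH sW T"
  shows "Sw h (\<lambda>x y. T (\<Pi>L x * y)) = T h"
proof -
  note lT = linW klin_comp[OF T]
  have "Sw h (\<lambda>x y. T (\<Pi>L x * y)) = Sw h (\<lambda>x y. Sw 1 (\<lambda>c d. sW (\<epsilon> (c * x)) (T (d * y))))"
    by (rule Sw_cong, rule pull_PiL[where T="\<lambda>r. T (r * _)"]) (intro lT)
  also have "\<dots> = Sw 1 (\<lambda>c d. Sw h (\<lambda>x y. sW (\<epsilon> (c * x)) (T (d * y))))"
    by (rule Sw_swap)
  also have "\<dots> = Sw h (\<lambda>x y. sW (\<epsilon> x) (T y))"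
    by (rule Sw_one_left[where sW=sW]) (intro lT)
  also have "\<dots> = T h" by (rule Sw_counit_left[OF T])
  finally show ?thesis .
qed

text \<open>For two copies \<open>a (x) b\<close> and \<open>c (x) d\<close> of Delta(1), both sides
  are the sum of \<open>a (x) d\<close> with coefficient \<epsilon>(c h b). The two weak counit
  axioms are the two ways to split this coefficient at \<open>h\<close>.\<close>

lemma Sw_PiR_PiL_swap:
  assumes T: "klin2 sH sH sW T"
  shows "Sw h (\<lambda>x y. T (\<Pi>R x) (\<Pi>L y)) = Sw h (\<lambda>x y. T (\<Pi>R y) (\<Pi>L x))"
proof -
  interpret W: vector_space sW by (rule W)
  note lT = linW klin2_comp[OF T]
  have T': "T (\<Pi>R x) (\<Pi>L y) = Sw 1 (\<lambda>a b. Sw 1 (\<lambda>c d. sW (\<epsilon> (c * y) * \<epsilon> (x * b)) (T a d)))" for x y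
  proof -
    have "T (\<Pi>R x) (\<Pi>L y) = Sw 1 (\<lambda>a b. sW (\<epsilon> (x * b)) (T a (\<Pi>L y)))"
      by (rule pull_PiR[where T="\<lambda>r. T r _"]) (intro lT)
    also have "\<dots> = Sw 1 (\<lambda>a b. Sw 1 (\<lambda>c d. sW (\<epsilon> (c * y)) (sW (\<epsilon> (x * b)) (T a d))))"
      by (rule Sw_cong, rule pull_PiL[where T="\<lambda>r. sW _ (T _ r)"]) (intro lT)
    finally show ?thesis by simp
  qed
  note sc = klin_scale_left[OF W klin_id]
  have "Sw h (\<lambda>x y. T (\<Pi>R x) (\<Pi>L y)) = Sw 1 (\<lambda>a b. Sw h (\<lambda>x y. Sw 1 (\<lambda>c d. sW (\<epsilon> (c * y) * \<epsilon> (x * b)) (T a d))))"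
    unfolding T' by (rule Sw_swap)
  also have "\<dots> = Sw 1 (\<lambda>a b. Sw 1 (\<lambda>c d. Sw h (\<lambda>x y. sW (\<epsilon> (c * y) * \<epsilon> (x * b)) (T a d))))"
    by (rule Sw_cong, rule Sw_swap)
  also have "\<dots> = Sw 1 (\<lambda>a b. Sw 1 (\<lambda>c d. sW (\<epsilon> (c * h * b)) (T a d)))"
    by (intro Sw_cong) (simp only: Sw_pull[where s="(*)" and s'=sW and G="\<lambda>c. sW c _", OF sc, symmetric] counit_mult2 Sw_def)
  also have "\<dots> = Sw 1 (\<lambda>a b. Sw 1 (\<lambda>c d. Sw h (\<lambda>x y. sW (\<epsilon> (c * x) * \<epsilon> (y * b)) (T a d))))"
    by (intro Sw_cong) (simp only: Sw_pull[where s="(*)" and s'=sW and G="\<lambda>c. sW c _", OF sc, symmetric] counit_mult1 Sw_def)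
  also have "\<dots> = Sw 1 (\<lambda>a b. Sw h (\<lambda>x y. Sw 1 (\<lambda>c d. sW (\<epsilon> (c * x) * \<epsilon> (y * b)) (T a d))))"
    by (rule Sw_cong, rule Sw_swap)
  also have "\<dots> = Sw h (\<lambda>x y. T (\<Pi>R y) (\<Pi>L x))"
    unfolding T' by (rule Sw_swap)
  finally show ?thesis .
qed

end

end

section \<open>The antipode reverses coproducts\<close>

context weak_hopf_algebra
begin

lemmas klin_S [lin] = klin_comp[OF klin_linear[OF antipode_linear]]

lemma PiL_antipode: "Sw h (\<lambda>x y. x * S y) = \<Pi>L h"
  unfolding Sw_def by (rule antipode_left)

lemma PiR_antipode: "Sw h (\<lambda>x y. S x * y) = \<Pi>R h"
  unfolding Sw_def by (rule antipode_right)

context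
  fixes sW :: "'k \<Rightarrow> 'w::ab_group_add \<Rightarrow> 'w"
  assumes W: "vector_space sW"
begin

lemmas linS = lin klin_Sw_fun[OF W] klin_Sw_arg[OF W] klin_scale_left[OF W] klin_scale_right[OF W]

lemma pull_PiL': "klin sH sW T \<Longrightarrow> T (\<Pi>L h) = Sw h (\<lambda>x y. T (x * S y))"
  unfolding PiL_antipode[symmetric] by (rule Sw_pull)

lemma pull_PiR': "klin sH sW T \<Longrightarrow> T (\<Pi>R h) = Sw h (\<lambda>x y. T (S x * y))"
  unfolding PiR_antipode[symmetric] by (rule Sw_pull)

lemma Sw_S_mid:
  assumes T: "klin sH sW T"
  shows "Sw h (\<lambda>x w. Sw w (\<lambda>y z. T (S x * y * S z))) = T (S h)"
proof -
  note lT = linS klin_comp[OF T]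
  have "T (S h) = T (Sw h (\<lambda>w z. Sw w (\<lambda>x y. S x * y * S z)))"
    using arg_cong[OF antipode_mid[of h], of T]
    unfolding Sw_def sw3_def by (simp add: sum_list_concat_map case_prod_unfold o_def)
  also have "\<dots> = Sw h (\<lambda>w z. Sw w (\<lambda>x y. T (S x * y * S z)))"
    unfolding Sw_pull[OF T] ..
  also have "\<dots> = Sw h (\<lambda>x w. Sw w (\<lambda>y z. T (S x * y * S z)))"
    by (rule Sw_coassoc[where sW=sW]) (intro lT)
  finally show ?thesis by simp
qed

lemma Sw_S_PiL:
  assumes T: "klin sH sW T"
  shows "Sw h (\<lambda>x y. T (S x * \<Pi>L y)) = T (S h)"
proof -
  note lT = linS klin_comp[OF T]
  have "Sw h (\<lambda>x y. T (S x * \<Pi>L y)) = Sw h (\<lambda>x w. Sw w (\<lambda>y z. T (S x * (y * S z))))"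
    by (rule Sw_cong, rule pull_PiL'[where T="\<lambda>r. T (_ * r)"]) (intro lT)
  then show ?thesis using Sw_S_mid[OF T] by (simp add: mult.assoc)
qed

lemma Sw_PiR_S:
  assumes T: "klin sH sW T"
  shows "Sw h (\<lambda>x y. T (\<Pi>R x * S y)) = T (S h)"
proof -
  note lT = linS klin_comp[OF T]
  have "Sw h (\<lambda>x y. T (\<Pi>R x * S y)) = Sw h (\<lambda>w z. Sw w (\<lambda>x y. T (S x * y * S z)))"
    by (rule Sw_cong, rule pull_PiR'[where T="\<lambda>r. T (r * _)"]) (intro lT)
  also have "\<dots> = Sw h (\<lambda>x w. Sw w (\<lambda>y z. T (S x * y * S z)))"
    by (rule Sw_coassoc[where sW=sW]) (intro lT)
  finally show ?thesis using Sw_S_mid[OF T] by simp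
qed

text \<open>In \<open>h1 S(h4) (x) h2 S(h3)\<close> the inner pair collapses to \<open>PiL\<close>.
  \<open>Sw_PiL_right\<close> trades this factor for Delta(1), so the outer pair collapses as well,
  and \<open>Sw_PiL\<close> recognizes the coproduct of \<open>PiL(h)\<close>.
  \<open>Sw_PiR_expand\<close> is analogous.\<close>

lemma Sw_PiL_expand:
  assumes T: "klin2 sH sH sW T"
  shows "Sw (\<Pi>L h) T = Sw h (\<lambda>x w. Sw w (\<lambda>y w'. Sw w' (\<lambda>z t. T (x * S t) (y * S z))))"
proof -
  note lT = linS klin2_comp[OF T]
  have "Sw h (\<lambda>x w. Sw w (\<lambda>y w'. Sw w' (\<lambda>z t. T (x * S t) (y * S z))))
     = Sw h (\<lambda>x w. Sw w (\<lambda>q t. Sw q (\<lambda>y z. T (x * S t) (y * S z))))"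
    by (rule Sw_cong, rule Sw_coassoc[symmetric, where sW=sW]) (intro lT)
  also have "\<dots> = Sw h (\<lambda>x w. Sw w (\<lambda>q t. T (x * S t) (\<Pi>L q)))"
    by (intro Sw_cong, rule pull_PiL'[symmetric]) (intro lT)
  also have "\<dots> = Sw h (\<lambda>p t. Sw p (\<lambda>x q. T (x * S t) (\<Pi>L q)))"
    by (rule Sw_coassoc[symmetric, where sW=sW]) (intro lT)
  also have "\<dots> = Sw h (\<lambda>p t. Sw 1 (\<lambda>e1 e2. T (e1 * p * S t) e2))"
    by (rule Sw_cong, rule Sw_PiL_right[OF W, where T="\<lambda>x q. T (x * S _) q"]) (intro lT)
  also have "\<dots> = Sw 1 (\<lambda>e1 e2. Sw h (\<lambda>p t. T (e1 * (p * S t)) e2))"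
    unfolding mult.assoc by (rule Sw_swap)
  also have "\<dots> = Sw 1 (\<lambda>e1 e2. T (e1 * \<Pi>L h) e2)"
    by (rule Sw_cong, rule pull_PiL'[symmetric, where T="\<lambda>r. T (_ * r) _"]) (intro lT)
  also have "\<dots> = Sw (\<Pi>L h) T" by (rule Sw_PiL(2)[OF W T, symmetric])
  finally show ?thesis by simp
qed

lemma Sw_PiR_expand:
  assumes T: "klin2 sH sH sW T"
  shows "Sw (\<Pi>R h) T = Sw h (\<lambda>x w. Sw w (\<lambda>y w'. Sw w' (\<lambda>z t. T (S y * z) (S x * t))))"
proof -
  note lT = linS klin2_comp[OF T]
  have "Sw h (\<lambda>x w. Sw w (\<lambda>y w'. Sw w' (\<lambda>z t. T (S y * z) (S x * t))))
     = Sw h (\<lambda>x w. Sw w (\<lambda>q t. Sw q (\<lambda>y z. T (S y * z) (S x * t))))"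
    by (rule Sw_cong, rule Sw_coassoc[symmetric, where sW=sW]) (intro lT)
  also have "\<dots> = Sw h (\<lambda>x w. Sw w (\<lambda>q t. T (\<Pi>R q) (S x * t)))"
    by (intro Sw_cong, rule pull_PiR'[symmetric, where T="\<lambda>r. T r _"]) (intro lT)
  also have "\<dots> = Sw h (\<lambda>x w. Sw 1 (\<lambda>e1 e2. T e1 (S x * (w * e2))))"
    by (rule Sw_cong, rule Sw_PiR_left[OF W, where T="\<lambda>q t. T q (S _ * t)"]) (intro lT)
  also have "\<dots> = Sw 1 (\<lambda>e1 e2. Sw h (\<lambda>x w. T e1 (S x * w * e2)))"
    unfolding mult.assoc by (rule Sw_swap)
  also have "\<dots> = Sw 1 (\<lambda>e1 e2. T e1 (\<Pi>R h * e2))"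
    by (rule Sw_cong, rule pull_PiR'[symmetric, where T="\<lambda>r. T _ (r * _)"]) (intro lT)
  also have "\<dots> = Sw (\<Pi>R h) T" by (rule Sw_PiR(2)[OF W T, symmetric])
  finally show ?thesis by simp
qed

text \<open>With \<open>\<Psi> = (S \<otimes> S) \<circ> \<Delta>\<^sup>o\<^sup>p\<close>, both sides equal \<open>\<Psi> * \<Delta> * \<Psi>\<close>.\<close>

lemma Sw_S:
  assumes T: "klin2 sH sH sW T"
  shows "Sw (S h) T = Sw h (\<lambda>x y. T (S y) (S x))"
proof -
  note lT = linS klin2_comp[OF T]
  have "Sw (S h) T = Sw h (\<lambda>x y. Sw (S x * \<Pi>L y) T)"
    by (rule Sw_S_PiL[symmetric]) (intro lT)
  also have "\<dots> = Sw h (\<lambda>x y. Sw (S x) (\<lambda>a b. Sw (\<Pi>L y) (\<lambda>c d. T (a * c) (b * d))))"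
    by (rule Sw_cong, rule Sw_mult[OF T])
  also have "\<dots> = Sw h (\<lambda>x y. Sw (S x) (\<lambda>a b. Sw y (\<lambda>p w. Sw w (\<lambda>q w'. Sw w' (\<lambda>r t. T (a * (p * S t)) (b * (q * S r)))))))"
    by (intro Sw_cong, rule Sw_PiL_expand[where T="\<lambda>c d. T (_ * c) (_ * d)"]) (intro lT)
  also have "\<dots> = Sw h (\<lambda>x y. Sw y (\<lambda>p w. Sw w (\<lambda>q w'. Sw (S x) (\<lambda>a b. Sw w' (\<lambda>r t. T (a * p * S t) (b * q * S r))))))"
    unfolding mult.assoc by (rule Sw_cong, rule HOL.trans[OF Sw_swap], rule Sw_cong, rule Sw_swap)
  also have "\<dots> = Sw h (\<lambda>x y. Sw y (\<lambda>g' w'. Sw g' (\<lambda>p q. Sw (S x) (\<lambda>a b. Sw w' (\<lambda>r t. T (a * p * S t) (b * q * S r))))))"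
    by (rule Sw_cong, rule Sw_coassoc[symmetric, where sW=sW]) (intro lT)
  also have "\<dots> = Sw h (\<lambda>x y. Sw y (\<lambda>g' w'. Sw (S x) (\<lambda>a b. Sw g' (\<lambda>p q. Sw w' (\<lambda>r t. T (a * p * S t) (b * q * S r))))))"
    by (intro Sw_cong, rule Sw_swap)
  also have "\<dots> = Sw h (\<lambda>x y. Sw y (\<lambda>g' w'. Sw (S x * g') (\<lambda>u v. Sw w' (\<lambda>r t. T (u * S t) (v * S r)))))"
    by (intro Sw_cong, rule Sw_mult[symmetric, where sW=sW]) (intro lT)
  also have "\<dots> = Sw h (\<lambda>g w'. Sw g (\<lambda>x g'. Sw (S x * g') (\<lambda>u v. Sw w' (\<lambda>r t. T (u * S t) (v * S r)))))"
    by (rule Sw_coassoc[symmetric, where sW=sW]) (intro lT)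
  \<comment> \<open>The product \<open>S(x) g'\<close> is now collected under one coproduct and may
    be replaced by \<open>PiR\<close>, whose expansion supplies the left factor of \<Psi> * \<Delta>
    * \<Psi>.\<close>
  also have "\<dots> = Sw h (\<lambda>g w'. Sw (\<Pi>R g) (\<lambda>u v. Sw w' (\<lambda>r t. T (u * S t) (v * S r))))"
    by (rule Sw_cong, rule pull_PiR'[symmetric]) (intro lT)
  also have "\<dots> = Sw h (\<lambda>g w'. Sw g (\<lambda>x w. Sw w (\<lambda>q s. Sw q (\<lambda>y z. Sw w' (\<lambda>r t. T (S y * z * S t) (S x * s * S r))))))"
  proof (rule Sw_cong)
    fix g w'
    have "Sw (\<Pi>R g) (\<lambda>u v. Sw w' (\<lambda>r t. T (u * S t) (v * S r)))
        = Sw g (\<lambda>x w. Sw w (\<lambda>y w''. Sw w'' (\<lambda>z s. Sw w' (\<lambda>r t. T (S y * z * S t) (S x * s * S r)))))"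
      by (rule Sw_PiR_expand) (intro lT)
    also have "\<dots> = Sw g (\<lambda>x w. Sw w (\<lambda>q s. Sw q (\<lambda>y z. Sw w' (\<lambda>r t. T (S y * z * S t) (S x * s * S r)))))"
      by (rule Sw_cong, rule Sw_coassoc[symmetric, where sW=sW]) (intro lT)
    finally show "Sw (\<Pi>R g) (\<lambda>u v. Sw w' (\<lambda>r t. T (u * S t) (v * S r))) = \<dots>" .
  qed
  also have "\<dots> = Sw h (\<lambda>g w'. Sw g (\<lambda>x w. Sw w (\<lambda>q s. Sw w' (\<lambda>r t. T (\<Pi>R q * S t) (S x * s * S r)))))"
    by (intro Sw_cong, subst Sw_swap, rule Sw_cong, rule pull_PiR'[symmetric, where T="\<lambda>r. T (r * _) _"]) (intro lT)
  also have "\<dots> = Sw h (\<lambda>x w. Sw w (\<lambda>g w'. Sw g (\<lambda>q s. Sw w' (\<lambda>r t. T (\<Pi>R q * S t) (S x * s * S r)))))"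
    by (rule Sw_coassoc[where sW=sW]) (intro lT)
  also have "\<dots> = Sw h (\<lambda>x w. Sw w (\<lambda>q w1. Sw w1 (\<lambda>s w'. Sw w' (\<lambda>r t. T (\<Pi>R q * S t) (S x * s * S r)))))"
    by (rule Sw_cong, rule Sw_coassoc[where sW=sW]) (intro lT)
  also have "\<dots> = Sw h (\<lambda>x w. Sw w (\<lambda>q w1. Sw w1 (\<lambda>p t. Sw p (\<lambda>s r. T (\<Pi>R q * S t) (S x * s * S r)))))"
    by (rule Sw_cong, rule Sw_cong, rule Sw_coassoc[symmetric, where sW=sW]) (intro lT)
  also have "\<dots> = Sw h (\<lambda>x w. Sw w (\<lambda>q w1. Sw w1 (\<lambda>p t. T (\<Pi>R q * S t) (S x * \<Pi>L p))))"
    unfolding mult.assoc by (intro Sw_cong, rule pull_PiL'[symmetric, where T="\<lambda>r. T _ (_ * r)"]) (intro lT)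
  also have "\<dots> = Sw h (\<lambda>x w. Sw w (\<lambda>g t. Sw g (\<lambda>q p. T (\<Pi>R q * S t) (S x * \<Pi>L p))))"
    by (rule Sw_cong, rule Sw_coassoc[symmetric, where sW=sW]) (intro lT)
  \<comment> \<open>So far the legs stand in the order x, q, p, t. Exchanging \<open>PiR\<close> and
    \<open>PiL\<close> puts p next to x and q next to t, where the identities
    \<open>Sw_S_PiL\<close> and \<open>Sw_PiR_S\<close> apply.\<close>
  also have "\<dots> = Sw h (\<lambda>x w. Sw w (\<lambda>g t. Sw g (\<lambda>p q. T (\<Pi>R q * S t) (S x * \<Pi>L p))))"
    by (rule Sw_cong, rule Sw_cong, rule Sw_PiR_PiL_swap[OF W, where T="\<lambda>a b. T (a * _) (_ * b)"]) (intro lT)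
  also have "\<dots> = Sw h (\<lambda>x w. Sw w (\<lambda>p g. Sw g (\<lambda>q t. T (\<Pi>R q * S t) (S x * \<Pi>L p))))"
    by (rule Sw_cong, rule Sw_coassoc[where sW=sW]) (intro lT)
  also have "\<dots> = Sw h (\<lambda>x w. Sw w (\<lambda>p g. T (S g) (S x * \<Pi>L p)))"
    by (intro Sw_cong, rule Sw_PiR_S[where T="\<lambda>r. T r _"]) (intro lT)
  also have "\<dots> = Sw h (\<lambda>w g. Sw w (\<lambda>x p. T (S g) (S x * \<Pi>L p)))"
    by (rule Sw_coassoc[symmetric, where sW=sW]) (intro lT)
  also have "\<dots> = Sw h (\<lambda>x y. T (S y) (S x))"
    by (rule Sw_cong, rule Sw_S_PiL) (intro lT)
  finally show ?thesis .
qed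

end

end

section \<open>Weak module algebras with an invertible cocycle\<close>

context weak_bialgebra
begin

lemma Sw_times: "Sw h T * c = Sw h (\<lambda>x y. T x y * c)" "c * Sw h T = Sw h (\<lambda>x y. c * T x y)"
  for c :: "'w::ring"
  unfolding Sw_def by (simp_all add: case_prod_unfold sum_list_mult_const sum_list_const_mult)

context
  fixes sW :: "'k \<Rightarrow> 'w::ab_group_add \<Rightarrow> 'w"
  assumes W: "vector_space sW"
begin

lemma Sw_mult_PiR:
  assumes T: "klin2 sH sH sW T"
  shows "Sw (h * \<Pi>R l) T = Sw h (\<lambda>x y. T x (y * \<Pi>R l))" "Sw (\<Pi>R l * h) T = Sw h (\<lambda>x y. T x (\<Pi>R l * y))"
proof -
  note lT = linW[OF W] klin2_comp[OF T]
  have "Sw (h * \<Pi>R l) T = Sw h (\<lambda>x y. Sw (\<Pi>R l) (\<lambda>u v. T (x * u) (y * v)))" by (rule Sw_mult[OF T])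
  also have "\<dots> = Sw h (\<lambda>x y. Sw 1 (\<lambda>u v. T (x * u) (y * v * \<Pi>R l)))"
    unfolding mult.assoc by (rule Sw_cong, rule Sw_PiR(1)[OF W]) (intro lT)
  also have "\<dots> = Sw h (\<lambda>x y. T x (y * \<Pi>R l))" by (rule Sw_one_right[where sW=sW]) (intro lT)
  finally show "Sw (h * \<Pi>R l) T = \<dots>" .
  have "Sw (\<Pi>R l * h) T = Sw (\<Pi>R l) (\<lambda>u v. Sw h (\<lambda>x y. T (u * x) (v * y)))" by (rule Sw_mult[OF T])
  also have "\<dots> = Sw 1 (\<lambda>u v. Sw h (\<lambda>x y. T (u * x) (\<Pi>R l * (v * y))))"
    unfolding mult.assoc[symmetric] by (rule Sw_PiR(2)[OF W]) (intro lT)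
  also have "\<dots> = Sw h (\<lambda>x y. T x (\<Pi>R l * y))" by (rule Sw_one_left[where sW=sW]) (intro lT)
  finally show "Sw (\<Pi>R l * h) T = \<dots>" .
qed

lemma Sw_mult_PiL:
  assumes T: "klin2 sH sH sW T"
  shows "Sw (h * \<Pi>L l) T = Sw h (\<lambda>x y. T (x * \<Pi>L l) y)" "Sw (\<Pi>L l * h) T = Sw h (\<lambda>x y. T (\<Pi>L l * x) y)"
proof -
  note lT = linW[OF W] klin2_comp[OF T]
  have "Sw (h * \<Pi>L l) T = Sw h (\<lambda>x y. Sw (\<Pi>L l) (\<lambda>u v. T (x * u) (y * v)))" by (rule Sw_mult[OF T])
  also have "\<dots> = Sw h (\<lambda>x y. Sw 1 (\<lambda>u v. T (x * u * \<Pi>L l) (y * v)))"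
    unfolding mult.assoc by (rule Sw_cong, rule Sw_PiL(2)[OF W]) (intro lT)
  also have "\<dots> = Sw h (\<lambda>x y. T (x * \<Pi>L l) y)" by (rule Sw_one_right[where sW=sW]) (intro lT)
  finally show "Sw (h * \<Pi>L l) T = \<dots>" .
  have "Sw (\<Pi>L l * h) T = Sw (\<Pi>L l) (\<lambda>u v. Sw h (\<lambda>x y. T (u * x) (v * y)))" by (rule Sw_mult[OF T])
  also have "\<dots> = Sw 1 (\<lambda>u v. Sw h (\<lambda>x y. T (\<Pi>L l * (u * x)) (v * y)))"
    unfolding mult.assoc[symmetric] by (rule Sw_PiL(1)[OF W]) (intro lT)
  also have "\<dots> = Sw h (\<lambda>x y. T (\<Pi>L l * x) y)" by (rule Sw_one_left[where sW=sW]) (intro lT)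
  finally show "Sw (\<Pi>L l * h) T = \<dots>" .
qed

text \<open>With \<open>Sw_one_PiL\<close>: the legs of Delta(1) may be taken in H^R and H^L.
  Identities known only for arguments of the form \<open>PiR(x)\<close> or \<open>PiL(x)\<close>
  thereby become available for the legs of Delta(1).\<close>

lemma Sw_one_PiR: "klin2 sH sH sW T \<Longrightarrow> Sw 1 (\<lambda>x y. T (\<Pi>R x) y) = Sw 1 T"
  using Sw_PiR_left[OF W, of T 1] by simp

lemma Sw_one_PiL: "klin2 sH sH sW T \<Longrightarrow> Sw 1 (\<lambda>x y. T x (\<Pi>L y)) = Sw 1 T"
  using Sw_PiL_right[OF W, of T 1] by simp

end

end

locale weak_cocycle = weak_hopf_algebra sH \<Delta> \<epsilon> S
  for sH :: "'k::field \<Rightarrow> 'h::{ring,monoid_mult} \<Rightarrow> 'h" and \<Delta> \<epsilon> S +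
  fixes sA :: "'k \<Rightarrow> 'a::{ring,monoid_mult} \<Rightarrow> 'a" and act :: "'h \<Rightarrow> 'a \<Rightarrow> 'a"
    and f finv :: "'h \<Rightarrow> 'h \<Rightarrow> 'a"
  assumes wma: "weak_module_algebra sH \<Delta> sA act"
    and coc: "cocycle_conditions sH \<Delta> sA act f"
    and inv: "convolution_inverse sH \<Delta> sA act f finv"
begin

lemma vsA: "vector_space sA" and algA: "k_algebra sA" and act_lin: "klin2 sH sA sA act"
  and act_mult: "act h (a * b) = Sw h (\<lambda>x y. act x a * act y b)"
  and act_act_one: "act h (act l 1) = act (h * l) 1"
  using wma bilinear_map_klin2 by (auto simp: weak_module_algebra_def k_algebra_def Sw_def)

lemma f_lin: "klin2 sH sH sA f" and finv_lin: "klin2 sH sH sA finv"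
  and f_u: "Sw h (\<lambda>h1 h2. Sw l (\<lambda>l1 l2. f h1 l1 * act (h2 * l2) 1)) = f h l"
  and f_unit_right: "Sw h (\<lambda>h1 h2. Sw 1 (\<lambda>e1 e2. act h1 (act e1 1) * f h2 e2)) = act h 1"
  and f_unit_left: "Sw 1 (\<lambda>e1 e2. act e1 1 * f e2 h) = act h 1"
  and f_twist: "Sw h (\<lambda>h1 h2. Sw l (\<lambda>l1 l2. f h1 l1 * act (h2 * l2) a))
     = Sw h (\<lambda>h1 h2. Sw l (\<lambda>l1 l2. act h1 (act l1 a) * f h2 l2))"
  and f_cocycle: "Sw h (\<lambda>h1 h2. Sw l (\<lambda>l1 l2. f h1 l1 * f (h2 * l2) m))
     = Sw h (\<lambda>h1 h2. Sw l (\<lambda>l1 l2. Sw m (\<lambda>m1 m2. act h1 (f l1 m1) * f h2 (l2 * m2))))"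
proof -
  note c = coc[unfolded cocycle_conditions_def]
  show "klin2 sH sH sA f" using c by (intro bilinear_map_klin2) (elim conjE)
  show "klin2 sH sH sA finv"
    using inv unfolding convolution_inverse_def Let_def by (intro bilinear_map_klin2) (elim conjE)
  show "Sw h (\<lambda>h1 h2. Sw l (\<lambda>l1 l2. f h1 l1 * act (h2 * l2) 1)) = f h l"
    unfolding Sw_def by (rule HOL.sym) (use c in \<open>elim conjE, blast\<close>)
  show "Sw h (\<lambda>h1 h2. Sw 1 (\<lambda>e1 e2. act h1 (act e1 1) * f h2 e2)) = act h 1"
    unfolding Sw_def by (rule HOL.sym) (use c in \<open>elim conjE, blast\<close>)
  show "Sw 1 (\<lambda>e1 e2. act e1 1 * f e2 h) = act h 1"
    unfolding Sw_def by (rule HOL.sym) (use c in \<open>elim conjE, blast\<close>)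
  show "Sw h (\<lambda>h1 h2. Sw l (\<lambda>l1 l2. f h1 l1 * act (h2 * l2) a))
     = Sw h (\<lambda>h1 h2. Sw l (\<lambda>l1 l2. act h1 (act l1 a) * f h2 l2))"
    unfolding Sw_def using c by (elim conjE) blast
  show "Sw h (\<lambda>h1 h2. Sw l (\<lambda>l1 l2. f h1 l1 * f (h2 * l2) m))
     = Sw h (\<lambda>h1 h2. Sw l (\<lambda>l1 l2. Sw m (\<lambda>m1 m2. act h1 (f l1 m1) * f h2 (l2 * m2))))"
    unfolding Sw_def using c by (elim conjE) blast
qed

lemma convolution_Sw: "convolution \<Delta> F G h l = Sw h (\<lambda>h1 h2. Sw l (\<lambda>l1 l2. F h1 l1 * G h2 l2))"
  by (simp add: convolution_def Sw_def)

abbreviation "u2 \<equiv> \<lambda>h l. act (h * l) 1"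

lemma conv_u_finv: "convolution \<Delta> u2 finv = finv"
  and conv_finv_u: "convolution \<Delta> finv u2 = finv"
  and conv_f_finv: "convolution \<Delta> f finv = u2"
  and conv_finv_f: "convolution \<Delta> finv f = u2"
  using inv by (auto simp: convolution_inverse_def Let_def)

lemmas klin_A [lin] = klin2_comp[OF k_algebra_klin2[OF algA]] klin2_comp[OF act_lin] klin2_comp[OF f_lin]
  klin2_comp[OF finv_lin] klin_scale_left[OF vsA] klin_scale_right[OF vsA] klin_Sw_fun[OF vsA] klin_Sw_arg[OF vsA]

text \<open>The axiom on \<open>a \<times> 1\<close>, an equality of tensors, evaluated on a
  bilinear map.\<close>

lemma Sw_one_act:
  assumes B: "klin2 sA sH sW B"
  shows "Sw 1 (\<lambda>e1 e2. B (a * act e1 1) e2) = Sw 1 (\<lambda>e1 e2. B (act e1 a) e2)"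
proof -
  have "tens sA sH [(a * act e1 1, e2). (e1, e2) \<leftarrow> sw \<Delta> 1] = tens sA sH [(act e1 a, e2). (e1, e2) \<leftarrow> sw \<Delta> 1]"
  proof -
    have "times_elt sH \<Delta> sA act [(a, 1)] = tens sA sH [(act e1 a, e2). (e1, e2) \<leftarrow> sw \<Delta> 1]"
      using coc unfolding cocycle_conditions_def by (elim conjE) blast
    then show ?thesis by (simp add: times_elt_def times_sum_def)
  qed
  then have "(\<Sum>(u, v)\<leftarrow>[(a * act e1 1, e2). (e1, e2) \<leftarrow> sw \<Delta> 1]. B u v) = (\<Sum>(u, v)\<leftarrow>[(act e1 a, e2). (e1, e2) \<leftarrow> sw \<Delta> 1]. B u v)"
    by (intro sum_cong_eval[OF _ B]) (simp only: tens_eq_iff)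
  then show ?thesis unfolding sum_list_pair_map Sw_def .
qed

lemma act_absorb: "Sw h (\<lambda>x y. act x 1 * act y a) = act h a" "Sw h (\<lambda>x y. act x a * act y 1) = act h a"
  using act_mult[of h 1 a] act_mult[of h a 1] by simp_all

section \<open>Values of the cocycle and its inverse at 1 and on H^R\<close>

lemma u_f: "Sw h (\<lambda>h1 h2. Sw l (\<lambda>l1 l2. act (h1 * l1) 1 * f h2 l2)) = f h l"
  using f_twist[of h l 1] f_u[of h l] by (simp add: act_act_one)

text \<open>Since \<open>h . (l . 1)\<close> is \<open>hl . 1\<close>, the sum in the right unit
  condition is \<open>u2 * f\<close> at (h, 1), and f absorbs \<open>u2\<close>.\<close>

lemma f_one_right: "f h 1 = act h 1"
  using f_unit_right[of h] u_f[of h 1] by (simp add: act_act_one)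

lemma f_one_left: "f 1 h = act h 1"
proof -
  have "f 1 h = Sw 1 (\<lambda>e1 e2. Sw h (\<lambda>x y. act e1 (act x 1) * f e2 y))"
    using u_f[of 1 h] by (simp add: act_act_one)
  also have "\<dots> = Sw h (\<lambda>x y. Sw 1 (\<lambda>e1 e2. act e1 (act x 1) * f e2 y))" by (rule Sw_swap)
  also have "\<dots> = Sw h (\<lambda>x y. Sw 1 (\<lambda>e1 e2. act x 1 * act e1 1 * f e2 y))"
    by (rule Sw_cong, rule Sw_one_act[symmetric, where sW=sA]) (intro lin)
  also have "\<dots> = Sw h (\<lambda>x y. act x 1 * act y 1)"
    by (simp add: mult.assoc f_unit_left Sw_times(2)[symmetric])
  finally show ?thesis by (simp add: act_absorb)
qed

text \<open>An element of H^R changes only the second leg of a coproduct. As f absorbs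
  \<open>u2\<close> on the right, that leg sits inside the product \<open>h2 l2\<close>, where the
  element can change sides. The inverse absorbs \<open>u2\<close> on both sides and is therefore
  balanced over H^R and over H^L.\<close>

lemma f_balanced_R: "f (h * \<Pi>R x) l = f h (\<Pi>R x * l)"
proof -
  have "f (h * \<Pi>R x) l = Sw h (\<lambda>h1 h2. Sw l (\<lambda>l1 l2. f h1 l1 * act (h2 * \<Pi>R x * l2) 1))"
    unfolding f_u[of "h * \<Pi>R x" l, symmetric] by (rule Sw_mult_PiR(1)[OF vsA]) (intro lin)
  also have "\<dots> = Sw h (\<lambda>h1 h2. Sw (\<Pi>R x * l) (\<lambda>l1 l2. f h1 l1 * act (h2 * l2) 1))"
    unfolding mult.assoc by (rule Sw_cong, rule Sw_mult_PiR(2)[OF vsA, symmetric]) (intro lin)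
  finally show ?thesis by (simp add: f_u)
qed

lemma finv_Sw:
  "Sw h (\<lambda>h1 h2. Sw l (\<lambda>l1 l2. finv h1 l1 * act (h2 * l2) 1)) = finv h l"
  "Sw h (\<lambda>h1 h2. Sw l (\<lambda>l1 l2. act (h1 * l1) 1 * finv h2 l2)) = finv h l"
  "Sw h (\<lambda>h1 h2. Sw l (\<lambda>l1 l2. f h1 l1 * finv h2 l2)) = act (h * l) 1"
  "Sw h (\<lambda>h1 h2. Sw l (\<lambda>l1 l2. finv h1 l1 * f h2 l2)) = act (h * l) 1"
  using fun_cong[OF fun_cong[OF conv_u_finv]] fun_cong[OF fun_cong[OF conv_finv_u]]
    fun_cong[OF fun_cong[OF conv_f_finv]] fun_cong[OF fun_cong[OF conv_finv_f]]
  unfolding convolution_Sw by auto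

lemma finv_balanced_R: "finv (h * \<Pi>R x) l = finv h (\<Pi>R x * l)"
proof -
  have "finv (h * \<Pi>R x) l = Sw h (\<lambda>h1 h2. Sw l (\<lambda>l1 l2. finv h1 l1 * act (h2 * \<Pi>R x * l2) 1))"
    unfolding finv_Sw(1)[of "h * \<Pi>R x" l, symmetric] by (rule Sw_mult_PiR(1)[OF vsA]) (intro lin)
  also have "\<dots> = Sw h (\<lambda>h1 h2. Sw (\<Pi>R x * l) (\<lambda>l1 l2. finv h1 l1 * act (h2 * l2) 1))"
    unfolding mult.assoc by (rule Sw_cong, rule Sw_mult_PiR(2)[OF vsA, symmetric]) (intro lin)
  finally show ?thesis by (simp add: finv_Sw)
qed

lemma finv_balanced_L: "finv (h * \<Pi>L x) l = finv h (\<Pi>L x * l)"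
proof -
  have "finv (h * \<Pi>L x) l = Sw h (\<lambda>h1 h2. Sw l (\<lambda>l1 l2. act (h1 * \<Pi>L x * l1) 1 * finv h2 l2))"
    unfolding finv_Sw(2)[of "h * \<Pi>L x" l, symmetric] by (rule Sw_mult_PiL(1)[OF vsA]) (intro lin)
  also have "\<dots> = Sw h (\<lambda>h1 h2. Sw (\<Pi>L x * l) (\<lambda>l1 l2. act (h1 * l1) 1 * finv h2 l2))"
    unfolding mult.assoc by (rule Sw_cong, rule Sw_mult_PiL(2)[OF vsA, symmetric]) (intro lin)
  finally show ?thesis by (simp add: finv_Sw)
qed

lemma f_PiR_right: "f h (\<Pi>R x) = act (h * \<Pi>R x) 1"
  using f_balanced_R[of h x 1] f_one_right by simp

lemma f_PiR_left: "f (\<Pi>R x) h = act (\<Pi>R x * h) 1"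
  using f_balanced_R[of 1 x h] f_one_left by simp

text \<open>The first leg of Delta(1) may be taken in H^R, where f agrees with \<open>u2\<close>.
  Hence \<open>f * f^{-1}\<close> at (1, h) is \<open>u2 * f^{-1}\<close> at (1, h).\<close>

lemma finv_one_left: "finv 1 h = act h 1"
proof -
  have "act h 1 = Sw 1 (\<lambda>e1 e2. Sw h (\<lambda>x y. f e1 x * finv e2 y))"
    using finv_Sw(3)[of 1 h] by simp
  also have "\<dots> = Sw 1 (\<lambda>e1 e2. Sw h (\<lambda>x y. f (\<Pi>R e1) x * finv e2 y))"
    by (rule Sw_one_PiR[OF vsA, symmetric]) (intro lin)
  also have "\<dots> = Sw 1 (\<lambda>e1 e2. Sw h (\<lambda>x y. act (\<Pi>R e1 * x) 1 * finv e2 y))"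
    unfolding f_PiR_left ..
  also have "\<dots> = Sw 1 (\<lambda>e1 e2. Sw h (\<lambda>x y. act (e1 * x) 1 * finv e2 y))"
    by (rule Sw_one_PiR[OF vsA]) (intro lin)
  finally show ?thesis using finv_Sw(2)[of 1 h] by simp
qed

text \<open>Here f is evaluated at a leg of Delta(1) and not at 1. That leg may be taken in H^R,
  where f becomes \<open>u2\<close>, and then Delta(1) is absorbed.\<close>

lemma f_unit_right_tail:
  assumes W: "vector_space sW" and B: "klin2 sA sH sW B"
  shows "Sw h (\<lambda>h1 h2. Sw 1 (\<lambda>e1 e2. B (f h1 e1) (h2 * e2))) = Sw h (\<lambda>h1 h2. B (act h1 1) h2)"
proof -
  note lB = lin linW[OF W] klin2_comp[OF B]
  have "Sw h (\<lambda>h1 h2. Sw 1 (\<lambda>e1 e2. B (f h1 e1) (h2 * e2)))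
      = Sw h (\<lambda>h1 h2. Sw 1 (\<lambda>e1 e2. B (f h1 (\<Pi>R e1)) (h2 * e2)))"
    by (rule Sw_cong, rule Sw_one_PiR[OF W, symmetric]) (intro lB)
  also have "\<dots> = Sw h (\<lambda>h1 h2. Sw 1 (\<lambda>e1 e2. B (act (h1 * e1) 1) (h2 * e2)))"
    unfolding f_PiR_right by (rule Sw_cong, rule Sw_one_PiR[OF W]) (intro lB)
  also have "\<dots> = Sw h (\<lambda>h1 h2. B (act h1 1) h2)"
    by (rule Sw_one_right[where sW=sW]) (intro lB)
  finally show ?thesis .
qed

lemma f_unit_left_tail:
  assumes W: "vector_space sW" and B: "klin2 sA sH sW B"
  shows "Sw 1 (\<lambda>e1 e2. Sw h (\<lambda>h1 h2. B (f e1 h1) (e2 * h2))) = Sw h (\<lambda>h1 h2. B (act h1 1) h2)"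
proof -
  note lB = lin linW[OF W] klin2_comp[OF B]
  have "Sw 1 (\<lambda>e1 e2. Sw h (\<lambda>h1 h2. B (f e1 h1) (e2 * h2)))
      = Sw 1 (\<lambda>e1 e2. Sw h (\<lambda>h1 h2. B (f (\<Pi>R e1) h1) (e2 * h2)))"
    by (rule Sw_one_PiR[OF W, symmetric]) (intro lB)
  also have "\<dots> = Sw 1 (\<lambda>e1 e2. Sw h (\<lambda>h1 h2. B (act (e1 * h1) 1) (e2 * h2)))"
    unfolding f_PiR_left by (rule Sw_one_PiR[OF W]) (intro lB)
  also have "\<dots> = Sw h (\<lambda>h1 h2. B (act h1 1) h2)"
    by (rule Sw_one_left[where sW=sW]) (intro lB)
  finally show ?thesis .
qed

section \<open>Convolution and the twisting rule for the inverse cocycle\<close>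

lemma convolution_assoc:
  assumes F: "klin2 sH sH sA F" and G: "klin2 sH sH sA G" and K: "klin2 sH sH sA K"
  shows "convolution \<Delta> (convolution \<Delta> F G) K = convolution \<Delta> F (convolution \<Delta> G K)"
proof (intro ext)
  fix h l
  note lF = lin klin2_comp[OF F] klin2_comp[OF G] klin2_comp[OF K]
  have "convolution \<Delta> (convolution \<Delta> F G) K h l
      = Sw h (\<lambda>u z. Sw l (\<lambda>v y. Sw u (\<lambda>a b. Sw v (\<lambda>c d. F a c * G b d * K z y))))"
    unfolding convolution_Sw Sw_times ..
  also have "\<dots> = Sw h (\<lambda>u z. Sw u (\<lambda>a b. Sw l (\<lambda>v y. Sw v (\<lambda>c d. F a c * G b d * K z y))))"
    by (rule Sw_cong, rule Sw_swap)
  also have "\<dots> = Sw h (\<lambda>a w. Sw w (\<lambda>b z. Sw l (\<lambda>v y. Sw v (\<lambda>c d. F a c * G b d * K z y))))"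
    by (rule Sw_coassoc[where sW=sA]) (intro lF)
  also have "\<dots> = Sw h (\<lambda>a w. Sw w (\<lambda>b z. Sw l (\<lambda>c v. Sw v (\<lambda>d y. F a c * G b d * K z y))))"
    by (rule Sw_cong, rule Sw_cong, rule Sw_coassoc[where sW=sA]) (intro lF)
  also have "\<dots> = Sw h (\<lambda>a w. Sw l (\<lambda>c v. Sw w (\<lambda>b z. Sw v (\<lambda>d y. F a c * G b d * K z y))))"
    by (rule Sw_cong, rule Sw_swap)
  also have "\<dots> = convolution \<Delta> F (convolution \<Delta> G K) h l"
    unfolding convolution_Sw Sw_times mult.assoc ..
  finally show "convolution \<Delta> (convolution \<Delta> F G) K h l = \<dots>" .
qed

lemma klin2_convolution [lin]:
  assumes F: "klin2 sH sH sA F" and G: "klin2 sH sH sA G"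
  shows "klin2 sH sH sA (convolution \<Delta> F G)"
proof -
  note lF = lin klin2_comp[OF F] klin2_comp[OF G]
  show ?thesis unfolding convolution_Sw by (intro lF)
qed

text \<open>Conjugation of the twisting condition by the inverse: for \<open>P = h . (l . a)\<close>
  and \<open>Q = hl . a\<close>, \<open>f^{-1} * P = f^{-1} * P * f * f^{-1} = f^{-1} * f * Q *
  f^{-1} = Q * f^{-1}\<close>, because \<open>P\<close> absorbs \<open>u2\<close> on the right and
  \<open>Q\<close> on the left.\<close>

lemma finv_twist: "Sw h (\<lambda>h1 h2. Sw l (\<lambda>l1 l2. finv h1 l1 * act h2 (act l2 a)))
    = Sw h (\<lambda>h1 h2. Sw l (\<lambda>l1 l2. act (h1 * l1) a * finv h2 l2))"
proof -
  define P where "P h l = act h (act l a)" for h l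
  define Q where "Q h l = act (h * l) a" for h l
  have lP: "klin2 sH sH sA P" "klin2 sH sH sA Q" "klin2 sH sH sA u2" unfolding P_def Q_def by (intro lin)+
  have PQ: "convolution \<Delta> P f = convolution \<Delta> f Q"
    unfolding P_def Q_def convolution_Sw f_twist ..
  have Pu: "convolution \<Delta> P u2 = P"
  proof (intro ext)
    fix h l
    have "convolution \<Delta> P u2 h l = Sw h (\<lambda>h1 h2. Sw l (\<lambda>l1 l2. act h1 (act l1 a) * act h2 (act l2 1)))"
      by (simp add: convolution_Sw P_def act_act_one)
    also have "\<dots> = Sw l (\<lambda>l1 l2. act h (act l1 a * act l2 1))" by (subst Sw_swap) (simp add: act_mult)
    also have "\<dots> = act h (Sw l (\<lambda>l1 l2. act l1 a * act l2 1))"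
      by (rule Sw_pull[where s=sA and s'=sA, symmetric]) (intro lin)
    finally show "convolution \<Delta> P u2 h l = P h l" by (simp add: act_absorb P_def)
  qed
  have uQ: "convolution \<Delta> u2 Q = Q"
  proof (intro ext)
    fix h l
    have "convolution \<Delta> u2 Q h l = Sw (h * l) (\<lambda>x y. act x 1 * act y a)"
      unfolding convolution_Sw Q_def by (rule Sw_mult[where sW=sA, symmetric]) (intro lin)
    then show "convolution \<Delta> u2 Q h l = Q h l" by (simp add: act_absorb Q_def)
  qed
  have "convolution \<Delta> finv P = convolution \<Delta> finv (convolution \<Delta> (convolution \<Delta> P f) finv)"
    by (simp add: convolution_assoc lP f_lin finv_lin conv_f_finv Pu)
  also have "\<dots> = convolution \<Delta> (convolution \<Delta> (convolution \<Delta> finv f) Q) finv"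
    unfolding PQ by (simp add: convolution_assoc lP f_lin finv_lin klin2_convolution)
  also have "\<dots> = convolution \<Delta> Q finv" by (simp add: conv_finv_f uQ)
  finally have "convolution \<Delta> finv P h l = convolution \<Delta> Q finv h l" by simp
  then show ?thesis by (simp add: convolution_Sw P_def Q_def)
qed

section \<open>Trilinear convolution and the action on values of the inverse cocycle\<close>

definition cv3 :: "('h \<Rightarrow> 'h \<Rightarrow> 'h \<Rightarrow> 'a) \<Rightarrow> ('h \<Rightarrow> 'h \<Rightarrow> 'h \<Rightarrow> 'a) \<Rightarrow> 'h \<Rightarrow> 'h \<Rightarrow> 'h \<Rightarrow> 'a" where
  "cv3 F G h l m = Sw h (\<lambda>h1 h2. Sw l (\<lambda>l1 l2. Sw m (\<lambda>m1 m2. F h1 l1 m1 * G h2 l2 m2)))"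

lemma cv3_assoc:
  assumes F: "klin3 sH sA F" and G: "klin3 sH sA G" and K: "klin3 sH sA K"
  shows "cv3 (cv3 F G) K = cv3 F (cv3 G K)"
proof (intro ext)
  fix h l m
  note lF = lin klin3_comp[OF F] klin3_comp[OF G] klin3_comp[OF K]
  let ?t = "\<lambda>a b z c d y e g x. F a c e * G b d g * K z y x"
  have "cv3 (cv3 F G) K h l m
      = Sw h (\<lambda>u z. Sw l (\<lambda>v y. Sw m (\<lambda>w x. Sw u (\<lambda>a b. Sw v (\<lambda>c d. Sw w (\<lambda>e g. ?t a b z c d y e g x))))))"
    unfolding cv3_def Sw_times ..
  also have "\<dots> = Sw h (\<lambda>u z. Sw l (\<lambda>v y. Sw u (\<lambda>a b. Sw v (\<lambda>c d. Sw m (\<lambda>w x. Sw w (\<lambda>e g. ?t a b z c d y e g x))))))"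
    by (rule Sw_cong, rule Sw_cong, rule HOL.trans[OF Sw_swap], rule Sw_cong, rule Sw_swap)
  also have "\<dots> = Sw h (\<lambda>u z. Sw u (\<lambda>a b. Sw l (\<lambda>v y. Sw v (\<lambda>c d. Sw m (\<lambda>w x. Sw w (\<lambda>e g. ?t a b z c d y e g x))))))"
    by (rule Sw_cong, rule Sw_swap)
  also have "\<dots> = Sw h (\<lambda>a w. Sw w (\<lambda>b z. Sw l (\<lambda>v y. Sw v (\<lambda>c d. Sw m (\<lambda>w x. Sw w (\<lambda>e g. ?t a b z c d y e g x))))))"
    by (rule Sw_coassoc[where sW=sA]) (intro lF)
  also have "\<dots> = Sw h (\<lambda>a w. Sw w (\<lambda>b z. Sw l (\<lambda>c v. Sw v (\<lambda>d y. Sw m (\<lambda>w x. Sw w (\<lambda>e g. ?t a b z c d y e g x))))))"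
    by (rule Sw_cong, rule Sw_cong, rule Sw_coassoc[where sW=sA]) (intro lF)
  also have "\<dots> = Sw h (\<lambda>a w. Sw w (\<lambda>b z. Sw l (\<lambda>c v. Sw v (\<lambda>d y. Sw m (\<lambda>e r. Sw r (\<lambda>g x. ?t a b z c d y e g x))))))"
    by (rule Sw_cong, rule Sw_cong, rule Sw_cong, rule Sw_cong, rule Sw_coassoc[where sW=sA]) (intro lF)
  also have "\<dots> = Sw h (\<lambda>a w. Sw l (\<lambda>c v. Sw w (\<lambda>b z. Sw v (\<lambda>d y. Sw m (\<lambda>e r. Sw r (\<lambda>g x. ?t a b z c d y e g x))))))"
    by (rule Sw_cong, rule Sw_swap)
  also have "\<dots> = Sw h (\<lambda>a w. Sw l (\<lambda>c v. Sw m (\<lambda>e r. Sw w (\<lambda>b z. Sw v (\<lambda>d y. Sw r (\<lambda>g x. ?t a b z c d y e g x))))))"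
    by (rule Sw_cong, rule Sw_cong, rule HOL.sym, rule HOL.trans[OF Sw_swap], rule Sw_cong, rule Sw_swap)
  also have "\<dots> = cv3 F (cv3 G K) h l m"
    unfolding cv3_def Sw_times mult.assoc ..
  finally show "cv3 (cv3 F G) K h l m = \<dots>" .
qed

lemma klin3_cv3:
  assumes F: "klin3 sH sA F" and G: "klin3 sH sA G"
  shows "klin3 sH sA (cv3 F G)"
proof -
  note lF = lin klin3_comp[OF F] klin3_comp[OF G]
  show ?thesis unfolding cv3_def by (intro lF)
qed

text \<open>In the convolution algebra of trilinear maps, write \<open>a\<^sub>1 = h \<cdot> f(l,m)\<close>, \<open>b = f(h,lm)\<close>,
  \<open>c = f(h,l)\<epsilon>(m)\<close> and \<open>d = f(hl,m)\<close>, with inverses \<open>a\<^sub>1'\<close>, \<open>d'\<close> relative to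
  \<open>u\<^sub>3 = hlm \<cdot> 1\<close>.  The cocycle identity \<open>c * d = a\<^sub>1 * b\<close> becomes \<open>a\<^sub>1' * c = b * d'\<close>.\<close>

lemma act_finv_f:
  "Sw h (\<lambda>h1 h2. Sw l (\<lambda>l1 l2. act h1 (finv l1 m) * f h2 l2))
   = Sw h (\<lambda>h1 h2. Sw l (\<lambda>l1 l2. Sw m (\<lambda>m1 m2. f h1 (l1 * m1) * finv (h2 * l2) m2)))"
proof -
  define a1 where "a1 h l m = act h (f l m)" for h l m
  define a1' where "a1' h l m = act h (finv l m)" for h l m
  define b where "b h l m = f h (l * m)" for h l m
  define c where "c h l m = sA (\<epsilon> m) (f h l)" for h l m
  define d where "d h l m = f (h * l) m" for h l m
  define d' where "d' h l m = finv (h * l) m" for h l m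
  define u3 where "u3 h l m = act (h * l * m) 1" for h l m
  note defs = a1_def a1'_def b_def c_def d_def d'_def u3_def
  have L: "klin3 sH sA a1" "klin3 sH sA a1'" "klin3 sH sA b" "klin3 sH sA c" "klin3 sH sA d" "klin3 sH sA d'" "klin3 sH sA u3"
    unfolding defs by (intro lin)+
  note LL = L klin3_cv3
  have scale_mult: "sA r (x * y) = sA r x * y" "x * sA r y = sA r x * y" for r x y
    using algA unfolding k_algebra_def by metis+
  have eps_right: "Sw m (\<lambda>m1 m2. sA (\<epsilon> m1) x * F m2) = x * F m" if "klin sH sA F" for x m F
  proof -
    note lF = lin klin_comp[OF that]
    have "Sw m (\<lambda>m1 m2. sA (\<epsilon> m1) (x * F m2)) = x * F m"
      by (rule Sw_counit_left[where sW=sA]) (intro lF)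
    then show ?thesis by (simp only: scale_mult)
  qed
  have eps_left: "Sw m (\<lambda>m1 m2. F m1 * sA (\<epsilon> m2) x) = F m * x" if "klin sH sA F" for x m F
  proof -
    note lF = lin klin_comp[OF that]
    have "Sw m (\<lambda>m1 m2. sA (\<epsilon> m2) (F m1 * x)) = F m * x"
      by (rule Sw_counit_right[where sW=sA]) (intro lF)
    then show ?thesis by (simp only: scale_mult)
  qed
  have cd: "cv3 c d = cv3 a1 b"
  proof (intro ext)
    fix h l m
    have "cv3 c d h l m = Sw h (\<lambda>h1 h2. Sw l (\<lambda>l1 l2. f h1 l1 * f (h2 * l2) m))"
      unfolding cv3_def c_def d_def by (intro Sw_cong, rule eps_right) (intro lin)
    then show "cv3 c d h l m = cv3 a1 b h l m" unfolding f_cocycle cv3_def a1_def b_def .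
  qed
  have dd': "cv3 d d' = u3"
  proof (intro ext)
    fix h l m
    have "cv3 d d' h l m = Sw (h * l) (\<lambda>x y. Sw m (\<lambda>m1 m2. f x m1 * finv y m2))"
      unfolding cv3_def d_def d'_def by (rule Sw_mult[where sW=sA, symmetric]) (intro lin)
    then show "cv3 d d' h l m = u3 h l m" by (simp add: finv_Sw u3_def)
  qed
  have act2: "Sw h (\<lambda>h1 h2. Sw l (\<lambda>l1 l2. Sw m (\<lambda>m1 m2. act h1 (X l1 m1) * act h2 (Y l2 m2))))
      = act h (Sw l (\<lambda>l1 l2. Sw m (\<lambda>m1 m2. X l1 m1 * Y l2 m2)))" for h l m X Y
  proof -
    have "Sw h (\<lambda>h1 h2. Sw l (\<lambda>l1 l2. Sw m (\<lambda>m1 m2. act h1 (X l1 m1) * act h2 (Y l2 m2))))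
        = Sw l (\<lambda>l1 l2. Sw h (\<lambda>h1 h2. Sw m (\<lambda>m1 m2. act h1 (X l1 m1) * act h2 (Y l2 m2))))"
      by (rule Sw_swap)
    also have "\<dots> = Sw l (\<lambda>l1 l2. Sw m (\<lambda>m1 m2. Sw h (\<lambda>h1 h2. act h1 (X l1 m1) * act h2 (Y l2 m2))))"
      by (rule Sw_cong, rule Sw_swap)
    also have "\<dots> = act h (Sw l (\<lambda>l1 l2. Sw m (\<lambda>m1 m2. X l1 m1 * Y l2 m2)))"
      unfolding Sw_pull[where s=sA and s'=sA, OF klin2D(2)[OF act_lin]] act_mult ..
    finally show ?thesis .
  qed
  have a1a1: "cv3 a1' a1 = u3"
    by (intro ext) (simp add: cv3_def a1_def a1'_def act2 finv_Sw act_act_one u3_def mult.assoc)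
  have ub: "cv3 u3 b = b"
  proof (intro ext)
    fix h l m
    have "cv3 u3 b h l m = Sw h (\<lambda>h1 h2. Sw (l * m) (\<lambda>x y. act (h1 * x) 1 * f h2 y))"
      unfolding cv3_def u3_def b_def mult.assoc by (rule Sw_cong, rule Sw_mult[where sW=sA, symmetric]) (intro lin)
    then show "cv3 u3 b h l m = b h l m" by (simp add: u_f b_def)
  qed
  \<comment> \<open>\<open>u3\<close> is only a local unit, so it does not commute with everything.
    That it commutes with \<open>c\<close> is the twisting condition at the element
    \<open>m . 1\<close>.\<close>
  have cu: "cv3 c u3 = cv3 u3 c"
  proof (intro ext)
    fix h l m
    have "cv3 c u3 h l m = Sw h (\<lambda>h1 h2. Sw l (\<lambda>l1 l2. f h1 l1 * act (h2 * l2 * m) 1))"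
      unfolding cv3_def c_def u3_def by (intro Sw_cong, rule eps_right) (intro lin)
    also have "\<dots> = Sw h (\<lambda>h1 h2. Sw l (\<lambda>l1 l2. f h1 l1 * act (h2 * l2) (act m 1)))"
      by (simp add: act_act_one)
    also have "\<dots> = Sw h (\<lambda>h1 h2. Sw l (\<lambda>l1 l2. act h1 (act l1 (act m 1)) * f h2 l2))"
      by (rule f_twist)
    also have "\<dots> = Sw h (\<lambda>h1 h2. Sw l (\<lambda>l1 l2. act (h1 * l1 * m) 1 * f h2 l2))"
      by (simp add: act_act_one mult.assoc)
    also have "\<dots> = cv3 u3 c h l m"
      unfolding cv3_def c_def u3_def by (intro Sw_cong, rule eps_left[symmetric]) (intro lin)
    finally show "cv3 c u3 h l m = cv3 u3 c h l m" .
  qed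
  have au: "cv3 a1' u3 = a1'"
  proof (intro ext)
    fix h l m
    have "cv3 a1' u3 h l m = Sw h (\<lambda>h1 h2. Sw l (\<lambda>l1 l2. Sw m (\<lambda>m1 m2. act h1 (finv l1 m1) * act h2 (act (l2 * m2) 1))))"
      by (simp add: cv3_def a1'_def u3_def act_act_one mult.assoc)
    also have "\<dots> = a1' h l m" by (subst act2) (simp add: finv_Sw a1'_def)
    finally show "cv3 a1' u3 h l m = a1' h l m" .
  qed
  have "cv3 a1' c = cv3 a1' (cv3 u3 c)" using LL by (simp add: cv3_assoc[symmetric] au)
  also have "\<dots> = cv3 a1' (cv3 c (cv3 d d'))" by (simp add: cu dd')
  also have "\<dots> = cv3 a1' (cv3 (cv3 c d) d')" using LL by (simp add: cv3_assoc)
  also have "\<dots> = cv3 (cv3 a1' a1) (cv3 b d')" unfolding cd using LL by (simp add: cv3_assoc)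
  also have "\<dots> = cv3 b d'" unfolding a1a1 using LL by (simp add: cv3_assoc[symmetric] ub)
  finally have "cv3 a1' c h l m = cv3 b d' h l m" by simp
  moreover have "cv3 a1' c h l m = Sw h (\<lambda>h1 h2. Sw l (\<lambda>l1 l2. act h1 (finv l1 m) * f h2 l2))"
    unfolding cv3_def c_def a1'_def by (intro Sw_cong, rule eps_left) (intro lin)
  ultimately show ?thesis by (simp add: cv3_def b_def d'_def)
qed

end

section \<open>The operators of \<open>A\<close> and \<open>H\<close> on a module over the crossed product\<close>

context weak_cocycle
begin

text \<open>\<open>PiR(g)\<close> is a combination of first legs of Delta(1), so
  \<open>Sw_one_act\<close> applies: H^R acts on A by right multiplications.\<close>

lemma act_PiR: "act (\<Pi>R g) a = a * act (\<Pi>R g) 1"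
proof -
  have "act (\<Pi>R g) a = Sw 1 (\<lambda>x y. sA (\<epsilon> (g * y)) (act x a))"
    by (rule pull_PiR[where sW=sA and T="\<lambda>x. act x a"]) (intro lin)
  also have "\<dots> = Sw 1 (\<lambda>x y. sA (\<epsilon> (g * y)) (a * act x 1))"
    by (rule Sw_one_act[symmetric, where sW=sA]) (intro lin)
  also have "\<dots> = a * act (\<Pi>R g) 1"
    by (rule pull_PiR[symmetric, where sW=sA and T="\<lambda>x. a * act x 1"]) (intro lin)
  finally show ?thesis .
qed

text \<open>After \<open>finv_twist\<close>, the element that acts on \<open>a\<close> is assembled
  from adjacent legs as \<open>S(h2) h3\<close>, so it lies in H^R and acts by right multiplication.
  Then \<open>a\<close> factors out on the left. This is the core of \<open>G'_J\<close>.\<close>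

lemma finv_S_twist:
  "Sw w (\<lambda>q r. Sw (S q) (\<lambda>a1 a2. Sw r (\<lambda>b1 b2. finv a1 b1 * act a2 (act b2 a)))) = a * Sw w (\<lambda>q r. finv (S q) r)"
proof -
  define Z where "Z a = Sw w (\<lambda>q r. Sw (S q) (\<lambda>a1 a2. Sw r (\<lambda>b1 b2. act (a1 * b1) a * finv a2 b2)))" for a
  have Z: "Z a = Sw w (\<lambda>v t. Sw t (\<lambda>g b2. act (\<Pi>R g) a * finv (S v) b2))" for a
  proof -
    have "Z a = Sw w (\<lambda>q r. Sw q (\<lambda>v h2. Sw r (\<lambda>b1 b2. act (S h2 * b1) a * finv (S v) b2)))"
      unfolding Z_def by (rule Sw_cong, rule Sw_S[OF vsA]) (intro lin)
    also have "\<dots> = Sw w (\<lambda>v t. Sw t (\<lambda>h2 r. Sw r (\<lambda>b1 b2. act (S h2 * b1) a * finv (S v) b2)))"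
      by (rule Sw_coassoc[where sW=sA]) (intro lin)
    also have "\<dots> = Sw w (\<lambda>v t. Sw t (\<lambda>g b2. Sw g (\<lambda>h2 b1. act (S h2 * b1) a * finv (S v) b2)))"
      by (rule Sw_cong, rule Sw_coassoc[symmetric, where sW=sA]) (intro lin)
    also have "\<dots> = Sw w (\<lambda>v t. Sw t (\<lambda>g b2. act (\<Pi>R g) a * finv (S v) b2))"
      by (rule Sw_cong, rule Sw_cong, rule pull_PiR'[symmetric, OF vsA, where T="\<lambda>x. act x _ * _"]) (intro lin)
    finally show ?thesis .
  qed
  have "Z a = a * Z 1" unfolding Z Sw_times by (subst act_PiR) (simp only: mult.assoc)
  also have "Z 1 = Sw w (\<lambda>q r. finv (S q) r)" unfolding Z_def finv_Sw ..
  finally show ?thesis unfolding finv_twist Z_def .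
qed

lemma Sw_S_mid_PiR:
  assumes W: "vector_space sW" and T: "klin3 sH sW T"
  shows "Sw w (\<lambda>q c. Sw q (\<lambda>q1 q2. Sw c (\<lambda>c1 c2. T (S q2 * c1) q1 c2))) = Sw w (\<lambda>q1 t. Sw t (\<lambda>g c2. T (\<Pi>R g) q1 c2))"
proof -
  note lT = linS[OF W] klin3_comp[OF T]
  have "Sw w (\<lambda>q c. Sw q (\<lambda>q1 q2. Sw c (\<lambda>c1 c2. T (S q2 * c1) q1 c2)))
      = Sw w (\<lambda>q1 t. Sw t (\<lambda>q2 c. Sw c (\<lambda>c1 c2. T (S q2 * c1) q1 c2)))"
    by (rule Sw_coassoc[where sW=sW]) (intro lT)
  also have "\<dots> = Sw w (\<lambda>q1 t. Sw t (\<lambda>g c2. Sw g (\<lambda>q2 c1. T (S q2 * c1) q1 c2)))"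
    by (rule Sw_cong, rule Sw_coassoc[symmetric, where sW=sW]) (intro lT)
  also have "\<dots> = Sw w (\<lambda>q1 t. Sw t (\<lambda>g c2. T (\<Pi>R g) q1 c2))"
    by (rule Sw_cong, rule Sw_cong, rule pull_PiR'[symmetric, OF W, where T="\<lambda>x. T x _ _"]) (intro lT)
  finally show ?thesis .
qed

text \<open>The second argument of f is \<open>S(q2) c1\<close> with adjacent legs, hence an element
  of H^R, and f may be replaced by \<open>u2\<close>. What remains is the absorption of
  \<open>u2\<close> by the inverse cocycle at \<open>p S(q)\<close>.\<close>

lemma f_finv_S:
  "Sw w (\<lambda>q c. Sw p (\<lambda>p1 p2. Sw q (\<lambda>q1 q2. Sw c (\<lambda>c1 c2. f p1 (S q2 * c1) * finv (p2 * S q1) c2))))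
   = Sw w (\<lambda>q c. finv (p * S q) c)"
proof -
  have "Sw w (\<lambda>q c. Sw p (\<lambda>p1 p2. Sw q (\<lambda>q1 q2. Sw c (\<lambda>c1 c2. f p1 (S q2 * c1) * finv (p2 * S q1) c2))))
      = Sw p (\<lambda>p1 p2. Sw w (\<lambda>q c. Sw q (\<lambda>q1 q2. Sw c (\<lambda>c1 c2. f p1 (S q2 * c1) * finv (p2 * S q1) c2))))"
    by (rule Sw_swap)
  also have "\<dots> = Sw p (\<lambda>p1 p2. Sw w (\<lambda>q1 t. Sw t (\<lambda>g c2. f p1 (\<Pi>R g) * finv (p2 * S q1) c2)))"
    by (rule Sw_cong, rule Sw_S_mid_PiR[OF vsA, where T="\<lambda>x q c. f _ x * finv (_ * S q) c"]) (intro lin)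
  also have "\<dots> = Sw p (\<lambda>p1 p2. Sw w (\<lambda>q1 t. Sw t (\<lambda>g c2. act (p1 * \<Pi>R g) 1 * finv (p2 * S q1) c2)))"
    unfolding f_PiR_right ..
  also have "\<dots> = Sw p (\<lambda>p1 p2. Sw w (\<lambda>q c. Sw q (\<lambda>q1 q2. Sw c (\<lambda>c1 c2. act (p1 * (S q2 * c1)) 1 * finv (p2 * S q1) c2))))"
    by (rule Sw_cong, rule Sw_S_mid_PiR[symmetric, OF vsA, where T="\<lambda>x q c. act (_ * x) 1 * finv (_ * S q) c"]) (intro lin)
  also have "\<dots> = Sw w (\<lambda>q c. Sw p (\<lambda>p1 p2. Sw q (\<lambda>q1 q2. Sw c (\<lambda>c1 c2. act (p1 * S q2 * c1) 1 * finv (p2 * S q1) c2))))"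
    unfolding mult.assoc by (rule Sw_swap)
  also have "\<dots> = Sw w (\<lambda>q c. Sw p (\<lambda>p1 p2. Sw (S q) (\<lambda>u1 u2. Sw c (\<lambda>c1 c2. act (p1 * u1 * c1) 1 * finv (p2 * u2) c2))))"
    by (rule Sw_cong, rule Sw_cong, rule Sw_S[OF vsA, symmetric]) (intro lin)
  also have "\<dots> = Sw w (\<lambda>q c. Sw (p * S q) (\<lambda>u1 u2. Sw c (\<lambda>c1 c2. act (u1 * c1) 1 * finv u2 c2)))"
    by (rule Sw_cong, rule Sw_mult[symmetric, where sW=sA]) (intro lin)
  finally show ?thesis unfolding finv_Sw .
qed

text \<open>The definition of \<open>PiR\<close> puts a copy of Delta(1) to the right of Delta(l).
  It is absorbed and leaves the sum of \<open>Sw_PiR_mult\<close>.\<close>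

lemma Sw_mult_PiR_absorb:
  assumes W: "vector_space sW" and T: "klin sH sW T"
  shows "Sw l (\<lambda>a w. T (a * \<Pi>R (h * w))) = T (\<Pi>R h * l)"
proof -
  note lT = linS[OF W] klin_comp[OF T]
  have "Sw l (\<lambda>a w. T (a * \<Pi>R (h * w))) = Sw l (\<lambda>a w. Sw 1 (\<lambda>c d. sW (\<epsilon> (h * (w * d))) (T (a * c))))"
    unfolding mult.assoc[symmetric, of h] by (rule Sw_cong, rule pull_PiR[where T="\<lambda>x. T (_ * x)"]) (intro lT)
  also have "\<dots> = Sw l (\<lambda>a w. sW (\<epsilon> (h * w)) (T a))"
    by (rule Sw_one_right[where sW=sW]) (intro lT)
  also have "\<dots> = T (\<Pi>R h * l)" by (rule Sw_PiR_mult[OF W T])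
  finally show ?thesis .
qed

end

text \<open>Modules over the crossed product, in terms of the operators \<open>J a\<close> of \<open>a \<times> 1\<close> and \<open>G h\<close> of
  \<open>1 \<times> h\<close>; then \<open>G' h\<close> is the operator of \<open>\<gamma>\<^sup>-\<^sup>1(h)\<close>.\<close>

locale cleft_action = weak_cocycle sH \<Delta> \<epsilon> S sA act f finv
  for sH :: "'k::field \<Rightarrow> 'h::{ring,monoid_mult} \<Rightarrow> 'h" and \<Delta> \<epsilon> S
    and sA :: "'k \<Rightarrow> 'a::{ring,monoid_mult} \<Rightarrow> 'a" and act f finv +
  fixes sM :: "'k \<Rightarrow> 'm::ab_group_add \<Rightarrow> 'm" and J :: "'a \<Rightarrow> 'm \<Rightarrow> 'm" and G :: "'h \<Rightarrow> 'm \<Rightarrow> 'm"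
  assumes vsM: "vector_space sM" and J_lin: "klin2 sA sM sM J" and G_lin: "klin2 sH sM sM G"
    and J_one: "J 1 m = m" and J_mult: "J (a * b) m = J a (J b m)"
    and G_one: "G 1 m = m" and G_unit: "Sw h (\<lambda>x y. J (act x 1) (G y m)) = G h m"
    and G_J: "G h (J a m) = Sw h (\<lambda>x y. J (act x a) (G y m))"
    and G_G: "G h (G l m) = Sw h (\<lambda>h1 h2. Sw l (\<lambda>l1 l2. J (f h1 l1) (G (h2 * l2) m)))"
begin

section \<open>The inverse of \<open>gamma\<close> as an operator\<close>

definition G' :: "'h \<Rightarrow> 'm \<Rightarrow> 'm" where
  "G' h m = Sw h (\<lambda>h1 w. Sw w (\<lambda>h2 h3. J (finv (S h2) h3) (G (S h1) m)))"

lemmas klin_M [lin] = klin2_comp[OF J_lin] klin2_comp[OF G_lin] klin_scale_left[OF vsM] klin_scale_right[OF vsM]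
  klin_Sw_fun[OF vsM] klin_Sw_arg[OF vsM]

lemma G'_lin: "klin2 sH sM sM G'"
  unfolding G'_def by (intro lin)

lemmas klin_M' [lin] = klin2_comp[OF G'_lin]

lemma J_Sw: "J (Sw h T) m = Sw h (\<lambda>x y. J (T x y) m)" "J a (Sw h U) = Sw h (\<lambda>x y. J a (U x y))"
  by (rule Sw_pull[where s=sA and s'=sM] Sw_pull[where s=sM and s'=sM]; intro lin)+

lemma G_Sw: "G h (Sw l U) = Sw l (\<lambda>x y. G h (U x y))" "G' h (Sw l U) = Sw l (\<lambda>x y. G' h (U x y))"
  by (rule Sw_pull[where s=sM and s'=sM]; intro lin)+

text \<open>The coproduct of an element of H^R is Delta(1) with a changed second leg. The cocycle
  thus sees a leg of Delta(1) only and disappears. With \<open>G_PiR_left\<close>: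
  \<open>gamma\<close> is multiplicative as soon as one factor lies in H^R.\<close>

lemma G_PiR_right: "G h (G (\<Pi>R l) m) = G (h * \<Pi>R l) m"
proof -
  have "G h (G (\<Pi>R l) m) = Sw h (\<lambda>h1 h2. Sw 1 (\<lambda>e1 e2. J (f h1 e1) (G (h2 * e2 * \<Pi>R l) m)))"
    unfolding G_G mult.assoc by (rule Sw_cong, rule Sw_PiR(1)[OF vsM]) (intro lin)
  also have "\<dots> = Sw h (\<lambda>h1 h2. J (act h1 1) (G (h2 * \<Pi>R l) m))"
    by (rule f_unit_right_tail[OF vsM]) (intro lin)
  also have "\<dots> = Sw (h * \<Pi>R l) (\<lambda>h1 h2. J (act h1 1) (G h2 m))"
    by (rule Sw_mult_PiR(1)[OF vsM, symmetric]) (intro lin)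
  finally show ?thesis unfolding G_unit .
qed

lemma G_PiR_left: "G (\<Pi>R l) (G h m) = G (\<Pi>R l * h) m"
proof -
  have "G (\<Pi>R l) (G h m) = Sw 1 (\<lambda>e1 e2. Sw h (\<lambda>h1 h2. J (f e1 h1) (G (\<Pi>R l * (e2 * h2)) m)))"
    unfolding G_G mult.assoc[symmetric] by (rule Sw_PiR(2)[OF vsM]) (intro lin)
  also have "\<dots> = Sw h (\<lambda>h1 h2. J (act h1 1) (G (\<Pi>R l * h2) m))"
    by (rule f_unit_left_tail[OF vsM]) (intro lin)
  also have "\<dots> = Sw (\<Pi>R l * h) (\<lambda>h1 h2. J (act h1 1) (G h2 m))"
    by (rule Sw_mult_PiR(2)[OF vsM, symmetric]) (intro lin)
  finally show ?thesis unfolding G_unit .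
qed

text \<open>On H^L, \<open>gamma\<close> takes values in A. The coproduct of \<open>PiL(l)\<close>
  is Delta(1) with its first leg multiplied by \<open>PiL(l)\<close>, and the rule
  \<open>G_J\<close>, read backwards, turns this sum into \<open>gamma(1)\<close> after an element
  of A.\<close>

lemma G_PiL: "G (\<Pi>L l) m = J (act (\<Pi>L l) 1) m"
proof -
  have "G (\<Pi>L l) m = Sw 1 (\<lambda>x y. J (act (x * \<Pi>L l) 1) (G y m))"
    unfolding G_unit[of "\<Pi>L l" m, symmetric] by (rule Sw_PiL(2)[OF vsM]) (intro lin)
  also have "\<dots> = G 1 (J (act (\<Pi>L l) 1) m)" unfolding G_J act_act_one ..
  finally show ?thesis unfolding G_one .
qed

text \<open>The counterpart of \<open>G_J\<close> for the inverse. Since S reverses coproducts, the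
  legs can be brought into the order of \<open>finv_S_twist\<close>.\<close>

lemma G'_J: "Sw h (\<lambda>x y. G' x (J (act y a) m)) = J a (G' h m)"
proof -
  have "Sw h (\<lambda>x y. G' x (J (act y a) m))
      = Sw h (\<lambda>x y. Sw x (\<lambda>h1 w. Sw w (\<lambda>h2 h3. Sw h1 (\<lambda>u v. J (finv (S h2) h3 * act (S v) (act y a)) (G (S u) m)))))"
    unfolding G'_def G_J J_Sw J_mult[symmetric]
    by (rule Sw_cong, rule Sw_cong, rule Sw_cong, rule Sw_S[OF vsM]) (intro lin)
  also have "\<dots> = Sw h (\<lambda>x y. Sw x (\<lambda>h1 w. Sw h1 (\<lambda>u v. Sw w (\<lambda>h2 h3. J (finv (S h2) h3 * act (S v) (act y a)) (G (S u) m)))))"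
    by (rule Sw_cong, rule Sw_cong, rule Sw_swap)
  also have "\<dots> = Sw h (\<lambda>x y. Sw x (\<lambda>u w'. Sw w' (\<lambda>v w. Sw w (\<lambda>h2 h3. J (finv (S h2) h3 * act (S v) (act y a)) (G (S u) m)))))"
    by (rule Sw_cong, rule Sw_coassoc[where sW=sM]) (intro lin)
  also have "\<dots> = Sw h (\<lambda>x y. Sw x (\<lambda>u w'. Sw w' (\<lambda>q h3. Sw q (\<lambda>v h2. J (finv (S h2) h3 * act (S v) (act y a)) (G (S u) m)))))"
    by (rule Sw_cong, rule Sw_cong, rule Sw_coassoc[symmetric, where sW=sM]) (intro lin)
  also have "\<dots> = Sw h (\<lambda>u w. Sw w (\<lambda>w' y. Sw w' (\<lambda>q h3. Sw q (\<lambda>v h2. J (finv (S h2) h3 * act (S v) (act y a)) (G (S u) m)))))"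
    by (rule Sw_coassoc[where sW=sM]) (intro lin)
  also have "\<dots> = Sw h (\<lambda>u w. Sw w (\<lambda>q r. Sw r (\<lambda>b1 b2. Sw q (\<lambda>v h2. J (finv (S h2) b1 * act (S v) (act b2 a)) (G (S u) m)))))"
    by (rule Sw_cong, rule Sw_coassoc[where sW=sM]) (intro lin)
  also have "\<dots> = Sw h (\<lambda>u w. Sw w (\<lambda>q r. Sw q (\<lambda>v h2. Sw r (\<lambda>b1 b2. J (finv (S h2) b1 * act (S v) (act b2 a)) (G (S u) m)))))"
    by (rule Sw_cong, rule Sw_cong, rule Sw_swap)
  also have "\<dots> = Sw h (\<lambda>u w. Sw w (\<lambda>q r. Sw (S q) (\<lambda>a1 a2. Sw r (\<lambda>b1 b2. J (finv a1 b1 * act a2 (act b2 a)) (G (S u) m)))))"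
    by (rule Sw_cong, rule Sw_cong, rule Sw_S[OF vsM, symmetric]) (intro lin)
  also have "\<dots> = J a (G' h m)"
    unfolding J_Sw(1)[symmetric] finv_S_twist unfolding J_mult G'_def J_Sw ..
  finally show ?thesis .
qed

lemma G'_unit: "Sw h (\<lambda>x y. G' x (J (act y 1) m)) = G' h m"
  unfolding G'_J J_one ..

text \<open>Since S reverses coproducts, the values of the inverse cocycle and of f meet in the
  order of a convolution product and give \<open>u2\<close>. The rest assembles to the coproduct of
  \<open>S(h1) h2\<close>.\<close>

lemma G'_G: "Sw h (\<lambda>x y. G' x (G y m)) = G (\<Pi>R h) m"
proof -
  let ?t = "\<lambda>u v h2 h3 c d. J (finv (S h2) h3 * f (S v) c) (G (S u * d) m)"
  have "Sw h (\<lambda>x y. G' x (G y m))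
      = Sw h (\<lambda>x y. Sw x (\<lambda>h1 w. Sw w (\<lambda>h2 h3. Sw h1 (\<lambda>u v. Sw y (\<lambda>c d. ?t u v h2 h3 c d)))))"
    unfolding G'_def G_G J_Sw J_mult[symmetric]
    by (rule Sw_cong, rule Sw_cong, rule Sw_cong, rule Sw_S[OF vsM]) (intro lin)
  also have "\<dots> = Sw h (\<lambda>x y. Sw x (\<lambda>h1 w. Sw h1 (\<lambda>u v. Sw w (\<lambda>h2 h3. Sw y (\<lambda>c d. ?t u v h2 h3 c d)))))"
    by (rule Sw_cong, rule Sw_cong, rule Sw_swap)
  also have "\<dots> = Sw h (\<lambda>x y. Sw x (\<lambda>u w'. Sw w' (\<lambda>v w. Sw w (\<lambda>h2 h3. Sw y (\<lambda>c d. ?t u v h2 h3 c d)))))"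
    by (rule Sw_cong, rule Sw_coassoc[where sW=sM]) (intro lin)
  also have "\<dots> = Sw h (\<lambda>u w1. Sw w1 (\<lambda>w' y. Sw w' (\<lambda>v w. Sw w (\<lambda>h2 h3. Sw y (\<lambda>c d. ?t u v h2 h3 c d)))))"
    by (rule Sw_coassoc[where sW=sM]) (intro lin)
  also have "\<dots> = Sw h (\<lambda>u w1. Sw w1 (\<lambda>v w2. Sw w2 (\<lambda>w y. Sw w (\<lambda>h2 h3. Sw y (\<lambda>c d. ?t u v h2 h3 c d)))))"
    by (rule Sw_cong, rule Sw_coassoc[where sW=sM]) (intro lin)
  also have "\<dots> = Sw h (\<lambda>u w1. Sw w1 (\<lambda>v w2. Sw w2 (\<lambda>h2 Q. Sw Q (\<lambda>h3 y. Sw y (\<lambda>c d. ?t u v h2 h3 c d)))))"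
    by (rule Sw_cong, rule Sw_cong, rule Sw_coassoc[where sW=sM]) (intro lin)
  also have "\<dots> = Sw h (\<lambda>u w1. Sw w1 (\<lambda>v w2. Sw w2 (\<lambda>h2 Q. Sw Q (\<lambda>r d. Sw r (\<lambda>h3 c. ?t u v h2 h3 c d)))))"
    by (rule Sw_cong, rule Sw_cong, rule Sw_cong, rule Sw_coassoc[symmetric, where sW=sM]) (intro lin)
  also have "\<dots> = Sw h (\<lambda>u w1. Sw w1 (\<lambda>s Q. Sw s (\<lambda>v h2. Sw Q (\<lambda>r d. Sw r (\<lambda>h3 c. ?t u v h2 h3 c d)))))"
    by (rule Sw_cong, rule Sw_coassoc[symmetric, where sW=sM]) (intro lin)
  also have "\<dots> = Sw h (\<lambda>P Q. Sw P (\<lambda>u s. Sw s (\<lambda>v h2. Sw Q (\<lambda>r d. Sw r (\<lambda>h3 c. ?t u v h2 h3 c d)))))"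
    by (rule Sw_coassoc[symmetric, where sW=sM]) (intro lin)
  also have "\<dots> = Sw h (\<lambda>P Q. Sw P (\<lambda>u s. Sw Q (\<lambda>r d. Sw s (\<lambda>v h2. Sw r (\<lambda>h3 c. ?t u v h2 h3 c d)))))"
    by (rule Sw_cong, rule Sw_cong, rule Sw_swap)
  also have "\<dots> = Sw h (\<lambda>P Q. Sw P (\<lambda>u s. Sw Q (\<lambda>r d. Sw (S s) (\<lambda>a1 a2. Sw r (\<lambda>b1 b2. J (finv a1 b1 * f a2 b2) (G (S u * d) m))))))"
    by (rule Sw_cong, rule Sw_cong, rule Sw_cong, rule Sw_S[OF vsM, symmetric]) (intro lin)
  also have "\<dots> = Sw h (\<lambda>P Q. Sw P (\<lambda>u s. Sw Q (\<lambda>r d. J (act (S s * r) 1) (G (S u * d) m))))"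
    unfolding J_Sw(1)[symmetric] finv_Sw ..
  also have "\<dots> = Sw h (\<lambda>P Q. Sw (S P) (\<lambda>a b. Sw Q (\<lambda>r d. J (act (a * r) 1) (G (b * d) m))))"
    by (rule Sw_cong, rule Sw_S[OF vsM, symmetric]) (intro lin)
  also have "\<dots> = Sw h (\<lambda>P Q. Sw (S P * Q) (\<lambda>x y. J (act x 1) (G y m)))"
    by (rule Sw_cong, rule Sw_mult[symmetric, where sW=sM]) (intro lin)
  also have "\<dots> = G (\<Pi>R h) m"
    unfolding G_unit by (rule pull_PiR'[OF vsM, symmetric]) (intro lin)
  finally show ?thesis .
qed

text \<open>Here h acts on a value of the inverse cocycle. \<open>act_finv_f\<close> trades this
  action for values of f and its inverse, and \<open>f_finv_S\<close> removes f. The remaining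
  antipode meets its neighbour to form \<open>PiL\<close>, which leaves the inverse cocycle at a leg
  of Delta(1).\<close>

lemma G_G': "Sw h (\<lambda>x y. G x (G' y m)) = J (act h 1) m"
proof -
  let ?t = "\<lambda>x1 y1 y2 a1 a2 b c. J (act x1 (finv (S b) c) * f y1 (S a2)) (G (y2 * S a1) m)"
  have "Sw h (\<lambda>x y. G x (G' y m))
      = Sw h (\<lambda>x y. Sw y (\<lambda>a w. Sw w (\<lambda>b c. Sw x (\<lambda>x1 x2. Sw x2 (\<lambda>y1 y2. Sw a (\<lambda>a1 a2. ?t x1 y1 y2 a1 a2 b c))))))"
    unfolding G'_def G_Sw G_J G_G J_Sw J_mult[symmetric]
    by (rule Sw_cong, rule Sw_cong, rule Sw_cong, rule Sw_cong, rule Sw_cong, rule Sw_S[OF vsM]) (intro lin)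
  also have "\<dots> = Sw h (\<lambda>x y. Sw y (\<lambda>a w. Sw w (\<lambda>b c. Sw x (\<lambda>p y2. Sw p (\<lambda>x1 y1. Sw a (\<lambda>a1 a2. ?t x1 y1 y2 a1 a2 b c))))))"
    by (rule Sw_cong, rule Sw_cong, rule Sw_cong, rule Sw_coassoc[symmetric, where sW=sM]) (intro lin)
  also have "\<dots> = Sw h (\<lambda>x y. Sw y (\<lambda>a w. Sw w (\<lambda>b c. Sw a (\<lambda>a1 a2. Sw x (\<lambda>p y2. Sw p (\<lambda>x1 y1. ?t x1 y1 y2 a1 a2 b c))))))"
    by (rule Sw_cong, rule Sw_cong, rule Sw_cong, rule HOL.sym, rule HOL.trans[OF Sw_swap], rule Sw_cong, rule Sw_swap)
  also have "\<dots> = Sw h (\<lambda>x y. Sw y (\<lambda>a w. Sw a (\<lambda>a1 a2. Sw w (\<lambda>b c. Sw x (\<lambda>p y2. Sw p (\<lambda>x1 y1. ?t x1 y1 y2 a1 a2 b c))))))"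
    by (rule Sw_cong, rule Sw_cong, rule Sw_swap)
  also have "\<dots> = Sw h (\<lambda>x y. Sw y (\<lambda>a1 w'. Sw w' (\<lambda>a2 w. Sw w (\<lambda>b c. Sw x (\<lambda>p y2. Sw p (\<lambda>x1 y1. ?t x1 y1 y2 a1 a2 b c))))))"
    by (rule Sw_cong, rule Sw_coassoc[where sW=sM]) (intro lin)
  also have "\<dots> = Sw h (\<lambda>x y. Sw y (\<lambda>a1 w'. Sw w' (\<lambda>q c. Sw q (\<lambda>a2 b. Sw x (\<lambda>p y2. Sw p (\<lambda>x1 y1. ?t x1 y1 y2 a1 a2 b c))))))"
    by (rule Sw_cong, rule Sw_cong, rule Sw_coassoc[symmetric, where sW=sM]) (intro lin)
  also have "\<dots> = Sw h (\<lambda>x y. Sw y (\<lambda>a1 w'. Sw w' (\<lambda>q c. Sw x (\<lambda>p y2. Sw p (\<lambda>x1 y1. Sw q (\<lambda>a2 b. ?t x1 y1 y2 a1 a2 b c))))))"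
    by (rule Sw_cong, rule Sw_cong, rule Sw_cong, rule HOL.trans[OF Sw_swap], rule Sw_cong, rule Sw_swap)
  also have "\<dots> = Sw h (\<lambda>x y. Sw y (\<lambda>a1 w'. Sw w' (\<lambda>q c. Sw x (\<lambda>p y2. Sw p (\<lambda>x1 y1. Sw (S q) (\<lambda>l1 l2. J (act x1 (finv l1 c) * f y1 l2) (G (y2 * S a1) m)))))))"
    by (rule Sw_cong, rule Sw_cong, rule Sw_cong, rule Sw_cong, rule Sw_cong, rule Sw_S[OF vsM, symmetric]) (intro lin)
  also have "\<dots> = Sw h (\<lambda>x y. Sw y (\<lambda>a1 w'. Sw w' (\<lambda>q c. Sw x (\<lambda>p y2. Sw p (\<lambda>p1 p2. Sw (S q) (\<lambda>l1 l2. Sw c (\<lambda>c1 c2. J (f p1 (l1 * c1) * finv (p2 * l2) c2) (G (y2 * S a1) m))))))))"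
    unfolding J_Sw(1)[symmetric] act_finv_f ..
  also have "\<dots> = Sw h (\<lambda>x y. Sw y (\<lambda>a1 w'. Sw w' (\<lambda>q c. Sw x (\<lambda>p y2. Sw p (\<lambda>p1 p2. Sw q (\<lambda>q1 q2. Sw c (\<lambda>c1 c2. J (f p1 (S q2 * c1) * finv (p2 * S q1) c2) (G (y2 * S a1) m))))))))"
    by (rule Sw_cong, rule Sw_cong, rule Sw_cong, rule Sw_cong, rule Sw_cong, rule Sw_S[OF vsM]) (intro lin)
  also have "\<dots> = Sw h (\<lambda>x y. Sw y (\<lambda>a1 w'. Sw x (\<lambda>p y2. Sw w' (\<lambda>q c. Sw p (\<lambda>p1 p2. Sw q (\<lambda>q1 q2. Sw c (\<lambda>c1 c2. J (f p1 (S q2 * c1) * finv (p2 * S q1) c2) (G (y2 * S a1) m))))))))"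
    by (rule Sw_cong, rule Sw_cong, rule Sw_swap)
  also have "\<dots> = Sw h (\<lambda>x y. Sw y (\<lambda>a1 w'. Sw x (\<lambda>p y2. Sw w' (\<lambda>q c. J (finv (p * S q) c) (G (y2 * S a1) m)))))"
    unfolding J_Sw(1)[symmetric] f_finv_S ..
  also have "\<dots> = Sw h (\<lambda>x y. Sw y (\<lambda>a1 w'. Sw w' (\<lambda>q c. Sw x (\<lambda>p y2. J (finv (p * S q) c) (G (y2 * S a1) m)))))"
    by (rule Sw_cong, rule Sw_cong, rule Sw_swap)
  also have "\<dots> = Sw h (\<lambda>x y. Sw y (\<lambda>z c. Sw z (\<lambda>a1 q. Sw x (\<lambda>p y2. J (finv (p * S q) c) (G (y2 * S a1) m)))))"
    by (rule Sw_cong, rule Sw_coassoc[symmetric, where sW=sM]) (intro lin)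
  also have "\<dots> = Sw h (\<lambda>x y. Sw y (\<lambda>z c. Sw x (\<lambda>p y2. Sw z (\<lambda>a1 q. J (finv (p * S q) c) (G (y2 * S a1) m)))))"
    by (rule Sw_cong, rule Sw_cong, rule Sw_swap)
  also have "\<dots> = Sw h (\<lambda>x y. Sw y (\<lambda>z c. Sw x (\<lambda>p y2. Sw (S z) (\<lambda>a b. J (finv (p * a) c) (G (y2 * b) m)))))"
    by (rule Sw_cong, rule Sw_cong, rule Sw_cong, rule Sw_S[OF vsM, symmetric]) (intro lin)
  also have "\<dots> = Sw h (\<lambda>x y. Sw y (\<lambda>z c. Sw (x * S z) (\<lambda>u v. J (finv u c) (G v m))))"
    by (rule Sw_cong, rule Sw_cong, rule Sw_mult[symmetric, where sW=sM]) (intro lin)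
  also have "\<dots> = Sw h (\<lambda>t c. Sw t (\<lambda>x z. Sw (x * S z) (\<lambda>u v. J (finv u c) (G v m))))"
    by (rule Sw_coassoc[symmetric, where sW=sM]) (intro lin)
  also have "\<dots> = Sw h (\<lambda>t c. Sw (\<Pi>L t) (\<lambda>u v. J (finv u c) (G v m)))"
    by (rule Sw_cong, rule pull_PiL'[OF vsM, symmetric]) (intro lin)
  \<comment> \<open>Balancedness over H^L moves \<open>PiL(t)\<close> to the second argument of the
    inverse cocycle, where \<open>PiL(h1) h2\<close> adds up to h.\<close>
  also have "\<dots> = Sw h (\<lambda>t c. Sw 1 (\<lambda>e1 e2. J (finv e1 (\<Pi>L t * c)) (G e2 m)))"
    unfolding finv_balanced_L[symmetric] by (rule Sw_cong, rule Sw_PiL(2)[OF vsM]) (intro lin)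
  also have "\<dots> = Sw 1 (\<lambda>e1 e2. J (finv e1 h) (G e2 m))"
    by (rule HOL.trans[OF Sw_swap], rule Sw_cong, rule Sw_PiL_absorb[OF vsM, where T="\<lambda>x. J (finv _ x) _"]) (intro lin)
  also have "\<dots> = Sw 1 (\<lambda>e1 e2. J (finv (\<Pi>R e1) h) (G e2 m))"
    by (rule Sw_one_PiR[OF vsM, symmetric]) (intro lin)
  also have "\<dots> = Sw 1 (\<lambda>e1 e2. J (act (\<Pi>R e1 * h) 1) (G e2 m))"
    using finv_balanced_R[of 1 _ h] by (simp add: finv_one_left)
  also have "\<dots> = Sw 1 (\<lambda>e1 e2. J (act (e1 * h) 1) (G e2 m))"
    by (rule Sw_one_PiR[OF vsM]) (intro lin)
  also have "\<dots> = J (act h 1) m"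
    unfolding act_act_one[symmetric] G_J[symmetric] G_one ..
  finally show ?thesis .
qed

text \<open>By \<open>G_G'\<close> the factor \<open>hl . 1\<close> can be written with
  \<open>gamma\<close> and its inverse. Families that absorb this factor are therefore determined by
  their composites with \<open>gamma(h2 l2)\<close>.\<close>

lemma cancel_G:
  assumes X: "\<And>l m. klin sH sM (\<lambda>h. X h l m)" "\<And>h m. klin sH sM (\<lambda>l. X h l m)" "\<And>h l. klin sM sM (X h l)"
  shows "Sw h (\<lambda>h1 h2. Sw l (\<lambda>l1 l2. X h1 l1 (J (act (h2 * l2) 1) m)))
    = Sw h (\<lambda>w h3. Sw l (\<lambda>v l3. Sw w (\<lambda>h1 h2. Sw v (\<lambda>l1 l2. X h1 l1 (G (h2 * l2) (G' (h3 * l3) m))))))"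
proof -
  note lX = lin klin_comp[OF X(1)] klin_comp[OF X(2)] klin_comp[OF X(3)]
  have "Sw h (\<lambda>h1 h2. Sw l (\<lambda>l1 l2. X h1 l1 (J (act (h2 * l2) 1) m)))
      = Sw h (\<lambda>h1 w. Sw l (\<lambda>l1 v. Sw (w * v) (\<lambda>x y. X h1 l1 (G x (G' y m)))))"
    unfolding G_G'[symmetric] Sw_pull[OF X(3)] ..
  also have "\<dots> = Sw h (\<lambda>h1 w. Sw l (\<lambda>l1 v. Sw w (\<lambda>h2 h3. Sw v (\<lambda>l2 l3. X h1 l1 (G (h2 * l2) (G' (h3 * l3) m))))))"
    by (rule Sw_cong, rule Sw_cong, rule Sw_mult[where sW=sM]) (intro lX)
  also have "\<dots> = Sw h (\<lambda>h1 w. Sw w (\<lambda>h2 h3. Sw l (\<lambda>l1 v. Sw v (\<lambda>l2 l3. X h1 l1 (G (h2 * l2) (G' (h3 * l3) m))))))"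
    by (rule Sw_cong, rule Sw_swap)
  also have "\<dots> = Sw h (\<lambda>w h3. Sw w (\<lambda>h1 h2. Sw l (\<lambda>l1 v. Sw v (\<lambda>l2 l3. X h1 l1 (G (h2 * l2) (G' (h3 * l3) m))))))"
    by (rule Sw_coassoc[symmetric, where sW=sM]) (intro lX)
  also have "\<dots> = Sw h (\<lambda>w h3. Sw w (\<lambda>h1 h2. Sw l (\<lambda>v l3. Sw v (\<lambda>l1 l2. X h1 l1 (G (h2 * l2) (G' (h3 * l3) m))))))"
    by (rule Sw_cong, rule Sw_cong, rule Sw_coassoc[symmetric, where sW=sM]) (intro lX)
  also have "\<dots> = Sw h (\<lambda>w h3. Sw l (\<lambda>v l3. Sw w (\<lambda>h1 h2. Sw v (\<lambda>l1 l2. X h1 l1 (G (h2 * l2) (G' (h3 * l3) m))))))"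
    by (rule Sw_cong, rule Sw_swap)
  finally show ?thesis .
qed

text \<open>The exchange rule of \<open>gamma\<close> and its inverse. Composed with
  \<open>gamma(h2 l2)\<close>, both sides become \<open>gamma(PiR(h) l)\<close>: the left one by
  \<open>G'_G\<close> and absorption of \<open>PiR\<close>, the right one by the product rule
  \<open>G_G\<close> and then \<open>G'_G\<close>. The inserted \<open>gamma\<close> is removed by
  \<open>cancel_G\<close>.\<close>

lemma G_G'_cocycle: "Sw l (\<lambda>l1 l2. G l1 (G' (h * l2) m)) = Sw h (\<lambda>h1 h2. G' h1 (J (f h2 l) m))"
proof -
  define L where "L h l m = Sw l (\<lambda>l1 l2. G l1 (G' (h * l2) m))" for h l m
  define R where "R h l m = Sw h (\<lambda>h1 h2. G' h1 (J (f h2 l) m))" for h l m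
  have lL: "klin sH sM (\<lambda>h. L h l m)" "klin sH sM (\<lambda>l. L h l m)" "klin sM sM (L h l)" for h l m
    unfolding L_def by (intro lin)+
  have lR: "klin sH sM (\<lambda>h. R h l m)" "klin sH sM (\<lambda>l. R h l m)" "klin sM sM (R h l)" for h l m
    unfolding R_def by (intro lin)+
  have L1: "Sw h (\<lambda>h1 h2. Sw l (\<lambda>l1 l2. L h1 l1 (Y (h2 * l2)))) = Sw l (\<lambda>a w. G a (Sw (h * w) (\<lambda>x y. G' x (Y y))))"
    if Y: "klin sH sM Y" for h l Y
  proof -
    note lY = lin klin_comp[OF Y]
    have "Sw h (\<lambda>h1 h2. Sw l (\<lambda>l1 l2. L h1 l1 (Y (h2 * l2))))
        = Sw h (\<lambda>h1 h2. Sw l (\<lambda>a w. Sw w (\<lambda>b l2. G a (G' (h1 * b) (Y (h2 * l2))))))"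
      unfolding L_def by (rule Sw_cong, rule Sw_coassoc[where sW=sM]) (intro lY)
    also have "\<dots> = Sw l (\<lambda>a w. Sw h (\<lambda>h1 h2. Sw w (\<lambda>b l2. G a (G' (h1 * b) (Y (h2 * l2))))))"
      by (rule Sw_swap)
    also have "\<dots> = Sw l (\<lambda>a w. Sw (h * w) (\<lambda>x y. G a (G' x (Y y))))"
      by (rule Sw_cong, rule Sw_mult[symmetric, where sW=sM]) (intro lY)
    finally show ?thesis unfolding G_Sw .
  qed
  have R1: "Sw h (\<lambda>h1 h2. Sw l (\<lambda>l1 l2. R h1 l1 (Y (h2 * l2))))
      = Sw h (\<lambda>a w. G' a (Sw w (\<lambda>b h2. Sw l (\<lambda>l1 l2. J (f b l1) (Y (h2 * l2))))))"
    if Y: "klin sH sM Y" for h l Y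
  proof -
    note lY = lin klin_comp[OF Y]
    have "Sw h (\<lambda>h1 h2. Sw l (\<lambda>l1 l2. R h1 l1 (Y (h2 * l2))))
        = Sw h (\<lambda>h1 h2. Sw h1 (\<lambda>a b. Sw l (\<lambda>l1 l2. G' a (J (f b l1) (Y (h2 * l2))))))"
      unfolding R_def by (rule Sw_cong, rule Sw_swap)
    also have "\<dots> = Sw h (\<lambda>a w. Sw w (\<lambda>b h2. Sw l (\<lambda>l1 l2. G' a (J (f b l1) (Y (h2 * l2))))))"
      by (rule Sw_coassoc[where sW=sM]) (intro lY)
    finally show ?thesis unfolding G_Sw .
  qed
  have LG: "Sw h (\<lambda>h1 h2. Sw l (\<lambda>l1 l2. L h1 l1 (G (h2 * l2) m))) = G (\<Pi>R h * l) m" for h l m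
  proof -
    have "Sw h (\<lambda>h1 h2. Sw l (\<lambda>l1 l2. L h1 l1 (G (h2 * l2) m))) = Sw l (\<lambda>a w. G (a * \<Pi>R (h * w)) m)"
      by (subst L1[of "\<lambda>x. G x m"], intro lin) (simp only: G'_G G_PiR_right)
    also have "\<dots> = G (\<Pi>R h * l) m" by (rule Sw_mult_PiR_absorb[OF vsM]) (intro lin)
    finally show ?thesis .
  qed
  have RG: "Sw h (\<lambda>h1 h2. Sw l (\<lambda>l1 l2. R h1 l1 (G (h2 * l2) m))) = G (\<Pi>R h * l) m" for h l m
    by (subst R1[of "\<lambda>x. G x m"], intro lin) (simp only: G_G[symmetric] G'_G G_PiR_left)
  have "L h l m = Sw h (\<lambda>h1 h2. Sw l (\<lambda>l1 l2. L h1 l1 (J (act (h2 * l2) 1) m)))"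
    by (subst L1[of "\<lambda>x. J (act x 1) m"], intro lin) (simp only: G'_unit L_def)
  also have "\<dots> = Sw h (\<lambda>h1 h2. Sw l (\<lambda>l1 l2. R h1 l1 (J (act (h2 * l2) 1) m)))"
    unfolding cancel_G[OF lL] cancel_G[OF lR] LG RG ..
  also have "\<dots> = R h l m"
    by (subst R1[of "\<lambda>x. J (act x 1) m"], intro lin) (simp only: J_mult[symmetric] J_Sw(1)[symmetric] f_u R_def)
  finally show ?thesis unfolding L_def R_def .
qed

lemma G_one_G': "Sw 1 (\<lambda>e1 e2. G e1 (G' (h * e2) m)) = G' h m"
  unfolding G_G'_cocycle f_one_right by (rule G'_unit)

text \<open>The inverse of \<open>gamma\<close> reverses products up to f, which is what makes M^K
  an H-module. The exchange rule produces \<open>gamma^{-1}(l1) gamma(l2)\<close>, that is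
  \<open>gamma(PiR)\<close>. This factor is moved to Delta(1) and absorbed by
  \<open>G_one_G'\<close>.\<close>

lemma G'_G': "Sw l (\<lambda>l1 l2. Sw h (\<lambda>h1 h2. G' l1 (G' h1 (J (f h2 l2) m)))) = G' (h * l) m"
proof -
  have "Sw l (\<lambda>l1 l2. Sw h (\<lambda>h1 h2. G' l1 (G' h1 (J (f h2 l2) m))))
      = Sw l (\<lambda>l1 w. Sw w (\<lambda>a b. G' l1 (G a (G' (h * b) m))))"
    unfolding G_Sw[symmetric] G_G'_cocycle ..
  also have "\<dots> = Sw l (\<lambda>v b. Sw v (\<lambda>l1 a. G' l1 (G a (G' (h * b) m))))"
    by (rule Sw_coassoc[symmetric, where sW=sM]) (intro lin)
  also have "\<dots> = Sw l (\<lambda>v b. G (\<Pi>R v) (G' (h * b) m))" unfolding G'_G ..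
  also have "\<dots> = Sw 1 (\<lambda>e1 e2. G e1 (G' (h * (l * e2)) m))"
    by (rule Sw_PiR_left[OF vsM]) (intro lin)
  finally show ?thesis unfolding mult.assoc[symmetric] G_one_G' .
qed

end

section \<open>The crossed product as a ring\<close>

context weak_cocycle
begin

abbreviation "te \<equiv> times_elt sH \<Delta> sA act"
abbreviation "ce a h \<equiv> te [(a, h)]"
abbreviation "E \<equiv> crossed_product sH \<Delta> sA act f"

text \<open>For bilinear \<open>B\<close>, \<open>bx B a h\<close> is the value of the induced linear map on \<open>a \<times> h\<close>, and \<open>pr B a h b l\<close>
  is its value on \<open>(a \<times> h)(b \<times> l)\<close>; identities in \<open>E\<close> are tested on all bilinear maps.\<close>

definition bx :: "('a \<Rightarrow> 'h \<Rightarrow> 'w::ab_group_add) \<Rightarrow> 'a \<Rightarrow> 'h \<Rightarrow> 'w" where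
  "bx B a h = Sw h (\<lambda>x y. B (a * act x 1) y)"

definition pr :: "('a \<Rightarrow> 'h \<Rightarrow> 'w::ab_group_add) \<Rightarrow> 'a \<Rightarrow> 'h \<Rightarrow> 'a \<Rightarrow> 'h \<Rightarrow> 'w" where
  "pr B a h b l = Sw h (\<lambda>h1 w. Sw w (\<lambda>h2 h3. Sw l (\<lambda>l1 l2. B (a * act h1 b * f h2 l1) (h3 * l2))))"

lemma times_sum_eval: "(\<Sum>(u, v)\<leftarrow>times_sum \<Delta> act t. B u v) = (\<Sum>(a, h)\<leftarrow>t. bx B a h)"
  unfolding times_sum_def bx_def Sw_def by (simp add: sum_list_concat_map case_prod_unfold o_def)

lemma te_eqI:
  assumes "\<And>B :: 'a \<Rightarrow> 'h \<Rightarrow> 'h \<Rightarrow> 'a. klin2 sA sH (\<lambda>c F x. sA c (F x)) B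
      \<Longrightarrow> (\<Sum>(a, h)\<leftarrow>t. bx B a h) = (\<Sum>(a, h)\<leftarrow>t'. bx B a h)"
  shows "te t = te t'"
  unfolding times_elt_def by (rule tens_eqI[OF vsA vs]) (simp add: times_sum_eval assms)

lemma te_eqD:
  assumes "te t = te t'" "klin2 sA sH sW B"
  shows "(\<Sum>(a, h)\<leftarrow>t. bx B a h) = (\<Sum>(a, h)\<leftarrow>t'. bx B a h)"
  using sum_cong_eval[OF _ assms(2)] assms(1)
  unfolding times_elt_def tens_eq_iff times_sum_eval[symmetric] by blast

lemma vsF: "vector_space (\<lambda>c F x. sA c (F x) :: 'a)"
proof -
  interpret vector_space sA by (rule vsA)
  show ?thesis by unfold_locales (auto simp: fun_eq_iff scale_right_distrib scale_left_distrib)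
qed

lemma te_append: "tens_add sA sH (te t) (te t') = te (t @ t')"
  unfolding times_elt_def tens_add_tens by (simp add: times_sum_def)

lemma tens_scale_tens: "tens_scale sA sH c (tens sA sH t) = tens sA sH [(sA c u, v). (u, v) \<leftarrow> t]"
  unfolding tens_scale_def
proof (rule tens_eqI[OF vsA vs])
  fix B :: "'a \<Rightarrow> 'h \<Rightarrow> 'h \<Rightarrow> 'a"
  assume B: "klin2 sA sH (\<lambda>c F x. sA c (F x)) B"
  have B': "klin2 sA sH (\<lambda>c F x. sA c (F x)) (\<lambda>u v. B (sA c u) v)"
    by (intro lin klin2_comp[OF B])
  show "(\<Sum>(u, v)\<leftarrow>[(sA c u, v). (u, v) \<leftarrow> rep (tens sA sH t)]. B u v) = (\<Sum>(u, v)\<leftarrow>[(sA c u, v). (u, v) \<leftarrow> t]. B u v)"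
    unfolding sum_list_pair_map using sum_cong_eval[OF rep_tens B', of t] by simp
qed

lemma te_scale: "tens_scale sA sH c (te t) = te [(sA c u, v). (u, v) \<leftarrow> t]"
proof -
  have "[(sA c u, v). (u, v) \<leftarrow> times_sum \<Delta> act t] = times_sum \<Delta> act [(sA c u, v). (u, v) \<leftarrow> t]"
    using algA unfolding times_sum_def k_algebra_def
    by (induction t) (auto simp: case_prod_unfold o_def)
  then show ?thesis unfolding times_elt_def tens_scale_tens by simp
qed

lemma ce_add: "ce (a + a') h = tens_add sA sH (ce a h) (ce a' h)" "ce a (h + h') = tens_add sA sH (ce a h) (ce a h')"
  and ce_scale: "ce (sA c a) h = tens_scale sA sH c (ce a h)" "ce a (sH c h) = tens_scale sA sH c (ce a h)"
proof -
  have bxl: "klin2 sA sH (\<lambda>c F x. sA c (F x)) (bx B)" if B: "klin2 sA sH (\<lambda>c F x. sA c (F x)) B"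
    for B :: "'a \<Rightarrow> 'h \<Rightarrow> 'h \<Rightarrow> 'a"
    unfolding bx_def by (intro lin linW[OF vsF] klin2_comp[OF B])
  note k = klin_add[OF klin2D(1)[OF bxl]] klin_add[OF klin2D(2)[OF bxl]]
    klin_scale[OF klin2D(1)[OF bxl]] klin_scale[OF klin2D(2)[OF bxl]]
  show "ce (a + a') h = tens_add sA sH (ce a h) (ce a' h)" "ce a (h + h') = tens_add sA sH (ce a h) (ce a h')"
    unfolding te_append by (rule te_eqI, simp add: k)+
  show "ce (sA c a) h = tens_scale sA sH c (ce a h)" "ce a (sH c h) = tens_scale sA sH c (ce a h)"
    unfolding te_scale by (simp, rule te_eqI, simp add: k)
qed

section \<open>The product of E, evaluated on test maps\<close>

context
  fixes sW :: "'k \<Rightarrow> 'w::ab_group_add \<Rightarrow> 'w" and B :: "'a \<Rightarrow> 'h \<Rightarrow> 'w"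
  assumes W: "vector_space sW" and B: "klin2 sA sH sW B"
begin

lemmas linB = lin linW[OF W] klin2_comp[OF B]

lemma bx_klin2: "klin2 sA sH sW (bx B)"
  unfolding bx_def by (intro linB)

lemma B_Sw: "B (Sw h T) v = Sw h (\<lambda>x y. B (T x y) v)"
  by (rule Sw_pull[where s=sA and s'=sW]) (intro linB)

lemma pr_klin2: "klin2 sA sH sW (\<lambda>a h. pr B a h b l)" "klin2 sA sH sW (\<lambda>b l. pr B a h b l)"
  unfolding pr_def by (intro linB)+

text \<open>The weak unit axiom splits the twofold coproduct of 1 so that f is evaluated at a
  product \<open>y u\<close>. Balancedness over H^R passes u on to l, where Delta(1) is absorbed,
  and the left unit condition removes f.\<close>

lemma pr_one_left: "pr B a 1 b l = bx B (a * b) l"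
proof -
  have "pr B a 1 b l = Sw 1 (\<lambda>x y. Sw 1 (\<lambda>u v. Sw l (\<lambda>l1 l2. B (a * act x b * f (y * u) l1) (v * l2))))"
    unfolding pr_def by (rule Sw_one1[where sW=sW]) (intro linB)
  also have "\<dots> = Sw 1 (\<lambda>x y. Sw 1 (\<lambda>u v. Sw l (\<lambda>l1 l2. B (a * act x b * f y (\<Pi>R u * l1)) (v * l2))))"
    unfolding f_balanced_R[symmetric] by (rule Sw_cong, rule Sw_one_PiR[OF W, symmetric]) (intro linB)
  also have "\<dots> = Sw 1 (\<lambda>x y. Sw 1 (\<lambda>u v. Sw l (\<lambda>l1 l2. B (a * act x b * f y (u * l1)) (v * l2))))"
    by (rule Sw_cong, rule Sw_one_PiR[OF W]) (intro linB)
  also have "\<dots> = Sw 1 (\<lambda>x y. Sw l (\<lambda>l1 l2. B (a * act x b * f y l1) l2))"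
    by (rule Sw_cong, rule Sw_one_left[where sW=sW]) (intro linB)
  also have "\<dots> = Sw l (\<lambda>l1 l2. Sw 1 (\<lambda>x y. B (a * (act x b * f y l1)) l2))"
    unfolding mult.assoc by (rule Sw_swap)
  also have "\<dots> = Sw l (\<lambda>l1 l2. Sw 1 (\<lambda>x y. B (a * (b * act x 1 * f y l1)) l2))"
    by (rule Sw_cong, rule Sw_one_act[symmetric, where sW=sW]) (intro linB)
  also have "\<dots> = bx B (a * b) l"
    unfolding B_Sw[symmetric] Sw_times(2)[symmetric] mult.assoc f_unit_left bx_def ..
  finally show ?thesis .
qed

lemma pr_one_right: "pr B a h b 1 = Sw h (\<lambda>x y. B (a * act x b) y)"
proof -
  have "pr B a h b 1 = Sw h (\<lambda>h1 w. Sw w (\<lambda>h2 h3. B (a * act h1 b * act h2 1) h3))"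
    unfolding pr_def by (rule Sw_cong, rule f_unit_right_tail[OF W, where B="\<lambda>u v. B (_ * u) v"]) (intro linB)
  also have "\<dots> = Sw h (\<lambda>p h3. Sw p (\<lambda>h1 h2. B (a * act h1 b * act h2 1) h3))"
    by (rule Sw_coassoc[symmetric, where sW=sW]) (intro linB)
  also have "\<dots> = Sw h (\<lambda>x y. B (a * act x b) y)"
    unfolding B_Sw[symmetric] Sw_times(2)[symmetric] mult.assoc act_absorb ..
  finally show ?thesis .
qed

text \<open>The product formula does not see the difference between \<open>a (x) h\<close> and its
  projection \<open>a \<times> h\<close> in the left factor. With \<open>pr_inv_right\<close> this
  makes the product independent of how the factors are written.\<close>

lemma pr_inv_left: "bx (\<lambda>a h. pr B a h b l) a h = pr B a h b l"
proof -
  have "bx (\<lambda>a h. pr B a h b l) a h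
      = Sw h (\<lambda>p w. Sw p (\<lambda>x h1. Sw w (\<lambda>h2 h3. Sw l (\<lambda>l1 l2. B (a * act x 1 * act h1 b * f h2 l1) (h3 * l2)))))"
    unfolding bx_def pr_def by (rule Sw_coassoc[symmetric, where sW=sW]) (intro linB)
  also have "\<dots> = Sw h (\<lambda>p w. Sw w (\<lambda>h2 h3. Sw l (\<lambda>l1 l2. Sw p (\<lambda>x h1. B (a * (act x 1 * act h1 b) * f h2 l1) (h3 * l2)))))"
    unfolding mult.assoc by (rule Sw_cong, rule HOL.trans[OF Sw_swap], rule Sw_cong, rule Sw_swap)
  also have "\<dots> = pr B a h b l"
    unfolding B_Sw[symmetric] Sw_times[symmetric] act_absorb pr_def ..
  finally show ?thesis .
qed

end

text \<open>Coassociativity in two arguments at once. It isolates a convolution product as a block,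
  so that the twisting and cocycle conditions can be applied as equations between convolution
  products inside longer expressions.\<close>

lemma convolution_tail:
  assumes W: "vector_space sW" and F: "klin2 sH sH sA F" and K: "klin2 sH sH sA K"
    and T: "\<And>v w. klin sA sW (\<lambda>u. T u v w)" "\<And>u w. klin sH sW (\<lambda>v. T u v w)" "\<And>u v. klin sH sW (T u v)"
  shows "Sw h (\<lambda>h1 h2. Sw l (\<lambda>l1 l2. Sw h2 (\<lambda>x y. Sw l2 (\<lambda>u v. T (F h1 l1 * K x u) y v))))
    = Sw h (\<lambda>p y. Sw l (\<lambda>q v. T (convolution \<Delta> F K p q) y v))"
proof -
  note lT = lin linW[OF W] klin_comp[OF T(1)] klin_comp[OF T(2)] klin_comp[OF T(3)] klin2_comp[OF F] klin2_comp[OF K]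
  have "Sw h (\<lambda>h1 h2. Sw l (\<lambda>l1 l2. Sw h2 (\<lambda>x y. Sw l2 (\<lambda>u v. T (F h1 l1 * K x u) y v))))
      = Sw h (\<lambda>h1 h2. Sw h2 (\<lambda>x y. Sw l (\<lambda>l1 l2. Sw l2 (\<lambda>u v. T (F h1 l1 * K x u) y v))))"
    by (rule Sw_cong, rule Sw_swap)
  also have "\<dots> = Sw h (\<lambda>p y. Sw p (\<lambda>h1 x. Sw l (\<lambda>l1 l2. Sw l2 (\<lambda>u v. T (F h1 l1 * K x u) y v))))"
    by (rule Sw_coassoc[symmetric, where sW=sW]) (intro lT)
  also have "\<dots> = Sw h (\<lambda>p y. Sw p (\<lambda>h1 x. Sw l (\<lambda>q v. Sw q (\<lambda>l1 u. T (F h1 l1 * K x u) y v))))"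
    by (rule Sw_cong, rule Sw_cong, rule Sw_coassoc[symmetric, where sW=sW]) (intro lT)
  also have "\<dots> = Sw h (\<lambda>p y. Sw l (\<lambda>q v. Sw p (\<lambda>h1 x. Sw q (\<lambda>l1 u. T (F h1 l1 * K x u) y v))))"
    by (rule Sw_cong, rule Sw_swap)
  also have "\<dots> = Sw h (\<lambda>p y. Sw l (\<lambda>q v. T (convolution \<Delta> F K p q) y v))"
    unfolding convolution_Sw Sw_pull[OF T(1)] ..
  finally show ?thesis .
qed

lemma convolution_eqs:
  "convolution \<Delta> f u2 = f" "convolution \<Delta> u2 f = f"
  "convolution \<Delta> f (\<lambda>h l. act (h * l) a) = convolution \<Delta> (\<lambda>h l. act h (act l a)) f"
  by (intro ext, simp only: convolution_Sw f_u u_f f_twist)+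

text \<open>Written as \<open>u2 * f\<close>, the cocycle starts with a value
  \<open>h . (l . 1)\<close>, and such a value absorbs the extra factor
  \<open>h1 . 1\<close>.\<close>

lemma act_f_absorb: "Sw h (\<lambda>x y. act x 1 * f y l) = f h l"
proof -
  have "Sw h (\<lambda>x y. act x 1 * f y l) = Sw h (\<lambda>x y. Sw y (\<lambda>p q. Sw l (\<lambda>l1 l2. act x 1 * (act p (act l1 1) * f q l2))))"
    unfolding Sw_times(2)[symmetric] act_act_one u_f ..
  also have "\<dots> = Sw h (\<lambda>w q. Sw w (\<lambda>x p. Sw l (\<lambda>l1 l2. act x 1 * (act p (act l1 1) * f q l2))))"
    by (rule Sw_coassoc[symmetric, where sW=sA]) (intro lin)
  also have "\<dots> = Sw h (\<lambda>w q. Sw l (\<lambda>l1 l2. Sw w (\<lambda>x p. act x 1 * act p (act l1 1) * f q l2)))"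
    unfolding mult.assoc by (rule Sw_cong, rule Sw_swap)
  also have "\<dots> = f h l"
    unfolding Sw_times(1)[symmetric] act_absorb unfolding act_act_one u_f ..
  finally show ?thesis .
qed

context
  fixes sW :: "'k \<Rightarrow> 'w::ab_group_add \<Rightarrow> 'w" and B :: "'a \<Rightarrow> 'h \<Rightarrow> 'w"
  assumes W: "vector_space sW" and B: "klin2 sA sH sW B"
begin

lemmas linB' = lin linW[OF W] klin2_comp[OF B]

text \<open>The tensor given by the product formula is already fixed by the projection onto E,
  because f absorbs \<open>u2\<close> on the right.\<close>

lemma pr_bx: "pr (bx B) a h b l = pr B a h b l"
proof -
  have u2l: "klin2 sH sH sA u2" by (intro lin)
  have "pr (bx B) a h b l = Sw h (\<lambda>h1 w. Sw w (\<lambda>h2 h3. Sw l (\<lambda>l1 l2. Sw h3 (\<lambda>x y. Sw l2 (\<lambda>u v.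
      B (a * act h1 b * (f h2 l1 * act (x * u) 1)) (y * v))))))"
    unfolding pr_def bx_def mult.assoc[of _ "f _ _"]
    by (rule Sw_cong, rule Sw_cong, rule Sw_cong, rule Sw_mult[where sW=sW]) (intro linB')
  also have "\<dots> = Sw h (\<lambda>h1 w. Sw w (\<lambda>h2 h3. Sw l (\<lambda>l1 l2. B (a * act h1 b * convolution \<Delta> f u2 h2 l1) (h3 * l2))))"
    by (rule Sw_cong, rule convolution_tail[OF W f_lin u2l]) (intro linB')+
  finally show ?thesis unfolding convolution_eqs pr_def .
qed

lemma pr_inv_right: "bx (\<lambda>b l. pr B a h b l) b l = pr B a h b l"
proof -
  have u2l: "klin2 sH sH sA u2" by (intro lin)
  have "bx (\<lambda>b l. pr B a h b l) b l = Sw l (\<lambda>x y. Sw h (\<lambda>h1 w. Sw h1 (\<lambda>p q. Sw w (\<lambda>h2 h3. Sw y (\<lambda>l1 l2.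
       B (a * act p b * (act (q * x) 1 * f h2 l1)) (h3 * l2))))))"
    unfolding bx_def pr_def act_mult[of _ b] Sw_times B_Sw[OF W B] act_act_one mult.assoc
    by (rule Sw_cong, rule Sw_cong, rule HOL.sym, rule HOL.trans[OF Sw_swap], rule Sw_cong, rule Sw_swap)
  also have "\<dots> = Sw l (\<lambda>x y. Sw h (\<lambda>p w'. Sw w' (\<lambda>q w. Sw w (\<lambda>h2 h3. Sw y (\<lambda>l1 l2.
       B (a * act p b * (act (q * x) 1 * f h2 l1)) (h3 * l2))))))"
    by (rule Sw_cong, rule Sw_coassoc[where sW=sW]) (intro linB')
  also have "\<dots> = Sw h (\<lambda>p w'. Sw w' (\<lambda>q w. Sw l (\<lambda>x y. Sw w (\<lambda>h2 h3. Sw y (\<lambda>l1 l2.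
       B (a * act p b * (act (q * x) 1 * f h2 l1)) (h3 * l2))))))"
    by (rule HOL.trans[OF Sw_swap], rule Sw_cong, rule Sw_swap)
  also have "\<dots> = Sw h (\<lambda>p w'. Sw w' (\<lambda>q w. Sw l (\<lambda>x y. B (a * act p b * convolution \<Delta> u2 f q x) (w * y))))"
    by (rule Sw_cong, rule convolution_tail[OF W u2l f_lin]) (intro linB')+
  finally show ?thesis unfolding convolution_eqs pr_def .
qed

text \<open>Both sides are brought to an expansion with the coefficient
  \<open>a (h1 . b) (h2 . (l1 . c)) (p1 . f(q1, n1)) f(p2, q2 n2)\<close>. On the left this takes
  the twisting and the cocycle condition, on the right only the rule for the action on a product.
  All other steps reorder legs.\<close>

lemma pr_assoc: "pr (\<lambda>u v. pr B u v c m) a h b l = pr (\<lambda>u v. pr B a h u v) b l c m"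
proof -
  have Ql: "klin2 sH sH sA (\<lambda>h l. act (h * l) c)" "klin2 sH sH sA (\<lambda>h l. act h (act l c))"
    and fl: "klin2 sH sH sA (\<lambda>h l. f (h * l) m1)" for m1 by (intro lin)+
  have "pr (\<lambda>u v. pr B u v c m) a h b l
      = Sw h (\<lambda>h1 w. Sw w (\<lambda>h2 h3. Sw l (\<lambda>l1 l2. Sw h3 (\<lambda>x1 x'. Sw l2 (\<lambda>y1 y'. Sw (x' * y') (\<lambda>g2 g3. Sw m (\<lambda>m1 m2.
          B (a * act h1 b * (f h2 l1 * act (x1 * y1) c) * f g2 m1) (g3 * m2))))))))"
    unfolding pr_def mult.assoc[of _ "f _ _" "act _ c"]
    by (rule Sw_cong, rule Sw_cong, rule Sw_cong, rule Sw_mult[where sW=sW]) (intro linB')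
  also have "\<dots> = Sw h (\<lambda>h1 w. Sw w (\<lambda>h2 h3. Sw l (\<lambda>l1 l2. Sw (h3 * l2) (\<lambda>g2 g3. Sw m (\<lambda>m1 m2.
          B (a * act h1 b * convolution \<Delta> f (\<lambda>h l. act (h * l) c) h2 l1 * f g2 m1) (g3 * m2))))))"
    by (rule Sw_cong, rule convolution_tail[OF W f_lin Ql(1)]) (intro linB')+
  \<comment> \<open>The twisting condition, applied to the isolated block.\<close>
  also have "\<dots> = Sw h (\<lambda>h1 w. Sw w (\<lambda>h2 h3. Sw l (\<lambda>l1 l2. Sw h3 (\<lambda>x1 x'. Sw l2 (\<lambda>y1 y'. Sw (x' * y') (\<lambda>g2 g3. Sw m (\<lambda>m1 m2.
          B (a * act h1 b * (act h2 (act l1 c) * f x1 y1) * f g2 m1) (g3 * m2))))))))"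
    unfolding convolution_eqs
    by (rule Sw_cong, rule convolution_tail[OF W Ql(2) f_lin, symmetric]) (intro linB')+
  also have "\<dots> = Sw h (\<lambda>h1 w. Sw w (\<lambda>h2 h3. Sw l (\<lambda>l1 l2. Sw h3 (\<lambda>x1 x'. Sw l2 (\<lambda>y1 y'. Sw x' (\<lambda>x2 x3. Sw y' (\<lambda>y2 y3. Sw m (\<lambda>m1 m2.
          B (a * act h1 b * act h2 (act l1 c) * (f x1 y1 * f (x2 * y2) m1)) (x3 * y3 * m2)))))))))"
    unfolding mult.assoc
    by (rule Sw_cong, rule Sw_cong, rule Sw_cong, rule Sw_cong, rule Sw_cong, subst mult.assoc[symmetric], rule Sw_mult[where sW=sW]) (intro linB')
  also have "\<dots> = Sw h (\<lambda>h1 w. Sw w (\<lambda>h2 h3. Sw l (\<lambda>l1 l2. Sw m (\<lambda>m1 m2. Sw h3 (\<lambda>x1 x'. Sw l2 (\<lambda>y1 y'. Sw x' (\<lambda>x2 x3. Sw y' (\<lambda>y2 y3.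
          B (a * act h1 b * act h2 (act l1 c) * (f x1 y1 * f (x2 * y2) m1)) (x3 * y3 * m2)))))))))"
    by (rule Sw_cong, rule Sw_cong, rule Sw_cong, rule HOL.sym, rule HOL.trans[OF Sw_swap], rule Sw_cong,
        rule HOL.trans[OF Sw_swap], rule Sw_cong, rule HOL.trans[OF Sw_swap], rule Sw_cong, rule Sw_swap)
  also have "\<dots> = Sw h (\<lambda>h1 w. Sw w (\<lambda>h2 h3. Sw l (\<lambda>l1 l2. Sw m (\<lambda>m1 m2. Sw h3 (\<lambda>x1 x'. Sw l2 (\<lambda>y1 y'.
          B (a * act h1 b * act h2 (act l1 c) * convolution \<Delta> f (\<lambda>h l. f (h * l) m1) x1 y1) (x' * y' * m2)))))))"
    by (rule Sw_cong, rule Sw_cong, rule Sw_cong, rule Sw_cong, rule convolution_tail[OF W f_lin fl]) (intro linB')+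
  \<comment> \<open>The cocycle condition, applied in the same way.\<close>
  also have "\<dots> = Sw h (\<lambda>h1 w. Sw w (\<lambda>h2 h3. Sw l (\<lambda>l1 l2. Sw m (\<lambda>m1 m2. Sw h3 (\<lambda>p x3. Sw l2 (\<lambda>q y3.
         Sw p (\<lambda>p1 p2. Sw q (\<lambda>q1 q2. Sw m1 (\<lambda>n1 n2.
          B (a * act h1 b * act h2 (act l1 c) * (act p1 (f q1 n1) * f p2 (q2 * n2))) (x3 * y3 * m2))))))))))"
    unfolding convolution_Sw f_cocycle Sw_times B_Sw[OF W B] ..
  also have "\<dots> = Sw h (\<lambda>h1 w. Sw w (\<lambda>h2 h3. Sw l (\<lambda>l1 l2. Sw m (\<lambda>m1 m2. Sw h3 (\<lambda>p x3. Sw p (\<lambda>p1 p2. Sw l2 (\<lambda>q y3.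
         Sw q (\<lambda>q1 q2. Sw m1 (\<lambda>n1 n2.
          B (a * act h1 b * act h2 (act l1 c) * (act p1 (f q1 n1) * f p2 (q2 * n2))) (x3 * y3 * m2))))))))))"
    by (rule Sw_cong, rule Sw_cong, rule Sw_cong, rule Sw_cong, rule Sw_cong, rule Sw_swap)
  also have "\<dots> = Sw h (\<lambda>h1 w. Sw w (\<lambda>h2 h3. Sw l (\<lambda>l1 l2. Sw m (\<lambda>m1 m2. Sw h3 (\<lambda>p1 p'. Sw p' (\<lambda>p2 x3. Sw l2 (\<lambda>q1 q'.
         Sw q' (\<lambda>q2 y3. Sw m1 (\<lambda>n1 n2.
          B (a * act h1 b * act h2 (act l1 c) * (act p1 (f q1 n1) * f p2 (q2 * n2))) (x3 * y3 * m2))))))))))"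
    by (rule Sw_cong, rule Sw_cong, rule Sw_cong, rule Sw_cong, rule HOL.trans[OF Sw_coassoc[where sW=sW]],
        intro linB', rule Sw_cong, rule Sw_cong, rule Sw_coassoc[where sW=sW]) (intro linB')
  also have "\<dots> = Sw h (\<lambda>h1 w. Sw w (\<lambda>h2 h3. Sw l (\<lambda>l1 l2. Sw h3 (\<lambda>p1 p'. Sw p' (\<lambda>p2 x3. Sw l2 (\<lambda>q1 q'.
         Sw q' (\<lambda>q2 y3. Sw m (\<lambda>m1 m2. Sw m1 (\<lambda>n1 n2.
          B (a * act h1 b * act h2 (act l1 c) * (act p1 (f q1 n1) * f p2 (q2 * n2))) (x3 * y3 * m2))))))))))"
    by (rule Sw_cong, rule Sw_cong, rule Sw_cong, rule HOL.trans[OF Sw_swap], rule Sw_cong,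
        rule HOL.trans[OF Sw_swap], rule Sw_cong, rule HOL.trans[OF Sw_swap], rule Sw_cong, rule Sw_swap)
  also have "\<dots> = Sw h (\<lambda>h1 w. Sw w (\<lambda>h2 h3. Sw l (\<lambda>l1 l2. Sw h3 (\<lambda>p1 p'. Sw p' (\<lambda>p2 x3. Sw l2 (\<lambda>q1 q'.
         Sw q' (\<lambda>q2 y3. Sw m (\<lambda>n1 m'. Sw m' (\<lambda>n2 m2.
          B (a * act h1 b * act h2 (act l1 c) * (act p1 (f q1 n1) * f p2 (q2 * n2))) (x3 * y3 * m2))))))))))"
    by (rule Sw_cong, rule Sw_cong, rule Sw_cong, rule Sw_cong, rule Sw_cong, rule Sw_cong, rule Sw_cong,
        rule Sw_coassoc[where sW=sW]) (intro linB')
  finally have L: "pr (\<lambda>u v. pr B u v c m) a h b l = \<dots>" .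
  have "pr (\<lambda>u v. pr B a h u v) b l c m
     = Sw l (\<lambda>l1 l2. Sw l2 (\<lambda>q1 q'. Sw m (\<lambda>n1 m'. Sw h (\<lambda>h1 w. Sw w (\<lambda>p2 x3. Sw q' (\<lambda>q2 y3. Sw m' (\<lambda>n2 m2.
          B (a * act h1 (b * act l1 c * f q1 n1) * f p2 (q2 * n2)) (x3 * (y3 * m2)))))))))"
    unfolding pr_def by (rule Sw_cong, rule Sw_cong, rule Sw_cong, rule Sw_cong, rule Sw_cong, rule Sw_mult[where sW=sW]) (intro linB')
  also have "\<dots> = Sw l (\<lambda>l1 l2. Sw l2 (\<lambda>q1 q'. Sw m (\<lambda>n1 m'. Sw h (\<lambda>h1 w. Sw h1 (\<lambda>u u'. Sw u' (\<lambda>h2 p1. Sw w (\<lambda>p2 x3. Sw q' (\<lambda>q2 y3. Sw m' (\<lambda>n2 m2.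
          B (a * act u b * act h2 (act l1 c) * (act p1 (f q1 n1) * f p2 (q2 * n2))) (x3 * y3 * m2))))))))))"
    (is "?L1 = ?L2")
  proof (rule Sw_cong, rule Sw_cong, rule Sw_cong, rule Sw_cong)
    fix l1 l2 q1 q' n1 m' h1 w
    have e: "act h1 (b * act l1 c * f q1 n1) = Sw h1 (\<lambda>u u'. Sw u' (\<lambda>h2 p1. act u b * (act h2 (act l1 c) * act p1 (f q1 n1))))"
      unfolding mult.assoc[of b] act_mult[of h1 b] act_mult[of _ "act l1 c"] Sw_times ..
    show "Sw w (\<lambda>p2 x3. Sw q' (\<lambda>q2 y3. Sw m' (\<lambda>n2 m2. B (a * act h1 (b * act l1 c * f q1 n1) * f p2 (q2 * n2)) (x3 * (y3 * m2)))))
        = Sw h1 (\<lambda>u u'. Sw u' (\<lambda>h2 p1. Sw w (\<lambda>p2 x3. Sw q' (\<lambda>q2 y3. Sw m' (\<lambda>n2 m2.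
          B (a * act u b * act h2 (act l1 c) * (act p1 (f q1 n1) * f p2 (q2 * n2))) (x3 * y3 * m2))))))"
      (is "_ = Sw h1 (\<lambda>u u'. Sw u' (\<lambda>h2 p1. Sw w (\<lambda>p2 x3. Sw q' (\<lambda>q2 y3. Sw m' (\<lambda>n2 m2. ?t u h2 p1 p2 x3 q2 y3 n2 m2)))))")
    proof -
      have "Sw w (\<lambda>p2 x3. Sw q' (\<lambda>q2 y3. Sw m' (\<lambda>n2 m2. B (a * act h1 (b * act l1 c * f q1 n1) * f p2 (q2 * n2)) (x3 * (y3 * m2)))))
        = Sw w (\<lambda>p2 x3. Sw q' (\<lambda>q2 y3. Sw m' (\<lambda>n2 m2. Sw h1 (\<lambda>u u'. Sw u' (\<lambda>h2 p1. ?t u h2 p1 p2 x3 q2 y3 n2 m2)))))"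
        unfolding e Sw_times B_Sw[OF W B] unfolding mult.assoc ..
      also have "\<dots> = Sw h1 (\<lambda>u u'. Sw w (\<lambda>p2 x3. Sw q' (\<lambda>q2 y3. Sw m' (\<lambda>n2 m2. Sw u' (\<lambda>h2 p1. ?t u h2 p1 p2 x3 q2 y3 n2 m2)))))"
        by (rule HOL.sym, rule HOL.trans[OF Sw_swap], rule Sw_cong, rule HOL.trans[OF Sw_swap], rule Sw_cong, rule Sw_swap)
      also have "\<dots> = Sw h1 (\<lambda>u u'. Sw u' (\<lambda>h2 p1. Sw w (\<lambda>p2 x3. Sw q' (\<lambda>q2 y3. Sw m' (\<lambda>n2 m2. ?t u h2 p1 p2 x3 q2 y3 n2 m2)))))"
        by (rule Sw_cong, rule HOL.sym, rule HOL.trans[OF Sw_swap], rule Sw_cong, rule HOL.trans[OF Sw_swap], rule Sw_cong, rule Sw_swap)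
      finally show ?thesis .
    qed
  qed
  also have "?L2 = Sw l (\<lambda>l1 l2. Sw l2 (\<lambda>q1 q'. Sw m (\<lambda>n1 m'. Sw h (\<lambda>u w'. Sw w' (\<lambda>u' w. Sw u' (\<lambda>h2 p1. Sw w (\<lambda>p2 x3. Sw q' (\<lambda>q2 y3. Sw m' (\<lambda>n2 m2.
          B (a * act u b * act h2 (act l1 c) * (act p1 (f q1 n1) * f p2 (q2 * n2))) (x3 * y3 * m2))))))))))"
    by (rule Sw_cong, rule Sw_cong, rule Sw_cong, rule Sw_coassoc[where sW=sW]) (intro linB')
  also have "\<dots> = Sw l (\<lambda>l1 l2. Sw l2 (\<lambda>q1 q'. Sw m (\<lambda>n1 m'. Sw h (\<lambda>u w'. Sw w' (\<lambda>h2 w. Sw w (\<lambda>p1 p'. Sw p' (\<lambda>p2 x3. Sw q' (\<lambda>q2 y3. Sw m' (\<lambda>n2 m2.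
          B (a * act u b * act h2 (act l1 c) * (act p1 (f q1 n1) * f p2 (q2 * n2))) (x3 * y3 * m2))))))))))"
    by (rule Sw_cong, rule Sw_cong, rule Sw_cong, rule Sw_cong, rule Sw_coassoc[where sW=sW]) (intro linB')
  also have "\<dots> = Sw l (\<lambda>l1 l2. Sw l2 (\<lambda>q1 q'. Sw h (\<lambda>u w'. Sw w' (\<lambda>h2 w. Sw w (\<lambda>p1 p'. Sw p' (\<lambda>p2 x3. Sw q' (\<lambda>q2 y3. Sw m (\<lambda>n1 m'. Sw m' (\<lambda>n2 m2.
          B (a * act u b * act h2 (act l1 c) * (act p1 (f q1 n1) * f p2 (q2 * n2))) (x3 * y3 * m2))))))))))"
    by (rule Sw_cong, rule Sw_cong, rule HOL.trans[OF Sw_swap], rule Sw_cong, rule HOL.trans[OF Sw_swap], rule Sw_cong,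
       rule HOL.trans[OF Sw_swap], rule Sw_cong, rule HOL.trans[OF Sw_swap], rule Sw_cong, rule Sw_swap)
  also have "\<dots> = Sw l (\<lambda>l1 l2. Sw h (\<lambda>u w'. Sw w' (\<lambda>h2 w. Sw w (\<lambda>p1 p'. Sw p' (\<lambda>p2 x3. Sw l2 (\<lambda>q1 q'. Sw q' (\<lambda>q2 y3. Sw m (\<lambda>n1 m'. Sw m' (\<lambda>n2 m2.
          B (a * act u b * act h2 (act l1 c) * (act p1 (f q1 n1) * f p2 (q2 * n2))) (x3 * y3 * m2))))))))))"
    by (rule Sw_cong, rule HOL.trans[OF Sw_swap], rule Sw_cong, rule HOL.trans[OF Sw_swap], rule Sw_cong,
       rule HOL.trans[OF Sw_swap], rule Sw_cong, rule Sw_swap)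
  also have "\<dots> = Sw h (\<lambda>u w'. Sw w' (\<lambda>h2 w. Sw l (\<lambda>l1 l2. Sw w (\<lambda>p1 p'. Sw p' (\<lambda>p2 x3. Sw l2 (\<lambda>q1 q'. Sw q' (\<lambda>q2 y3. Sw m (\<lambda>n1 m'. Sw m' (\<lambda>n2 m2.
          B (a * act u b * act h2 (act l1 c) * (act p1 (f q1 n1) * f p2 (q2 * n2))) (x3 * y3 * m2))))))))))"
    by (rule HOL.trans[OF Sw_swap], rule Sw_cong, rule Sw_swap)
  finally show ?thesis unfolding L ..
qed

end

section \<open>E as a ring\<close>

lemma te_times_rep: "te (times_rep sH \<Delta> sA act (te t)) = te t"
  unfolding times_rep_def by (rule someI[of "\<lambda>s. te s = te t" t]) (rule HOL.refl)

definition te_prod :: "('a \<times> 'h) list \<Rightarrow> ('a \<times> 'h) list \<Rightarrow> ('a \<times> 'h) list" where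
  "te_prod s t = [(a * act h1 b * f h2 l1, h3 * l2).
     (a, h) \<leftarrow> s, (b, l) \<leftarrow> t, (h1, h2, h3) \<leftarrow> sw3 \<Delta> h, (l1, l2) \<leftarrow> sw \<Delta> l]"

lemma te_prod_eval:
  assumes "vector_space sW" and B: "klin2 sA sH sW B"
  shows "(\<Sum>(u, v)\<leftarrow>te_prod s t. B u v) = (\<Sum>(a, h)\<leftarrow>s. \<Sum>(b, l)\<leftarrow>t. pr B a h b l)"
proof -
  have "pr B a h b l = (\<Sum>(h1, h2, h3)\<leftarrow>sw3 \<Delta> h. \<Sum>(l1, l2)\<leftarrow>sw \<Delta> l. B (a * act h1 b * f h2 l1) (h3 * l2))" for a h b l
  proof -
    have "pr B a h b l = Sw h (\<lambda>w h3. Sw w (\<lambda>h1 h2. Sw l (\<lambda>l1 l2. B (a * act h1 b * f h2 l1) (h3 * l2))))"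
      unfolding pr_def by (rule Sw_coassoc[symmetric, where sW=sW]) (intro linB[OF assms])
    then show ?thesis unfolding Sw_def sw3_def by (simp add: sum_list_concat_map case_prod_unfold o_def)
  qed
  then show ?thesis unfolding te_prod_def by (simp add: sum_list_concat_map case_prod_unfold o_def)
qed

text \<open>The product of E is computed from arbitrary presentations of its factors. This is its
  well-definedness, obtained on test maps by changing one factor at a time.\<close>

lemma te_prod_cong:
  assumes "te s = te s'" "te t = te t'"
  shows "te (te_prod s t) = te (te_prod s' t')"
proof (rule te_eqI)
  fix B :: "'a \<Rightarrow> 'h \<Rightarrow> 'h \<Rightarrow> 'a"
  let ?W = "\<lambda>c F x. sA c (F x) :: 'a"
  assume B: "klin2 sA sH ?W B"
  have e: "(\<Sum>(u, v)\<leftarrow>te_prod s t. bx B u v) = (\<Sum>(a, h)\<leftarrow>s. \<Sum>(b, l)\<leftarrow>t. pr B a h b l)" for s t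
    unfolding te_prod_eval[OF vsF bx_klin2[OF vsF B]] pr_bx[OF vsF B] ..
  have "(\<Sum>(a, h)\<leftarrow>s. \<Sum>(b, l)\<leftarrow>t. pr B a h b l) = (\<Sum>(a, h)\<leftarrow>s. \<Sum>(b, l)\<leftarrow>t'. pr B a h b l)"
    using te_eqD[OF assms(2) pr_klin2(2)[OF vsF B]] unfolding pr_inv_right[OF vsF B] by simp
  also have "\<dots> = (\<Sum>(b, l)\<leftarrow>t'. \<Sum>(a, h)\<leftarrow>s. pr B a h b l)"
    unfolding case_prod_unfold by (rule sum_list_swap)
  also have "\<dots> = (\<Sum>(b, l)\<leftarrow>t'. \<Sum>(a, h)\<leftarrow>s'. pr B a h b l)"
    using te_eqD[OF assms(1) pr_klin2(1)[OF vsF B]] unfolding pr_inv_left[OF vsF B] by simp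
  also have "\<dots> = (\<Sum>(a, h)\<leftarrow>s'. \<Sum>(b, l)\<leftarrow>t'. pr B a h b l)"
    unfolding case_prod_unfold by (rule sum_list_swap)
  finally show "(\<Sum>(u, v)\<leftarrow>te_prod s t. bx B u v) = (\<Sum>(u, v)\<leftarrow>te_prod s' t'. bx B u v)" unfolding e .
qed

lemma E_simps:
  "carrier E = range te" "\<one>\<^bsub>E\<^esub> = ce 1 1" "te s \<oplus>\<^bsub>E\<^esub> te t = te (s @ t)" "\<zero>\<^bsub>E\<^esub> = te []"
  "c \<odot>\<^bsub>E\<^esub> te t = te [(sA c u, v). (u, v) \<leftarrow> t]"
proof -
  show "te s \<oplus>\<^bsub>E\<^esub> te t = te (s @ t)" "c \<odot>\<^bsub>E\<^esub> te t = te [(sA c u, v). (u, v) \<leftarrow> t]"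
    unfolding te_append[symmetric] te_scale[symmetric] by (simp_all add: crossed_product_def)
  show "\<zero>\<^bsub>E\<^esub> = te []" by (simp add: crossed_product_def times_elt_def times_sum_def)
qed (simp_all add: crossed_product_def)

lemma E_mult: "te s \<otimes>\<^bsub>E\<^esub> te t = te (te_prod s t)"
proof -
  have "te s \<otimes>\<^bsub>E\<^esub> te t = te (te_prod (times_rep sH \<Delta> sA act (te s)) (times_rep sH \<Delta> sA act (te t)))"
    unfolding crossed_product_def te_prod_def monoid.select_convs ..
  then show ?thesis using te_prod_cong[OF te_times_rep te_times_rep] by (simp only:)
qed

lemma te_in [simp]: "te t \<in> carrier E"
  by (simp add: E_simps)

lemma carrierE: "x \<in> carrier E \<Longrightarrow> (\<And>t. x = te t \<Longrightarrow> P) \<Longrightarrow> P"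
  by (auto simp: E_simps)

lemma E_closed: "x \<in> carrier E \<Longrightarrow> y \<in> carrier E \<Longrightarrow> x \<oplus>\<^bsub>E\<^esub> y \<in> carrier E"
  "x \<in> carrier E \<Longrightarrow> y \<in> carrier E \<Longrightarrow> x \<otimes>\<^bsub>E\<^esub> y \<in> carrier E"
  "x \<in> carrier E \<Longrightarrow> c \<odot>\<^bsub>E\<^esub> x \<in> carrier E" "\<one>\<^bsub>E\<^esub> \<in> carrier E"
  by (auto elim!: carrierE simp: E_simps(2-) E_mult)

lemma te_test_eqI:
  assumes "\<And>B :: 'a \<Rightarrow> 'h \<Rightarrow> 'h \<Rightarrow> 'a. klin2 sA sH (\<lambda>c F x. sA c (F x)) B
    \<Longrightarrow> (\<Sum>(a, h)\<leftarrow>te_prod s t. bx B a h) = (\<Sum>(a, h)\<leftarrow>r. bx B a h)"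
  shows "te s \<otimes>\<^bsub>E\<^esub> te t = te r"
  unfolding E_mult by (rule te_eqI) (rule assms)

lemma te_prod_test:
  assumes "vector_space sW" "klin2 sA sH sW B"
  shows "(\<Sum>(u, v)\<leftarrow>te_prod s t. bx B u v) = (\<Sum>(a, h)\<leftarrow>s. \<Sum>(b, l)\<leftarrow>t. pr B a h b l)"
  unfolding te_prod_eval[OF assms(1) bx_klin2[OF assms]] pr_bx[OF assms] ..

lemma E_distrib:
  assumes "x \<in> carrier E" "y \<in> carrier E" "z \<in> carrier E"
  shows "(x \<oplus>\<^bsub>E\<^esub> y) \<otimes>\<^bsub>E\<^esub> z = x \<otimes>\<^bsub>E\<^esub> z \<oplus>\<^bsub>E\<^esub> y \<otimes>\<^bsub>E\<^esub> z"
    "z \<otimes>\<^bsub>E\<^esub> (x \<oplus>\<^bsub>E\<^esub> y) = z \<otimes>\<^bsub>E\<^esub> x \<oplus>\<^bsub>E\<^esub> z \<otimes>\<^bsub>E\<^esub> y"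
proof -
  obtain r s t where [simp]: "x = te r" "y = te s" "z = te t" using assms by (auto elim!: carrierE)
  show "(x \<oplus>\<^bsub>E\<^esub> y) \<otimes>\<^bsub>E\<^esub> z = x \<otimes>\<^bsub>E\<^esub> z \<oplus>\<^bsub>E\<^esub> y \<otimes>\<^bsub>E\<^esub> z"
    unfolding E_mult E_simps \<open>x = _\<close> \<open>y = _\<close> \<open>z = _\<close>
    by (rule te_eqI) (simp only: te_prod_test[OF vsF] map_append sum_list.append)
  show "z \<otimes>\<^bsub>E\<^esub> (x \<oplus>\<^bsub>E\<^esub> y) = z \<otimes>\<^bsub>E\<^esub> x \<oplus>\<^bsub>E\<^esub> z \<otimes>\<^bsub>E\<^esub> y"
    unfolding E_mult E_simps \<open>x = _\<close> \<open>y = _\<close> \<open>z = _\<close>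
    by (rule te_eqI) (simp only: te_prod_test[OF vsF] map_append sum_list.append, simp add: case_prod_unfold sum_list_addf)
qed

lemma E_one:
  assumes "x \<in> carrier E"
  shows "\<one>\<^bsub>E\<^esub> \<otimes>\<^bsub>E\<^esub> x = x" "x \<otimes>\<^bsub>E\<^esub> \<one>\<^bsub>E\<^esub> = x"
proof -
  obtain t where t: "x = te t" using assms by (auto elim!: carrierE)
  have 1: "pr B a h 1 1 = bx B a h" if "klin2 sA sH (\<lambda>c F x. sA c (F x)) B" for a h and B :: "'a \<Rightarrow> 'h \<Rightarrow> 'h \<Rightarrow> 'a"
    unfolding pr_one_right[OF vsF that] bx_def ..
  show "\<one>\<^bsub>E\<^esub> \<otimes>\<^bsub>E\<^esub> x = x" "x \<otimes>\<^bsub>E\<^esub> \<one>\<^bsub>E\<^esub> = x"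
    unfolding t E_simps(2)
    by (rule te_test_eqI, simp only: te_prod_test[OF vsF], simp add: case_prod_unfold pr_one_left[OF vsF] 1)+
qed

lemma E_assoc:
  assumes "x \<in> carrier E" "y \<in> carrier E" "z \<in> carrier E"
  shows "(x \<otimes>\<^bsub>E\<^esub> y) \<otimes>\<^bsub>E\<^esub> z = x \<otimes>\<^bsub>E\<^esub> (y \<otimes>\<^bsub>E\<^esub> z)"
proof -
  obtain r s t where rst: "x = te r" "y = te s" "z = te t" using assms by (auto elim!: carrierE)
  show ?thesis unfolding rst E_mult
  proof (rule te_eqI)
    fix B :: "'a \<Rightarrow> 'h \<Rightarrow> 'h \<Rightarrow> 'a"
    let ?W = "\<lambda>c F x. sA c (F x) :: 'a"
    assume B: "klin2 sA sH ?W B"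
    have l1: "klin2 sA sH ?W (\<lambda>u v. pr B u v c m)" and l2: "klin2 sA sH ?W (\<lambda>u v. pr B a h u v)" for a h c m
      by (rule pr_klin2[OF vsF B])+
    have "(\<Sum>(u, v)\<leftarrow>te_prod (te_prod r s) t. bx B u v) = (\<Sum>(c, m)\<leftarrow>t. \<Sum>(u, v)\<leftarrow>te_prod r s. pr B u v c m)"
      unfolding te_prod_test[OF vsF B] unfolding case_prod_unfold by (rule sum_list_swap)
    also have "\<dots> = (\<Sum>(c, m)\<leftarrow>t. \<Sum>(a, h)\<leftarrow>r. \<Sum>(b, l)\<leftarrow>s. pr (\<lambda>u v. pr B a h u v) b l c m)"
      unfolding te_prod_eval[OF vsF l1] pr_assoc[OF vsF B] ..
    also have "\<dots> = (\<Sum>(a, h)\<leftarrow>r. \<Sum>(c, m)\<leftarrow>t. \<Sum>(b, l)\<leftarrow>s. pr (\<lambda>u v. pr B a h u v) b l c m)"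
      unfolding case_prod_unfold by (rule sum_list_swap)
    also have "\<dots> = (\<Sum>(a, h)\<leftarrow>r. \<Sum>(b, l)\<leftarrow>s. \<Sum>(c, m)\<leftarrow>t. pr (\<lambda>u v. pr B a h u v) b l c m)"
      unfolding case_prod_unfold by (subst sum_list_swap) (rule HOL.refl)
    also have "\<dots> = (\<Sum>(u, v)\<leftarrow>te_prod r (te_prod s t). bx B u v)"
      unfolding te_prod_test[OF vsF B] te_prod_eval[OF vsF l2] ..
    finally show "(\<Sum>(u, v)\<leftarrow>te_prod (te_prod r s) t. bx B u v) = (\<Sum>(u, v)\<leftarrow>te_prod r (te_prod s t). bx B u v)" .
  qed
qed

section \<open>The generators \<open>j(a)\<close> and \<open>gamma(h)\<close>, and linear maps on
  E\<close>

abbreviation "j \<equiv> jnu sH \<Delta> sA act"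
abbreviation "\<gamma> \<equiv> gam sH \<Delta> sA act"

lemma j_ce: "j a = ce a 1" and gam_ce: "\<gamma> h = ce 1 h"
  by (simp_all add: jnu_def gam_def)

lemma j_mult_ce: "j a \<otimes>\<^bsub>E\<^esub> ce b l = ce (a * b) l"
  unfolding j_ce by (rule te_test_eqI) (simp add: te_prod_test[OF vsF] pr_one_left[OF vsF])

lemma j_gam: "j a \<otimes>\<^bsub>E\<^esub> \<gamma> h = ce a h"
  unfolding gam_ce j_mult_ce by simp

lemma j_mult: "j a \<otimes>\<^bsub>E\<^esub> j b = j (a * b)"
  using j_mult_ce[of a b 1] by (simp add: j_ce)

lemma j_one: "j 1 = \<one>\<^bsub>E\<^esub>"
  by (simp add: j_ce E_simps)

lemma j_in [simp]: "j a \<in> carrier E" and gam_in [simp]: "\<gamma> h \<in> carrier E"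
  by (simp_all add: j_ce gam_ce)

text \<open>The scalars act through K, so additive and left K-linear maps on E are k-linear.\<close>

lemma j_scale: "x \<in> carrier E \<Longrightarrow> c \<odot>\<^bsub>E\<^esub> x = j (sA c 1) \<otimes>\<^bsub>E\<^esub> x"
proof -
  assume "x \<in> carrier E"
  then obtain t where t: "x = te t" by (auto elim!: carrierE)
  show ?thesis unfolding t E_simps j_ce
  proof (rule te_test_eqI[symmetric])
    fix B :: "'a \<Rightarrow> 'h \<Rightarrow> 'h \<Rightarrow> 'a"
    assume B: "klin2 sA sH (\<lambda>c F x. sA c (F x)) B"
    have "sA c 1 * b = sA c b" for b using algA unfolding k_algebra_def by (metis mult_1)
    then show "(\<Sum>(a, h)\<leftarrow>te_prod [(sA c 1, 1)] t. bx B a h) = (\<Sum>(a, h)\<leftarrow>[(sA c u, v). (u, v) \<leftarrow> t]. bx B a h)"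
      unfolding te_prod_test[OF vsF B] sum_list_pair_map by (simp add: case_prod_unfold pr_one_left[OF vsF B])
  qed
qed

definition Elin :: "('k \<Rightarrow> 'w::ab_group_add \<Rightarrow> 'w) \<Rightarrow> (('a \<times> 'h) list set \<Rightarrow> 'w) \<Rightarrow> bool" where
  "Elin sW T \<longleftrightarrow> (\<forall>x\<in>carrier E. \<forall>y\<in>carrier E. T (x \<oplus>\<^bsub>E\<^esub> y) = T x + T y)
     \<and> (\<forall>c. \<forall>x\<in>carrier E. T (c \<odot>\<^bsub>E\<^esub> x) = sW c (T x))"

lemma Elin_te:
  assumes "Elin sW T"
  shows "T (te t) = (\<Sum>(a, h)\<leftarrow>t. T (ce a h))"
proof (induction t)
  case Nil
  have "T (te [] \<oplus>\<^bsub>E\<^esub> te []) = T (te []) + T (te [])" using assms te_in unfolding Elin_def by blast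
  then show ?case by (simp add: E_simps)
next
  case (Cons p t)
  have "T (te [p] \<oplus>\<^bsub>E\<^esub> te t) = T (te [p]) + T (te t)" using assms te_in unfolding Elin_def by blast
  then show ?case using Cons by (cases p) (simp add: E_simps)
qed

lemma Elin_klin2: "Elin sW T \<Longrightarrow> klin2 sA sH sW (\<lambda>a h. T (ce a h))"
  unfolding Elin_def by (intro klin2I klinI) (simp_all add: ce_add ce_scale crossed_product_def)

text \<open>Because \<open>(h1 . 1)(h2 . 1)\<close> is \<open>h . 1\<close>, the element
  \<open>a \<times> h\<close> is also the sum of the elements
  \<open>(a (h1 . 1)) \<times> h2\<close>.\<close>

lemma Elin_bx:
  assumes T: "Elin sW T"
  shows "bx (\<lambda>a h. T (ce a h)) a h = T (ce a h)"
proof -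
  have "te (times_sum \<Delta> act [(a, h)]) = ce a h"
  proof (rule te_eqI)
    fix B :: "'a \<Rightarrow> 'h \<Rightarrow> 'h \<Rightarrow> 'a"
    assume B: "klin2 sA sH (\<lambda>c F x. sA c (F x)) B"
    have "bx (bx B) a h = Sw h (\<lambda>p w. Sw p (\<lambda>x y. B (a * act x 1 * act y 1) w))"
      unfolding bx_def by (rule Sw_coassoc[symmetric, where sW="\<lambda>c F x. sA c (F x)"]) (intro linB[OF vsF B])
    also have "\<dots> = bx B a h"
      unfolding mult.assoc B_Sw[OF vsF B, symmetric] Sw_times(2)[symmetric] act_absorb bx_def ..
    finally show "(\<Sum>(a, h)\<leftarrow>times_sum \<Delta> act [(a, h)]. bx B a h) = (\<Sum>(a, h)\<leftarrow>[(a, h)]. bx B a h)"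
      unfolding times_sum_eval by simp
  qed
  then have "T (ce a h) = (\<Sum>(a, h)\<leftarrow>times_sum \<Delta> act [(a, h)]. T (ce a h))"
    using Elin_te[OF T] by metis
  then show ?thesis unfolding times_sum_eval by simp
qed

lemma Elin_mult:
  assumes W: "vector_space sW" and T: "Elin sW T"
  shows "T (ce a h \<otimes>\<^bsub>E\<^esub> ce b l) = pr (\<lambda>a h. T (ce a h)) a h b l"
  using Elin_te[OF T, of "te_prod [(a, h)] [(b, l)]"]
  unfolding E_mult te_prod_eval[OF W Elin_klin2[OF T]] by simp

lemma Elin_gam_j:
  assumes W: "vector_space sW" and T: "Elin sW T"
  shows "T (\<gamma> h \<otimes>\<^bsub>E\<^esub> j a) = Sw h (\<lambda>x y. T (j (act x a) \<otimes>\<^bsub>E\<^esub> \<gamma> y))"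
  unfolding j_gam unfolding gam_ce j_ce Elin_mult[OF assms] pr_one_right[OF W Elin_klin2[OF T]] by simp

lemma Elin_gam_ce:
  assumes W: "vector_space sW" and T: "Elin sW T"
  shows "T (\<gamma> h \<otimes>\<^bsub>E\<^esub> ce b l)
    = Sw h (\<lambda>h1 w. Sw w (\<lambda>h2 h3. Sw l (\<lambda>l1 l2. T (j (act h1 b * f h2 l1) \<otimes>\<^bsub>E\<^esub> \<gamma> (h3 * l2)))))"
  unfolding j_gam unfolding gam_ce Elin_mult[OF assms] pr_def by simp

text \<open>The general product formula contains a further factor \<open>h1 . 1\<close>, which f
  absorbs.\<close>

lemma Elin_gam_gam:
  assumes W: "vector_space sW" and T: "Elin sW T"
  shows "T (\<gamma> h \<otimes>\<^bsub>E\<^esub> \<gamma> l) = Sw h (\<lambda>h1 h2. Sw l (\<lambda>l1 l2. T (j (f h1 l1) \<otimes>\<^bsub>E\<^esub> \<gamma> (h2 * l2))))"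
proof -
  note lT = lin linW[OF W] klin2_comp[OF Elin_klin2[OF T]]
  have "T (\<gamma> h \<otimes>\<^bsub>E\<^esub> \<gamma> l) = Sw h (\<lambda>h1 w. Sw w (\<lambda>h2 h3. Sw l (\<lambda>l1 l2. T (ce (act h1 1 * f h2 l1) (h3 * l2)))))"
    unfolding gam_ce[of l] Elin_gam_ce[OF assms] j_gam ..
  also have "\<dots> = Sw h (\<lambda>p h3. Sw p (\<lambda>h1 h2. Sw l (\<lambda>l1 l2. T (ce (act h1 1 * f h2 l1) (h3 * l2)))))"
    by (rule Sw_coassoc[symmetric, where sW=sW]) (intro lT)
  also have "\<dots> = Sw h (\<lambda>p h3. Sw l (\<lambda>l1 l2. Sw p (\<lambda>h1 h2. T (ce (act h1 1 * f h2 l1) (h3 * l2)))))"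
    by (rule Sw_cong, rule Sw_swap)
  also have "\<dots> = Sw h (\<lambda>h1 h2. Sw l (\<lambda>l1 l2. T (ce (f h1 l1) (h2 * l2))))"
    unfolding B_Sw[OF W Elin_klin2[OF T], symmetric] act_f_absorb ..
  finally show ?thesis unfolding j_gam .
qed

lemma Elin_gam:
  assumes T: "Elin sW T"
  shows "klin sH sW (\<lambda>h. T (\<gamma> h))" "klin sA sW (\<lambda>a. T (j a))" "Sw h (\<lambda>x y. T (j (act x 1) \<otimes>\<^bsub>E\<^esub> \<gamma> y)) = T (\<gamma> h)"
proof -
  show "klin sH sW (\<lambda>h. T (\<gamma> h))" "klin sA sW (\<lambda>a. T (j a))"
    unfolding gam_ce j_ce using klin2D[OF Elin_klin2[OF T]] by auto
  show "Sw h (\<lambda>x y. T (j (act x 1) \<otimes>\<^bsub>E\<^esub> \<gamma> y)) = T (\<gamma> h)"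
    unfolding j_gam using Elin_bx[OF T, of 1 h] by (simp add: bx_def gam_ce)
qed

end

section \<open>The Hochschild differential of a bimodule over a ring extension\<close>

locale ring_bimodule =
  fixes E :: "('k::field, 'e, 'z) module_scheme" (structure) and K :: "'e set"
    and sM :: "'k \<Rightarrow> 'm::ab_group_add \<Rightarrow> 'm" and lm :: "'e \<Rightarrow> 'm \<Rightarrow> 'm" and rm :: "'m \<Rightarrow> 'e \<Rightarrow> 'm"
  assumes add_closed: "x \<in> carrier E \<Longrightarrow> y \<in> carrier E \<Longrightarrow> x \<oplus> y \<in> carrier E"
    and mult_closed: "x \<in> carrier E \<Longrightarrow> y \<in> carrier E \<Longrightarrow> x \<otimes> y \<in> carrier E"
    and distrib_right: "x \<in> carrier E \<Longrightarrow> y \<in> carrier E \<Longrightarrow> z \<in> carrier E \<Longrightarrow> (x \<oplus> y) \<otimes> z = x \<otimes> z \<oplus> y \<otimes> z"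
    and distrib_left: "x \<in> carrier E \<Longrightarrow> y \<in> carrier E \<Longrightarrow> z \<in> carrier E \<Longrightarrow> z \<otimes> (x \<oplus> y) = z \<otimes> x \<oplus> z \<otimes> y"
    and assoc: "x \<in> carrier E \<Longrightarrow> y \<in> carrier E \<Longrightarrow> z \<in> carrier E \<Longrightarrow> (x \<otimes> y) \<otimes> z = x \<otimes> (y \<otimes> z)"
    and K_sub: "K \<subseteq> carrier E"
    and bim: "bimodule E sM lm rm"
begin

lemma K_in: "c \<in> K \<Longrightarrow> c \<in> carrier E"
  using K_sub by blast

lemma vsM: "vector_space sM"
  and lm_lin: "x \<in> carrier E \<Longrightarrow> klin sM sM (lm x)"
  and rm_lin: "x \<in> carrier E \<Longrightarrow> klin sM sM (\<lambda>m. rm m x)"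
  and lm_add: "x \<in> carrier E \<Longrightarrow> y \<in> carrier E \<Longrightarrow> lm (x \<oplus> y) m = lm x m + lm y m"
  and rm_add: "x \<in> carrier E \<Longrightarrow> y \<in> carrier E \<Longrightarrow> rm m (x \<oplus> y) = rm m x + rm m y"
  and lm_mult: "x \<in> carrier E \<Longrightarrow> y \<in> carrier E \<Longrightarrow> lm (x \<otimes> y) m = lm x (lm y m)"
  and rm_mult: "x \<in> carrier E \<Longrightarrow> y \<in> carrier E \<Longrightarrow> rm m (x \<otimes> y) = rm (rm m x) y"
  and lm_rm: "x \<in> carrier E \<Longrightarrow> y \<in> carrier E \<Longrightarrow> rm (lm x m) y = lm x (rm m y)"
  and lm_smult: "x \<in> carrier E \<Longrightarrow> lm (c \<odot> x) m = sM c (lm x m)"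
  and rm_smult: "x \<in> carrier E \<Longrightarrow> rm m (c \<odot> x) = sM c (rm m x)"
  and lm_one: "lm \<one> m = m" and rm_one: "rm m \<one> = m"
  using bim by (auto simp: bimodule_def klin_linear)

text \<open>The Hochschild differential without its first summand.\<close>

fun tau :: "('e list \<Rightarrow> 'm) \<Rightarrow> 'e list \<Rightarrow> 'm" where
  "tau \<phi> [] = 0"
| "tau \<phi> [x] = - rm (\<phi> []) x"
| "tau \<phi> (x # y # ys) = - \<phi> (x \<otimes> y # ys) - tau (\<lambda>zs. \<phi> (x # zs)) (y # ys)"

lemma sM_minus: "sM (- c) m = - sM c m"
  using klin_minus(1)[OF klin_scale_left[OF vsM klin_id]] .

text \<open>\<open>tau\<close> recurses on the first argument. A further argument in front shifts
  the position of every later product by one, which accounts for the sign in its last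
  equation.\<close>

lemma hochschild_diff_tau:
  assumes "length xs = Suc n" "set xs \<subseteq> carrier E"
  shows "hochschild_diff E sM lm rm n \<phi> xs = lm (hd xs) (\<phi> (tl xs)) + tau \<phi> xs"
proof -
  interpret vector_space sM by (rule vsM)
  have "(\<Sum>i<n. sM ((-1) ^ Suc i) (\<phi> (take i xs @ [xs ! i \<otimes> xs ! Suc i] @ drop (Suc (Suc i)) xs)))
      + sM ((-1) ^ Suc n) (rm (\<phi> (butlast xs)) (last xs)) = tau \<phi> xs"
    using assms(1)
  proof (induction \<phi> xs arbitrary: n rule: tau.induct)
    case (3 \<phi> x y ys)
    then obtain n' where n': "n = Suc n'" "length (y # ys) = Suc n'" by auto
    note IH = "3.IH"[OF n'(2)]
    have "(\<Sum>i<n. sM ((-1) ^ Suc i) (\<phi> (take i (x # y # ys) @ [(x # y # ys) ! i \<otimes> (x # y # ys) ! Suc i] @ drop (Suc (Suc i)) (x # y # ys))))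
      = - \<phi> (x \<otimes> y # ys) - (\<Sum>i<n'. sM ((-1) ^ Suc i) (\<phi> (x # take i (y # ys) @ [(y # ys) ! i \<otimes> (y # ys) ! Suc i] @ drop (Suc (Suc i)) (y # ys))))"
      unfolding n'(1) sum.lessThan_Suc_shift by (simp add: sum_negf)
    then show ?case using IH n' by (simp add: algebra_simps)
  qed auto
  then show ?thesis using assms unfolding hochschild_diff_def by (simp add: algebra_simps)
qed

lemma tau_cong:
  assumes "\<And>zs. Suc (length zs) = length xs \<Longrightarrow> set zs \<subseteq> carrier E \<Longrightarrow> \<phi> zs = \<psi> zs" "set xs \<subseteq> carrier E"
  shows "tau \<phi> xs = tau \<psi> xs"
  using assms
proof (induction \<phi> xs arbitrary: \<psi> rule: tau.induct)
  case (3 \<phi> x y ys)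
  have "tau (\<lambda>zs. \<phi> (x # zs)) (y # ys) = tau (\<lambda>zs. \<psi> (x # zs)) (y # ys)"
    by (rule "3.IH") (use "3.prems" in auto)
  moreover have "\<phi> (x \<otimes> y # ys) = \<psi> (x \<otimes> y # ys)"
    using "3.prems" by (auto simp: mult_closed)
  ultimately show ?case by simp
qed auto

lemma tau_klin:
  assumes F: "klin sM sM F" and R: "\<And>x m. x \<in> carrier E \<Longrightarrow> F (rm m x) = rm (F m) x"
    and xs: "set xs \<subseteq> carrier E"
  shows "tau (\<lambda>zs. F (\<phi> zs)) xs = F (tau \<phi> xs)"
  using xs by (induction \<phi> xs rule: tau.induct) (simp_all add: klin_minus[OF F] klin_zero[OF F] R)

lemma tau_add:
  assumes "set xs \<subseteq> carrier E"
  shows "tau (\<lambda>zs. \<phi> zs + \<psi> zs) xs = tau \<phi> xs + tau \<psi> xs"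
  using assms by (induction \<phi> xs arbitrary: \<psi> rule: tau.induct) (simp_all add: klin_add[OF rm_lin])

lemma tau_zero:
  assumes "set xs \<subseteq> carrier E"
  shows "tau (\<lambda>zs. 0) xs = 0"
  using tau_add[OF assms, of "\<lambda>_. 0" "\<lambda>_. 0"] by simp

lemma tau_minus:
  assumes "set xs \<subseteq> carrier E"
  shows "tau (\<lambda>zs. - \<phi> zs) xs = - tau \<phi> xs"
  using tau_add[OF assms, of \<phi> "\<lambda>zs. - \<phi> zs"] tau_zero[OF assms] by (simp add: eq_neg_iff_add_eq_0 add.commute)

lemma tau_sum_list:
  assumes "set xs \<subseteq> carrier E"
  shows "tau (\<lambda>zs. \<Sum>p\<leftarrow>L. \<phi> p zs) xs = (\<Sum>p\<leftarrow>L. tau (\<phi> p) xs)"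
  by (induction L) (simp_all add: tau_zero[OF assms] tau_add[OF assms])

text \<open>The left action on M enters only the first summand of the Hochschild differential, so
  the remainder squares to zero by itself. This allows another first summand in the
  bicomplex.\<close>

lemma tau_tau:
  assumes "set xs \<subseteq> carrier E" "length xs \<ge> 2"
  shows "tau (tau \<phi>) xs = 0"
  using assms
proof (induction xs arbitrary: \<phi>)
  case (Cons x xs')
  then obtain y zs where xs': "xs' = y # zs" by (cases xs') auto
  show ?case
  proof (cases zs)
    case Nil
    then show ?thesis using Cons.prems by (simp add: xs' rm_mult klin_minus[OF rm_lin])
  next
    case (Cons z zs')
    \<comment> \<open>\<open>\<psi>\<close> is \<open>\<phi>\<close> with x multiplied into the
      first entry. After the induction hypothesis only two terms remain, and associativity
      identifies them.\<close>
    define \<psi> where "\<psi> w = \<phi> (x \<otimes> hd w # tl w)" for w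
    have sub: "set (y # z # zs') \<subseteq> carrier E" "x \<in> carrier E" using Cons.prems xs' Cons by auto
    have IH: "tau (tau (\<lambda>w. \<phi> (x # w))) (y # z # zs') = 0"
      using Cons.IH[of "\<lambda>w. \<phi> (x # w)"] Cons.prems xs' Cons by simp
    have "tau (\<lambda>w. tau \<phi> (x # w)) (y # z # zs') = tau (\<lambda>w. - \<psi> w + - tau (\<lambda>v. \<phi> (x # v)) w) (y # z # zs')"
    proof (rule tau_cong[OF _ sub(1)])
      fix w :: "'e list" assume "Suc (length w) = length (y # z # zs')"
      then obtain w1 ws where "w = w1 # ws" by (cases w) auto
      then show "tau \<phi> (x # w) = - \<psi> w + - tau (\<lambda>v. \<phi> (x # v)) w" by (simp add: \<psi>_def)
    qed
    also have "\<dots> = - tau \<psi> (y # z # zs')"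
      unfolding tau_add[OF sub(1)] tau_minus[OF sub(1)] IH by simp
    finally have 1: "tau (\<lambda>w. tau \<phi> (x # w)) (y # z # zs') = - tau \<psi> (y # z # zs')" .
    have "tau (tau \<phi>) (x # y # z # zs') = - tau \<phi> (x \<otimes> y # z # zs') + tau \<psi> (y # z # zs')"
      by (subst tau.simps(3)) (simp only: 1 minus_minus diff_conv_add_uminus)
    also have "\<dots> = 0" using sub by (simp add: \<psi>_def assoc)
    finally show ?thesis using xs' Cons by simp
  qed
qed simp

text \<open>The conditions on Hochschild cochains that do not involve the left action on \<open>M\<close>.\<close>

definition RC :: "nat \<Rightarrow> ('e list \<Rightarrow> 'm) \<Rightarrow> bool" where
  "RC n \<phi> \<longleftrightarrow>
     (\<forall>us x y vs. Suc (length us + length vs) = n \<longrightarrow> set (us @ [x, y] @ vs) \<subseteq> carrier E \<longrightarrow>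
          \<phi> (us @ [x \<oplus> y] @ vs) = \<phi> (us @ [x] @ vs) + \<phi> (us @ [y] @ vs))
     \<and> (\<forall>us x c y vs. Suc (Suc (length us + length vs)) = n \<longrightarrow> c \<in> K \<longrightarrow>
          set (us @ [x, y] @ vs) \<subseteq> carrier E \<longrightarrow>
          \<phi> (us @ [x \<otimes> c, y] @ vs) = \<phi> (us @ [x, c \<otimes> y] @ vs))
     \<and> (\<forall>c x xs. Suc (length xs) = n \<longrightarrow> c \<in> K \<longrightarrow> set (xs @ [x]) \<subseteq> carrier E \<longrightarrow>
          \<phi> (xs @ [x \<otimes> c]) = rm (\<phi> (xs @ [x])) c)
     \<and> (\<forall>xs. length xs = n \<longrightarrow> set xs \<subseteq> carrier E \<longrightarrow> set xs \<inter> K \<noteq> {} \<longrightarrow> \<phi> xs = 0)"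

lemma RC_add: "RC n \<phi> \<Longrightarrow> Suc (length us + length vs) = n \<Longrightarrow> set us \<subseteq> carrier E \<Longrightarrow> set vs \<subseteq> carrier E
    \<Longrightarrow> x \<in> carrier E \<Longrightarrow> y \<in> carrier E \<Longrightarrow> \<phi> (us @ (x \<oplus> y) # vs) = \<phi> (us @ x # vs) + \<phi> (us @ y # vs)"
  and RC_bal: "RC n \<phi> \<Longrightarrow> Suc (Suc (length us + length vs)) = n \<Longrightarrow> c \<in> K \<Longrightarrow> set us \<subseteq> carrier E \<Longrightarrow> set vs \<subseteq> carrier E
    \<Longrightarrow> x \<in> carrier E \<Longrightarrow> y \<in> carrier E \<Longrightarrow> \<phi> (us @ (x \<otimes> c) # y # vs) = \<phi> (us @ x # (c \<otimes> y) # vs)"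
  and RC_right: "RC n \<phi> \<Longrightarrow> Suc (length xs) = n \<Longrightarrow> c \<in> K \<Longrightarrow> set xs \<subseteq> carrier E \<Longrightarrow> x \<in> carrier E
    \<Longrightarrow> \<phi> (xs @ [x \<otimes> c]) = rm (\<phi> (xs @ [x])) c"
  and RC_norm: "RC n \<phi> \<Longrightarrow> Suc (length us + length vs) = n \<Longrightarrow> set us \<subseteq> carrier E \<Longrightarrow> set vs \<subseteq> carrier E
    \<Longrightarrow> c \<in> K \<Longrightarrow> \<phi> (us @ c # vs) = 0"
proof -
  assume r: "RC n \<phi>"
  show "Suc (length us + length vs) = n \<Longrightarrow> set us \<subseteq> carrier E \<Longrightarrow> set vs \<subseteq> carrier E
    \<Longrightarrow> x \<in> carrier E \<Longrightarrow> y \<in> carrier E \<Longrightarrow> \<phi> (us @ (x \<oplus> y) # vs) = \<phi> (us @ x # vs) + \<phi> (us @ y # vs)"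
    using r[unfolded RC_def, THEN conjunct1, rule_format, of us vs x y] by simp
  show "Suc (Suc (length us + length vs)) = n \<Longrightarrow> c \<in> K \<Longrightarrow> set us \<subseteq> carrier E \<Longrightarrow> set vs \<subseteq> carrier E
    \<Longrightarrow> x \<in> carrier E \<Longrightarrow> y \<in> carrier E \<Longrightarrow> \<phi> (us @ (x \<otimes> c) # y # vs) = \<phi> (us @ x # (c \<otimes> y) # vs)"
    using r[unfolded RC_def, THEN conjunct2, THEN conjunct1, rule_format, of us vs c x y] by simp
  show "Suc (length xs) = n \<Longrightarrow> c \<in> K \<Longrightarrow> set xs \<subseteq> carrier E \<Longrightarrow> x \<in> carrier E
    \<Longrightarrow> \<phi> (xs @ [x \<otimes> c]) = rm (\<phi> (xs @ [x])) c"
    using r[unfolded RC_def, THEN conjunct2, THEN conjunct2, THEN conjunct1, rule_format, of xs c x] by simp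
  show "Suc (length us + length vs) = n \<Longrightarrow> set us \<subseteq> carrier E \<Longrightarrow> set vs \<subseteq> carrier E
    \<Longrightarrow> c \<in> K \<Longrightarrow> \<phi> (us @ c # vs) = 0"
    using r[unfolded RC_def, THEN conjunct2, THEN conjunct2, THEN conjunct2, rule_format, of "us @ c # vs"] K_in by auto
qed

lemma RC_Cons:
  assumes "RC (Suc n) \<phi>" "u \<in> carrier E"
  shows "RC n (\<lambda>zs. \<phi> (u # zs))"
proof -
  note r = assms(1)
  show ?thesis unfolding RC_def
  proof (intro conjI allI impI)
    fix us vs x y assume "Suc (length us + length vs) = n" "set (us @ [x, y] @ vs) \<subseteq> carrier E"
    then show "\<phi> (u # us @ [x \<oplus> y] @ vs) = \<phi> (u # us @ [x] @ vs) + \<phi> (u # us @ [y] @ vs)"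
      using RC_add[OF r, of "u # us" vs x y] assms(2) by simp
  next
    fix us x c y vs assume "Suc (Suc (length us + length vs)) = n" "c \<in> K" "set (us @ [x, y] @ vs) \<subseteq> carrier E"
    then show "\<phi> (u # us @ [x \<otimes> c, y] @ vs) = \<phi> (u # us @ [x, c \<otimes> y] @ vs)"
      using RC_bal[OF r, of "u # us" vs c x y] assms(2) by simp
  next
    fix c x xs assume "Suc (length xs) = n" "c \<in> K" "set (xs @ [x]) \<subseteq> carrier E"
    then show "\<phi> (u # xs @ [x \<otimes> c]) = rm (\<phi> (u # xs @ [x])) c"
      using RC_right[OF r, of "u # xs" c x] assms(2) by simp
  next
    fix xs assume xs: "length xs = n" "set xs \<subseteq> carrier E" "set xs \<inter> K \<noteq> {}"
    then obtain c us vs where "c \<in> K" "xs = us @ c # vs" by (auto simp: disjoint_iff in_set_conv_decomp)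
    then show "\<phi> (u # xs) = 0" using RC_norm[OF r, of "u # us" vs c] xs assms(2) by auto
  qed
qed

section \<open>The remainder respects the cochain conditions\<close>

lemma tau_slot_add:
  assumes "RC n \<phi>" "length us + length vs = n" "set us \<subseteq> carrier E" "set vs \<subseteq> carrier E" "x \<in> carrier E" "y \<in> carrier E"
  shows "tau \<phi> (us @ (x \<oplus> y) # vs) = tau \<phi> (us @ x # vs) + tau \<phi> (us @ y # vs)"
  using assms
proof (induction us arbitrary: \<phi> n)
  case Nil
  show ?case
  proof (cases vs)
    case Nil
    then show ?thesis using Nil.prems by (simp add: rm_add)
  next
    case (Cons v vs')
    have sub: "set (v # vs') \<subseteq> carrier E" using Nil.prems Cons by simp
    have "tau (\<lambda>zs. \<phi> ((x \<oplus> y) # zs)) (v # vs') = tau (\<lambda>zs. \<phi> (x # zs) + \<phi> (y # zs)) (v # vs')"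
      using Nil.prems Cons RC_add[OF Nil.prems(1), of "[]"] by (intro tau_cong[OF _ sub]) auto
    moreover have "\<phi> ((x \<oplus> y) \<otimes> v # vs') = \<phi> (x \<otimes> v # vs') + \<phi> (y \<otimes> v # vs')"
      using RC_add[OF Nil.prems(1), of "[]" vs' "x \<otimes> v" "y \<otimes> v"] Nil.prems Cons by (simp add: distrib_right mult_closed)
    ultimately show ?thesis using Cons by (simp add: tau_add[OF sub])
  qed
next
  case (Cons u us)
  obtain n' where n': "n = Suc n'" using Cons.prems by auto
  have r: "RC n' (\<lambda>zs. \<phi> (u # zs))" using RC_Cons Cons.prems n' by simp
  have IH: "tau (\<lambda>zs. \<phi> (u # zs)) (us @ (x \<oplus> y) # vs) = tau (\<lambda>zs. \<phi> (u # zs)) (us @ x # vs) + tau (\<lambda>zs. \<phi> (u # zs)) (us @ y # vs)"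
    using Cons.IH[OF r] Cons.prems n' by simp
  show ?case
  proof (cases us)
    case Nil
    then show ?thesis using IH RC_add[OF Cons.prems(1), of "[]" vs "u \<otimes> x" "u \<otimes> y"] Cons.prems
      by (simp add: distrib_left mult_closed)
  next
    case (Cons u' us')
    then show ?thesis using IH RC_add[OF Cons.prems(1), of "u \<otimes> u' # us'" vs x y] Cons.prems
      by (simp add: mult_closed)
  qed
qed

lemma tau_slot_bal:
  assumes "RC n \<phi>" "Suc (length us + length vs) = n" "c \<in> K" "set us \<subseteq> carrier E" "set vs \<subseteq> carrier E" "x \<in> carrier E" "y \<in> carrier E"
  shows "tau \<phi> (us @ (x \<otimes> c) # y # vs) = tau \<phi> (us @ x # (c \<otimes> y) # vs)"
  using assms
proof (induction us arbitrary: \<phi> n)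
  case Nil
  have cE: "c \<in> carrier E" using Nil.prems K_in by blast
  show ?case
  proof (cases vs)
    case Nil
    then show ?thesis using Nil.prems cE RC_right[OF Nil.prems(1), of "[]" c x] by (simp add: rm_mult assoc)
  next
    case (Cons v vs')
    have sub: "set (v # vs') \<subseteq> carrier E" using Nil.prems Cons by simp
    have "tau (\<lambda>zs. \<phi> (x \<otimes> c # y # zs)) (v # vs') = tau (\<lambda>zs. \<phi> (x # c \<otimes> y # zs)) (v # vs')"
      using Nil.prems Cons RC_bal[OF Nil.prems(1), of "[]"] by (intro tau_cong[OF _ sub]) auto
    moreover have "\<phi> (x \<otimes> c # y \<otimes> v # vs') = \<phi> (x # c \<otimes> (y \<otimes> v) # vs')"
      using RC_bal[OF Nil.prems(1), of "[]" vs' c x "y \<otimes> v"] Nil.prems Cons by (simp add: mult_closed)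
    ultimately show ?thesis using Cons Nil.prems cE by (simp add: assoc)
  qed
next
  case (Cons u us)
  have cE: "c \<in> carrier E" using Cons.prems K_in by blast
  obtain n' where n': "n = Suc n'" using Cons.prems by auto
  have r: "RC n' (\<lambda>zs. \<phi> (u # zs))" using RC_Cons Cons.prems n' by simp
  have IH: "tau (\<lambda>zs. \<phi> (u # zs)) (us @ (x \<otimes> c) # y # vs) = tau (\<lambda>zs. \<phi> (u # zs)) (us @ x # (c \<otimes> y) # vs)"
    using Cons.IH[OF r] Cons.prems n' by simp
  show ?case
  proof (cases us)
    case Nil
    then show ?thesis using IH RC_bal[OF Cons.prems(1), of "[]" vs c "u \<otimes> x" y] Cons.prems cE
      by (simp add: mult_closed assoc[symmetric])
  next
    case (Cons u' us')
    then show ?thesis using IH RC_bal[OF Cons.prems(1), of "u \<otimes> u' # us'" vs c x y] Cons.prems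
      by (simp add: mult_closed)
  qed
qed

lemma tau_slot_right:
  assumes "RC n \<phi>" "length us = n" "c \<in> K" "set us \<subseteq> carrier E" "x \<in> carrier E"
  shows "tau \<phi> (us @ [x \<otimes> c]) = rm (tau \<phi> (us @ [x])) c"
  using assms
proof (induction us arbitrary: \<phi> n)
  case Nil
  then show ?case using K_in by (simp add: rm_mult klin_minus[OF rm_lin])
next
  case (Cons u us)
  have cE: "c \<in> carrier E" using Cons.prems K_in by blast
  obtain n' where n': "n = Suc n'" using Cons.prems by auto
  have r: "RC n' (\<lambda>zs. \<phi> (u # zs))" using RC_Cons Cons.prems n' by simp
  have IH: "tau (\<lambda>zs. \<phi> (u # zs)) (us @ [x \<otimes> c]) = rm (tau (\<lambda>zs. \<phi> (u # zs)) (us @ [x])) c"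
    using Cons.IH[OF r] Cons.prems n' by simp
  show ?case
  proof (cases us)
    case Nil
    then show ?thesis using IH RC_right[OF Cons.prems(1), of "[]" c "u \<otimes> x"] Cons.prems cE
      by (simp add: mult_closed assoc[symmetric] klin_minus[OF rm_lin])
  next
    case (Cons u' us')
    then show ?thesis using IH RC_right[OF Cons.prems(1), of "u \<otimes> u' # us'" c x] Cons.prems cE
      by (simp add: mult_closed klin_minus[OF rm_lin])
  qed
qed

text \<open>An entry of K behind the first position survives only in the two products with its
  neighbours. They cancel because cochains are K-balanced; at the last position right K-linearity
  takes the place of balancedness.\<close>

lemma tau_slot_norm:
  assumes "RC n \<phi>" "Suc (length us + length vs) = n" "c \<in> K" "set us \<subseteq> carrier E" "set vs \<subseteq> carrier E" "u \<in> carrier E"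
  shows "tau \<phi> (u # us @ c # vs) = 0"
  using assms
proof (induction us arbitrary: \<phi> n u)
  case Nil
  have cE: "c \<in> carrier E" using Nil.prems K_in by blast
  show ?case
  proof (cases vs)
    case Nil
    then show ?thesis using Nil.prems RC_right[OF Nil.prems(1), of "[]" c u] by simp
  next
    case (Cons v vs')
    have sub: "set (v # vs') \<subseteq> carrier E" using Nil.prems Cons by simp
    have "tau (\<lambda>zs. \<phi> (u # c # zs)) (v # vs') = tau (\<lambda>zs. 0) (v # vs')"
      using Nil.prems Cons RC_norm[OF Nil.prems(1), of "[u]"] by (intro tau_cong[OF _ sub]) auto
    then show ?thesis
      using Cons Nil.prems RC_bal[OF Nil.prems(1), of "[]" vs' c u v] by (simp add: tau_zero[OF sub])
  qed
next
  case (Cons u' us')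
  obtain n' where n': "n = Suc n'" using Cons.prems by auto
  have r: "RC n' (\<lambda>zs. \<phi> (u # zs))" using RC_Cons Cons.prems n' by simp
  have "tau (\<lambda>zs. \<phi> (u # zs)) (u' # us' @ c # vs) = 0"
    using Cons.IH[OF r] Cons.prems n' by simp
  then show ?case using RC_norm[OF Cons.prems(1), of "u \<otimes> u' # us'" vs c] Cons.prems by (simp add: mult_closed)
qed

section \<open>Cochains and differentials with a variable first summand\<close>

abbreviation "HC \<equiv> hochschild_cochains E K lm rm"

lemma HC_iff: "\<phi> \<in> HC n \<longleftrightarrow> (\<forall>xs. \<not> (length xs = n \<and> set xs \<subseteq> carrier E) \<longrightarrow> \<phi> xs = 0) \<and> RC n \<phi>
    \<and> (\<forall>c x xs. Suc (length xs) = n \<longrightarrow> c \<in> K \<longrightarrow> set (x # xs) \<subseteq> carrier E \<longrightarrow> \<phi> ((c \<otimes> x) # xs) = lm c (\<phi> (x # xs)))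
    \<and> (n = 0 \<longrightarrow> \<phi> [] \<in> centralizer K lm rm)"
  unfolding hochschild_cochains_def RC_def by (simp only: mem_Collect_eq conj_ac)

lemma HC_zero: "\<phi> \<in> HC n \<Longrightarrow> \<not> (length xs = n \<and> set xs \<subseteq> carrier E) \<Longrightarrow> \<phi> xs = 0"
  and HC_RC: "\<phi> \<in> HC n \<Longrightarrow> RC n \<phi>"
  and HC_left: "\<phi> \<in> HC n \<Longrightarrow> Suc (length xs) = n \<Longrightarrow> c \<in> K \<Longrightarrow> x \<in> carrier E \<Longrightarrow> set xs \<subseteq> carrier E
      \<Longrightarrow> \<phi> ((c \<otimes> x) # xs) = lm c (\<phi> (x # xs))"
  and HC_cent: "\<phi> \<in> HC 0 \<Longrightarrow> c \<in> K \<Longrightarrow> lm c (\<phi> []) = rm (\<phi> []) c"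
proof -
  assume \<phi>: "\<phi> \<in> HC n"
  show "\<not> (length xs = n \<and> set xs \<subseteq> carrier E) \<Longrightarrow> \<phi> xs = 0" "RC n \<phi>"
    using \<phi> unfolding HC_iff by blast+
  have "\<forall>c x xs. Suc (length xs) = n \<longrightarrow> c \<in> K \<longrightarrow> set (x # xs) \<subseteq> carrier E \<longrightarrow> \<phi> ((c \<otimes> x) # xs) = lm c (\<phi> (x # xs))"
    using \<phi> unfolding HC_iff by blast
  then show "Suc (length xs) = n \<Longrightarrow> c \<in> K \<Longrightarrow> x \<in> carrier E \<Longrightarrow> set xs \<subseteq> carrier E \<Longrightarrow> \<phi> ((c \<otimes> x) # xs) = lm c (\<phi> (x # xs))"
    by simp
next
  show "\<phi> \<in> HC 0 \<Longrightarrow> c \<in> K \<Longrightarrow> lm c (\<phi> []) = rm (\<phi> []) c"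
    unfolding HC_iff centralizer_def by blast
qed

definition diff_with :: "nat \<Rightarrow> ('e \<Rightarrow> 'e list \<Rightarrow> 'm) \<Rightarrow> ('e list \<Rightarrow> 'm) \<Rightarrow> 'e list \<Rightarrow> 'm" where
  "diff_with n \<Lambda> \<phi> xs = (if length xs = Suc n \<and> set xs \<subseteq> carrier E then \<Lambda> (hd xs) (tl xs) + tau \<phi> xs else 0)"

text \<open>Conditions on the first summand \<Lambda> under which the differential maps cochains to
  cochains. They serve the Hochschild differential, where \<Lambda> is the left action, and the
  horizontal differential of the bicomplex. In degree 0 there is no second argument to take over an
  element of K, so balancedness is replaced by right linearity.\<close>

lemma diff_with_in_HC:
  assumes \<phi>: "\<phi> \<in> HC n"
    and add: "\<And>x y es. x \<in> carrier E \<Longrightarrow> y \<in> carrier E \<Longrightarrow> length es = n \<Longrightarrow> set es \<subseteq> carrier E \<Longrightarrow> \<Lambda> (x \<oplus> y) es = \<Lambda> x es + \<Lambda> y es"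
    and RC: "\<And>x. x \<in> carrier E \<Longrightarrow> RC n (\<Lambda> x)"
    and left: "\<And>c x es. c \<in> K \<Longrightarrow> x \<in> carrier E \<Longrightarrow> length es = n \<Longrightarrow> set es \<subseteq> carrier E \<Longrightarrow> \<Lambda> (c \<otimes> x) es = lm c (\<Lambda> x es)"
    and K: "\<And>c es. c \<in> K \<Longrightarrow> length es = n \<Longrightarrow> set es \<subseteq> carrier E \<Longrightarrow> \<Lambda> c es = lm c (\<phi> es)"
    and bal: "\<And>c x y es. c \<in> K \<Longrightarrow> x \<in> carrier E \<Longrightarrow> y \<in> carrier E \<Longrightarrow> Suc (length es) = n \<Longrightarrow> set es \<subseteq> carrier E
        \<Longrightarrow> \<Lambda> (x \<otimes> c) (y # es) = \<Lambda> x (c \<otimes> y # es)"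
    and bal0: "\<And>c x. n = 0 \<Longrightarrow> c \<in> K \<Longrightarrow> x \<in> carrier E \<Longrightarrow> \<Lambda> (x \<otimes> c) [] = rm (\<Lambda> x []) c"
  shows "diff_with n \<Lambda> \<phi> \<in> HC (Suc n)"
proof -
  note r = HC_RC[OF \<phi>]
  let ?D = "diff_with n \<Lambda> \<phi>"
  have D: "?D (x # es) = \<Lambda> x es + tau \<phi> (x # es)" if "length es = n" "x \<in> carrier E" "set es \<subseteq> carrier E" for x es
    using that by (simp add: diff_with_def)
  show ?thesis unfolding HC_iff RC_def
  proof (intro conjI allI impI)
    fix xs assume "\<not> (length xs = Suc n \<and> set xs \<subseteq> carrier E)"
    then show "?D xs = 0" unfolding diff_with_def by (simp only: if_False)
  next
    fix us x y vs
    assume a: "Suc (length us + length vs) = Suc n" "set (us @ [x, y] @ vs) \<subseteq> carrier E"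
    have t: "tau \<phi> (us @ (x \<oplus> y) # vs) = tau \<phi> (us @ x # vs) + tau \<phi> (us @ y # vs)"
      by (rule tau_slot_add[OF r]) (use a in auto)
    show "?D (us @ [x \<oplus> y] @ vs) = ?D (us @ [x] @ vs) + ?D (us @ [y] @ vs)"
    proof (cases us)
      case Nil
      then show ?thesis using a t add by (simp add: D add_closed)
    next
      case (Cons u us')
      then show ?thesis using a t RC_add[OF RC[of u], of us' vs x y] by (simp add: D add_closed)
    qed
  next
    fix us x c y vs
    assume a: "Suc (Suc (length us + length vs)) = Suc n" "c \<in> K" "set (us @ [x, y] @ vs) \<subseteq> carrier E"
    have cE: "c \<in> carrier E" using a K_in by blast
    have t: "tau \<phi> (us @ (x \<otimes> c) # y # vs) = tau \<phi> (us @ x # (c \<otimes> y) # vs)"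
      by (rule tau_slot_bal[OF r]) (use a in auto)
    show "?D (us @ [x \<otimes> c, y] @ vs) = ?D (us @ [x, c \<otimes> y] @ vs)"
    proof (cases us)
      case Nil
      then show ?thesis using a t bal cE by (simp add: D mult_closed)
    next
      case (Cons u us')
      then show ?thesis using a t cE RC_bal[OF RC[of u], of us' vs c x y] by (simp add: D mult_closed)
    qed
  next
    fix c x xs
    assume a: "Suc (length xs) = Suc n" "c \<in> K" "set (xs @ [x]) \<subseteq> carrier E"
    have cE: "c \<in> carrier E" using a K_in by blast
    have t: "tau \<phi> (xs @ [x \<otimes> c]) = rm (tau \<phi> (xs @ [x])) c"
      by (rule tau_slot_right[OF r]) (use a in auto)
    show "?D (xs @ [x \<otimes> c]) = rm (?D (xs @ [x])) c"
    proof (cases xs)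
      case Nil
      then show ?thesis using a t cE bal0 D[of "[]" "x \<otimes> c"] D[of "[]" x] by (simp add: mult_closed klin_add[OF rm_lin] klin_minus[OF rm_lin])
    next
      case (Cons u us')
      then show ?thesis using a t cE RC_right[OF RC[of u], of us' c x] by (simp add: D mult_closed klin_add[OF rm_lin])
    qed
  next
    fix xs assume a: "length xs = Suc n" "set xs \<subseteq> carrier E" "set xs \<inter> K \<noteq> {}"
    then obtain c us vs where c: "c \<in> K" "xs = us @ c # vs" by (auto simp: disjoint_iff in_set_conv_decomp)
    show "?D xs = 0"
    proof (cases us)
      case Nil
      have s: "c \<in> carrier E" "set vs \<subseteq> carrier E" "length vs = n" using a c Nil by auto
      \<comment> \<open>For an entry of K in front, the first summand cancels against the first
        product by left K-linearity. If there is no further argument, it cancels against the right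
        action, because the value of \<open>\<phi>\<close> centralizes K.\<close>
      have "lm c (\<phi> vs) + tau \<phi> (c # vs) = 0"
      proof (cases vs)
        case Nil
        then show ?thesis using s \<phi> c HC_cent by auto
      next
        case (Cons y ys)
        have "tau (\<lambda>zs. \<phi> (c # zs)) (y # ys) = tau (\<lambda>zs. 0) (y # ys)"
          using s Cons RC_norm[OF r, of "[]"] c by (intro tau_cong) auto
        then show ?thesis using Cons s c HC_left[OF \<phi>, of ys c y] tau_zero[of "y # ys"] by simp
      qed
      then show ?thesis using c Nil K[of c vs] s by (simp add: D)
    next
      case (Cons u us')
      then show ?thesis using a c RC_norm[OF RC[of u], of us' vs c] tau_slot_norm[OF r, of us' vs c u] by (simp add: D)
    qed
  next
    fix c x xs assume a: "Suc (length xs) = Suc n" "c \<in> K" "set (x # xs) \<subseteq> carrier E"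
    have cE: "c \<in> carrier E" using a K_in by blast
    have "tau \<phi> ((c \<otimes> x) # xs) = lm c (tau \<phi> (x # xs))"
    proof (cases xs)
      case Nil
      then show ?thesis using a cE \<phi> HC_cent[of \<phi> c] by (simp add: rm_mult klin_minus[OF lm_lin] lm_rm[symmetric])
    next
      case (Cons y ys)
      have sub: "set (y # ys) \<subseteq> carrier E" using a Cons by auto
      have "tau (\<lambda>zs. \<phi> (c \<otimes> x # zs)) (y # ys) = tau (\<lambda>zs. lm c (\<phi> (x # zs))) (y # ys)"
        using a Cons HC_left[OF \<phi>] by (intro tau_cong[OF _ sub]) auto
      also have "\<dots> = lm c (tau (\<lambda>zs. \<phi> (x # zs)) (y # ys))"
        using cE by (intro tau_klin[OF lm_lin _ sub]) (auto simp: lm_rm)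
      finally show ?thesis using Cons a cE HC_left[OF \<phi>, of ys c "x \<otimes> y"]
        by (simp add: klin_minus[OF lm_lin] assoc mult_closed)
    qed
    then show "?D ((c \<otimes> x) # xs) = lm c (?D (x # xs))"
      using a cE left by (simp add: D mult_closed klin_add[OF lm_lin])
  next
    assume "Suc n = 0" then show "?D [] \<in> centralizer K lm rm" by simp
  qed
qed

end

section \<open>Bicomplexes with exact rows and columns\<close>

definition subsp :: "('k \<Rightarrow> 'v::ab_group_add \<Rightarrow> 'v) \<Rightarrow> 'v set \<Rightarrow> bool" where
  "subsp s A \<longleftrightarrow> 0 \<in> A \<and> (\<forall>x\<in>A. \<forall>y\<in>A. x + y \<in> A) \<and> (\<forall>c. \<forall>x\<in>A. s c x \<in> A)"

definition lin_on :: "('k \<Rightarrow> 'v::ab_group_add \<Rightarrow> 'v) \<Rightarrow> ('k \<Rightarrow> 'w::ab_group_add \<Rightarrow> 'w) \<Rightarrow> 'v set \<Rightarrow> ('v \<Rightarrow> 'w) \<Rightarrow> bool" where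
  "lin_on s s' A F \<longleftrightarrow> (\<forall>x\<in>A. \<forall>y\<in>A. F (x + y) = F x + F y) \<and> (\<forall>c. \<forall>x\<in>A. F (s c x) = s' c (F x))"

lemma subspD: "subsp s A \<Longrightarrow> 0 \<in> A" "subsp s A \<Longrightarrow> x \<in> A \<Longrightarrow> y \<in> A \<Longrightarrow> x + y \<in> A"
  "subsp s A \<Longrightarrow> x \<in> A \<Longrightarrow> s c x \<in> A"
  by (auto simp: subsp_def)

lemma subsp_diff:
  assumes "vector_space s" "subsp s A" "x \<in> A" "y \<in> A"
  shows "- y \<in> A" "x - y \<in> A"
proof -
  interpret vector_space s by (rule assms(1))
  have "s (-1) y \<in> A" using subspD(3)[OF assms(2,4)] .
  then show "- y \<in> A" by simp
  then show "x - y \<in> A" using subspD(2)[OF assms(2,3), of "- y"] by simp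
qed

lemma lin_onD: "lin_on s s' A F \<Longrightarrow> x \<in> A \<Longrightarrow> y \<in> A \<Longrightarrow> F (x + y) = F x + F y"
  "lin_on s s' A F \<Longrightarrow> x \<in> A \<Longrightarrow> F (s c x) = s' c (F x)"
  by (auto simp: lin_on_def)

lemma lin_on_diff:
  assumes "vector_space s" "vector_space s'" "subsp s A" "lin_on s s' A F"
  shows "F 0 = 0" "x \<in> A \<Longrightarrow> F (- x) = - F x" "x \<in> A \<Longrightarrow> y \<in> A \<Longrightarrow> F (x - y) = F x - F y"
proof -
  interpret v: vector_space s by (rule assms(1))
  interpret w: vector_space s' by (rule assms(2))
  show "F 0 = 0" using lin_onD(1)[OF assms(4), of 0 0] subspD(1)[OF assms(3)] by simp
  show m: "x \<in> A \<Longrightarrow> F (- x) = - F x" for x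
    using lin_onD(2)[OF assms(4), of x "-1"] by simp
  show "x \<in> A \<Longrightarrow> y \<in> A \<Longrightarrow> F (x - y) = F x - F y"
    using lin_onD(1)[OF assms(4), of x "- y"] m subsp_diff(1)[OF assms(1,3), of y y] by simp
qed

lemma subsp_coboundaries:
  assumes "vector_space s" "\<And>n. subsp s (C n)" "\<And>n. lin_on s s (C n) (d n)"
  shows "subsp s (coboundaries C d n)"
proof (cases n)
  case 0
  interpret vector_space s by (rule assms(1))
  show ?thesis by (simp add: 0 coboundaries_def subsp_def)
next
  case (Suc i)
  have "0 = d i 0" using lin_on_diff(1)[OF assms(1,1,2,3), of i] by simp
  then have "0 \<in> d i ` C i" using subspD(1)[OF assms(2)] by blast
  moreover have "d i x + d i y \<in> d i ` C i" if "x \<in> C i" "y \<in> C i" for x y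
    using that lin_onD(1)[OF assms(3) that] subspD(2)[OF assms(2) that] by (metis imageI)
  moreover have "s c (d i x) \<in> d i ` C i" if "x \<in> C i" for x c
    using that lin_onD(2)[OF assms(3) that] subspD(3)[OF assms(2) that] by (metis imageI)
  ultimately show ?thesis by (auto simp: Suc coboundaries_def subsp_def)
qed

lemma coset_eq_iff:
  assumes "vector_space s" "subsp s B"
  shows "{x + b | b. b \<in> B} = {y + b | b. b \<in> B} \<longleftrightarrow> x - y \<in> B"
proof
  assume "{x + b | b. b \<in> B} = {y + b | b. b \<in> B}"
  moreover have "x \<in> {x + b | b. b \<in> B}" using subspD(1)[OF assms(2)] by force
  ultimately show "x - y \<in> B" by auto
next
  have *: "{x + b | b. b \<in> B} \<subseteq> {y + b | b. b \<in> B}" if "x - y \<in> B" for x y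
  proof safe
    fix b assume "b \<in> B"
    then have "(x - y) + b \<in> B" using that subspD(2)[OF assms(2)] by blast
    then show "\<exists>b'. x + b = y + b' \<and> b' \<in> B" by (intro exI[of _ "(x - y) + b"]) simp
  qed
  assume a: "x - y \<in> B"
  then have "y - x \<in> B" using subsp_diff(1)[OF assms a a] by simp
  then show "{x + b | b. b \<in> B} = {y + b | b. b \<in> B}" using * a by blast
qed

lemma coset_add_eq:
  assumes "vector_space s" "subsp s B"
  shows "coset_add {x + b | b. b \<in> B} {y + b | b. b \<in> B} = {x + y + b | b. b \<in> B}"
proof (intro Set.set_eqI iffI)
  fix z assume "z \<in> coset_add {x + b | b. b \<in> B} {y + b | b. b \<in> B}"
  then obtain b b' where "b \<in> B" "b' \<in> B" "z = (x + b) + (y + b')" unfolding coset_add_def by auto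
  then show "z \<in> {x + y + b | b. b \<in> B}" using subspD(2)[OF assms(2), of b b']
    by (auto simp: algebra_simps intro!: exI[of _ "b + b'"])
next
  fix z assume "z \<in> {x + y + b | b. b \<in> B}"
  then obtain b where b: "b \<in> B" "z = (x + 0) + (y + b)" by (auto simp: add.assoc)
  then show "z \<in> coset_add {x + b | b. b \<in> B} {y + b | b. b \<in> B}"
    unfolding coset_add_def using subspD(1)[OF assms(2)] by blast
qed

lemma coset_scale_eq:
  assumes "vector_space s" "subsp s B"
  shows "coset_scale s B c {x + b | b. b \<in> B} = {s c x + b | b. b \<in> B}"
proof (intro Set.set_eqI iffI)
  interpret vector_space s by (rule assms(1))
  fix z assume "z \<in> coset_scale s B c {x + b | b. b \<in> B}"
  then obtain b b' where b: "b \<in> B" "b' \<in> B" "z = s c (x + b) + b'" unfolding coset_scale_def by auto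
  then have "s c b + b' \<in> B" using subspD[OF assms(2)] by blast
  then show "z \<in> {s c x + b | b. b \<in> B}" using b by (auto simp: scale_right_distrib add.assoc)
next
  fix z assume "z \<in> {s c x + b | b. b \<in> B}"
  moreover have "x \<in> {x + b | b. b \<in> B}" using subspD(1)[OF assms(2)] by force
  ultimately show "z \<in> coset_scale s B c {x + b | b. b \<in> B}" unfolding coset_scale_def by blast
qed

text \<open>A zigzag through a bicomplex involves choices and gives a relation between cocycles, not
  a map. A linear relation that is total on both sides and matches coboundaries with coboundaries
  induces an isomorphism.\<close>

lemma cohomology_iso_of_relation:
  fixes s :: "'k::field \<Rightarrow> 'v::ab_group_add \<Rightarrow> 'v" and s' :: "'k \<Rightarrow> 'w::ab_group_add \<Rightarrow> 'w"
  assumes v: "vector_space s" "vector_space s'"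
    and B: "subsp s (coboundaries C d n)" "subsp s' (coboundaries C' d' n)"
    and dom: "\<And>y x. R y x \<Longrightarrow> y \<in> cocycles C d n \<and> x \<in> cocycles C' d' n"
    and tot: "\<And>y. y \<in> cocycles C d n \<Longrightarrow> \<exists>x. R y x" and surj: "\<And>x. x \<in> cocycles C' d' n \<Longrightarrow> \<exists>y. R y x"
    and add: "\<And>y x y' x'. R y x \<Longrightarrow> R y' x' \<Longrightarrow> R (y + y') (x + x')"
    and scale: "\<And>y x c. R y x \<Longrightarrow> R (s c y) (s' c x)"
    and bd: "\<And>y x. R y x \<Longrightarrow> y \<in> coboundaries C d n \<longleftrightarrow> x \<in> coboundaries C' d' n"
  shows "cohomology_iso s C d s' C' d' n"
proof -
  interpret v: vector_space s by (rule v)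
  interpret w: vector_space s' by (rule v)
  let ?B = "coboundaries C d n" and ?B' = "coboundaries C' d' n"
  define cs where "cs y = {y + b | b. b \<in> ?B}" for y
  define cs' where "cs' x = {x + b | b. b \<in> ?B'}" for x
  have cs_eq: "cs x = cs y \<longleftrightarrow> x - y \<in> ?B" for x y unfolding cs_def by (rule coset_eq_iff[OF v(1) B(1)])
  have cs'_eq: "cs' x = cs' y \<longleftrightarrow> x - y \<in> ?B'" for x y unfolding cs'_def by (rule coset_eq_iff[OF v(2) B(2)])
  have Rdiff: "R (y - y') (x - x')" if "R y x" "R y' x'" for y x y' x'
    using add[OF that(1) scale[OF that(2), of "-1"]] by simp
  have coh: "cohomology C d n = cs ` cocycles C d n" "cohomology C' d' n = cs' ` cocycles C' d' n"
    unfolding cohomology_def cs_def cs'_def by auto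
  \<comment> \<open>Any partner of any element of the coset will do: for two related pairs the
    difference is again related, so \<open>bd\<close> makes the partners differ by a
    coboundary.\<close>
  define \<Phi> where "\<Phi> X = cs' (SOME x. \<exists>y\<in>X. R y x)" for X
  have self: "y \<in> cs y" for y unfolding cs_def using subspD(1)[OF B(1)] by force
  have \<Phi>: "\<Phi> (cs y) = cs' x" if "R y x" for y x
  proof -
    have "\<exists>x. \<exists>y'\<in>cs y. R y' x" using that self by blast
    then have "\<exists>y'\<in>cs y. R y' (SOME x. \<exists>y'\<in>cs y. R y' x)" by (rule someI_ex)
    then obtain y' where y': "y' \<in> cs y" "R y' (SOME x. \<exists>y'\<in>cs y. R y' x)" by blast
    have "y' - y \<in> ?B" using y'(1) unfolding cs_def by auto
    then show ?thesis unfolding \<Phi>_def cs'_eq using bd[OF Rdiff[OF y'(2) that]] by blast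
  qed
  note cadd = coset_add_eq[OF v(1) B(1), folded cs_def] and cadd' = coset_add_eq[OF v(2) B(2), folded cs'_def]
    and cscale = coset_scale_eq[OF v(1) B(1), folded cs_def] and cscale' = coset_scale_eq[OF v(2) B(2), folded cs'_def]
  show ?thesis unfolding cohomology_iso_def
  proof (intro exI[of _ \<Phi>] conjI ballI allI)
    show "bij_betw \<Phi> (cohomology C d n) (cohomology C' d' n)"
      unfolding bij_betw_def
    proof
      show "inj_on \<Phi> (cohomology C d n)"
      proof (rule inj_onI)
        fix X Y assume XY: "X \<in> cohomology C d n" "Y \<in> cohomology C d n" and eq: "\<Phi> X = \<Phi> Y"
        obtain y x y' x' where y: "X = cs y" "R y x" "Y = cs y'" "R y' x'" using XY coh tot by (metis imageE)
        then have "x - x' \<in> ?B'" using eq \<Phi> cs'_eq by metis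
        then show "X = Y" using bd[OF Rdiff[OF y(2) y(4)]] y cs_eq by blast
      qed
      show "\<Phi> ` cohomology C d n = cohomology C' d' n"
      proof (intro Set.set_eqI iffI)
        fix Z assume "Z \<in> \<Phi> ` cohomology C d n"
        then obtain y where "y \<in> cocycles C d n" "Z = \<Phi> (cs y)" using coh by auto
        then show "Z \<in> cohomology C' d' n" using tot \<Phi> dom coh by (metis imageI)
      next
        fix Z assume "Z \<in> cohomology C' d' n"
        then obtain x y where "Z = cs' x" "R y x" using coh surj by (metis imageE)
        then show "Z \<in> \<Phi> ` cohomology C d n" using \<Phi> dom coh by (metis imageI)
      qed
    qed
  next
    fix X Y assume "X \<in> cohomology C d n" "Y \<in> cohomology C d n"
    then obtain y x y' x' where y: "X = cs y" "R y x" "Y = cs y'" "R y' x'" using coh tot by (metis imageE)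
    show "\<Phi> (coset_add X Y) = coset_add (\<Phi> X) (\<Phi> Y)"
      using \<Phi>[OF add[OF y(2,4)]] \<Phi>[OF y(2)] \<Phi>[OF y(4)] y cadd cadd' by simp
  next
    fix c X assume "X \<in> cohomology C d n"
    then obtain y x where y: "X = cs y" "R y x" using coh tot by (metis imageE)
    show "\<Phi> (coset_scale s ?B c X) = coset_scale s' ?B' c (\<Phi> X)"
      using \<Phi>[OF scale[OF y(2)]] \<Phi>[OF y(2)] y cscale cscale' by simp
  qed
qed

text \<open>An anticommuting first-quadrant bicomplex whose rows are resolutions of the complex \<open>X\<close> and
  whose columns are resolutions of the complex \<open>Y\<close>.\<close>

locale exact_bicomplex =
  fixes sB :: "'k::field \<Rightarrow> 'b::ab_group_add \<Rightarrow> 'b" and B :: "nat \<Rightarrow> nat \<Rightarrow> 'b set"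
    and h v :: "nat \<Rightarrow> nat \<Rightarrow> 'b \<Rightarrow> 'b"
    and sX :: "'k \<Rightarrow> 'x::ab_group_add \<Rightarrow> 'x" and X :: "nat \<Rightarrow> 'x set" and dX :: "nat \<Rightarrow> 'x \<Rightarrow> 'x" and \<eta> :: "nat \<Rightarrow> 'x \<Rightarrow> 'b"
    and sY :: "'k \<Rightarrow> 'y::ab_group_add \<Rightarrow> 'y" and Y :: "nat \<Rightarrow> 'y set" and dY :: "nat \<Rightarrow> 'y \<Rightarrow> 'y" and \<epsilon> :: "nat \<Rightarrow> 'y \<Rightarrow> 'b"
  assumes vB: "vector_space sB" and vX: "vector_space sX" and vY: "vector_space sY"
    and B_sub: "subsp sB (B p q)" and X_sub: "subsp sX (X n)" and Y_sub: "subsp sY (Y n)"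
    and h_lin: "lin_on sB sB (B p q) (h p q)" and v_lin: "lin_on sB sB (B p q) (v p q)"
    and \<eta>_lin: "lin_on sX sB (X n) (\<eta> n)" and \<epsilon>_lin: "lin_on sY sB (Y n) (\<epsilon> n)"
    and dX_lin: "lin_on sX sX (X n) (dX n)" and dY_lin: "lin_on sY sY (Y n) (dY n)"
    and h_in: "b \<in> B p q \<Longrightarrow> h p q b \<in> B (Suc p) q" and v_in: "b \<in> B p q \<Longrightarrow> v p q b \<in> B p (Suc q)"
    and \<eta>_in: "x \<in> X n \<Longrightarrow> \<eta> n x \<in> B 0 n" and \<epsilon>_in: "y \<in> Y n \<Longrightarrow> \<epsilon> n y \<in> B n 0"
    and \<eta>_inj: "\<eta> n x = 0 \<Longrightarrow> x \<in> X n \<Longrightarrow> x = 0"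
    and \<epsilon>_inj: "\<epsilon> n y = 0 \<Longrightarrow> y \<in> Y n \<Longrightarrow> y = 0"
    and dX_in: "x \<in> X n \<Longrightarrow> dX n x \<in> X (Suc n)" and dY_in: "y \<in> Y n \<Longrightarrow> dY n y \<in> Y (Suc n)"
    and h_\<eta>: "x \<in> X n \<Longrightarrow> h 0 n (\<eta> n x) = 0" and v_\<epsilon>: "y \<in> Y n \<Longrightarrow> v n 0 (\<epsilon> n y) = 0"
    and v_\<eta>: "x \<in> X n \<Longrightarrow> v 0 n (\<eta> n x) = \<eta> (Suc n) (dX n x)"
    and h_\<epsilon>: "y \<in> Y n \<Longrightarrow> h n 0 (\<epsilon> n y) = \<epsilon> (Suc n) (dY n y)"
    and hh: "b \<in> B p q \<Longrightarrow> h (Suc p) q (h p q b) = 0" and vv: "b \<in> B p q \<Longrightarrow> v p (Suc q) (v p q b) = 0"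
    and hv: "b \<in> B p q \<Longrightarrow> h p (Suc q) (v p q b) + v (Suc p) q (h p q b) = 0"
    and row0: "b \<in> B 0 q \<Longrightarrow> h 0 q b = 0 \<Longrightarrow> \<exists>x\<in>X q. b = \<eta> q x"
    and row: "b \<in> B (Suc p) q \<Longrightarrow> h (Suc p) q b = 0 \<Longrightarrow> \<exists>b'\<in>B p q. b = h p q b'"
    and col0: "b \<in> B p 0 \<Longrightarrow> v p 0 b = 0 \<Longrightarrow> \<exists>y\<in>Y p. b = \<epsilon> p y"
    and col: "b \<in> B p (Suc q) \<Longrightarrow> v p (Suc q) b = 0 \<Longrightarrow> \<exists>b'\<in>B p q. b = v p q b'"
begin

text \<open>\<open>T n\<close> is the total complex in degree \<open>n - 1\<close>, so that \<open>T 0 = 0\<close>.\<close>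

definition T :: "nat \<Rightarrow> (nat \<Rightarrow> 'b) set" where
  "T n = {t. (\<forall>p<n. t p \<in> B p (n - Suc p)) \<and> (\<forall>p\<ge>n. t p = 0)}"

text \<open>For \<open>t\<close> in \<open>T n\<close>, component p of the result lies in
  \<open>B p (n - p)\<close>. It receives \<open>h\<close> from position (p - 1, n - p) and
  \<open>v\<close> from position (p, n - 1 - p); the guards are the two ends of the
  antidiagonal.\<close>

definition D :: "nat \<Rightarrow> (nat \<Rightarrow> 'b) \<Rightarrow> nat \<Rightarrow> 'b" where
  "D n t p = (if 0 < p \<and> p \<le> n then h (p - 1) (n - p) (t (p - 1)) else 0)
           + (if p < n then v p (n - Suc p) (t p) else 0)"

definition sng :: "nat \<Rightarrow> 'b \<Rightarrow> nat \<Rightarrow> 'b" where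
  "sng m b p = (if p = m then b else 0)"

lemmas B0 = subspD(1)[OF B_sub] and Badd = subspD(2)[OF B_sub] and Bscale = subspD(3)[OF B_sub]
  and Bdiff = subsp_diff[OF vB B_sub]
lemmas h0 = lin_on_diff(1)[OF vB vB B_sub h_lin] and v0 = lin_on_diff(1)[OF vB vB B_sub v_lin]
  and hdiff = lin_on_diff(2,3)[OF vB vB B_sub h_lin] and vdiff = lin_on_diff(2,3)[OF vB vB B_sub v_lin]
  and hadd = lin_onD[OF h_lin] and vadd = lin_onD[OF v_lin]

lemma T_in: "t \<in> T n \<Longrightarrow> p < n \<Longrightarrow> t p \<in> B p (n - Suc p)"
  by (simp add: T_def)

lemma T_in_pred:
  assumes "t \<in> T n" "0 < p \<and> p \<le> n"
  shows "t (p - 1) \<in> B (p - 1) (n - p)"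
proof -
  have "p - 1 < n" using assms(2) by linarith
  then show ?thesis using T_in[OF assms(1), of "p - 1"] assms(2) by simp
qed

lemma D_zero: "D n (\<lambda>_. 0) = (\<lambda>_. 0)"
  by (rule ext) (simp add: D_def h0 v0)

lemma T_D: "t \<in> T n \<Longrightarrow> D n t \<in> T (Suc n)"
proof -
  assume t: "t \<in> T n"
  have "D n t p \<in> B p (n - p)" if "p \<le> n" for p
  proof -
    have 1: "h (p - 1) (n - p) (t (p - 1)) \<in> B p (n - p)" if p: "0 < p \<and> p \<le> n"
      using h_in[OF T_in_pred[OF t p]] p by simp
    have 2: "v p (n - Suc p) (t p) \<in> B p (n - p)" if p: "p < n"
      using v_in[OF T_in[OF t p]] p by (simp add: Suc_diff_Suc)
    have "(if 0 < p \<and> p \<le> n then h (p - 1) (n - p) (t (p - 1)) else 0) \<in> B p (n - p)"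
      by (cases "0 < p \<and> p \<le> n") (simp_all only: 1 B0 if_True if_False simp_thms)
    moreover have "(if p < n then v p (n - Suc p) (t p) else 0) \<in> B p (n - p)"
      using 2 B0 by simp
    ultimately show ?thesis unfolding D_def by (rule Badd)
  qed
  then show ?thesis unfolding T_def by (auto simp: D_def)
qed

lemma D_D:
  assumes "t \<in> T n"
  shows "D (Suc n) (D n t) = (\<lambda>_. 0)"
proof
  fix p
  have tB: "t p \<in> B p (n - Suc p)" if "p < n" for p using assms that by (simp add: T_def)
  \<comment> \<open>The part of \<open>D t\<close> that comes from \<open>h\<close> is killed by
    \<open>h\<close>, so only the part from \<open>v\<close> is left. \<open>vD\<close> is the
    counterpart, and the two leftovers cancel because the squares anticommute.\<close>
  have hD: "h (p - 1) (Suc n - p) (D n t (p - 1)) = h (p - 1) (Suc n - p) (if p - 1 < n then v (p - 1) (n - p) (t (p - 1)) else 0)"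
    if p: "0 < p" "p \<le> Suc n"
  proof (cases "p = 1")
    case True then show ?thesis by (simp add: D_def)
  next
    case False
    then have 1: "t (p - 2) \<in> B (p - 2) (Suc n - p)" using tB[of "p - 2"] p by (simp add: Suc_diff_le numeral_2_eq_2)
    have 2: "h (p - 2) (Suc n - p) (t (p - 2)) \<in> B (p - 1) (Suc n - p)"
      using h_in[OF 1] False p by (simp add: Suc_diff_Suc numeral_2_eq_2)
    have 3: "h (p - 1) (Suc n - p) (h (p - 2) (Suc n - p) (t (p - 2))) = 0"
      using hh[OF 1] False p by (simp add: Suc_diff_Suc numeral_2_eq_2)
    have 4: "(if p - 1 < n then v (p - 1) (n - p) (t (p - 1)) else 0) \<in> B (p - 1) (Suc n - p)"
      using v_in[of "t (p - 1)" "p - 1" "n - p"] tB[of "p - 1"] p by (auto simp: B0 Suc_diff_le)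
    have "D n t (p - 1) = h (p - 2) (Suc n - p) (t (p - 2)) + (if p - 1 < n then v (p - 1) (n - p) (t (p - 1)) else 0)"
      using False p unfolding D_def by (auto simp: numeral_2_eq_2 Suc_diff_Suc Suc_diff_le)
    then show ?thesis using hadd(1)[OF 2 4] 3 by simp
  qed
  have vD: "v p (n - p) (D n t p) = v p (n - p) (if 0 < p then h (p - 1) (n - p) (t (p - 1)) else 0)"
    if p: "p \<le> n"
  proof (cases "p < n")
    case False then show ?thesis using p by (simp add: D_def)
  next
    case True
    have 1: "v p (n - Suc p) (t p) \<in> B p (n - p)" "v p (n - p) (v p (n - Suc p) (t p)) = 0"
      using v_in[OF tB[OF True]] vv[OF tB[OF True]] True by (simp_all add: Suc_diff_Suc)
    have 2: "(if 0 < p then h (p - 1) (n - p) (t (p - 1)) else 0) \<in> B p (n - p)"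
      using h_in[of "t (p - 1)" "p - 1" "n - p"] tB[of "p - 1"] p by (auto simp: B0)
    have "D n t p = (if 0 < p then h (p - 1) (n - p) (t (p - 1)) else 0) + v p (n - Suc p) (t p)"
      using True by (simp add: D_def)
    then show ?thesis using vadd(1)[OF 2 1(1)] 1(2) by simp
  qed
  consider "p = 0" | "0 < p" "p \<le> n" | "p = Suc n" | "p > Suc n" by linarith
  then show "D (Suc n) (D n t) p = 0"
  proof cases
    case 1
    then have "D (Suc n) (D n t) p = v 0 n (D n t 0)" by (simp add: D_def[of "Suc n"])
    then show ?thesis using vD 1 by (simp add: v0)
  next
    case 2
    have e: "D (Suc n) (D n t) p = h (p - 1) (Suc n - p) (D n t (p - 1)) + v p (n - p) (D n t p)"
      using 2 by (simp add: D_def[of "Suc n"])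
    have "D (Suc n) (D n t) p = h (p - 1) (Suc (n - p)) (v (p - 1) (n - p) (t (p - 1))) + v (Suc (p - 1)) (n - p) (h (p - 1) (n - p) (t (p - 1)))"
      unfolding e using hD vD 2 by (auto simp: Suc_diff_le)
    also have "\<dots> = 0" using hv[OF tB[of "p - 1"]] 2 by auto
    finally show ?thesis .
  next
    case 3
    then have "D (Suc n) (D n t) p = h n 0 (D n t n)" by (simp add: D_def[of "Suc n"])
    then show ?thesis using hD 3 by (simp add: h0)
  next
    case 4
    then show ?thesis by (simp add: D_def[of "Suc n"])
  qed
qed

lemma T_sub: "t \<in> T n \<Longrightarrow> t' \<in> T n \<Longrightarrow> t - t' \<in> T n" "t \<in> T n \<Longrightarrow> t' \<in> T n \<Longrightarrow> t + t' \<in> T n"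
  "t \<in> T n \<Longrightarrow> (\<lambda>p. sB c (t p)) \<in> T n" "t \<in> T n \<Longrightarrow> - t \<in> T n" "(\<lambda>_. 0) \<in> T n"
proof -
  interpret vector_space sB by (rule vB)
  show "t \<in> T n \<Longrightarrow> t' \<in> T n \<Longrightarrow> t - t' \<in> T n" "t \<in> T n \<Longrightarrow> t' \<in> T n \<Longrightarrow> t + t' \<in> T n"
    "t \<in> T n \<Longrightarrow> (\<lambda>p. sB c (t p)) \<in> T n" "t \<in> T n \<Longrightarrow> - t \<in> T n" "(\<lambda>_. 0) \<in> T n"
    by (auto simp: T_def Bdiff Badd Bscale B0)
qed

lemma D_lin:
  assumes "t \<in> T n" "t' \<in> T n"
  shows "D n (t - t') = D n t - D n t'" "D n (t + t') = D n t + D n t'" "D n (\<lambda>p. sB c (t p)) = (\<lambda>p. sB c (D n t p))" "D n (- t) = - D n t"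
proof -
  interpret vector_space sB by (rule vB)
  have if_ops: "(P \<Longrightarrow> a = x - y) \<Longrightarrow> (if P then a else 0) = (if P then x else 0) - (if P then y else 0)"
    "(P \<Longrightarrow> a = x + y) \<Longrightarrow> (if P then a else 0) = (if P then x else 0) + (if P then y else 0)"
    "(P \<Longrightarrow> a = sB c x) \<Longrightarrow> (if P then a else 0) = sB c (if P then x else 0)"
    "(P \<Longrightarrow> a = - x) \<Longrightarrow> (if P then a else 0) = - (if P then x else 0)" for P a x y
    by simp_all
  have h: "(if 0 < p \<and> p \<le> n then h (p - 1) (n - p) (t (p - 1) - t' (p - 1)) else 0)
      = (if 0 < p \<and> p \<le> n then h (p - 1) (n - p) (t (p - 1)) else 0) - (if 0 < p \<and> p \<le> n then h (p - 1) (n - p) (t' (p - 1)) else 0)"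
    "(if 0 < p \<and> p \<le> n then h (p - 1) (n - p) (t (p - 1) + t' (p - 1)) else 0)
      = (if 0 < p \<and> p \<le> n then h (p - 1) (n - p) (t (p - 1)) else 0) + (if 0 < p \<and> p \<le> n then h (p - 1) (n - p) (t' (p - 1)) else 0)"
    "(if 0 < p \<and> p \<le> n then h (p - 1) (n - p) (sB c (t (p - 1))) else 0)
      = sB c (if 0 < p \<and> p \<le> n then h (p - 1) (n - p) (t (p - 1)) else 0)"
    "(if 0 < p \<and> p \<le> n then h (p - 1) (n - p) (- t (p - 1)) else 0)
      = - (if 0 < p \<and> p \<le> n then h (p - 1) (n - p) (t (p - 1)) else 0)" for p
    by (rule if_ops, rule hdiff(2)[OF T_in_pred[OF assms(1)] T_in_pred[OF assms(2)]], assumption+)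
      (rule if_ops, rule hadd(1)[OF T_in_pred[OF assms(1)] T_in_pred[OF assms(2)]], assumption+,
       rule if_ops, rule hadd(2)[OF T_in_pred[OF assms(1)]], assumption,
       rule if_ops, rule hdiff(1)[OF T_in_pred[OF assms(1)]], assumption)
  have v: "(if p < n then v p (n - Suc p) (t p - t' p) else 0)
      = (if p < n then v p (n - Suc p) (t p) else 0) - (if p < n then v p (n - Suc p) (t' p) else 0)"
    "(if p < n then v p (n - Suc p) (t p + t' p) else 0)
      = (if p < n then v p (n - Suc p) (t p) else 0) + (if p < n then v p (n - Suc p) (t' p) else 0)"
    "(if p < n then v p (n - Suc p) (sB c (t p)) else 0) = sB c (if p < n then v p (n - Suc p) (t p) else 0)"
    "(if p < n then v p (n - Suc p) (- t p) else 0) = - (if p < n then v p (n - Suc p) (t p) else 0)" for p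
    by (rule if_ops, rule vdiff(2)[OF T_in[OF assms(1)] T_in[OF assms(2)]], assumption+)
      (rule if_ops, rule vadd(1)[OF T_in[OF assms(1)] T_in[OF assms(2)]], assumption+,
       rule if_ops, rule vadd(2)[OF T_in[OF assms(1)]], assumption,
       rule if_ops, rule vdiff(1)[OF T_in[OF assms(1)]], assumption)
  show "D n (t - t') = D n t - D n t'"
    by (rule ext) (simp only: D_def minus_apply h(1) v(1) add_diff_add)
  show "D n (t + t') = D n t + D n t'"
    by (rule ext) (simp only: D_def plus_fun_apply h(2) v(2), simp only: ac_simps)
  show "D n (\<lambda>p. sB c (t p)) = (\<lambda>p. sB c (D n t p))"
    by (rule ext) (simp only: D_def h(3) v(3) scale_right_distrib)
  show "D n (- t) = - D n t"
    by (rule ext) (simp only: D_def uminus_apply h(4) v(4) minus_add_distrib)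
qed

lemma T_sng: "b \<in> B m n \<Longrightarrow> sng m b \<in> T (Suc (m + n))"
  by (auto simp: T_def sng_def B0)

lemma D_sng:
  assumes "b \<in> B m n"
  shows "D (Suc (m + n)) (sng m b) = sng (Suc m) (h m n b) + sng m (v m n b)"
proof
  fix p
  have [simp]: "h p' q 0 = 0" "v p' q 0 = 0" for p' q by (rule h0 v0)+
  show "D (Suc (m + n)) (sng m b) p = (sng (Suc m) (h m n b) + sng m (v m n b)) p"
    by (cases "p = Suc m"; cases "p = m") (auto simp: D_def sng_def)
qed

text \<open>The entry with the largest p is a horizontal cocycle, hence equal to \<open>h b\<close>
  by exactness of the rows. Subtracting the total differential of \<open>b\<close> removes it at the
  cost of the entry one column to the left. Only the components of \<open>D t\<close> with p at
  least 1 must vanish, so \<open>t\<close> may also be a cochain whose differential lies in column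
  0.\<close>

lemma row_concentrate:
  assumes "t \<in> T (Suc n)" "\<And>p. p > m \<Longrightarrow> t p = 0" "\<And>p. p \<ge> 1 \<Longrightarrow> D (Suc n) t p = 0"
  shows "\<exists>w\<in>T n. \<forall>p\<ge>1. (t - D n w) p = 0"
  using assms
proof (induction m arbitrary: t)
  case 0
  show ?case using 0 D_zero by (intro bexI[of _ "\<lambda>_. 0"]) (auto simp: T_sub)
next
  case (Suc k)
  show ?case
  proof (cases "Suc k \<le> n")
    case False
    then have "t p = 0" if "p > k" for p using Suc.prems(1) that by (simp add: T_def)
    then show ?thesis using Suc.IH Suc.prems by blast
  next
    case True
    have tB: "t (Suc k) \<in> B (Suc k) (n - Suc k)" using Suc.prems(1) True by (auto simp: T_def)
    have "D (Suc n) t (Suc (Suc k)) = h (Suc k) (n - Suc k) (t (Suc k))"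
      using Suc.prems(2)[of "Suc (Suc k)"] True by (simp add: D_def v0)
    then have "h (Suc k) (n - Suc k) (t (Suc k)) = 0" using Suc.prems(3) by simp
    then obtain b where b: "b \<in> B k (n - Suc k)" "t (Suc k) = h k (n - Suc k) b" using row[OF tB] by blast
    have w: "sng k b \<in> T n" using T_sng[OF b(1)] True by simp
    have Dw: "D n (sng k b) = sng (Suc k) (t (Suc k)) + sng k (v k (n - Suc k) b)"
      using D_sng[OF b(1)] b(2) True by simp
    have t': "t - D n (sng k b) \<in> T (Suc n)" using Suc.prems(1) T_D[OF w] by (rule T_sub)
    have z: "(t - D n (sng k b)) p = 0" if "p > k" for p
      unfolding Dw using that Suc.prems(2)[of p] by (auto simp: sng_def)
    have "D (Suc n) (t - D n (sng k b)) p = 0" if "p \<ge> 1" for p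
      unfolding D_lin(1)[OF Suc.prems(1) T_D[OF w]] D_D[OF w] using Suc.prems(3)[OF that] by simp
    then obtain w' where w': "w' \<in> T n" "\<forall>p\<ge>1. (t - D n (sng k b) - D n w') p = 0" using Suc.IH[OF t' z] by blast
    have "t - D n (sng k b + w') = t - D n (sng k b) - D n w'"
      unfolding D_lin(2)[OF w w'(1)] by (simp only: diff_diff_eq)
    then show ?thesis using w'(2) T_sub(2)[OF w w'(1)] by metis
  qed
qed

text \<open>As for the rows, now starting from the smallest p: that entry is a vertical cocycle, and
  removing it changes the entry one column to the right. The counter m is the distance of the first
  possibly nonzero entry from position n.\<close>

lemma col_concentrate:
  assumes "t \<in> T (Suc n)" "\<And>p. p + m < n \<Longrightarrow> t p = 0" "\<And>p. p \<le> n \<Longrightarrow> D (Suc n) t p = 0"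
  shows "\<exists>w\<in>T n. \<forall>p. p \<noteq> n \<longrightarrow> (t - D n w) p = 0"
  using assms
proof (induction m arbitrary: t)
  case 0
  note D_zero
  moreover have "t p = 0" if "p \<noteq> n" for p
    using 0 that by (cases "p < n") (auto simp: T_def)
  ultimately show ?case by (intro bexI[of _ "\<lambda>_. 0"]) (auto simp: T_sub)
next
  case (Suc k)
  show ?case
  proof (cases "Suc k \<le> n")
    case False
    then show ?thesis using Suc.IH Suc.prems by simp
  next
    case True
    define m where "m = n - Suc k"
    have n: "n = Suc (m + k)" using True m_def by simp
    have tB: "t m \<in> B m (Suc k)" using Suc.prems(1) unfolding T_def n by (auto dest!: spec[of _ m])
    have "D (Suc n) t m = v m (Suc k) (t m)"
      using Suc.prems(2)[of "m - 1"] n by (auto simp: D_def h0 Suc_diff_le)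
    then have "v m (Suc k) (t m) = 0" using Suc.prems(3)[of m] n by simp
    then obtain b where b: "b \<in> B m k" "t m = v m k b" using col[OF tB] by blast
    have w: "sng m b \<in> T n" using T_sng[OF b(1)] n by simp
    have Dw: "D n (sng m b) = sng (Suc m) (h m k b) + sng m (t m)"
      using D_sng[OF b(1)] b(2) n by simp
    have t': "t - D n (sng m b) \<in> T (Suc n)" using Suc.prems(1) T_D[OF w] by (rule T_sub)
    have z: "(t - D n (sng m b)) p = 0" if "p + k < n" for p
      unfolding Dw using that Suc.prems(2)[of p] n by (cases "p = m") (auto simp: sng_def)
    have "D (Suc n) (t - D n (sng m b)) p = 0" if "p \<le> n" for p
      unfolding D_lin(1)[OF Suc.prems(1) T_D[OF w]] D_D[OF w] using Suc.prems(3)[OF that] by simp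
    then obtain w' where w': "w' \<in> T n" "\<forall>p. p \<noteq> n \<longrightarrow> (t - D n (sng m b) - D n w') p = 0" using Suc.IH[OF t' z] by blast
    have "t - D n (sng m b + w') = t - D n (sng m b) - D n w'"
      unfolding D_lin(2)[OF w w'(1)] by (simp only: diff_diff_eq)
    then show ?thesis using w'(2) T_sub(2)[OF w w'(1)] by metis
  qed
qed

lemma row_concentrate':
  assumes "t \<in> T (Suc n)" "\<And>p. p \<ge> 1 \<Longrightarrow> D (Suc n) t p = 0"
  shows "\<exists>w\<in>T n. \<exists>b\<in>B 0 n. t - D n w = sng 0 b \<and> h 0 n b = 0 \<and> v 0 n b = D (Suc n) t 0"
proof -
  have "t p = 0" if "p > n" for p using assms(1) that by (simp add: T_def)
  then obtain w where w: "w \<in> T n" "\<forall>p\<ge>1. (t - D n w) p = 0" using row_concentrate[OF assms(1) _ assms(2), of n] by blast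
  define b where "b = (t - D n w) 0"
  have tw: "t - D n w \<in> T (Suc n)" by (rule T_sub(1)[OF assms(1) T_D[OF w(1)]])
  then have b: "b \<in> B 0 n" unfolding b_def using T_in[OF tw, of 0] by simp
  have e: "t - D n w = sng 0 b" unfolding b_def using w(2) by (auto simp: sng_def fun_eq_iff)
  have "D (Suc n) t = D (Suc n) (t - D n w)" unfolding D_lin(1)[OF assms(1) T_D[OF w(1)]] D_D[OF w(1)] by (simp add: fun_eq_iff)
  also have "\<dots> = sng 1 (h 0 n b) + sng 0 (v 0 n b)" unfolding e using D_sng[OF b] by simp
  finally have "D (Suc n) t = sng 1 (h 0 n b) + sng 0 (v 0 n b)" .
  then have "h 0 n b = D (Suc n) t 1" "v 0 n b = D (Suc n) t 0" by (simp_all add: sng_def)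
  then show ?thesis using w(1) b e assms(2)[of 1] by auto
qed

lemma col_concentrate':
  assumes "t \<in> T (Suc n)" "\<And>p. p \<le> n \<Longrightarrow> D (Suc n) t p = 0"
  shows "\<exists>w\<in>T n. \<exists>b\<in>B n 0. t - D n w = sng n b \<and> v n 0 b = 0 \<and> h n 0 b = D (Suc n) t (Suc n)"
proof -
  obtain w where w: "w \<in> T n" "\<forall>p. p \<noteq> n \<longrightarrow> (t - D n w) p = 0" using col_concentrate[OF assms(1) _ assms(2), of n] by auto
  define b where "b = (t - D n w) n"
  have tw: "t - D n w \<in> T (Suc n)" by (rule T_sub(1)[OF assms(1) T_D[OF w(1)]])
  then have b: "b \<in> B n 0" unfolding b_def using T_in[OF tw, of n] by simp
  have e: "t - D n w = sng n b" unfolding b_def using w(2) by (auto simp: sng_def fun_eq_iff)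
  have "D (Suc n) t = D (Suc n) (t - D n w)" unfolding D_lin(1)[OF assms(1) T_D[OF w(1)]] D_D[OF w(1)] by (simp add: fun_eq_iff)
  also have "\<dots> = sng (Suc n) (h n 0 b) + sng n (v n 0 b)" unfolding e using D_sng[OF b] by simp
  finally have "D (Suc n) t = sng (Suc n) (h n 0 b) + sng n (v n 0 b)" .
  then have "h n 0 b = D (Suc n) t (Suc n)" "v n 0 b = D (Suc n) t n" by (simp_all add: sng_def)
  then show ?thesis using w(1) b e assms(2)[of n] by auto
qed

text \<open>Related means that the two images in the total complex are cohomologous. The primitive
  is in \<open>T n\<close>, the total complex one degree below the cocycles.\<close>

definition R :: "nat \<Rightarrow> 'y \<Rightarrow> 'x \<Rightarrow> bool" where
  "R n y x \<longleftrightarrow> y \<in> cocycles Y dY n \<and> x \<in> cocycles X dX n \<and> (\<exists>c\<in>T n. D n c = sng n (\<epsilon> n y) - sng 0 (\<eta> n x))"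

lemmas \<eta>_diff = lin_on_diff[OF vX vB X_sub \<eta>_lin] and \<epsilon>_diff = lin_on_diff[OF vY vB Y_sub \<epsilon>_lin]

lemma R_total:
  assumes y: "y \<in> cocycles Y dY n"
  shows "\<exists>x. R n y x"
proof -
  have yY: "y \<in> Y n" "dY n y = 0" using y by (auto simp: cocycles_def)
  let ?t = "sng n (\<epsilon> n y)"
  have t: "?t \<in> T (Suc n)" using T_sng[OF \<epsilon>_in[OF yY(1)]] by simp
  have "D (Suc n) ?t = sng (Suc n) 0 + sng n 0"
    using D_sng[OF \<epsilon>_in[OF yY(1)]] v_\<epsilon>[OF yY(1)] h_\<epsilon>[OF yY(1)] \<epsilon>_diff(1) yY(2) by simp
  then obtain w b where w: "w \<in> T n" "b \<in> B 0 n" "?t - D n w = sng 0 b" "h 0 n b = 0" "v 0 n b = 0"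
    using row_concentrate'[OF t] by (auto simp: sng_def)
  then obtain x where x: "x \<in> X n" "b = \<eta> n x" using row0 by blast
  have "\<eta> (Suc n) (dX n x) = 0" using v_\<eta>[OF x(1)] w x by simp
  then have "dX n x = 0" using \<eta>_inj dX_in[OF x(1)] by blast
  moreover have "D n w = sng n (\<epsilon> n y) - sng 0 (\<eta> n x)" using w(3) x(2) by (simp add: algebra_simps)
  ultimately show ?thesis unfolding R_def using y x w(1) by (auto simp: cocycles_def)
qed

lemma R_surj:
  assumes x: "x \<in> cocycles X dX n"
  shows "\<exists>y. R n y x"
proof -
  have xX: "x \<in> X n" "dX n x = 0" using x by (auto simp: cocycles_def)
  let ?t = "sng 0 (\<eta> n x)"
  have t: "?t \<in> T (Suc n)" using T_sng[OF \<eta>_in[OF xX(1)]] by simp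
  have "D (Suc n) ?t = sng (Suc 0) 0 + sng 0 0"
    using D_sng[OF \<eta>_in[OF xX(1)]] v_\<eta>[OF xX(1)] h_\<eta>[OF xX(1)] \<eta>_diff(1) xX(2) by simp
  then obtain w b where w: "w \<in> T n" "b \<in> B n 0" "?t - D n w = sng n b" "v n 0 b = 0" "h n 0 b = 0"
    using col_concentrate'[OF t] by (auto simp: sng_def)
  then obtain y where y: "y \<in> Y n" "b = \<epsilon> n y" using col0 by blast
  have "\<epsilon> (Suc n) (dY n y) = 0" using h_\<epsilon>[OF y(1)] w y by simp
  then have "dY n y = 0" using \<epsilon>_inj dY_in[OF y(1)] by blast
  moreover have "D n (- w) = sng n (\<epsilon> n y) - sng 0 (\<eta> n x)"
    using w(3) y(2) D_lin(4)[OF w(1) w(1)] by (simp add: algebra_simps)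
  ultimately show ?thesis unfolding R_def using x y T_sub(4)[OF w(1)] by (auto simp: cocycles_def)
qed

text \<open>If x is the coboundary of x', adding the edge image of x' to the primitive
  \<open>c\<close> gives a cochain whose differential is the edge image of y alone. Concentrating it
  in the bottom row yields a y' with coboundary y. The converse concentrates in column 0.\<close>

lemma R_boundary:
  assumes "R n y x"
  shows "y \<in> coboundaries Y dY n \<longleftrightarrow> x \<in> coboundaries X dX n"
proof -
  obtain c where c: "c \<in> T n" "D n c = sng n (\<epsilon> n y) - sng 0 (\<eta> n x)" and yY: "y \<in> Y n" and xX: "x \<in> X n"
    using assms by (auto simp: R_def cocycles_def)
  show ?thesis
  proof (cases n)
    case 0
    \<comment> \<open>In degree 0 the total complex has no coboundaries, so the two edge images
      coincide.\<close>
    have "D n c 0 = 0" by (simp add: D_def 0)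
    then have e: "\<epsilon> 0 y = \<eta> 0 x" using c(2) 0 by (simp add: sng_def)
    have "y = 0 \<longleftrightarrow> x = 0" using e \<epsilon>_inj[of 0 y] \<eta>_inj[of 0 x] yY xX 0 \<epsilon>_diff(1)[of 0] \<eta>_diff(1)[of 0] by auto
    then show ?thesis by (simp add: 0 coboundaries_def)
  next
    case (Suc i)
    show ?thesis
    proof
      assume "x \<in> coboundaries X dX n"
      then obtain x' where x': "x' \<in> X i" "x = dX i x'" by (auto simp: Suc coboundaries_def)
      let ?a = "sng 0 (\<eta> i x')"
      have a: "?a \<in> T n" using T_sng[OF \<eta>_in[OF x'(1)]] Suc by simp
      have "D n ?a = sng 1 0 + sng 0 (\<eta> n x)"
        using D_sng[OF \<eta>_in[OF x'(1)]] v_\<eta>[OF x'(1)] h_\<eta>[OF x'(1)] x'(2) Suc by simp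
      then have Dt: "D n (c + ?a) = sng n (\<epsilon> n y)" unfolding D_lin(2)[OF c(1) a] c(2) by (auto simp: fun_eq_iff sng_def)
      have t: "c + ?a \<in> T (Suc i)" using T_sub(2)[OF c(1) a] Suc by simp
      obtain b where b: "b \<in> B i 0" "v i 0 b = 0" "h i 0 b = \<epsilon> n y"
        using col_concentrate'[OF t] Dt Suc by (auto simp: sng_def)
      obtain y' where y': "y' \<in> Y i" "b = \<epsilon> i y'" using col0 b by blast
      have "\<epsilon> n (dY i y') = \<epsilon> n y" using h_\<epsilon>[OF y'(1)] y' b Suc by simp
      then have "\<epsilon> n (dY i y' - y) = 0" using \<epsilon>_diff(3)[OF _ yY, of "dY i y'"] dY_in[OF y'(1)] Suc by simp
      moreover have "dY i y' - y \<in> Y n" using subsp_diff(2)[OF vY Y_sub] dY_in[OF y'(1)] yY Suc by simp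
      ultimately have "dY i y' - y = 0" using \<epsilon>_inj by blast
      then show "y \<in> coboundaries Y dY n" using y'(1) by (auto simp: Suc coboundaries_def)
    next
      assume "y \<in> coboundaries Y dY n"
      then obtain y' where y': "y' \<in> Y i" "y = dY i y'" by (auto simp: Suc coboundaries_def)
      let ?a = "sng i (\<epsilon> i y')"
      have a: "?a \<in> T n" using T_sng[OF \<epsilon>_in[OF y'(1)]] Suc by simp
      have "D n ?a = sng n (\<epsilon> n y) + sng i 0"
        using D_sng[OF \<epsilon>_in[OF y'(1)]] v_\<epsilon>[OF y'(1)] h_\<epsilon>[OF y'(1)] y'(2) Suc by simp
      then have Dt: "D n (?a - c) = sng 0 (\<eta> n x)" unfolding D_lin(1)[OF a c(1)] c(2) by (auto simp: fun_eq_iff sng_def)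
      have t: "?a - c \<in> T (Suc i)" using T_sub(1)[OF a c(1)] Suc by simp
      obtain b where b: "b \<in> B 0 i" "h 0 i b = 0" "v 0 i b = \<eta> n x"
        using row_concentrate'[OF t] Dt Suc by (auto simp: sng_def)
      obtain x' where x': "x' \<in> X i" "b = \<eta> i x'" using row0 b by blast
      have "\<eta> n (dX i x') = \<eta> n x" using v_\<eta>[OF x'(1)] x' b Suc by simp
      then have "\<eta> n (dX i x' - x) = 0" using \<eta>_diff(3)[OF _ xX, of "dX i x'"] dX_in[OF x'(1)] Suc by simp
      moreover have "dX i x' - x \<in> X n" using subsp_diff(2)[OF vX X_sub] dX_in[OF x'(1)] xX Suc by simp
      ultimately have "dX i x' - x = 0" using \<eta>_inj by blast
      then show "x \<in> coboundaries X dX n" using x'(1) by (auto simp: Suc coboundaries_def)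
    qed
  qed
qed

lemma cocycles_sub:
  assumes "vector_space s" "subsp s (C n)" "lin_on s s (C n) (d n)"
  shows "x \<in> cocycles C d n \<Longrightarrow> y \<in> cocycles C d n \<Longrightarrow> x + y \<in> cocycles C d n" "x \<in> cocycles C d n \<Longrightarrow> s c x \<in> cocycles C d n"
proof -
  interpret vector_space s by (rule assms(1))
  show "x \<in> cocycles C d n \<Longrightarrow> y \<in> cocycles C d n \<Longrightarrow> x + y \<in> cocycles C d n" "x \<in> cocycles C d n \<Longrightarrow> s c x \<in> cocycles C d n"
    using subspD[OF assms(2)] lin_onD[OF assms(3)] by (auto simp: cocycles_def)
qed

theorem cohomology_iso_edges: "cohomology_iso sY Y dY sX X dX n"
proof (rule cohomology_iso_of_relation[OF vY vX, where R="R n"])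
  show "subsp sY (coboundaries Y dY n)" by (rule subsp_coboundaries[OF vY Y_sub dY_lin])
  show "subsp sX (coboundaries X dX n)" by (rule subsp_coboundaries[OF vX X_sub dX_lin])
  show "y \<in> cocycles Y dY n \<and> x \<in> cocycles X dX n" if "R n y x" for y x using that by (simp add: R_def)
  show "R n (y + y') (x + x')" if r: "R n y x" "R n y' x'" for y x y' x'
  proof -
    obtain c c' where c: "c \<in> T n" "D n c = sng n (\<epsilon> n y) - sng 0 (\<eta> n x)" "c' \<in> T n" "D n c' = sng n (\<epsilon> n y') - sng 0 (\<eta> n x')"
      using r by (auto simp: R_def)
    have "y \<in> Y n" "y' \<in> Y n" "x \<in> X n" "x' \<in> X n" using r by (auto simp: R_def cocycles_def)
    then have "D n (c + c') = sng n (\<epsilon> n (y + y')) - sng 0 (\<eta> n (x + x'))"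
      unfolding D_lin(2)[OF c(1,3)] c(2,4) by (auto simp: fun_eq_iff sng_def lin_onD[OF \<epsilon>_lin] lin_onD[OF \<eta>_lin])
    then show ?thesis using r T_sub(2)[OF c(1,3)] cocycles_sub(1)[where C=X and d=dX, OF vX X_sub dX_lin] cocycles_sub(1)[where C=Y and d=dY, OF vY Y_sub dY_lin]
      unfolding R_def by blast
  qed
  show "R n (sY k y) (sX k x)" if r: "R n y x" for y x k
  proof -
    interpret vector_space sB by (rule vB)
    obtain c where c: "c \<in> T n" "D n c = sng n (\<epsilon> n y) - sng 0 (\<eta> n x)"
      using r by (auto simp: R_def)
    have "y \<in> Y n" "x \<in> X n" using r by (auto simp: R_def cocycles_def)
    then have "D n (\<lambda>p. sB k (c p)) = sng n (\<epsilon> n (sY k y)) - sng 0 (\<eta> n (sX k x))"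
      unfolding D_lin(3)[OF c(1,1)] c(2) by (auto simp: fun_eq_iff sng_def lin_onD[OF \<epsilon>_lin] lin_onD[OF \<eta>_lin] scale_right_diff_distrib)
    then show ?thesis using r T_sub(3)[OF c(1)] cocycles_sub(2)[where C=X and d=dX, OF vX X_sub dX_lin] cocycles_sub(2)[where C=Y and d=dY, OF vY Y_sub dY_lin]
      unfolding R_def by blast
  qed
qed (use R_total R_surj R_boundary in auto)

end

section \<open>Bimodules over the crossed product\<close>

context weak_bialgebra
begin

lemma PiR_one: "\<Pi>R 1 = 1"
  using Sw_counit_right[where sW=sH and T="\<lambda>x. x" and h=1, OF klin_id] by (simp add: PiR_Sw)

lemma PiR_idem: "\<Pi>R (\<Pi>R h) = \<Pi>R h"
proof -
  have "\<Pi>R h = Sw (\<Pi>R h) (\<lambda>x y. sH (\<epsilon> y) x)"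
    using Sw_counit_right[where sW=sH and T="\<lambda>x. x" and h="\<Pi>R h", OF klin_id] by simp
  also have "\<dots> = Sw 1 (\<lambda>x y. sH (\<epsilon> (\<Pi>R h * y)) x)"
    by (rule Sw_PiR(2)[OF vs]) (intro lin)
  finally show ?thesis by (simp add: PiR_Sw)
qed

text \<open>After Delta(1) is inserted on the right, the weak counit axiom splits the coefficient in
  \<open>PiR\<close> at the second leg of Delta(1), and the counit then removes the second leg of h.
  This form is used for the columns at the edge q = 0.\<close>

lemma Sw_PiR_right:
  assumes W: "vector_space sW" and T: "klin2 sH sH sW T"
  shows "Sw h (\<lambda>x y. T x (\<Pi>R y)) = Sw 1 (\<lambda>e1 e2. T (h * e1) (\<Pi>R e2))"
proof -
  interpret W: vector_space sW by (rule W)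
  note lT = linW[OF W] klin2_comp[OF T]
  have cm: "\<epsilon> (y * v * b) = Sw v (\<lambda>p q. \<epsilon> (y * p) * \<epsilon> (q * b))" for y v b
    unfolding Sw_def by (rule counit_mult1)
  have "Sw h (\<lambda>x y. T x (\<Pi>R y)) = Sw h (\<lambda>x y. Sw 1 (\<lambda>u v. T (x * u) (\<Pi>R (y * v))))"
    by (rule Sw_one_right[symmetric, where sW=sW]) (intro lT)
  also have "\<dots> = Sw h (\<lambda>x y. Sw 1 (\<lambda>u v. Sw 1 (\<lambda>a b. sW (\<epsilon> (y * v * b)) (T (x * u) a))))"
    by (rule Sw_cong, rule Sw_cong, rule pull_PiR[where T="\<lambda>r. T _ r"]) (intro lT)
  also have "\<dots> = Sw h (\<lambda>x y. Sw 1 (\<lambda>u v. Sw v (\<lambda>p q. Sw 1 (\<lambda>a b. sW (\<epsilon> (y * p)) (sW (\<epsilon> (q * b)) (T (x * u) a))))))"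
    unfolding cm Sw_pull[where s="(*)" and s'=sW and G="\<lambda>c. sW c _", OF klin_scale_left[OF W klin_id]] W.scale_scale
    by (rule Sw_cong, rule Sw_cong, rule Sw_swap)
  also have "\<dots> = Sw h (\<lambda>x y. Sw 1 (\<lambda>u v. Sw v (\<lambda>p q. sW (\<epsilon> (y * p)) (T (x * u) (\<Pi>R q)))))"
  proof -
    have "T w (\<Pi>R q) = Sw 1 (\<lambda>a b. sW (\<epsilon> (q * b)) (T w a))" for w q
      by (rule pull_PiR[where T="\<lambda>r. T w r"]) (intro lT)
    then show ?thesis by (simp only: Sw_pull[OF klin_scale_right[OF W klin_id]])
  qed
  also have "\<dots> = Sw h (\<lambda>x y. Sw 1 (\<lambda>w q. Sw w (\<lambda>u p. sW (\<epsilon> (y * p)) (T (x * u) (\<Pi>R q)))))"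
    by (rule Sw_cong, rule Sw_coassoc[symmetric, where sW=sW]) (intro lT)
  also have "\<dots> = Sw 1 (\<lambda>w q. Sw h (\<lambda>x y. Sw w (\<lambda>u p. sW (\<epsilon> (y * p)) (T (x * u) (\<Pi>R q)))))"
    by (rule Sw_swap)
  also have "\<dots> = Sw 1 (\<lambda>w q. Sw (h * w) (\<lambda>x y. sW (\<epsilon> y) (T x (\<Pi>R q))))"
    by (rule Sw_cong, rule Sw_mult[symmetric, where sW=sW]) (intro lT)
  also have "\<dots> = Sw 1 (\<lambda>e1 e2. T (h * e1) (\<Pi>R e2))"
    by (rule Sw_cong, rule Sw_counit_right[where sW=sW]) (intro lT)
  finally show ?thesis .
qed

end

locale crossed_bimodule = weak_cocycle sH \<Delta> \<epsilon> S sA act f finv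
  for sH :: "'k::field \<Rightarrow> 'h::{ring,monoid_mult} \<Rightarrow> 'h" and \<Delta> \<epsilon> S
    and sA :: "'k \<Rightarrow> 'a::{ring,monoid_mult} \<Rightarrow> 'a" and act f finv +
  fixes sM :: "'k \<Rightarrow> 'm::ab_group_add \<Rightarrow> 'm" and lm :: "('a \<times> 'h) list set \<Rightarrow> 'm \<Rightarrow> 'm"
    and rm :: "'m \<Rightarrow> ('a \<times> 'h) list set \<Rightarrow> 'm"
  assumes bimE: "bimodule E sM lm rm"
begin

abbreviation "K \<equiv> range j"

lemma K_sub_E: "K \<subseteq> carrier E"
  by auto

sublocale RB: ring_bimodule E K sM lm rm
  using E_closed E_distrib E_assoc K_sub_E bimE by unfold_locales

abbreviation "J a m \<equiv> lm (j a) m"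
abbreviation "G h m \<equiv> lm (\<gamma> h) m"

lemma Elin_lm: "Elin sM (\<lambda>x. lm x m)" and Elin_rm: "Elin sM (\<lambda>x. rm m x)"
  unfolding Elin_def using RB.lm_add RB.rm_add RB.lm_smult RB.rm_smult by auto

lemma gam_one: "\<gamma> 1 = \<one>\<^bsub>E\<^esub>"
  by (simp add: gam_ce E_simps)

sublocale CA: cleft_action sH \<Delta> \<epsilon> S sA act f finv sM "\<lambda>a m. lm (j a) m" "\<lambda>h m. lm (\<gamma> h) m"
proof (rule cleft_action.intro[OF weak_cocycle_axioms], rule cleft_action_axioms.intro)
  show "vector_space sM" by (rule RB.vsM)
  show "klin2 sA sM sM (\<lambda>a m. lm (j a) m)"
    by (intro klin2I Elin_gam(2)[OF Elin_lm] RB.lm_lin) simp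
  show "klin2 sH sM sM (\<lambda>h m. lm (\<gamma> h) m)"
    by (intro klin2I Elin_gam(1)[OF Elin_lm] RB.lm_lin) simp
  show "lm (j 1) m = m" "lm (\<gamma> 1) m = m" for m by (simp_all add: j_one gam_one RB.lm_one)
  show "lm (j (a * b)) m = lm (j a) (lm (j b) m)" for a b m
    by (simp add: j_mult[symmetric] RB.lm_mult)
  show "Sw h (\<lambda>x y. lm (j (act x 1)) (lm (\<gamma> y) m)) = lm (\<gamma> h) m" for h m
    using Elin_gam(3)[OF Elin_lm[of m], of h] by (simp add: RB.lm_mult)
  show "lm (\<gamma> h) (lm (j a) m) = Sw h (\<lambda>x y. lm (j (act x a)) (lm (\<gamma> y) m))" for h a m
    using Elin_gam_j[OF RB.vsM Elin_lm[of m], of h a] by (simp add: RB.lm_mult)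
  show "lm (\<gamma> h) (lm (\<gamma> l) m) = Sw h (\<lambda>h1 h2. Sw l (\<lambda>l1 l2. lm (j (f h1 l1)) (lm (\<gamma> (h2 * l2)) m)))" for h l m
    using Elin_gam_gam[OF RB.vsM Elin_lm[of m], of h l] by (simp add: RB.lm_mult)
qed

lemma rm_klin [lin]: "klin s sH F \<Longrightarrow> klin s sM (\<lambda>x. rm m (\<gamma> (F x)))"
  "klin s sA F' \<Longrightarrow> klin s sM (\<lambda>x. rm m (j (F' x)))"
  using klin_comp[OF Elin_gam(1)[OF Elin_rm]] klin_comp[OF Elin_gam(2)[OF Elin_rm]] by blast+

lemma rm_klin' [lin]: "x \<in> carrier E \<Longrightarrow> klin s sM U \<Longrightarrow> klin s sM (\<lambda>y. rm (U y) x)"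
  using klin_comp[OF RB.rm_lin] .

lemma lm_klin' [lin]: "x \<in> carrier E \<Longrightarrow> klin s sM U \<Longrightarrow> klin s sM (\<lambda>y. lm x (U y))"
  using klin_comp[OF RB.lm_lin] .

lemmas klin_CA [lin] = CA.klin_M CA.klin_M'

lemma te_carrier [lin]: "te t \<in> carrier E" "j a \<in> carrier E" "\<gamma> h \<in> carrier E"
  by simp_all

lemma rm_Sw: "x \<in> carrier E \<Longrightarrow> rm (Sw h U) x = Sw h (\<lambda>a b. rm (U a b) x)"
  by (rule Sw_pull[OF RB.rm_lin])

lemma G'_rm: "x \<in> carrier E \<Longrightarrow> rm (CA.G' h m) x = CA.G' h (rm m x)"
  unfolding CA.G'_def by (simp add: rm_Sw RB.lm_rm)

lemma gam_inv_lm: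
  shows "gam_inv sH \<Delta> S sA act f finv h \<in> carrier E" "lm (gam_inv sH \<Delta> S sA act f finv h) m = CA.G' h m"
proof -
  have fold: "foldr (add E) xs \<zero>\<^bsub>E\<^esub> \<in> carrier E \<and> lm (foldr (add E) xs \<zero>\<^bsub>E\<^esub>) m = (\<Sum>x\<leftarrow>xs. lm x m)"
    if "set xs \<subseteq> carrier E" for xs
    using that
  proof (induction xs)
    case Nil
    have "\<zero>\<^bsub>E\<^esub> \<in> carrier E" by (simp add: E_simps)
    moreover have "lm \<zero>\<^bsub>E\<^esub> m = 0" using Elin_te[OF Elin_lm[of m], of "[]"] by (simp add: E_simps)
    ultimately show ?case by simp
  next
    case (Cons x xs)
    then show ?case by (simp add: E_closed RB.lm_add)
  qed
  let ?xs = "[j (finv (S h2) h3) \<otimes>\<^bsub>E\<^esub> \<gamma> (S h1). (h1, h2, h3) \<leftarrow> sw3 \<Delta> h]"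
  have "set ?xs \<subseteq> carrier E" by (auto simp: E_closed)
  note g = fold[OF this]
  show "gam_inv sH \<Delta> S sA act f finv h \<in> carrier E" using g by (simp add: gam_inv_def Let_def)
  have "(\<Sum>x\<leftarrow>?xs. lm x m) = Sw h (\<lambda>w h3. Sw w (\<lambda>h1 h2. J (finv (S h2) h3) (G (S h1) m)))"
    unfolding Sw_def sw3_def by (simp add: sum_list_concat_map case_prod_unfold o_def RB.lm_mult)
  also have "\<dots> = CA.G' h m"
    unfolding CA.G'_def by (rule Sw_coassoc[where sW=sM]) (intro lin)
  finally show "lm (gam_inv sH \<Delta> S sA act f finv h) m = CA.G' h m" using g by (simp add: gam_inv_def Let_def)
qed

section \<open>M^K as a right H-module\<close>

abbreviation "MK \<equiv> centralizer K lm rm"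
abbreviation "mact \<equiv> M_action sH \<Delta> S sA act f finv lm rm"

lemma MK_iff: "m \<in> MK \<longleftrightarrow> (\<forall>a. J a m = rm m (j a))"
  by (auto simp: centralizer_def)

lemma mact_Sw: "mact m h = Sw h (\<lambda>h1 h2. CA.G' h1 (rm m (\<gamma> h2)))"
  unfolding M_action_def Sw_def[symmetric] gam_inv_lm(2) by (simp add: G'_rm)

lemma mact_klin [lin]: "klin s sM U \<Longrightarrow> klin s sM (\<lambda>x. mact (U x) h)" "klin s sH F \<Longrightarrow> klin s sM (\<lambda>x. mact m (F x))"
  unfolding mact_Sw by (intro lin; assumption)+

text \<open>The right-handed form of \<open>G_PiL\<close>, which concerns operators on the
  left.\<close>

lemma rm_gam_PiL: "rm m (\<gamma> (\<Pi>L l)) = rm m (j (act (\<Pi>L l) 1))"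
proof -
  note T = Elin_rm[of m]
  have "rm m (\<gamma> (\<Pi>L l)) = Sw (\<Pi>L l) (\<lambda>x y. rm (rm m (j (act x 1))) (\<gamma> y))"
    using Elin_gam(3)[OF T, of "\<Pi>L l"] by (simp add: RB.rm_mult)
  also have "\<dots> = Sw 1 (\<lambda>x y. rm (rm m (j (act (x * \<Pi>L l) 1))) (\<gamma> y))"
    by (rule Sw_PiL(2)[OF RB.vsM]) (intro lin)
  also have "\<dots> = rm m (\<gamma> 1 \<otimes>\<^bsub>E\<^esub> j (act (\<Pi>L l) 1))"
    unfolding Elin_gam_j[OF RB.vsM T] by (simp add: act_act_one RB.rm_mult)
  finally show ?thesis by (simp add: gam_one E_one)
qed

text \<open>Moving \<open>a\<close> past the inverse of \<open>gamma\<close> turns it into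
  \<open>h2 . a\<close>. This element passes m, because m centralizes A, and the commutation rule of
  \<open>gamma\<close> restores \<open>a\<close> on the right.\<close>

lemma J_mact: "m \<in> MK \<Longrightarrow> J a (mact m h) = rm (mact m h) (j a)"
proof -
  assume m: "m \<in> MK"
  have "J a (mact m h) = Sw h (\<lambda>h1 h2. Sw h1 (\<lambda>x y. CA.G' x (J (act y a) (rm m (\<gamma> h2)))))"
    unfolding mact_Sw CA.J_Sw CA.G'_J[symmetric] ..
  also have "\<dots> = Sw h (\<lambda>x w. Sw w (\<lambda>y h2. CA.G' x (J (act y a) (rm m (\<gamma> h2)))))"
    by (rule Sw_coassoc[where sW=sM]) (intro lin)
  also have "\<dots> = Sw h (\<lambda>x w. CA.G' x (Sw w (\<lambda>y h2. rm m (j (act y a) \<otimes>\<^bsub>E\<^esub> \<gamma> h2))))"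
    using m by (simp add: CA.G_Sw RB.lm_rm[symmetric] RB.rm_mult MK_iff)
  also have "\<dots> = Sw h (\<lambda>x w. CA.G' x (rm (rm m (\<gamma> w)) (j a)))"
    unfolding Elin_gam_j[OF RB.vsM Elin_rm, symmetric] by (simp add: RB.rm_mult)
  finally show ?thesis by (simp add: mact_Sw rm_Sw G'_rm)
qed

text \<open>The product \<open>gamma(h2) gamma(l2)\<close> creates a value of f in front. Since m
  centralizes A, this value can be moved to the left of m, where \<open>G'_G'\<close> consumes
  it.\<close>

lemma mact_mact:
  assumes m: "m \<in> MK"
  shows "mact (mact m h) l = mact m (h * l)"
proof -
  have "mact (mact m h) l = Sw l (\<lambda>l1 l2. Sw h (\<lambda>h1 h2. CA.G' l1 (CA.G' h1 (rm m (\<gamma> h2 \<otimes>\<^bsub>E\<^esub> \<gamma> l2)))))"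
    unfolding mact_Sw by (simp add: rm_Sw G'_rm CA.G_Sw RB.rm_mult)
  also have "\<dots> = Sw l (\<lambda>l1 l2. Sw h (\<lambda>h1 h2. Sw h2 (\<lambda>a b. Sw l2 (\<lambda>c d. CA.G' l1 (CA.G' h1 (J (f a c) (rm m (\<gamma> (b * d)))))))))"
    using m unfolding Elin_gam_gam[OF RB.vsM Elin_rm] by (simp add: CA.G_Sw RB.lm_rm[symmetric] RB.rm_mult MK_iff)
  also have "\<dots> = Sw l (\<lambda>l1 l2. Sw h (\<lambda>u b. Sw u (\<lambda>h1 a. Sw l2 (\<lambda>c d. CA.G' l1 (CA.G' h1 (J (f a c) (rm m (\<gamma> (b * d)))))))))"
    by (rule Sw_cong, rule Sw_coassoc[symmetric, where sW=sM]) (intro lin)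
  also have "\<dots> = Sw l (\<lambda>l1 l2. Sw l2 (\<lambda>c d. Sw h (\<lambda>u b. Sw u (\<lambda>h1 a. CA.G' l1 (CA.G' h1 (J (f a c) (rm m (\<gamma> (b * d)))))))))"
    by (rule Sw_cong, rule HOL.sym, rule HOL.trans[OF Sw_swap], rule Sw_cong, rule Sw_swap)
  also have "\<dots> = Sw l (\<lambda>v d. Sw v (\<lambda>l1 c. Sw h (\<lambda>u b. Sw u (\<lambda>h1 a. CA.G' l1 (CA.G' h1 (J (f a c) (rm m (\<gamma> (b * d)))))))))"
    by (rule Sw_coassoc[symmetric, where sW=sM]) (intro lin)
  also have "\<dots> = Sw l (\<lambda>v d. Sw h (\<lambda>u b. Sw v (\<lambda>l1 c. Sw u (\<lambda>h1 a. CA.G' l1 (CA.G' h1 (J (f a c) (rm m (\<gamma> (b * d)))))))))"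
    by (rule Sw_cong, rule Sw_swap)
  also have "\<dots> = Sw h (\<lambda>u b. Sw l (\<lambda>v d. CA.G' (u * v) (rm m (\<gamma> (b * d)))))"
    unfolding CA.G'_G' by (rule Sw_swap)
  also have "\<dots> = mact m (h * l)"
    unfolding mact_Sw by (rule Sw_mult[symmetric, where sW=sM]) (intro lin)
  finally show ?thesis .
qed

text \<open>The second leg of Delta(1) may be taken in H^L, where \<open>gamma\<close> has values in
  A and so commutes with m. What is left is \<open>gamma^{-1}\<close> times \<open>gamma\<close> at
  1, that is \<open>gamma(PiR(1)) = 1\<close>.\<close>

lemma mact_one:
  assumes m: "m \<in> MK"
  shows "mact m 1 = m"
proof -
  have "mact m 1 = Sw 1 (\<lambda>e1 e2. CA.G' e1 (rm m (\<gamma> (\<Pi>L e2))))"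
    unfolding mact_Sw by (rule Sw_one_PiL[OF RB.vsM, symmetric]) (intro lin)
  also have "\<dots> = Sw 1 (\<lambda>e1 e2. CA.G' e1 (G (\<Pi>L e2) m))"
    using m unfolding rm_gam_PiL CA.G_PiL by (simp add: MK_iff)
  also have "\<dots> = Sw 1 (\<lambda>e1 e2. CA.G' e1 (G e2 m))"
    by (rule Sw_one_PiL[OF RB.vsM]) (intro lin)
  finally show ?thesis unfolding CA.G'_G PiR_one by (simp add: gam_one RB.lm_one)
qed

lemma right_module_MK: "right_module sH sM MK mact"
proof -
  interpret vector_space sM by (rule RB.vsM)
  note k = klin_add[OF mact_klin(1)[OF klin_id]] klin_scale[OF mact_klin(1)[OF klin_id]]
    klin_add[OF mact_klin(2)[OF klin_id]] klin_scale[OF mact_klin(2)[OF klin_id]]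
  have J0: "J a 0 = 0" "rm 0 (j a) = 0" for a
    using klin_zero[OF RB.lm_lin] klin_zero[OF RB.rm_lin] by auto
  show ?thesis unfolding right_module_def
  proof (intro conjI ballI allI)
    show "vector_space sM" by (rule RB.vsM)
    show "0 \<in> MK" by (simp add: MK_iff J0)
    show "u + v \<in> MK" if "u \<in> MK" "v \<in> MK" for u v
      using that by (simp add: MK_iff klin_add[OF RB.lm_lin] klin_add[OF RB.rm_lin])
    show "sM c v \<in> MK" if "v \<in> MK" for c v
      using that by (simp add: MK_iff klin_scale[OF RB.lm_lin] klin_scale[OF RB.rm_lin])
    show "mact v h \<in> MK" if "v \<in> MK" for v h using that J_mact by (simp add: MK_iff)
  qed (use k mact_mact mact_one in auto)
qed

section \<open>The action of E on maps from H to M\<close>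

text \<open>\<open>lam e F\<close> is \<open>e\<^sup>0 \<cdot> F(e\<^sup>1)\<close> for the coaction \<open>j(a)\<gamma>(h) \<mapsto> j(a)\<gamma>(h\<^sup>1) \<otimes> h\<^sup>2\<close> of \<open>H\<close> on \<open>E\<close>.\<close>

definition lam :: "('a \<times> 'h) list set \<Rightarrow> ('h \<Rightarrow> 'm) \<Rightarrow> 'm" where
  "lam e F = (\<Sum>(a, h)\<leftarrow>rep e. Sw h (\<lambda>h1 h2. J a (G h1 (F h2))))"

text \<open>The definition uses a representative in A (x) H. The bilinear expression is unchanged by
  the projection onto E, so every presentation by terms \<open>a \<times> h\<close> gives the same
  value.\<close>

lemma lam_te:
  assumes F: "klin sH sM F"
  shows "lam (te t) F = (\<Sum>(a, h)\<leftarrow>t. Sw h (\<lambda>h1 h2. J a (G h1 (F h2))))"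
proof -
  note lF = lin klin_comp[OF F]
  let ?B = "\<lambda>a h. Sw h (\<lambda>h1 h2. J a (G h1 (F h2)))"
  have B: "klin2 sA sH sM ?B" by (intro lF)
  have eq: "bx ?B a h = ?B a h" for a h
  proof -
    have "bx ?B a h = Sw h (\<lambda>p w. Sw p (\<lambda>x y. J (a * act x 1) (G y (F w))))"
      unfolding bx_def by (rule Sw_coassoc[symmetric, where sW=sM]) (intro lF)
    then show ?thesis unfolding CA.J_mult CA.J_Sw(2)[symmetric] CA.G_unit .
  qed
  have "lam (te t) F = (\<Sum>(a, h)\<leftarrow>times_sum \<Delta> act t. ?B a h)"
    unfolding lam_def times_elt_def by (rule HOL.sym, rule sum_cong_eval[OF rep_tens B])
  then show ?thesis unfolding times_sum_eval eq .
qed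

lemma lam_ce: "klin sH sM F \<Longrightarrow> lam (ce a h) F = Sw h (\<lambda>h1 h2. J a (G h1 (F h2)))"
  by (simp add: lam_te)

lemma lam_one: "klin sH sM F \<Longrightarrow> lam \<one>\<^bsub>E\<^esub> F = Sw 1 (\<lambda>h1 h2. G h1 (F h2))"
  by (simp add: E_simps lam_ce CA.J_one)

lemma lam_add: "klin sH sM F \<Longrightarrow> x \<in> carrier E \<Longrightarrow> y \<in> carrier E \<Longrightarrow> lam (x \<oplus>\<^bsub>E\<^esub> y) F = lam x F + lam y F"
  by (auto elim!: carrierE simp: E_simps lam_te)

lemma lam_J: "klin sH sM F \<Longrightarrow> x \<in> carrier E \<Longrightarrow> lam (j a \<otimes>\<^bsub>E\<^esub> x) F = J a (lam x F)"
proof -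
  assume F: "klin sH sM F" and x: "x \<in> carrier E"
  note lF = lin klin_comp[OF F]
  let ?B = "\<lambda>a h. Sw h (\<lambda>h1 h2. J a (G h1 (F h2)))"
  have B: "klin2 sA sH sM ?B" by (intro lF)
  obtain t where t: "x = te t" using x by (auto elim!: carrierE)
  have eq: "bx ?B b h = ?B b h" for b h
  proof -
    have "bx ?B b h = Sw h (\<lambda>p w. Sw p (\<lambda>x y. J (b * act x 1) (G y (F w))))"
      unfolding bx_def by (rule Sw_coassoc[symmetric, where sW=sM]) (intro lF)
    then show ?thesis unfolding CA.J_mult CA.J_Sw(2)[symmetric] CA.G_unit .
  qed
  have "j a \<otimes>\<^bsub>E\<^esub> te t = te (te_prod [(a, 1)] t)" by (simp add: j_ce E_mult)
  then have "lam (j a \<otimes>\<^bsub>E\<^esub> te t) F = (\<Sum>(b, h)\<leftarrow>t. pr ?B a 1 b h)"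
    by (simp add: lam_te[OF F] te_prod_eval[OF RB.vsM B])
  also have "\<dots> = (\<Sum>(b, h)\<leftarrow>t. ?B (a * b) h)" unfolding pr_one_left[OF RB.vsM B] eq ..
  also have "\<dots> = J a (\<Sum>(b, h)\<leftarrow>t. ?B b h)"
    by (subst klin_sum_list[OF RB.lm_lin]) (simp_all add: CA.J_mult CA.J_Sw(2) case_prod_unfold)
  finally show ?thesis unfolding t lam_te[OF F] .
qed

lemma lam_rm: "x \<in> carrier E \<Longrightarrow> lam e (\<lambda>h. rm (F h) x) = rm (lam e F) x"
  unfolding lam_def by (subst klin_sum_list[OF RB.rm_lin]) (simp_all add: rm_Sw RB.lm_rm case_prod_unfold)

lemma lam_klin_fun: "(\<And>h. klin s sM (\<lambda>x. F x h)) \<Longrightarrow> klin s sM (\<lambda>x. lam e (F x))"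
proof -
  assume F: "\<And>h. klin s sM (\<lambda>x. F x h)"
  have 1: "klin s sM (\<lambda>x. Sw h (\<lambda>h1 h2. J a (G h1 (F x h2))))" for a h
    by (intro lin F)
  show ?thesis
    by (rule klinI) (simp_all add: lam_def klin_add[OF 1] klin_scale[OF 1] case_prod_unfold sum_list_addf
        klin_sum_list[OF klin_scale_right[OF RB.vsM klin_id]])
qed

lemma lam_add_fun: "lam e (\<lambda>h. F h + F' h) = lam e F + lam e F'"
  by (simp add: lam_def klin_add[OF RB.lm_lin] Sw_add_fun case_prod_unfold sum_list_addf)

lemma lam_scale_fun: "lam e (\<lambda>h. sM c (F h)) = sM c (lam e F)"
  by (simp add: lam_def klin_scale[OF RB.lm_lin] Sw_pull[OF klin_scale_right[OF RB.vsM klin_id]] case_prod_unfold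
      klin_sum_list[OF klin_scale_right[OF RB.vsM klin_id]])

text \<open>The coaction is multiplicative: the product formula of E, evaluated on the bilinear
  expression of \<open>lam\<close>, reproduces \<open>G_J\<close> and \<open>G_G\<close>. Since 1
  acts as averaging over Delta(1), averaging is idempotent and compatible with the action of
  E.\<close>

lemma lam_mult:
  assumes F: "klin sH sM F" and x: "x \<in> carrier E" and y: "y \<in> carrier E"
  shows "lam (x \<otimes>\<^bsub>E\<^esub> y) F = lam x (\<lambda>h. lam y (\<lambda>l. F (h * l)))"
proof -
  note lF = lin klin_comp[OF F]
  let ?B = "\<lambda>a h. Sw h (\<lambda>h1 h2. J a (G h1 (F h2)))"
  have B: "klin2 sA sH sM ?B" by (intro lF)
  obtain s t where st: "x = te s" "y = te t" using x y by (auto elim!: carrierE)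
  have lF2: "klin sH sM (\<lambda>l. F (h * l))" "klin sH sM (\<lambda>h. F (h * l))" for h l by (intro lF)+
  have lF3: "klin sH sM (\<lambda>h. lam y (\<lambda>l. F (h * l)))" by (rule lam_klin_fun) (rule lF2)
  have pr: "pr ?B a h b l = Sw h (\<lambda>h1 h2. J a (G h1 (Sw l (\<lambda>l1 l2. J b (G l1 (F (h2 * l2)))))))" for a h b l
  proof -
    have "pr ?B a h b l = Sw h (\<lambda>x w. Sw w (\<lambda>u h3. Sw l (\<lambda>c l2. Sw h3 (\<lambda>p q. Sw l2 (\<lambda>r s.
        J (a * act x b * f u c) (G (p * r) (F (q * s))))))))"
      unfolding pr_def by (rule Sw_cong, rule Sw_cong, rule Sw_cong, rule Sw_mult[where sW=sM]) (intro lF)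
    also have "\<dots> = Sw h (\<lambda>x w. Sw w (\<lambda>u h3. Sw h3 (\<lambda>p q. Sw l (\<lambda>c l2. Sw l2 (\<lambda>r s.
        J (a * act x b * f u c) (G (p * r) (F (q * s))))))))"
      by (rule Sw_cong, rule Sw_cong, rule Sw_swap)
    also have "\<dots> = Sw h (\<lambda>x w. Sw w (\<lambda>y q. Sw y (\<lambda>u p. Sw l (\<lambda>c l2. Sw l2 (\<lambda>r s.
        J (a * act x b * f u c) (G (p * r) (F (q * s))))))))"
      by (rule Sw_cong, rule Sw_coassoc[symmetric, where sW=sM]) (intro lF)
    also have "\<dots> = Sw h (\<lambda>h1 q. Sw h1 (\<lambda>x y. Sw y (\<lambda>u p. Sw l (\<lambda>c l2. Sw l2 (\<lambda>r s.
        J (a * act x b * f u c) (G (p * r) (F (q * s))))))))"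
      by (rule Sw_coassoc[symmetric, where sW=sM]) (intro lF)
    also have "\<dots> = Sw h (\<lambda>h1 q. Sw h1 (\<lambda>x y. Sw y (\<lambda>u p. Sw l (\<lambda>l1 s. Sw l1 (\<lambda>c r.
        J (a * act x b * f u c) (G (p * r) (F (q * s))))))))"
      by (rule Sw_cong, rule Sw_cong, rule Sw_cong, rule Sw_coassoc[symmetric, where sW=sM]) (intro lF)
    also have "\<dots> = Sw h (\<lambda>h1 q. Sw h1 (\<lambda>x y. Sw l (\<lambda>l1 s. Sw y (\<lambda>u p. Sw l1 (\<lambda>c r.
        J (a * act x b * f u c) (G (p * r) (F (q * s))))))))"
      by (rule Sw_cong, rule Sw_cong, rule Sw_swap)
    also have "\<dots> = Sw h (\<lambda>h1 q. Sw l (\<lambda>l1 s. Sw h1 (\<lambda>x y. J a (J (act x b) (Sw y (\<lambda>u p. Sw l1 (\<lambda>c r.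
        J (f u c) (G (p * r) (F (q * s))))))))))"
      unfolding CA.J_Sw(2) CA.J_mult[symmetric] mult.assoc by (rule Sw_cong, rule Sw_swap)
    also have "\<dots> = Sw h (\<lambda>h1 h2. J a (G h1 (Sw l (\<lambda>l1 l2. J b (G l1 (F (h2 * l2)))))))"
      unfolding CA.G_Sw CA.J_Sw(2) CA.G_G[symmetric] CA.G_J ..
    finally show ?thesis .
  qed
  have "lam (x \<otimes>\<^bsub>E\<^esub> y) F = (\<Sum>(a, h)\<leftarrow>s. \<Sum>(b, l)\<leftarrow>t. pr ?B a h b l)"
    unfolding st E_mult lam_te[OF F] te_prod_eval[OF RB.vsM B] ..
  also have "\<dots> = (\<Sum>(a, h)\<leftarrow>s. Sw h (\<lambda>h1 h2. J a (G h1 (\<Sum>(b, l)\<leftarrow>t. Sw l (\<lambda>l1 l2. J b (G l1 (F (h2 * l2))))))))"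
  proof -
    have "(\<Sum>(b, l)\<leftarrow>t. Sw h (\<lambda>h1 h2. J a (G h1 (Z b l h2)))) = Sw h (\<lambda>h1 h2. J a (G h1 (\<Sum>(b, l)\<leftarrow>t. Z b l h2)))"
      for a h and Z :: "'a \<Rightarrow> 'h \<Rightarrow> 'h \<Rightarrow> 'm"
      unfolding case_prod_unfold klin_sum_list[OF RB.lm_lin[OF te_carrier(3)]] klin_sum_list[OF RB.lm_lin[OF te_carrier(2)]]
      unfolding Sw_def case_prod_unfold by (rule sum_list_swap)
    then show ?thesis unfolding pr by simp
  qed
  also have "\<dots> = lam x (\<lambda>h. lam y (\<lambda>l. F (h * l)))"
    unfolding st(1) lam_te[OF lF3] unfolding st(2) lam_te[OF lF2(1)] ..
  finally show ?thesis .
qed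

text \<open>By \<open>G_G'\<close> the factor \<open>gamma\<close> from the coaction undoes the
  inverse of \<open>gamma\<close> in the action on M^K. This is why H-linear maps into M^K are
  horizontal cocycles in column 0.\<close>

lemma lam_mact:
  assumes m: "m \<in> MK" and x: "x \<in> carrier E"
  shows "lam x (\<lambda>h. mact m h) = rm m x"
proof -
  have l: "klin sH sM (\<lambda>h. mact m h)" by (intro lin)
  have eq: "Sw l (\<lambda>h1 h2. J a (G h1 (mact m h2))) = rm m (ce a l)" for a l
  proof -
    have "Sw l (\<lambda>h1 h2. G h1 (mact m h2)) = Sw l (\<lambda>w b. Sw w (\<lambda>h1 x. G h1 (CA.G' x (rm m (\<gamma> b)))))"
      unfolding mact_Sw CA.G_Sw by (rule Sw_coassoc[symmetric, where sW=sM]) (intro lin)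
    also have "\<dots> = Sw l (\<lambda>w b. rm m (j (act w 1) \<otimes>\<^bsub>E\<^esub> \<gamma> b))"
      using m unfolding CA.G_G' by (simp add: RB.lm_rm[symmetric] RB.rm_mult MK_iff)
    also have "\<dots> = rm m (\<gamma> l)" by (rule Elin_gam(3)[OF Elin_rm])
    finally show ?thesis using m
      by (simp add: CA.J_Sw(2)[symmetric] j_gam[symmetric] RB.rm_mult RB.lm_rm[symmetric] MK_iff)
  qed
  obtain t where t: "x = te t" using x by (auto elim!: carrierE)
  show ?thesis unfolding t lam_te[OF l] eq by (rule Elin_te[OF Elin_rm, symmetric])
qed

text \<open>Only a first leg of Delta(1) acts on \<open>a\<close>, and it acts by right
  multiplication. So \<open>gamma(H^R)\<close> centralizes A, and multiplying a cochain by
  \<open>gamma(g x)\<close> keeps it K-linear.\<close>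

lemma G_J_PiR: "G (\<Pi>R l) (J a m) = J a (G (\<Pi>R l) m)"
proof -
  have "G (\<Pi>R l) (J a m) = Sw 1 (\<lambda>e1 e2. J (act e1 a) (G (\<Pi>R l * e2) m))"
    unfolding CA.G_J by (rule Sw_PiR(2)[OF RB.vsM]) (intro lin)
  also have "\<dots> = Sw 1 (\<lambda>e1 e2. J (a * act e1 1) (G (\<Pi>R l * e2) m))"
    by (rule Sw_one_act[where sW=sM, symmetric]) (intro lin)
  also have "\<dots> = Sw (\<Pi>R l) (\<lambda>x y. J (a * act x 1) (G y m))"
    by (rule Sw_PiR(2)[OF RB.vsM, symmetric]) (intro lin)
  finally show ?thesis unfolding CA.J_mult CA.J_Sw(2)[symmetric] CA.G_unit .
qed

text \<open>The action on H^R contains \<open>PiR\<close>, and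
  \<open>gamma(l1) gamma(PiR(y l2))\<close> reduces to \<open>gamma(y l)\<close> for y in H^R by
  \<open>Sw_mult_PiR_absorb\<close>. This is the compatibility of the edge map with the first
  summand of the horizontal differential.\<close>

lemma lam_G_PiR:
  assumes x: "x \<in> carrier E"
  shows "lam x (\<lambda>h. G (\<Pi>R (\<Pi>R y * h)) m) = G (\<Pi>R y) (lm x m)"
proof -
  have l: "klin sH sM (\<lambda>h. G (\<Pi>R (\<Pi>R y * h)) m)" by (intro lin)
  have eq: "Sw l (\<lambda>h1 h2. J a (G h1 (G (\<Pi>R (\<Pi>R y * h2)) m))) = G (\<Pi>R y) (lm (ce a l) m)" for a l
  proof -
    have "Sw l (\<lambda>h1 h2. G (h1 * \<Pi>R (\<Pi>R y * h2)) m) = G (\<Pi>R (\<Pi>R y) * l) m"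
      by (rule Sw_mult_PiR_absorb[OF RB.vsM]) (intro lin)
    then show ?thesis
      by (simp add: CA.J_Sw(2)[symmetric] CA.G_PiR_right PiR_idem CA.G_PiR_left[symmetric] G_J_PiR j_gam[symmetric] RB.lm_mult)
  qed
  obtain t where t: "x = te t" using x by (auto elim!: carrierE)
  have "lm (te t) m = (\<Sum>(a, h)\<leftarrow>t. lm (ce a h) m)" by (rule Elin_te[OF Elin_lm])
  then have "G (\<Pi>R y) (lm (te t) m) = (\<Sum>(a, h)\<leftarrow>t. G (\<Pi>R y) (lm (ce a h) m))"
    by (simp add: klin_sum_list[OF RB.lm_lin] case_prod_unfold)
  then show ?thesis unfolding t lam_te[OF l] eq by simp
qed

text \<open>The legs of Delta(1) act on \<open>a\<close> by right multiplication, so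
  \<open>a\<close> comes out on the left. Averaging therefore preserves the left K-linearity of
  cochains.\<close>

lemma J_average:
  assumes "klin sH sM F"
  shows "Sw 1 (\<lambda>e1 e2. G e1 (J a (F e2))) = J a (Sw 1 (\<lambda>e1 e2. G e1 (F e2)))"
proof -
  note lF = lin klin_comp[OF assms]
  have "Sw 1 (\<lambda>e1 e2. G e1 (J a (F e2))) = Sw 1 (\<lambda>u w. Sw w (\<lambda>v e2. J (act u a) (G v (F e2))))"
    unfolding CA.G_J by (rule Sw_coassoc[where sW=sM]) (intro lF)
  also have "\<dots> = Sw 1 (\<lambda>u w. Sw w (\<lambda>v e2. J (a * act u 1) (G v (F e2))))"
    by (rule Sw_one_act[where sW=sM, symmetric]) (intro lF)
  also have "\<dots> = Sw 1 (\<lambda>w e2. Sw w (\<lambda>u v. J (a * act u 1) (G v (F e2))))"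
    by (rule Sw_coassoc[symmetric, where sW=sM]) (intro lF)
  finally show ?thesis unfolding CA.J_mult CA.J_Sw(2)[symmetric] CA.G_unit .
qed

section \<open>The operator behind the contraction of the rows\<close>

definition LT :: "(('a \<times> 'h) list set \<Rightarrow> 'm) \<Rightarrow> 'h \<Rightarrow> 'm" where
  "LT T k = Sw k (\<lambda>h1 h2. CA.G' h1 (T (\<gamma> h2)))"

context
  fixes T assumes T: "Elin sM T" and T_left: "\<And>a x. x \<in> carrier E \<Longrightarrow> T (j a \<otimes>\<^bsub>E\<^esub> x) = J a (T x)"
begin

lemma klin_T: "klin s sH F \<Longrightarrow> klin s sM (\<lambda>x. T (\<gamma> (F x)))"
  by (rule klin_comp[OF Elin_gam(1)[OF T]])

lemma LT_klin: "klin s sH F \<Longrightarrow> klin s sM (\<lambda>x. LT T (F x))"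
  unfolding LT_def by (intro lin klin_T)

text \<open>Trades \<open>a\<close> in front of the operator for \<open>a\<close> behind
  \<open>gamma(k2)\<close> in the argument of T. There balancedness moves it on to the next
  argument, so the contracted cochain is left K-linear.\<close>

lemma LT_J: "Sw k (\<lambda>h1 h2. CA.G' h1 (T (\<gamma> h2 \<otimes>\<^bsub>E\<^esub> j a))) = J a (LT T k)"
proof -
  have "Sw k (\<lambda>h1 h2. CA.G' h1 (T (\<gamma> h2 \<otimes>\<^bsub>E\<^esub> j a))) = Sw k (\<lambda>h1 w. Sw w (\<lambda>u v. CA.G' h1 (J (act u a) (T (\<gamma> v)))))"
    unfolding Elin_gam_j[OF RB.vsM T] by (simp add: CA.G_Sw T_left)
  also have "\<dots> = Sw k (\<lambda>p v. Sw p (\<lambda>h1 u. CA.G' h1 (J (act u a) (T (\<gamma> v)))))"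
    by (rule Sw_coassoc[symmetric, where sW=sM]) (intro lin klin_T)
  finally show ?thesis unfolding CA.G'_J CA.J_Sw(2)[symmetric] LT_def .
qed

text \<open>The first summand of the horizontal differential turns into a product inside the
  argument of T, which is the missing term of the cocycle condition at \<open>gamma(k2)\<close>. The
  exchange rule \<open>G_G'_cocycle\<close> is the step that moves \<open>gamma\<close> past its
  inverse.\<close>

lemma lam_LT:
  assumes x: "x \<in> carrier E"
  shows "lam x (\<lambda>l. LT T (k * l)) = Sw k (\<lambda>h1 h2. CA.G' h1 (T (\<gamma> h2 \<otimes>\<^bsub>E\<^esub> x)))"
proof -
  have l: "klin sH sM (\<lambda>l. LT T (k * l))" by (intro lin LT_klin)
  have eq: "Sw l (\<lambda>l1 l2. J b (G l1 (LT T (k * l2)))) = Sw k (\<lambda>h1 h2. CA.G' h1 (T (\<gamma> h2 \<otimes>\<^bsub>E\<^esub> ce b l)))" for b l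
  proof -
    have "Sw k (\<lambda>h1 h2. CA.G' h1 (T (\<gamma> h2 \<otimes>\<^bsub>E\<^esub> ce b l)))
        = Sw k (\<lambda>h1 h2. Sw h2 (\<lambda>u w. CA.G' h1 (J (act u b) (Sw w (\<lambda>h3 h4. Sw l (\<lambda>l1 l2. J (f h3 l1) (T (\<gamma> (h4 * l2)))))))))"
      unfolding Elin_gam_ce[OF RB.vsM T] by (simp add: CA.G_Sw T_left CA.J_mult CA.J_Sw(2))
    also have "\<dots> = Sw k (\<lambda>p w. Sw p (\<lambda>h1 u. CA.G' h1 (J (act u b) (Sw w (\<lambda>h3 h4. Sw l (\<lambda>l1 l2. J (f h3 l1) (T (\<gamma> (h4 * l2)))))))))"
      by (rule Sw_coassoc[symmetric, where sW=sM]) (intro lin klin_T)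
    also have "\<dots> = J b (Sw k (\<lambda>p w. Sw w (\<lambda>h3 h4. Sw l (\<lambda>l1 l2. CA.G' p (J (f h3 l1) (T (\<gamma> (h4 * l2))))))))"
      unfolding CA.G'_J unfolding CA.G_Sw CA.J_Sw(2) ..
    also have "Sw k (\<lambda>p w. Sw w (\<lambda>h3 h4. Sw l (\<lambda>l1 l2. CA.G' p (J (f h3 l1) (T (\<gamma> (h4 * l2)))))))
       = Sw k (\<lambda>q h4. Sw q (\<lambda>p h3. Sw l (\<lambda>l1 l2. CA.G' p (J (f h3 l1) (T (\<gamma> (h4 * l2)))))))"
      by (rule Sw_coassoc[symmetric, where sW=sM]) (intro lin klin_T)
    also have "\<dots> = Sw k (\<lambda>q h4. Sw l (\<lambda>l1 l2. Sw q (\<lambda>p h3. CA.G' p (J (f h3 l1) (T (\<gamma> (h4 * l2)))))))"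
      by (rule Sw_cong, rule Sw_swap)
    also have "\<dots> = Sw k (\<lambda>q h4. Sw l (\<lambda>l1 l2. Sw l1 (\<lambda>a c. G a (CA.G' (q * c) (T (\<gamma> (h4 * l2)))))))"
      unfolding CA.G_G'_cocycle ..
    also have "\<dots> = Sw k (\<lambda>q h4. Sw l (\<lambda>a w. Sw w (\<lambda>c l2. G a (CA.G' (q * c) (T (\<gamma> (h4 * l2)))))))"
      by (rule Sw_cong, rule Sw_coassoc[where sW=sM]) (intro lin klin_T)
    also have "\<dots> = Sw l (\<lambda>a w. Sw k (\<lambda>q h4. Sw w (\<lambda>c l2. G a (CA.G' (q * c) (T (\<gamma> (h4 * l2)))))))"
      by (rule Sw_swap)
    also have "\<dots> = Sw l (\<lambda>a w. Sw (k * w) (\<lambda>x y. G a (CA.G' x (T (\<gamma> y)))))"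
      by (rule Sw_cong, rule Sw_mult[symmetric, where sW=sM]) (intro lin klin_T)
    finally show ?thesis unfolding LT_def CA.G_Sw CA.J_Sw(2) by simp
  qed
  obtain t where t: "x = te t" using x by (auto elim!: carrierE)
  have E': "Elin sM (\<lambda>x. Sw k (\<lambda>h1 h2. CA.G' h1 (T (\<gamma> h2 \<otimes>\<^bsub>E\<^esub> x))))"
  proof -
    have a: "T (\<gamma> h2 \<otimes>\<^bsub>E\<^esub> (x \<oplus>\<^bsub>E\<^esub> y)) = T (\<gamma> h2 \<otimes>\<^bsub>E\<^esub> x) + T (\<gamma> h2 \<otimes>\<^bsub>E\<^esub> y)"
      if "x \<in> carrier E" "y \<in> carrier E" for h2 x y
      using T that by (simp add: E_distrib E_closed Elin_def)
    have b: "T (\<gamma> h2 \<otimes>\<^bsub>E\<^esub> (c \<odot>\<^bsub>E\<^esub> x)) = sM c (T (\<gamma> h2 \<otimes>\<^bsub>E\<^esub> x))" if x: "x \<in> carrier E" for h2 c x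
    proof -
      obtain t where t: "x = te t" using x by (auto elim!: carrierE)
      note lp = pr_klin2(2)[OF RB.vsM Elin_klin2[OF T], of 1 h2]
      have e: "T (\<gamma> h2 \<otimes>\<^bsub>E\<^esub> te t) = (\<Sum>(b, l)\<leftarrow>t. pr (\<lambda>a h. T (ce a h)) 1 h2 b l)" for t
      proof -
        have "T (te (te_prod [(1, h2)] t)) = (\<Sum>(b, l)\<leftarrow>t. pr (\<lambda>a h. T (ce a h)) 1 h2 b l)"
          using Elin_te[OF T, of "te_prod [(1, h2)] t"] te_prod_eval[OF RB.vsM Elin_klin2[OF T], of "[(1, h2)]" t] by simp
        then show ?thesis unfolding gam_ce E_mult .
      qed
      show ?thesis unfolding t E_simps e sum_list_pair_map
        by (subst klin_sum_list[OF klin_scale_right[OF RB.vsM klin_id]]) (simp add: klin_scale[OF klin2D(1)[OF lp]] case_prod_unfold)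
    qed
    have G'a: "CA.G' h (m + m') = CA.G' h m + CA.G' h m'" "CA.G' h (sM c m) = sM c (CA.G' h m)" for h m m' c
      by (rule klin_add[OF klin2D(2)[OF CA.G'_lin]] klin_scale[OF klin2D(2)[OF CA.G'_lin]])+
    show ?thesis unfolding Elin_def
      by (simp add: a b G'a Sw_add_fun Sw_pull[OF klin_scale_right[OF RB.vsM klin_id]])
  qed
  show ?thesis unfolding t lam_te[OF l] Elin_te[OF E', of t] by (simp add: eq)
qed

end

end

section \<open>The bicomplex of a projective resolution\<close>

text \<open>Preimages in V are chosen for a basis of the span of the image. The extension is linear
  on the whole target with values in V, because it will be applied to elements outside the image as
  well.\<close>

lemma linear_section:
  fixes s :: "'k::field \<Rightarrow> 'v::ab_group_add \<Rightarrow> 'v" and t :: "'k \<Rightarrow> 'w::ab_group_add \<Rightarrow> 'w"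
  assumes s: "vector_space s" "vector_space t" and V: "subsp s V" and d: "lin_on s t V d"
  shows "\<exists>\<sigma>. (\<forall>z. \<sigma> z \<in> V) \<and> klin t s \<sigma> \<and> (\<forall>x\<in>V. d (\<sigma> (d x)) = d x)"
proof -
  interpret v: vector_space s by (rule s)
  interpret w: vector_space t by (rule s)
  interpret p: vector_space_pair t s by unfold_locales
  obtain Bs where Bs: "Bs \<subseteq> d ` V" "w.independent Bs" "d ` V \<subseteq> w.span Bs"
    using w.maximal_independent_subset[of "d ` V"] by blast
  have "\<forall>b\<in>Bs. \<exists>v\<in>V. d v = b" using Bs(1) by blast
  then obtain pre where pre: "\<forall>b\<in>Bs. pre b \<in> V \<and> d (pre b) = b" by metis
  define \<sigma> where "\<sigma> = p.construct Bs pre"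
  have lin: "Vector_Spaces.linear t s \<sigma>" unfolding \<sigma>_def by (rule p.linear_construct[OF Bs(2)])
  have "v.subspace V" using subspD[OF V] by (auto simp: v.subspace_def)
  then have "v.span (pre ` Bs) \<subseteq> V" using pre by (intro v.span_minimal) auto
  then have in_V: "\<sigma> z \<in> V" for z unfolding \<sigma>_def using p.construct_in_span[OF Bs(2)] by blast
  have k: "klin t s \<sigma>" using lin by (rule klin_linear)
  have "d (\<sigma> z) = z" if "z \<in> w.span Bs" for z
  proof -
    interpret q: vector_space_pair t t by unfold_locales
    have "Vector_Spaces.linear t t (\<lambda>z. d (\<sigma> z))"
      unfolding linear_iff_klin using s in_V by (auto intro!: klinI simp: klin_add[OF k] klin_scale[OF k] lin_onD[OF d])
    moreover have "Vector_Spaces.linear t t (\<lambda>z. z)"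
      unfolding linear_iff_klin using s klin_id by auto
    ultimately show ?thesis
      by (rule q.linear_eq_on[OF _ _ that]) (use pre in \<open>simp add: \<sigma>_def p.construct_basis[OF Bs(2)]\<close>)
  qed
  then show ?thesis using in_V k Bs(3) by blast
qed

section \<open>Closure properties of the cochain conditions\<close>

context ring_bimodule
begin

lemma RC_zero: "RC n (\<lambda>_. 0)"
  by (simp add: RC_def klin_zero[OF rm_lin] K_in)

lemma RC_plus: "RC n \<phi> \<Longrightarrow> RC n \<psi> \<Longrightarrow> RC n (\<lambda>es. \<phi> es + \<psi> es)"
  unfolding RC_def by (simp add: klin_add[OF rm_lin] K_in)

lemma RC_sum_list: "(\<And>p. RC n (\<phi> p)) \<Longrightarrow> RC n (\<lambda>es. \<Sum>p\<leftarrow>L. \<phi> p es)"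
  by (induction L) (simp_all add: RC_zero RC_plus)

lemma RC_sum: "(\<And>p. p \<in> A \<Longrightarrow> RC n (\<phi> p)) \<Longrightarrow> RC n (\<lambda>es. \<Sum>p\<in>A. \<phi> p es)"
  by (induction A rule: infinite_finite_induct) (simp_all add: RC_zero RC_plus)

lemma RC_map:
  assumes r: "RC n \<phi>" and F: "klin sM sM F" and R: "\<And>x m. x \<in> carrier E \<Longrightarrow> F (rm m x) = rm (F m) x"
  shows "RC n (\<lambda>es. F (\<phi> es))"
  using r unfolding RC_def by (simp add: klin_add[OF F] klin_zero[OF F] R K_in)

lemma HC_I:
  assumes "\<And>xs. \<not> (length xs = n \<and> set xs \<subseteq> carrier E) \<Longrightarrow> \<phi> xs = 0" "RC n \<phi>"
    "\<And>c x xs. Suc (length xs) = n \<Longrightarrow> c \<in> K \<Longrightarrow> x \<in> carrier E \<Longrightarrow> set xs \<subseteq> carrier E \<Longrightarrow> \<phi> ((c \<otimes> x) # xs) = lm c (\<phi> (x # xs))"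
    "\<And>c. n = 0 \<Longrightarrow> c \<in> K \<Longrightarrow> lm c (\<phi> []) = rm (\<phi> []) c"
  shows "\<phi> \<in> HC n"
  unfolding HC_iff centralizer_def using assms by auto

lemma HC_map:
  assumes \<phi>: "\<phi> \<in> HC n" and F: "klin sM sM F" and R: "\<And>x m. x \<in> carrier E \<Longrightarrow> F (rm m x) = rm (F m) x"
    and L: "\<And>c m. c \<in> K \<Longrightarrow> F (lm c m) = lm c (F m)"
  shows "(\<lambda>es. F (\<phi> es)) \<in> HC n"
proof (rule HC_I)
  show "RC n (\<lambda>es. F (\<phi> es))" by (rule RC_map[OF HC_RC[OF \<phi>] F R])
  show "F (\<phi> xs) = 0" if "\<not> (length xs = n \<and> set xs \<subseteq> carrier E)" for xs
    using HC_zero[OF \<phi> that] klin_zero[OF F] by simp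
  show "lm c (F (\<phi> [])) = rm (F (\<phi> [])) c" if "n = 0" "c \<in> K" for c
    using HC_cent[of \<phi> c] \<phi> that by (simp add: L[symmetric] R[symmetric] K_in)
qed (simp add: HC_left[OF \<phi>] L)

lemma HC_plus:
  assumes "\<phi> \<in> HC n" "\<psi> \<in> HC n"
  shows "(\<lambda>es. \<phi> es + \<psi> es) \<in> HC n"
proof (rule HC_I)
  show "RC n (\<lambda>es. \<phi> es + \<psi> es)" by (intro RC_plus HC_RC assms)
  show "\<phi> xs + \<psi> xs = 0" if "\<not> (length xs = n \<and> set xs \<subseteq> carrier E)" for xs
    using HC_zero[OF assms(1) that] HC_zero[OF assms(2) that] by simp
  show "lm c (\<phi> [] + \<psi> []) = rm (\<phi> [] + \<psi> []) c" if "n = 0" "c \<in> K" for c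
    using HC_cent[of \<phi> c] HC_cent[of \<psi> c] assms that by (simp add: klin_add[OF lm_lin] klin_add[OF rm_lin] K_in)
qed (simp add: HC_left[OF assms(1)] HC_left[OF assms(2)] klin_add[OF lm_lin] K_in)

lemma HC_zero_fun: "(\<lambda>_. 0) \<in> HC n"
  by (rule HC_I) (simp_all add: RC_zero klin_zero[OF lm_lin] klin_zero[OF rm_lin] K_in)

lemma HC_scale: "\<phi> \<in> HC n \<Longrightarrow> (\<lambda>es. sM c (\<phi> es)) \<in> HC n"
  by (rule HC_map[OF _ klin_scale_right[OF vsM klin_id]]) (simp_all add: klin_scale[OF rm_lin] klin_scale[OF lm_lin] K_in)

lemma hochschild_diff_with: "hochschild_diff E sM lm rm n \<phi> = diff_with n (\<lambda>e es. lm e (\<phi> es)) \<phi>"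
proof
  fix xs
  show "hochschild_diff E sM lm rm n \<phi> xs = diff_with n (\<lambda>e es. lm e (\<phi> es)) \<phi> xs"
  proof (cases "length xs = Suc n \<and> set xs \<subseteq> carrier E")
    case True
    then show ?thesis using hochschild_diff_tau[of xs n \<phi>] by (simp add: diff_with_def)
  next
    case False
    then show ?thesis unfolding hochschild_diff_def diff_with_def by (simp only: if_False)
  qed
qed

lemma hochschild_diff_in:
  assumes \<phi>: "\<phi> \<in> HC n"
  shows "hochschild_diff E sM lm rm n \<phi> \<in> HC (Suc n)"
  unfolding hochschild_diff_with
proof (rule diff_with_in_HC[OF \<phi>])
  show "RC n (\<lambda>es. lm x (\<phi> es))" if "x \<in> carrier E" for x
    using that by (intro RC_map[OF HC_RC[OF \<phi>] lm_lin]) (simp_all add: lm_rm)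
  show "lm (x \<otimes> c) (\<phi> (y # es)) = lm x (\<phi> (c \<otimes> y # es))"
    if "c \<in> K" "x \<in> carrier E" "y \<in> carrier E" "Suc (length es) = n" "set es \<subseteq> carrier E" for c x y es
    using that by (simp add: HC_left[OF \<phi>] lm_mult K_in)
  show "lm (x \<otimes> c) (\<phi> []) = rm (lm x (\<phi> [])) c" if "n = 0" "c \<in> K" "x \<in> carrier E" for c x
    using that \<phi> HC_cent[of \<phi> c] by (simp add: lm_mult lm_rm K_in)
qed (simp_all add: lm_add lm_mult K_in)

lemma tau_sum:
  assumes "set xs \<subseteq> carrier E"
  shows "tau (\<lambda>zs. \<Sum>p\<in>A. \<phi> p zs) xs = (\<Sum>p\<in>A. tau (\<phi> p) xs)"
  by (induction A rule: infinite_finite_induct) (simp_all add: tau_zero[OF assms] tau_add[OF assms])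

end

lemma psum_superset:
  fixes \<Psi> :: "'v \<Rightarrow> 'h::ab_group_add \<Rightarrow> 'w::ab_group_add"
  assumes "\<And>w. \<Psi> w 0 = 0" "finite A" "Poly_Mapping.keys F \<subseteq> A"
  shows "(\<Sum>w\<in>Poly_Mapping.keys F. \<Psi> w (Poly_Mapping.lookup F w)) = (\<Sum>w\<in>A. \<Psi> w (Poly_Mapping.lookup F w))"
  using assms by (intro sum.mono_neutral_left) (auto simp: in_keys_iff)

lemma lookup_map_zero: "f 0 = 0 \<Longrightarrow> Poly_Mapping.lookup (Poly_Mapping.map f F) w = f (Poly_Mapping.lookup F w)"
  by (simp add: Poly_Mapping.map.rep_eq when_def)

lemma poly_mapping_sum_single: "F = (\<Sum>w\<in>Poly_Mapping.keys F. Poly_Mapping.single w (Poly_Mapping.lookup F w))"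
  for F :: "'v \<Rightarrow>\<^sub>0 'h::ab_group_add"
proof (rule poly_mapping_eqI)
  fix k
  show "Poly_Mapping.lookup F k = Poly_Mapping.lookup (\<Sum>w\<in>Poly_Mapping.keys F. Poly_Mapping.single w (Poly_Mapping.lookup F w)) k"
    by (simp add: lookup_sum lookup_single when_def in_keys_iff)
qed

context crossed_bimodule
begin

lemma tau_Sw: "set xs \<subseteq> carrier E \<Longrightarrow> RB.tau (\<lambda>zs. Sw h (\<lambda>x y. \<phi> x y zs)) xs = Sw h (\<lambda>x y. RB.tau (\<phi> x y) xs)"
  unfolding Sw_def case_prod_unfold by (rule RB.tau_sum_list)

lemma RC_Sw: "(\<And>x y. RB.RC n (\<phi> x y)) \<Longrightarrow> RB.RC n (\<lambda>es. Sw h (\<lambda>x y. \<phi> x y es))"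
  unfolding Sw_def case_prod_unfold by (rule RB.RC_sum_list)

lemma tau_lam:
  assumes xs: "set xs \<subseteq> carrier E"
  shows "RB.tau (\<lambda>zs. lam e (\<lambda>h. \<phi> h zs)) xs = lam e (\<lambda>h. RB.tau (\<phi> h) xs)"
proof -
  have 1: "RB.tau (\<lambda>zs. lm x (\<psi> zs)) xs = lm x (RB.tau \<psi> xs)" if "x \<in> carrier E" for x \<psi>
    by (rule RB.tau_klin[OF RB.lm_lin[OF that] _ xs]) (simp add: RB.lm_rm that)
  show ?thesis unfolding lam_def case_prod_unfold by (simp add: RB.tau_sum_list[OF xs] tau_Sw[OF xs] 1)
qed

lemma RC_lam:
  assumes "\<And>h. RB.RC n (\<phi> h)"
  shows "RB.RC n (\<lambda>es. lam e (\<lambda>h. \<phi> h es))"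
proof -
  have lm: "RB.RC n (\<lambda>es. lm x (\<psi> es))" if "RB.RC n \<psi>" "x \<in> carrier E" for \<psi> x
    by (rule RB.RC_map[OF that(1) RB.lm_lin[OF that(2)]]) (simp add: RB.lm_rm that)
  show ?thesis unfolding lam_def case_prod_unfold
    by (rule RB.RC_sum_list, rule RC_Sw, rule lm, rule lm, rule assms) simp_all
qed

lemma lam_sum: "lam e (\<lambda>h. \<Sum>w\<in>A. \<phi> w h) = (\<Sum>w\<in>A. lam e (\<phi> w))"
proof -
  have "lam e (\<lambda>h. 0) = 0" using lam_add_fun[of e "\<lambda>_. 0" "\<lambda>_. 0"] by simp
  then show ?thesis by (induction A rule: infinite_finite_induct) (simp_all add: lam_add_fun)
qed

lemma lm_smult_one: "lm (j (sA c 1)) m = sM c m"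
  using j_scale[OF E_closed(4), of c] RB.lm_smult[OF E_closed(4), of c m] by (simp add: E_one RB.lm_one)

text \<open>A cochain is left A-linear in its first argument, hence determined there by its values
  at the \<open>gamma(h)\<close>, the only ones that the contraction uses.\<close>

lemma slot_Elin:
  assumes \<phi>: "\<phi> \<in> RB.HC (Suc n)"
  shows "Elin sM (\<lambda>x. \<phi> (x # es))" "x \<in> carrier E \<Longrightarrow> \<phi> ((j a \<otimes>\<^bsub>E\<^esub> x) # es) = J a (\<phi> (x # es))"
proof -
  interpret vector_space sM by (rule RB.vsM)
  have J0: "J a 0 = 0" for a by (rule klin_zero[OF RB.lm_lin]) simp
  show l: "\<phi> ((j a \<otimes>\<^bsub>E\<^esub> x) # es) = J a (\<phi> (x # es))" if "x \<in> carrier E" for x a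
  proof (cases "length es = n \<and> set es \<subseteq> carrier E")
    case True
    then show ?thesis using RB.HC_left[OF \<phi>, of es "j a" x] that by simp
  next
    case False
    then have "\<phi> (y # es) = 0" for y using RB.HC_zero[OF \<phi>, of "y # es"] by auto
    then show ?thesis by (simp add: J0)
  qed
  show "Elin sM (\<lambda>x. \<phi> (x # es))"
  proof (cases "length es = n \<and> set es \<subseteq> carrier E")
    case True
    then show ?thesis
      using RB.RC_add[OF RB.HC_RC[OF \<phi>], of "[]" es] l by (auto simp: Elin_def j_scale lm_smult_one)
  next
    case False
    then have "\<phi> (y # es) = 0" for y using RB.HC_zero[OF \<phi>, of "y # es"] by auto
    then show ?thesis by (simp add: Elin_def)
  qed
qed

end

locale crossed_resolution = crossed_bimodule sH \<Delta> \<epsilon> S sA act f finv sM lm rm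
  for sH :: "'k::field \<Rightarrow> 'h::{ring,monoid_mult} \<Rightarrow> 'h" and \<Delta> \<epsilon> S
    and sA :: "'k \<Rightarrow> 'a::{ring,monoid_mult} \<Rightarrow> 'a" and act f finv
    and sM :: "'k \<Rightarrow> 'm::ab_group_add \<Rightarrow> 'm" and lm rm +
  fixes sP :: "'k \<Rightarrow> 'p::ab_group_add \<Rightarrow> 'p" and P :: "nat \<Rightarrow> 'p set" and rP :: "'p \<Rightarrow> 'h \<Rightarrow> 'p"
    and d :: "nat \<Rightarrow> 'p \<Rightarrow> 'p" and g :: "'p \<Rightarrow> 'h"
  assumes res: "projective_resolution sH sP P rP d g sH (range \<Pi>R) (HR_action sH \<Delta> \<epsilon>)"
begin

lemma proj: "projective_module sH sP (P n) rP"
  using res by (simp add: projective_resolution_def)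

lemma rmod: "right_module sH sP (P n) rP"
  using proj by (simp add: projective_module_def)

lemma vsP: "vector_space sP"
  using rmod[of 0] by (simp add: right_module_def)

lemma P_sub: "subsp sP (P n)"
  using rmod[of n] by (auto simp: right_module_def subsp_def)

lemmas P_closed = subspD[OF P_sub] subsp_diff[OF vsP P_sub]

lemma rP_in: "x \<in> P n \<Longrightarrow> rP x h \<in> P n" and rP_mult: "x \<in> P n \<Longrightarrow> rP (rP x h) l = rP x (h * l)"
  and rP_klin: "x \<in> P n \<Longrightarrow> klin sH sP (rP x)"
  and rP_add: "x \<in> P n \<Longrightarrow> y \<in> P n \<Longrightarrow> rP (x + y) h = rP x h + rP y h"
  and rP_scale: "x \<in> P n \<Longrightarrow> rP (sP c x) h = sP c (rP x h)"
  using rmod[of n] by (auto simp: right_module_def klin_def)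

lemma d_hom: "right_hom sP (P (Suc n)) rP sP (P n) rP (d n)" and g_hom: "right_hom sP (P 0) rP sH (range \<Pi>R) (HR_action sH \<Delta> \<epsilon>) g"
  using res by (auto simp: projective_resolution_def)

lemma d_in: "x \<in> P (Suc n) \<Longrightarrow> d n x \<in> P n" and d_act: "x \<in> P (Suc n) \<Longrightarrow> d n (rP x h) = rP (d n x) h"
  and d_lin: "lin_on sP sP (P (Suc n)) (d n)"
  using d_hom[of n] by (auto simp: right_hom_def lin_on_def)

lemma g_in: "x \<in> P 0 \<Longrightarrow> g x \<in> range \<Pi>R" and g_act: "x \<in> P 0 \<Longrightarrow> g (rP x h) = \<Pi>R (g x * h)"
  and g_lin: "lin_on sP sH (P 0) g"
  using g_hom by (auto simp: right_hom_def lin_on_def HR_action_def)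

lemma g_PiR: "x \<in> P 0 \<Longrightarrow> \<Pi>R (g x) = g x"
  using g_in PiR_idem by (metis imageE)

lemma g_surj: "g ` P 0 = range \<Pi>R" and ker_g: "{x \<in> P 0. g x = 0} = d 0 ` P 1"
  and ker_d: "{x \<in> P (Suc n). d n x = 0} = d (Suc n) ` P (Suc (Suc n))"
  using res by (auto simp: projective_resolution_def)

lemma d_d: "x \<in> P (Suc (Suc n)) \<Longrightarrow> d n (d (Suc n) x) = 0"
  using ker_d[of n] by blast

lemma g_d: "x \<in> P (Suc 0) \<Longrightarrow> g (d 0 x) = 0"
  using ker_g by auto

section \<open>Terms and differentials of the bicomplex\<close>

definition BB :: "nat \<Rightarrow> nat \<Rightarrow> ('p \<Rightarrow> ('a \<times> 'h) list set list \<Rightarrow> 'm) set" where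
  "BB p q = {\<beta>. (\<forall>x. x \<notin> P q \<longrightarrow> \<beta> x = (\<lambda>_. 0)) \<and> (\<forall>x\<in>P q. \<beta> x \<in> RB.HC p)
     \<and> (\<forall>x\<in>P q. \<forall>y\<in>P q. \<forall>es. \<beta> (x + y) es = \<beta> x es + \<beta> y es)
     \<and> (\<forall>c. \<forall>x\<in>P q. \<forall>es. \<beta> (sP c x) es = sM c (\<beta> x es))
     \<and> (\<forall>x\<in>P q. \<forall>es. Sw 1 (\<lambda>e1 e2. G e1 (\<beta> (rP x e2) es)) = \<beta> x es)}"

lemma BB_off: "\<beta> \<in> BB p q \<Longrightarrow> x \<notin> P q \<Longrightarrow> \<beta> x = (\<lambda>_. 0)" and BB_HC: "\<beta> \<in> BB p q \<Longrightarrow> x \<in> P q \<Longrightarrow> \<beta> x \<in> RB.HC p"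
  and BB_lin: "\<beta> \<in> BB p q \<Longrightarrow> lin_on sP sM (P q) (\<lambda>x. \<beta> x es)"
  and BB_N: "\<beta> \<in> BB p q \<Longrightarrow> x \<in> P q \<Longrightarrow> Sw 1 (\<lambda>e1 e2. G e1 (\<beta> (rP x e2) es)) = \<beta> x es"
  by (auto simp: BB_def lin_on_def)

lemmas BB_add = lin_onD(1)[OF BB_lin] and BB_scale = lin_onD(2)[OF BB_lin]
  and BB_diff = lin_on_diff[OF vsP RB.vsM P_sub BB_lin]

lemma BB_klin: "\<beta> \<in> BB p q \<Longrightarrow> x \<in> P q \<Longrightarrow> klin sH sM (\<lambda>h. \<beta> (rP x h) es)"
  using rP_klin[of x q] by (intro klinI) (simp_all add: klin_add klin_scale BB_add BB_scale rP_in)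

lemma BB_lam_one: "\<beta> \<in> BB p q \<Longrightarrow> x \<in> P q \<Longrightarrow> lam \<one>\<^bsub>E\<^esub> (\<lambda>h. \<beta> (rP x h) es) = \<beta> x es"
  by (simp add: lam_one[OF BB_klin] BB_N)

definition hB :: "nat \<Rightarrow> nat \<Rightarrow> ('p \<Rightarrow> ('a \<times> 'h) list set list \<Rightarrow> 'm) \<Rightarrow> 'p \<Rightarrow> ('a \<times> 'h) list set list \<Rightarrow> 'm" where
  "hB p q \<beta> = (\<lambda>x. if x \<in> P q then RB.diff_with p (\<lambda>e es. lam e (\<lambda>h. \<beta> (rP x h) es)) (\<beta> x) else (\<lambda>_. 0))"

text \<open>The sign in \<open>vB\<close> makes the squares anticommute.\<close>

definition sg :: "nat \<Rightarrow> 'm \<Rightarrow> 'm" where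
  "sg p m = (if even p then m else - m)"

definition vB :: "nat \<Rightarrow> nat \<Rightarrow> ('p \<Rightarrow> ('a \<times> 'h) list set list \<Rightarrow> 'm) \<Rightarrow> 'p \<Rightarrow> ('a \<times> 'h) list set list \<Rightarrow> 'm" where
  "vB p q \<beta> = (\<lambda>x es. if x \<in> P (Suc q) then sg p (\<beta> (d q x) es) else 0)"

definition etaB :: "nat \<Rightarrow> ('p \<Rightarrow> 'm) \<Rightarrow> 'p \<Rightarrow> ('a \<times> 'h) list set list \<Rightarrow> 'm" where
  "etaB q \<phi> = (\<lambda>x es. if es = [] then \<phi> x else 0)"

definition epsB :: "nat \<Rightarrow> (('a \<times> 'h) list set list \<Rightarrow> 'm) \<Rightarrow> 'p \<Rightarrow> ('a \<times> 'h) list set list \<Rightarrow> 'm" where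
  "epsB p \<phi> = (\<lambda>x es. if x \<in> P 0 then G (g x) (\<phi> es) else 0)"

lemma sg_klin: "klin sM sM (sg p)"
proof -
  interpret vector_space sM by (rule RB.vsM)
  show ?thesis by (auto simp: klin_def sg_def)
qed

lemma sg_sg: "sg p (sg p m) = m" and sg_Suc: "sg (Suc p) m = - sg p m"
  by (simp_all add: sg_def)

lemma sg_commute: "klin sM sM F \<Longrightarrow> F (sg p m) = sg p (F m)"
  by (simp add: sg_def klin_minus)

lemma hB_Cons: "x \<in> P q \<Longrightarrow> length es = p \<Longrightarrow> e \<in> carrier E \<Longrightarrow> set es \<subseteq> carrier E
    \<Longrightarrow> hB p q \<beta> x (e # es) = lam e (\<lambda>h. \<beta> (rP x h) es) + RB.tau (\<beta> x) (e # es)"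
  by (simp add: hB_def RB.diff_with_def)

lemma hB_outside: "\<not> (x \<in> P q \<and> length es = Suc p \<and> set es \<subseteq> carrier E) \<Longrightarrow> hB p q \<beta> x es = 0"
  unfolding hB_def RB.diff_with_def by (cases "x \<in> P q") (simp_all only: if_True if_False simp_thms)

lemma hB_cases:
  assumes "\<And>e es'. es = e # es' \<Longrightarrow> x \<in> P q \<Longrightarrow> length es' = p \<Longrightarrow> e \<in> carrier E \<Longrightarrow> set es' \<subseteq> carrier E \<Longrightarrow> Q"
    and "\<not> (x \<in> P q \<and> length es = Suc p \<and> set es \<subseteq> carrier E) \<Longrightarrow> Q"
  shows Q
proof (cases "x \<in> P q \<and> length es = Suc p \<and> set es \<subseteq> carrier E")
  case True
  then show ?thesis using assms(1) by (cases es) auto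
qed (rule assms(2))

lemma vsB: "vector_space (\<lambda>c (\<beta> :: 'p \<Rightarrow> ('a \<times> 'h) list set list \<Rightarrow> 'm) x es. sM c (\<beta> x es))"
proof -
  interpret vector_space sM by (rule RB.vsM)
  show ?thesis by unfold_locales (auto simp: fun_eq_iff scale_right_distrib scale_left_distrib)
qed

lemma vs_fun_scale: "vector_space (fun_scale sM :: 'k \<Rightarrow> ('x \<Rightarrow> 'm) \<Rightarrow> 'x \<Rightarrow> 'm)"
proof -
  interpret vector_space sM by (rule RB.vsM)
  show ?thesis by unfold_locales (auto simp: fun_eq_iff fun_scale_def scale_right_distrib scale_left_distrib)
qed

lemma BB_sub: "subsp (\<lambda>c \<beta> x es. sM c (\<beta> x es)) (BB p q)"
proof -
  interpret vector_space sM by (rule RB.vsM)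
  have G_a: "G h (m + m') = G h m + G h m'" "G h (sM c m) = sM c (G h m)" "G h 0 = 0" for h m m' c
    using klin_add[OF RB.lm_lin] klin_scale[OF RB.lm_lin] klin_zero[OF RB.lm_lin] by auto
  have Sw0: "Sw 1 (\<lambda>_ _. 0) = (0 :: 'm)" by (simp add: Sw_def case_prod_unfold)
  have z: "0 \<in> BB p q" unfolding BB_def using RB.HC_zero_fun by (simp add: zero_fun_def G_a Sw0)
  have a: "\<beta> + \<beta>' \<in> BB p q" if b: "\<beta> \<in> BB p q" "\<beta>' \<in> BB p q" for \<beta> \<beta>'
    unfolding BB_def mem_Collect_eq
  proof (intro conjI ballI allI impI)
    fix x es
    show "x \<notin> P q \<Longrightarrow> (\<beta> + \<beta>') x = (\<lambda>_. 0)" using b by (simp add: BB_off fun_eq_iff)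
    assume x: "x \<in> P q"
    show "(\<beta> + \<beta>') x \<in> RB.HC p" using RB.HC_plus[OF BB_HC[OF b(1) x] BB_HC[OF b(2) x]] by (simp add: plus_fun_def)
    show "Sw 1 (\<lambda>e1 e2. G e1 ((\<beta> + \<beta>') (rP x e2) es)) = (\<beta> + \<beta>') x es"
      using BB_N[OF b(1) x] BB_N[OF b(2) x] by (simp add: G_a Sw_add_fun)
  qed (simp_all add: BB_add[OF b(1)] BB_add[OF b(2)] BB_scale[OF b(1)] BB_scale[OF b(2)] scale_right_distrib)
  have s: "(\<lambda>x es. sM c (\<beta> x es)) \<in> BB p q" if b: "\<beta> \<in> BB p q" for c \<beta>
    unfolding BB_def mem_Collect_eq
  proof (intro conjI ballI allI impI)
    fix x es
    show "x \<notin> P q \<Longrightarrow> (\<lambda>es. sM c (\<beta> x es)) = (\<lambda>_. 0)" using b by (simp add: BB_off fun_eq_iff)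
    assume x: "x \<in> P q"
    show "(\<lambda>es. sM c (\<beta> x es)) \<in> RB.HC p" by (rule RB.HC_scale[OF BB_HC[OF b x]])
    show "Sw 1 (\<lambda>e1 e2. G e1 (sM c (\<beta> (rP x e2) es))) = sM c (\<beta> x es)"
      unfolding BB_N[OF b x, symmetric] by (simp add: G_a Sw_pull[OF klin_scale_right[OF RB.vsM klin_id]])
  qed (simp_all add: BB_add[OF b] BB_scale[OF b] scale_right_distrib mult.commute)
  show ?thesis unfolding subsp_def using z a s by blast
qed

lemma HC_sub: "subsp (fun_scale sM) (RB.HC n)"
proof -
  have "fun_scale sM c \<phi> = (\<lambda>es. sM c (\<phi> es))" for c and \<phi> :: "('a \<times> 'h) list set list \<Rightarrow> 'm"
    by (simp add: fun_eq_iff fun_scale_def)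
  then show ?thesis unfolding subsp_def using RB.HC_zero_fun RB.HC_plus RB.HC_scale
    by (auto simp: zero_fun_def plus_fun_def)
qed

abbreviation "XX \<equiv> hom_cochains sP P rP sM MK mact"

lemma XX_iff: "\<phi> \<in> XX n \<longleftrightarrow> (\<forall>x\<in>P n. \<phi> x \<in> MK) \<and> lin_on sP sM (P n) \<phi> \<and> (\<forall>x\<in>P n. \<forall>h. \<phi> (rP x h) = mact (\<phi> x) h) \<and> (\<forall>x. x \<notin> P n \<longrightarrow> \<phi> x = 0)"
  by (auto simp: hom_cochains_def right_hom_def lin_on_def)

lemma XX_sub: "subsp (fun_scale sM) (XX n)"
proof -
  interpret vector_space sM by (rule RB.vsM)
  note r = right_module_MK[unfolded right_module_def]
  have MK0: "0 \<in> MK" and MKa: "u \<in> MK \<Longrightarrow> v \<in> MK \<Longrightarrow> u + v \<in> MK" and MKs: "v \<in> MK \<Longrightarrow> sM c v \<in> MK" for u v c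
    using r by blast+
  note m = klin_add[OF mact_klin(1)[OF klin_id]] klin_scale[OF mact_klin(1)[OF klin_id]] klin_zero[OF mact_klin(1)[OF klin_id]]
  show ?thesis unfolding subsp_def
    by (auto simp: XX_iff lin_on_def fun_scale_def MK0 MKa MKs m scale_right_distrib mult.commute)
qed

lemma hB_lin: "lin_on (\<lambda>c \<beta> x es. sM c (\<beta> x es)) (\<lambda>c \<beta> x es. sM c (\<beta> x es)) (BB p q) (hB p q)"
proof -
  interpret vector_space sM by (rule RB.vsM)
  have 1: "hB p q (\<beta> + \<beta>') x es = hB p q \<beta> x es + hB p q \<beta>' x es" for \<beta> \<beta>' x es
    by (rule hB_cases[of es x q p]) (simp_all add: hB_Cons hB_outside lam_add_fun RB.tau_add plus_fun_def)
  have 2: "hB p q (\<lambda>x es. sM c (\<beta> x es)) x es = sM c (hB p q \<beta> x es)" for c \<beta> x es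
  proof (rule hB_cases[of es x q p])
    fix e es' assume "es = e # es'" "x \<in> P q" "length es' = p" "e \<in> carrier E" "set es' \<subseteq> carrier E"
    moreover from this have "RB.tau (\<lambda>es. sM c (\<beta> x es)) (e # es') = sM c (RB.tau (\<beta> x) (e # es'))"
      by (intro RB.tau_klin klin_scale_right[OF RB.vsM klin_id]) (simp_all add: klin_scale[OF RB.rm_lin])
    ultimately show ?thesis by (simp add: hB_Cons lam_scale_fun scale_right_distrib)
  qed (simp add: hB_outside)
  show ?thesis unfolding lin_on_def using 1 2 by (simp add: fun_eq_iff)
qed

lemma vB_lin: "lin_on (\<lambda>c \<beta> x es. sM c (\<beta> x es)) (\<lambda>c \<beta> x es. sM c (\<beta> x es)) (BB p q) (vB p q)"
proof -
  interpret vector_space sM by (rule RB.vsM)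
  show ?thesis unfolding lin_on_def vB_def
    by (simp add: fun_eq_iff klin_add[OF sg_klin] klin_scale[OF sg_klin])
qed

lemma hB_in:
  assumes b: "\<beta> \<in> BB p q"
  shows "hB p q \<beta> \<in> BB (Suc p) q"
proof -
  interpret vector_space sM by (rule RB.vsM)
  have HC: "RB.diff_with p (\<lambda>e es. lam e (\<lambda>h. \<beta> (rP x h) es)) (\<beta> x) \<in> RB.HC (Suc p)" if x: "x \<in> P q" for x
  proof (rule RB.diff_with_in_HC[OF BB_HC[OF b x]])
    note k = BB_klin[OF b x]
    show "lam (u \<oplus>\<^bsub>E\<^esub> v) (\<lambda>h. \<beta> (rP x h) es) = lam u (\<lambda>h. \<beta> (rP x h) es) + lam v (\<lambda>h. \<beta> (rP x h) es)"
      if "u \<in> carrier E" "v \<in> carrier E" for u v es using lam_add[OF k that] .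
    show "RB.RC p (\<lambda>es. lam e (\<lambda>h. \<beta> (rP x h) es))" for e
      by (intro RC_lam RB.HC_RC[OF BB_HC[OF b]] rP_in[OF x])
    show "lam (c \<otimes>\<^bsub>E\<^esub> e) (\<lambda>h. \<beta> (rP x h) es) = lm c (lam e (\<lambda>h. \<beta> (rP x h) es))"
      if "c \<in> K" "e \<in> carrier E" for c e es using that lam_J[OF k] by auto
    \<comment> \<open>On K the action through the coaction is the given left action, since
      \<open>j(a) = j(a) 1\<close> and 1 acts on \<open>BB\<close> as the identity.\<close>
    have lK: "lam (j a) (\<lambda>h. \<beta> (rP y h) es) = J a (\<beta> y es)" if y: "y \<in> P q" for a es y
      using lam_J[OF BB_klin[OF b y] E_closed(4), of a es] by (simp add: E_one BB_lam_one[OF b y])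
    show "lam c (\<lambda>h. \<beta> (rP x h) es) = lm c (\<beta> x es)" if "c \<in> K" for c es using that lK[OF x] by auto
    have bal: "lam (e \<otimes>\<^bsub>E\<^esub> j a) (\<lambda>h. \<beta> (rP x h) es) = lam e (\<lambda>h. J a (\<beta> (rP x h) es))" if "e \<in> carrier E" for e a es
      unfolding lam_mult[OF k that j_in] rP_mult[OF x, symmetric] lK[OF rP_in[OF x]] ..
    show "lam (e \<otimes>\<^bsub>E\<^esub> c) (\<lambda>h. \<beta> (rP x h) (y # es)) = lam e (\<lambda>h. \<beta> (rP x h) (c \<otimes>\<^bsub>E\<^esub> y # es))"
      if "c \<in> K" "e \<in> carrier E" "y \<in> carrier E" "Suc (length es) = p" "set es \<subseteq> carrier E" for c e y es
      using that bal RB.HC_left[OF BB_HC[OF b rP_in[OF x]]] by auto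
    show "lam (e \<otimes>\<^bsub>E\<^esub> c) (\<lambda>h. \<beta> (rP x h) []) = rm (lam e (\<lambda>h. \<beta> (rP x h) [])) c"
      if p: "p = 0" and c: "c \<in> K" "e \<in> carrier E" for c e
    proof -
      obtain a where a: "c = j a" using c by auto
      have "J a (\<beta> (rP x h) []) = rm (\<beta> (rP x h) []) (j a)" for h
        using RB.HC_cent[of "\<beta> (rP x h)" "j a"] BB_HC[OF b rP_in[OF x]] p by auto
      then show ?thesis using bal c a by (simp add: lam_rm)
    qed
  qed
  show ?thesis unfolding BB_def mem_Collect_eq
  proof (intro conjI ballI allI impI)
    fix x es
    show "x \<notin> P q \<Longrightarrow> hB p q \<beta> x = (\<lambda>_. 0)" by (simp add: hB_def)
    assume x: "x \<in> P q"
    show "hB p q \<beta> x \<in> RB.HC (Suc p)" using HC[OF x] x by (simp add: hB_def)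
    show "hB p q \<beta> (x + y) es = hB p q \<beta> x es + hB p q \<beta> y es" if y: "y \<in> P q" for y
    proof (rule hB_cases[of es "x + y" q p])
      fix e es' assume e: "es = e # es'" "length es' = p" "e \<in> carrier E" "set es' \<subseteq> carrier E"
      have "\<beta> (x + y) = (\<lambda>es. \<beta> x es + \<beta> y es)" using BB_add[OF b x y] by auto
      then show ?thesis using e x y
        by (simp add: hB_Cons P_closed rP_add[OF x y] BB_add[OF b] rP_in[OF x] rP_in[OF y] lam_add_fun RB.tau_add)
    qed (use x y P_closed in \<open>simp add: hB_outside\<close>)
    show "hB p q \<beta> (sP c x) es = sM c (hB p q \<beta> x es)" for c
    proof (rule hB_cases[of es "sP c x" q p])
      fix e es' assume e: "es = e # es'" "length es' = p" "e \<in> carrier E" "set es' \<subseteq> carrier E"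
      have "\<beta> (sP c x) = (\<lambda>es. sM c (\<beta> x es))" using BB_scale[OF b x] by auto
      moreover have "RB.tau (\<lambda>es. sM c (\<beta> x es)) (e # es') = sM c (RB.tau (\<beta> x) (e # es'))"
        using e by (intro RB.tau_klin klin_scale_right[OF RB.vsM klin_id]) (simp_all add: klin_scale[OF RB.rm_lin])
      ultimately show ?thesis using e x
        by (simp add: hB_Cons P_closed rP_scale[OF x] BB_scale[OF b] rP_in[OF x] lam_scale_fun scale_right_distrib)
    qed (use x P_closed in \<open>simp add: hB_outside\<close>)
    show "Sw 1 (\<lambda>e1 e2. G e1 (hB p q \<beta> (rP x e2) es)) = hB p q \<beta> x es"
    proof (rule hB_cases[of es x q p])
      fix e es' assume e: "es = e # es'" "length es' = p" "e \<in> carrier E" "set es' \<subseteq> carrier E"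
      have sub: "set (e # es') \<subseteq> carrier E" using e by simp
      have l: "klin sH sM (\<lambda>k. lam e (\<lambda>h. \<beta> (rP x (k * h)) es'))"
        by (rule lam_klin_fun) (intro klin_comp[OF BB_klin[OF b x]] lin)
      have "Sw 1 (\<lambda>e1 e2. G e1 (hB p q \<beta> (rP x e2) es))
         = Sw 1 (\<lambda>e1 e2. G e1 (lam e (\<lambda>h. \<beta> (rP x (e2 * h)) es'))) + Sw 1 (\<lambda>e1 e2. G e1 (RB.tau (\<beta> (rP x e2)) es))"
        using e by (simp add: hB_Cons rP_in[OF x] rP_mult[OF x] klin_add[OF RB.lm_lin] Sw_add_fun)
      \<comment> \<open>Averaging is the operator of 1, and \<open>1 e = e\<close>.\<close>
      also have "Sw 1 (\<lambda>e1 e2. G e1 (lam e (\<lambda>h. \<beta> (rP x (e2 * h)) es'))) = lam e (\<lambda>h. \<beta> (rP x h) es')"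
        unfolding lam_one[OF l, symmetric] lam_mult[OF BB_klin[OF b x] E_closed(4) e(3), symmetric] E_one[OF e(3)] ..
      also have "Sw 1 (\<lambda>e1 e2. G e1 (RB.tau (\<beta> (rP x e2)) es)) = RB.tau (\<lambda>zs. Sw 1 (\<lambda>e1 e2. G e1 (\<beta> (rP x e2) zs))) es"
        unfolding e(1) tau_Sw[OF sub] by (rule Sw_cong, rule RB.tau_klin[symmetric, OF RB.lm_lin _ sub]) (simp_all add: RB.lm_rm)
      also have "\<dots> = RB.tau (\<beta> x) es" unfolding BB_N[OF b x] ..
      finally show ?thesis using e x by (simp add: hB_Cons)
    qed (use x in \<open>simp add: hB_outside rP_in klin_zero[OF RB.lm_lin] Sw_def case_prod_unfold\<close>)
  qed
qed

lemma BB_pullback: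
  assumes b: "\<beta> \<in> BB p q" and F: "\<And>x. x \<in> P q' \<Longrightarrow> F x \<in> P q" "lin_on sP sP (P q') F" "\<And>x h. x \<in> P q' \<Longrightarrow> F (rP x h) = rP (F x) h"
  shows "(\<lambda>x es. if x \<in> P q' then sg n (\<beta> (F x) es) else 0) \<in> BB p q'"
  unfolding BB_def mem_Collect_eq
proof (intro conjI ballI allI impI)
  note s = klin_add[OF sg_klin] klin_scale[OF sg_klin]
  fix x es
  assume x: "x \<in> P q'"
  have "(\<lambda>es. sg n (\<beta> (F x) es)) \<in> RB.HC p"
    by (rule RB.HC_map[OF BB_HC[OF b F(1)[OF x]] sg_klin]) (simp_all add: sg_def klin_minus[OF RB.lm_lin] klin_minus[OF RB.rm_lin] RB.K_in)
  then show "(\<lambda>es. if x \<in> P q' then sg n (\<beta> (F x) es) else 0) \<in> RB.HC p" using x by simp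
  show "(if x + y \<in> P q' then sg n (\<beta> (F (x + y)) es) else 0) = (if x \<in> P q' then sg n (\<beta> (F x) es) else 0) + (if y \<in> P q' then sg n (\<beta> (F y) es) else 0)"
    if "y \<in> P q'" for y using that x by (simp add: P_closed lin_onD[OF F(2)] BB_add[OF b] F(1) s)
  show "(if sP c x \<in> P q' then sg n (\<beta> (F (sP c x)) es) else 0) = sM c (if x \<in> P q' then sg n (\<beta> (F x) es) else 0)" for c
    using x by (simp add: P_closed lin_onD[OF F(2)] BB_scale[OF b] F(1) s)
  show "Sw 1 (\<lambda>e1 e2. G e1 (if rP x e2 \<in> P q' then sg n (\<beta> (F (rP x e2)) es) else 0)) = (if x \<in> P q' then sg n (\<beta> (F x) es) else 0)"
    using x BB_N[OF b F(1)[OF x], of es] by (simp add: rP_in F(3) sg_commute[OF RB.lm_lin] Sw_pull[OF sg_klin, symmetric])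
qed auto

lemma vB_in: "\<beta> \<in> BB p q \<Longrightarrow> vB p q \<beta> \<in> BB p (Suc q)"
  unfolding vB_def by (rule BB_pullback[OF _ d_in d_lin d_act])

text \<open>The terms with the product of the first two arguments cancel by \<open>lam_mult\<close>,
  the mixed terms cancel by \<open>tau_lam\<close>, and the rest is the square of the
  remainder.\<close>

lemma hB_hB:
  assumes b: "\<beta> \<in> BB p q"
  shows "hB (Suc p) q (hB p q \<beta>) = 0"
proof (intro ext)
  fix x es
  show "hB (Suc p) q (hB p q \<beta>) x es = 0 x es"
  proof (rule hB_cases[of es x q "Suc p"])
    fix c es1 assume x: "x \<in> P q" and es: "es = c # es1" "length es1 = Suc p" "c \<in> carrier E" "set es1 \<subseteq> carrier E"
    obtain e es' where es1: "es1 = e # es'" "length es' = p" "e \<in> carrier E" "set es' \<subseteq> carrier E"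
      using es by (cases es1) auto
    have sub: "set (e # es') \<subseteq> carrier E" using es1 by simp
    let ?L = "lam (c \<otimes>\<^bsub>E\<^esub> e) (\<lambda>h. \<beta> (rP x h) es')"
    let ?A = "lam c (\<lambda>h. RB.tau (\<beta> (rP x h)) (e # es'))"
    have 1: "lam c (\<lambda>h. hB p q \<beta> (rP x h) (e # es')) = ?L + ?A"
      using es1 by (simp add: hB_Cons rP_in[OF x] rP_mult[OF x] lam_add_fun lam_mult[OF BB_klin[OF b x] es(3) es1(3)])
    have 2: "hB p q \<beta> x (c \<otimes>\<^bsub>E\<^esub> e # es') = ?L + RB.tau (\<beta> x) (c \<otimes>\<^bsub>E\<^esub> e # es')"
      using es es1 x by (simp add: hB_Cons E_closed)
    have "RB.tau (\<lambda>zs. hB p q \<beta> x (c # zs)) (e # es') = RB.tau (\<lambda>zs. lam c (\<lambda>h. \<beta> (rP x h) zs) + RB.tau (\<beta> x) (c # zs)) (e # es')"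
      using es es1 x by (intro RB.tau_cong[OF _ sub]) (simp add: hB_Cons)
    also have "\<dots> = ?A + RB.tau (\<lambda>zs. RB.tau (\<beta> x) (c # zs)) (e # es')"
      unfolding RB.tau_add[OF sub] tau_lam[OF sub] ..
    finally have 3: "RB.tau (\<lambda>zs. hB p q \<beta> x (c # zs)) (e # es') = \<dots>" .
    have "RB.tau (RB.tau (\<beta> x)) (c # e # es') = 0"
      using es es1 by (intro RB.tau_tau) auto
    then show ?thesis using es es1 x 1 2 3 by (simp add: hB_Cons)
  qed (simp add: hB_outside)
qed

lemma vB_vB:
  assumes b: "\<beta> \<in> BB p q"
  shows "vB p (Suc q) (vB p q \<beta>) = 0"
proof (intro ext)
  fix x es
  show "vB p (Suc q) (vB p q \<beta>) x es = 0 x es"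
    by (simp add: vB_def d_in d_d BB_diff(1)[OF b] klin_zero[OF sg_klin])
qed

lemma hB_vB:
  assumes b: "\<beta> \<in> BB p q"
  shows "hB p (Suc q) (vB p q \<beta>) + vB (Suc p) q (hB p q \<beta>) = 0"
proof (intro ext)
  fix x es
  show "(hB p (Suc q) (vB p q \<beta>) + vB (Suc p) q (hB p q \<beta>)) x es = 0 x es"
  proof (rule hB_cases[of es x "Suc q" p])
    fix e es' assume x: "x \<in> P (Suc q)" and es: "es = e # es'" "length es' = p" "e \<in> carrier E" "set es' \<subseteq> carrier E"
    have sub: "set (e # es') \<subseteq> carrier E" using es by simp
    have s: "lam e (\<lambda>h. sg p (F h)) = sg p (lam e F)" for F
      using lam_scale_fun[of e "-1" F] by (cases "even p") (simp_all add: sg_def RB.sM_minus vector_space.vector_space_assms(4)[OF RB.vsM])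
    have "RB.tau (\<lambda>zs. sg p (\<beta> (d q x) zs)) (e # es') = sg p (RB.tau (\<beta> (d q x)) (e # es'))"
      by (rule RB.tau_klin[OF sg_klin _ sub]) (simp add: sg_commute[OF RB.rm_lin])
    moreover have "vB p q \<beta> x = (\<lambda>zs. sg p (\<beta> (d q x) zs))" using x by (simp add: vB_def)
    ultimately have "hB p (Suc q) (vB p q \<beta>) x es = sg p (hB p q \<beta> (d q x) es)"
      using x es by (simp add: hB_Cons d_in klin_add[OF sg_klin] s[symmetric]) (simp add: vB_def rP_in d_act)
    then show ?thesis using x by (simp add: vB_def[of "Suc p"] sg_Suc)
  next
    assume n: "\<not> (x \<in> P (Suc q) \<and> length es = Suc p \<and> set es \<subseteq> carrier E)"
    then have "vB (Suc p) q (hB p q \<beta>) x es = 0"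
      using hB_outside[of "d q x" q es p \<beta>] by (cases "x \<in> P (Suc q)") (simp_all add: vB_def klin_zero[OF sg_klin])
    then show ?thesis using hB_outside[OF n] by simp
  qed
qed

section \<open>Edge maps and exactness\<close>

lemma G_zero: "G h 0 = 0"
  by (rule klin_zero[OF RB.lm_lin]) simp

lemma Sw_zero_fun: "Sw h (\<lambda>_ _. 0) = 0"
  by (simp add: Sw_def case_prod_unfold)

lemma lam_gam: "klin sH sM F \<Longrightarrow> lam (\<gamma> l) F = Sw l (\<lambda>l1 l2. G l1 (F l2))"
  by (simp add: gam_ce lam_ce CA.J_one)

lemma etaB_in:
  assumes \<phi>: "\<phi> \<in> XX q"
  shows "etaB q \<phi> \<in> BB 0 q"
proof -
  note x = \<phi>[unfolded XX_iff]
  have l\<phi>: "lin_on sP sM (P q) \<phi>" using x by blast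
  have HC: "(\<lambda>es. if es = [] then m else 0) \<in> RB.HC 0" if "m \<in> MK" for m
    by (rule RB.HC_I) (use that in \<open>auto simp: RB.RC_def centralizer_def\<close>)
  show ?thesis unfolding BB_def mem_Collect_eq
  proof (intro conjI ballI allI impI)
    fix z es
    show "z \<notin> P q \<Longrightarrow> etaB q \<phi> z = (\<lambda>_. 0)" using x by (auto simp: etaB_def)
    assume z: "z \<in> P q"
    show "etaB q \<phi> z \<in> RB.HC 0" using HC x z by (simp add: etaB_def)
    show "etaB q \<phi> (z + y) es = etaB q \<phi> z es + etaB q \<phi> y es" if "y \<in> P q" for y
      using lin_onD(1)[OF l\<phi> z that] by (simp add: etaB_def)
    show "etaB q \<phi> (sP c z) es = sM c (etaB q \<phi> z es)" for c
      using lin_onD(2)[OF l\<phi> z] klin_zero[OF klin_scale_right[OF RB.vsM klin_id]] by (simp add: etaB_def)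
    have m: "\<phi> z \<in> MK" "\<phi> (rP z h) = mact (\<phi> z) h" for h using x z by auto
    have "Sw 1 (\<lambda>e1 e2. G e1 (mact (\<phi> z) e2)) = lam \<one>\<^bsub>E\<^esub> (\<lambda>h. mact (\<phi> z) h)"
      by (rule lam_one[symmetric]) (intro lin)
    also have "\<dots> = \<phi> z" by (simp add: lam_mact[OF m(1)] E_closed RB.rm_one)
    finally show "Sw 1 (\<lambda>e1 e2. G e1 (etaB q \<phi> (rP z e2) es)) = etaB q \<phi> z es"
      by (simp add: etaB_def m G_zero Sw_zero_fun)
  qed
qed

lemma hB_etaB:
  assumes \<phi>: "\<phi> \<in> XX q"
  shows "hB 0 q (etaB q \<phi>) = 0"
proof (intro ext)
  fix x es
  show "hB 0 q (etaB q \<phi>) x es = 0 x es"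
  proof (rule hB_cases[of es x q 0])
    fix e es' assume x: "x \<in> P q" and es: "es = e # es'" "length es' = 0" "e \<in> carrier E" "set es' \<subseteq> carrier E"
    have m: "\<phi> x \<in> MK" "\<phi> (rP x h) = mact (\<phi> x) h" for h using \<phi> x by (auto simp: XX_iff)
    show ?thesis using x es by (simp add: hB_Cons etaB_def m lam_mact[OF m(1)])
  qed (simp add: hB_outside)
qed

lemma vB_etaB: "vB 0 q (etaB q \<phi>) = etaB (Suc q) (hom_diff P d q \<phi>)"
  by (simp add: fun_eq_iff vB_def etaB_def hom_diff_def sg_def)

lemma hom_diff_in:
  assumes \<phi>: "\<phi> \<in> XX n"
  shows "hom_diff P d n \<phi> \<in> XX (Suc n)"
proof -
  have lin: "lin_on sP sM (P n) \<phi>" using \<phi> by (simp add: XX_iff)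
  show ?thesis using \<phi> lin_onD[OF lin] lin_onD[OF d_lin] unfolding XX_iff
    by (auto simp: hom_diff_def lin_on_def d_in d_act P_closed rP_in)
qed

lemma epsB_in:
  assumes \<phi>: "\<phi> \<in> RB.HC p"
  shows "epsB p \<phi> \<in> BB p 0"
  unfolding BB_def mem_Collect_eq
proof (intro conjI ballI allI impI)
  fix x es
  show "x \<notin> P 0 \<Longrightarrow> epsB p \<phi> x = (\<lambda>_. 0)" by (simp add: epsB_def)
  assume x: "x \<in> P 0"
  have "(\<lambda>es. G (g x) (\<phi> es)) \<in> RB.HC p"
  proof (rule RB.HC_map[OF \<phi>])
    show "klin sM sM (lm (\<gamma> (g x)))" by (rule RB.lm_lin) simp
    show "G (g x) (lm c m) = lm c (G (g x) m)" if "c \<in> K" for c m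
      using that G_J_PiR[of "g x"] g_PiR[OF x] by auto
  qed (simp add: RB.lm_rm)
  then show "epsB p \<phi> x \<in> RB.HC p" using x by (simp add: epsB_def)
  have gl: "klin sH sM (\<lambda>h. G h m)" for m by (intro lin)
  show "epsB p \<phi> (x + y) es = epsB p \<phi> x es + epsB p \<phi> y es" if "y \<in> P 0" for y
    using x that by (simp add: epsB_def P_closed lin_onD[OF g_lin] klin_add[OF gl])
  show "epsB p \<phi> (sP c x) es = sM c (epsB p \<phi> x es)" for c
    using x by (simp add: epsB_def P_closed lin_onD[OF g_lin] klin_scale[OF gl])
  have "Sw 1 (\<lambda>e1 e2. G e1 (G (\<Pi>R (\<Pi>R (g x) * e2)) (\<phi> es))) = lam \<one>\<^bsub>E\<^esub> (\<lambda>h. G (\<Pi>R (\<Pi>R (g x) * h)) (\<phi> es))"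
    by (rule lam_one[symmetric]) (intro lin)
  also have "\<dots> = G (\<Pi>R (g x)) (\<phi> es)" by (simp add: lam_G_PiR E_closed RB.lm_one)
  finally show "Sw 1 (\<lambda>e1 e2. G e1 (epsB p \<phi> (rP x e2) es)) = epsB p \<phi> x es"
    using x by (simp add: epsB_def rP_in g_act g_PiR)
qed

lemma vB_epsB: "vB p 0 (epsB p \<phi>) = 0"
proof -
  have "G 0 m = 0" for m by (rule klin_zero[of sH sM]) (intro lin)
  then show ?thesis by (simp add: fun_eq_iff vB_def epsB_def d_in g_d klin_zero[OF sg_klin])
qed

lemma hB_epsB:
  assumes \<phi>: "\<phi> \<in> RB.HC p"
  shows "hB p 0 (epsB p \<phi>) = epsB (Suc p) (hochschild_diff E sM lm rm p \<phi>)"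
proof (intro ext)
  fix x es
  show "hB p 0 (epsB p \<phi>) x es = epsB (Suc p) (hochschild_diff E sM lm rm p \<phi>) x es"
  proof (rule hB_cases[of es x 0 p])
    fix e es' assume x: "x \<in> P 0" and es: "es = e # es'" "length es' = p" "e \<in> carrier E" "set es' \<subseteq> carrier E"
    have "lam e (\<lambda>h. G (g (rP x h)) (\<phi> es')) = G (g x) (lm e (\<phi> es'))"
      using lam_G_PiR[OF es(3), of "g x" "\<phi> es'"] x by (simp add: g_act g_PiR)
    moreover have "RB.tau (\<lambda>es. G (g x) (\<phi> es)) (e # es') = G (g x) (RB.tau \<phi> (e # es'))"
      by (rule RB.tau_klin[OF RB.lm_lin]) (use es in \<open>simp_all add: RB.lm_rm\<close>)
    ultimately show ?thesis using x es RB.hochschild_diff_tau[of es p \<phi>]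
      by (simp add: hB_Cons) (simp add: epsB_def rP_in klin_add[OF RB.lm_lin])
  next
    assume n: "\<not> (x \<in> P 0 \<and> length es = Suc p \<and> set es \<subseteq> carrier E)"
    show ?thesis unfolding hB_outside[OF n] using n
      by (auto simp: epsB_def hochschild_diff_def G_zero)
  qed
qed

text \<open>1 is \<open>PiR(1)\<close>, hence in H^R. Evaluation at a preimage of 1 recovers \<phi>
  from its edge image.\<close>

lemma base_point: "\<exists>x\<in>P 0. g x = 1"
  using g_surj PiR_one by (metis imageE rangeI)

lemma epsB_inj:
  assumes "epsB p \<phi> = 0"
  shows "\<phi> = 0"
proof
  fix es
  obtain x where x: "x \<in> P 0" "g x = 1" using base_point by blast
  have "epsB p \<phi> x es = 0" using assms by simp
  then show "\<phi> es = 0 es" using x by (simp add: epsB_def gam_one RB.lm_one)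
qed

lemma etaB_inj:
  assumes "etaB q \<phi> = 0"
  shows "\<phi> = 0"
proof
  fix x
  have "etaB q \<phi> x [] = 0" using assms by simp
  then show "\<phi> x = 0 x" by (simp add: etaB_def)
qed

text \<open>The inverse of \<open>gamma\<close> undoes the action of \<open>gamma\<close> on
  \<open>BB\<close>: \<open>gamma^{-1}(h1) gamma(h2)\<close> is \<open>gamma(PiR)\<close>, which
  \<open>Sw_PiR_left\<close> turns into averaging over Delta(1), the identity on
  \<open>BB\<close>.\<close>

lemma G'_lam:
  assumes b: "\<beta> \<in> BB p q" and y: "y \<in> P q"
  shows "Sw k (\<lambda>h1 h2. CA.G' h1 (lam (\<gamma> h2) (\<lambda>h. \<beta> (rP y h) es))) = \<beta> (rP y k) es"
proof -
  note lF = lin klin_comp[OF BB_klin[OF b y]]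
  have "Sw k (\<lambda>h1 h2. CA.G' h1 (lam (\<gamma> h2) (\<lambda>h. \<beta> (rP y h) es)))
      = Sw k (\<lambda>w l2. Sw w (\<lambda>h1 l1. CA.G' h1 (G l1 (\<beta> (rP y l2) es))))"
    unfolding lam_gam[OF BB_klin[OF b y]] CA.G_Sw by (rule Sw_coassoc[symmetric, where sW=sM]) (intro lF)
  also have "\<dots> = Sw 1 (\<lambda>e1 e2. G e1 (\<beta> (rP y (k * e2)) es))"
    unfolding CA.G'_G by (rule Sw_PiR_left[OF RB.vsM]) (intro lF)
  also have "\<dots> = \<beta> (rP y k) es"
    unfolding rP_mult[OF y, symmetric] by (rule BB_N[OF b rP_in[OF y]])
  finally show ?thesis .
qed

text \<open>At the argument \<open>gamma(l)\<close> the cocycle condition equates the action through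
  the coaction with the right action on M. Applying the inverse of \<open>gamma\<close> and
  \<open>G'_lam\<close> turns this into H-linearity for the action on M^K.\<close>

lemma row0:
  assumes b: "\<beta> \<in> BB 0 q" and h: "hB 0 q \<beta> = 0"
  shows "\<exists>\<phi>\<in>XX q. \<beta> = etaB q \<phi>"
proof
  let ?\<phi> = "\<lambda>x. \<beta> x []"
  have z: "\<beta> x es = 0" if "es \<noteq> []" for x es
    using RB.HC_zero[OF BB_HC[OF b], of x es] BB_off[OF b, of x] that by (cases "x \<in> P q") auto
  then show "\<beta> = etaB q ?\<phi>" by (auto simp: fun_eq_iff etaB_def)
  have "\<beta> (rP x h) [] = mact (\<beta> x []) h" if x: "x \<in> P q" for x h
  proof -
    have "lam (\<gamma> l) (\<lambda>h. \<beta> (rP x h) []) = rm (\<beta> x []) (\<gamma> l)" for l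
      using fun_cong[OF fun_cong[OF h], of x "[\<gamma> l]"] x by (simp add: hB_Cons)
    then show ?thesis using G'_lam[OF b x, of h "[]"] by (simp add: mact_Sw)
  qed
  moreover have "\<beta> x [] \<in> MK" if "x \<in> P q" for x
    using RB.HC_cent[OF BB_HC[OF b that]] by (auto simp: centralizer_def)
  ultimately show "?\<phi> \<in> XX q" using BB_lin[OF b] BB_off[OF b] by (simp add: XX_iff)
qed

lemma BB_sum:
  assumes b: "\<beta> \<in> BB p q" and y: "\<And>w. y w \<in> P q"
  shows "finite A \<Longrightarrow> (\<Sum>w\<in>A. y w) \<in> P q \<and> \<beta> (\<Sum>w\<in>A. y w) es = (\<Sum>w\<in>A. \<beta> (y w) es)"
  by (induction A rule: finite_induct) (simp_all add: P_closed y BB_add[OF b] BB_diff(1)[OF b])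

lemma row:
  assumes b: "\<beta> \<in> BB (Suc p) q" and h: "hB (Suc p) q \<beta> = 0"
  shows "\<exists>\<beta>'\<in>BB p q. \<beta> = hB p q \<beta>'"
proof -
  interpret vector_space sM by (rule RB.vsM)
  let ?sF = "\<lambda>c. Poly_Mapping.map (sH c) :: ('p \<Rightarrow>\<^sub>0 'h) \<Rightarrow> ('p \<Rightarrow>\<^sub>0 'h)"
  let ?rF = "\<lambda>F h. Poly_Mapping.map (\<lambda>x. x * h) F :: 'p \<Rightarrow>\<^sub>0 'h"
  obtain i \<pi> where i: "right_hom sP (P q) rP ?sF UNIV ?rF i" and \<pi>: "right_hom ?sF UNIV ?rF sP (P q) rP \<pi>"
    and \<pi>i: "\<And>x. x \<in> P q \<Longrightarrow> \<pi> (i x) = x"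
    using proj[of q] unfolding projective_module_def Let_def by blast
  \<comment> \<open>Dual basis: every x in \<open>P q\<close> is the sum of the \<open>pw w\<close>
    times the coefficient of \<open>i x\<close> at w.\<close>
  define pw where "pw w = \<pi> (Poly_Mapping.single w 1)" for w
  have pw: "pw w \<in> P q" for w using \<pi> by (simp add: pw_def right_hom_def)
  define T where "T w es = (\<lambda>e. \<beta> (pw w) (e # es))" for w es
  have T: "Elin sM (T w es)" "x \<in> carrier E \<Longrightarrow> T w es (j a \<otimes>\<^bsub>E\<^esub> x) = J a (T w es x)" for w es a x
    using slot_Elin[OF BB_HC[OF b pw]] by (simp_all add: T_def)
  have LTl: "klin sH sM (LT (T w es))" for w es
    using LT_klin[OF T klin_id] .
  \<comment> \<open>The contraction formula for an arbitrary element of the free module, where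
    linearity can be checked coefficient by coefficient.\<close>
  define ev where "ev F es = (\<Sum>w\<in>Poly_Mapping.keys F. LT (T w es) (Poly_Mapping.lookup F w))" for F es
  have ev: "ev F es = (\<Sum>w\<in>A. LT (T w es) (Poly_Mapping.lookup F w))"
    if "finite A" "Poly_Mapping.keys F \<subseteq> A" for F es A
    unfolding ev_def by (rule psum_superset[where \<Psi>="\<lambda>w. LT (T w es)", OF klin_zero[OF LTl] that])
  have ev_add: "ev (F + F') es = ev F es + ev F' es" for F F' es
  proof -
    let ?A = "Poly_Mapping.keys F \<union> Poly_Mapping.keys F'"
    have "Poly_Mapping.keys (F + F') \<subseteq> ?A" by (rule Poly_Mapping.keys_add)
    then show ?thesis using ev[of ?A F] ev[of ?A F'] ev[of ?A "F + F'"]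
      by (simp add: lookup_add klin_add[OF LTl] sum.distrib)
  qed
  have keys_map: "Poly_Mapping.keys (Poly_Mapping.map u F) \<subseteq> Poly_Mapping.keys F" if "u 0 = 0" for u :: "'h \<Rightarrow> 'h" and F :: "'p \<Rightarrow>\<^sub>0 'h"
    using that by (auto simp: in_keys_iff lookup_map_zero)
  have sH0: "sH c 0 = 0" for c using klin_zero[OF klin_scale_right[OF vs klin_id]] .
  have ev_scale: "ev (?sF c F) es = sM c (ev F es)" for c F es
    using ev[OF _ keys_map[of "sH c" F]] ev_def[of F es]
    by (simp add: lookup_map_zero sH0 klin_scale[OF LTl] scale_sum_right)
  have ev_act: "ev (?rF F h) es = (\<Sum>w\<in>Poly_Mapping.keys F. LT (T w es) (Poly_Mapping.lookup F w * h))" for F h es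
    using ev[OF _ keys_map[of "\<lambda>x. x * h" F]] by (simp add: lookup_map_zero)
  have i_add: "x \<in> P q \<Longrightarrow> y \<in> P q \<Longrightarrow> i (x + y) = i x + i y" and i_scale: "x \<in> P q \<Longrightarrow> i (sP c x) = ?sF c (i x)"
    and i_act: "x \<in> P q \<Longrightarrow> i (rP x h) = ?rF (i x) h" for x y c h
    using i by (auto simp: right_hom_def)
  have lam_ev: "lam e (\<lambda>h. ev (?rF F h) es) = (\<Sum>w\<in>Poly_Mapping.keys F. Sw (Poly_Mapping.lookup F w) (\<lambda>h1 h2. CA.G' h1 (T w es (\<gamma> h2 \<otimes>\<^bsub>E\<^esub> e))))"
    if "e \<in> carrier E" for e F es
    unfolding ev_act lam_sum by (rule sum.cong[OF HOL.refl]) (rule lam_LT[OF T that])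
  define \<beta>' where "\<beta>' x es = (if x \<in> P q then ev (i x) es else 0)" for x es
  have HC_ev: "ev F \<in> RB.HC p" for F
  proof (rule RB.HC_I)
    have G': "klin sM sM (CA.G' h)" for h by (intro lin)
    have "RB.RC p (\<lambda>es. LT (T w es) k)" for w k
      unfolding LT_def T_def
      by (rule RC_Sw, rule RB.RC_map[OF RB.RC_Cons[OF RB.HC_RC[OF BB_HC[OF b pw]]] G']) (simp_all add: G'_rm)
    then have "RB.RC p (\<lambda>es. ev F es)" unfolding ev_def by (intro RB.RC_sum)
    then show "RB.RC p (ev F)" .
    have G'0: "CA.G' h 0 = 0" for h by (rule klin_zero[OF G'])
    show "ev F xs = 0" if "\<not> (length xs = p \<and> set xs \<subseteq> carrier E)" for xs
    proof -
      have "T w xs e = 0" for w e using RB.HC_zero[OF BB_HC[OF b pw], of "e # xs"] that by (auto simp: T_def)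
      then show ?thesis by (simp add: ev_def LT_def G'0 Sw_zero_fun)
    qed
    have sumJ: "J a (ev F es) = (\<Sum>w\<in>Poly_Mapping.keys F. J a (LT (T w es) (Poly_Mapping.lookup F w)))" for a es
      unfolding ev_def by (rule klin_sum[OF RB.lm_lin]) simp
    have LJ: "J a (LT (T w es) k) = Sw k (\<lambda>h1 h2. CA.G' h1 (T w es (\<gamma> h2 \<otimes>\<^bsub>E\<^esub> j a)))" for a w es k
      by (rule LT_J[OF T, symmetric])
    show "ev F (c \<otimes>\<^bsub>E\<^esub> x # xs) = lm c (ev F (x # xs))"
      if s: "Suc (length xs) = p" "c \<in> K" "x \<in> carrier E" "set xs \<subseteq> carrier E" for c x xs
    proof -
      obtain a where a: "c = j a" using s by auto
      have "T w (c \<otimes>\<^bsub>E\<^esub> x # xs) (\<gamma> h2) = T w (x # xs) (\<gamma> h2 \<otimes>\<^bsub>E\<^esub> j a)" for w h2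
        using RB.RC_bal[OF RB.HC_RC[OF BB_HC[OF b pw]], of "[]" xs c "\<gamma> h2" x] s a by (simp add: T_def)
      then show ?thesis unfolding a sumJ LJ by (simp add: ev_def LT_def a)
    qed
    show "lm c (ev F []) = rm (ev F []) c" if s: "p = 0" "c \<in> K" for c
    proof -
      obtain a where a: "c = j a" using s by auto
      have "T w [] (\<gamma> h2 \<otimes>\<^bsub>E\<^esub> j a) = rm (T w [] (\<gamma> h2)) c" for w h2
        using RB.RC_right[OF RB.HC_RC[OF BB_HC[OF b pw]], of "[]" c "\<gamma> h2"] s a by (simp add: T_def)
      moreover have "rm (ev F []) c = (\<Sum>w\<in>Poly_Mapping.keys F. rm (LT (T w []) (Poly_Mapping.lookup F w)) c)"
        unfolding ev_def by (rule klin_sum[OF RB.rm_lin]) (simp add: a)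
      ultimately show ?thesis unfolding a sumJ LJ by (simp add: LT_def rm_Sw G'_rm)
    qed
  qed
  have in_BB: "\<beta>' \<in> BB p q"
    unfolding BB_def mem_Collect_eq
  proof (intro conjI ballI allI impI)
    fix x es
    show "x \<notin> P q \<Longrightarrow> \<beta>' x = (\<lambda>_. 0)" by (simp add: \<beta>'_def fun_eq_iff)
    assume x: "x \<in> P q"
    have "\<beta>' x = ev (i x)" using x by (simp add: \<beta>'_def fun_eq_iff)
    then show "\<beta>' x \<in> RB.HC p" using HC_ev by simp
    show "\<beta>' (x + y) es = \<beta>' x es + \<beta>' y es" if "y \<in> P q" for y
      using x that by (simp add: \<beta>'_def P_closed i_add ev_add)
    show "\<beta>' (sP c x) es = sM c (\<beta>' x es)" for c
      using x by (simp add: \<beta>'_def P_closed i_scale ev_scale)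
    have mk: "klin sH sM (\<lambda>h. LT (T w es) (z * h))" for w z
      by (rule klin_comp[OF LTl]) (intro lin)
    have k: "klin sH sM (\<lambda>h. ev (?rF (i x) h) es)"
      unfolding ev_act by (rule klinI) (simp_all add: klin_add[OF mk] klin_scale[OF mk] sum.distrib scale_sum_right)
    have "Sw 1 (\<lambda>e1 e2. G e1 (\<beta>' (rP x e2) es)) = lam \<one>\<^bsub>E\<^esub> (\<lambda>h. ev (?rF (i x) h) es)"
      using x by (simp add: \<beta>'_def rP_in i_act lam_one[OF k])
    \<comment> \<open>The operator of 1 multiplies the argument \<open>gamma(h2)\<close> by 1, so
      averaging leaves the contraction unchanged.\<close>
    also have "\<dots> = \<beta>' x es"
      unfolding lam_ev[OF E_closed(4)] using x by (simp add: \<beta>'_def ev_def LT_def E_one)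
    finally show "Sw 1 (\<lambda>e1 e2. G e1 (\<beta>' (rP x e2) es)) = \<beta>' x es" .
  qed
  have "\<beta> x es = hB p q \<beta>' x es" for x es
  proof (rule hB_cases[of es x q p])
    fix e es' assume x: "x \<in> P q" and es: "es = e # es'" "length es' = p" "e \<in> carrier E" "set es' \<subseteq> carrier E"
    have sub: "set (e # es') \<subseteq> carrier E" using es by simp
    let ?A = "Poly_Mapping.keys (i x)" and ?k = "Poly_Mapping.lookup (i x)"
    let ?t = "\<lambda>w h2. RB.tau (\<lambda>zs. \<beta> (pw w) (\<gamma> h2 # zs)) (e # es')"
    have "\<beta>' x = (\<lambda>es. ev (i x) es)" using x by (simp add: \<beta>'_def fun_eq_iff)
    then have "RB.tau (\<beta>' x) (e # es') = (\<Sum>w\<in>?A. Sw (?k w) (\<lambda>h1 h2. RB.tau (\<lambda>zs. CA.G' h1 (\<beta> (pw w) (\<gamma> h2 # zs))) (e # es')))"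
      unfolding ev_def LT_def T_def by (simp only: RB.tau_sum[OF sub] tau_Sw[OF sub])
    also have "\<dots> = (\<Sum>w\<in>?A. Sw (?k w) (\<lambda>h1 h2. CA.G' h1 (?t w h2)))"
    proof -
      have "RB.tau (\<lambda>zs. CA.G' h (\<psi> zs)) (e # es') = CA.G' h (RB.tau \<psi> (e # es'))" for h \<psi>
        by (rule RB.tau_klin[OF _ _ sub]) (intro lin, simp add: G'_rm)
      then show ?thesis by simp
    qed
    finally have t: "RB.tau (\<beta>' x) (e # es') = \<dots>" .
    have l: "lam e (\<lambda>h. \<beta>' (rP x h) es') = (\<Sum>w\<in>?A. Sw (?k w) (\<lambda>h1 h2. CA.G' h1 (\<beta> (pw w) (\<gamma> h2 \<otimes>\<^bsub>E\<^esub> e # es'))))"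
      using lam_ev[OF es(3), of "i x" es'] x by (simp add: \<beta>'_def rP_in i_act T_def)
    have ac: "u + v = l" if "l + (- u - v) = 0" for l u v :: 'm
    proof -
      have "l + (- u - v) = l - (u + v)" by (simp add: algebra_simps)
      then show ?thesis using that by simp
    qed
    \<comment> \<open>The cocycle condition of \<open>\<beta>\<close> at \<open>gamma(h2)\<close>,
      \<open>e\<close>, \<open>es'\<close>. Under the inverse of \<open>gamma\<close> its right-hand
      side becomes \<open>\<beta>\<close> at \<open>pw w\<close> times the coefficient, by
      \<open>G'_lam\<close>, and the sum over w is \<open>\<beta> x\<close>.\<close>
    have br: "\<beta> (pw w) (\<gamma> h2 \<otimes>\<^bsub>E\<^esub> e # es') + ?t w h2 = lam (\<gamma> h2) (\<lambda>h. \<beta> (rP (pw w) h) (e # es'))" for w h2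
      by (rule ac) (use fun_cong[OF fun_cong[OF h], of "pw w" "\<gamma> h2 # e # es'"] es pw in \<open>simp add: hB_Cons\<close>)
    have "hB p q \<beta>' x es = (\<Sum>w\<in>?A. Sw (?k w) (\<lambda>h1 h2. CA.G' h1 (\<beta> (pw w) (\<gamma> h2 \<otimes>\<^bsub>E\<^esub> e # es') + ?t w h2)))"
    proof -
      have G'a: "CA.G' h (m + m') = CA.G' h m + CA.G' h m'" for h m m' by (rule klin_add[OF klin2D(2)[OF CA.G'_lin]])
      show ?thesis using x es t l by (simp add: hB_Cons G'a Sw_add_fun sum.distrib)
    qed
    also have "\<dots> = (\<Sum>w\<in>?A. \<beta> (rP (pw w) (?k w)) es)"
      unfolding br G'_lam[OF b pw] es(1) ..
    also have "\<dots> = \<beta> (\<Sum>w\<in>?A. rP (pw w) (?k w)) es"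
      using BB_sum[OF b, of "\<lambda>w. rP (pw w) (?k w)" ?A es] pw rP_in by simp
    also have "(\<Sum>w\<in>?A. rP (pw w) (?k w)) = x"
    proof -
      have pa: "\<pi> (F + F') = \<pi> F + \<pi> F'" and pr: "\<pi> (?rF F h) = rP (\<pi> F) h" for F F' h
        using \<pi> by (auto simp: right_hom_def)
      have p0: "\<pi> 0 = 0" using pa[of 0 0] by simp
      have "Poly_Mapping.single w k = ?rF (Poly_Mapping.single w 1) k" for w k
        by (rule poly_mapping_eqI) (simp add: lookup_map_zero lookup_single when_def)
      then have "rP (pw w) k = \<pi> (Poly_Mapping.single w k)" for w k
        by (metis pw_def pr)
      moreover have "\<pi> (\<Sum>w\<in>B. F w) = (\<Sum>w\<in>B. \<pi> (F w))" for B and F :: "'p \<Rightarrow> 'p \<Rightarrow>\<^sub>0 'h"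
        by (induction B rule: infinite_finite_induct) (simp_all add: p0 pa)
      ultimately have "(\<Sum>w\<in>?A. rP (pw w) (?k w)) = \<pi> (\<Sum>w\<in>?A. Poly_Mapping.single w (?k w))" by simp
      then show ?thesis using \<pi>i[OF x] by (simp add: poly_mapping_sum_single[symmetric])
    qed
    finally show ?thesis by simp
  next
    assume n: "\<not> (x \<in> P q \<and> length es = Suc p \<and> set es \<subseteq> carrier E)"
    then show ?thesis unfolding hB_outside[OF n] using BB_off[OF b] RB.HC_zero[OF BB_HC[OF b]] by (cases "x \<in> P q") auto
  qed
  then show ?thesis using in_BB by (intro bexI[of _ \<beta>']) (auto simp: fun_eq_iff)
qed

text \<open>By exactness at \<open>P 0\<close>, the value at x depends only on \<open>g x\<close>.
  For x1 over 1, the element x1 acted on by \<open>g x\<close> has the same image as x, and the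
  coproduct of \<open>g x\<close> in H^R, a modified Delta(1), brings \<open>gamma(g x)\<close> out
  in front.\<close>

lemma col0:
  assumes b: "\<beta> \<in> BB p 0" and v: "vB p 0 \<beta> = 0"
  shows "\<exists>\<phi>\<in>RB.HC p. \<beta> = epsB p \<phi>"
proof -
  obtain x1 where x1: "x1 \<in> P 0" "g x1 = 1" using base_point by blast
  have d0: "\<beta> (d 0 x) es = 0" if "x \<in> P 1" for x es
    using fun_cong[OF fun_cong[OF v], of x es] that sg_sg[of p "\<beta> (d 0 x) es"] by (simp add: vB_def klin_zero[OF sg_klin])
  have dep: "\<beta> x es = \<beta> y es" if xy: "x \<in> P 0" "y \<in> P 0" "g x = g y" for x y es
  proof -
    have "g (x - y) = 0" using xy lin_on_diff(3)[OF vsP vs P_sub g_lin] by simp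
    then obtain z where "z \<in> P 1" "x - y = d 0 z" using ker_g P_closed(5)[OF xy(1,2)] by blast
    then have "\<beta> (x - y) es = 0" using d0 by simp
    then show ?thesis using BB_diff(3)[OF b that(1,2)] by simp
  qed
  note F = BB_klin[OF b x1(1)]
  note lF = lin klin_comp[OF F]
  \<comment> \<open>Acting on x1 with \<open>h\<close> or with \<open>PiR(h)\<close> gives the same
    image \<open>PiR(h)\<close> under g.\<close>
  have P1: "\<beta> (rP x1 (\<Pi>R h)) es = \<beta> (rP x1 h) es" for h es
    by (rule dep) (use x1 in \<open>simp_all add: rP_in g_act PiR_idem\<close>)
  have "\<beta> x es = G (g x) (\<beta> x1 es)" if x: "x \<in> P 0" for x es
  proof -
    let ?y = "g x"
    have y: "\<Pi>R ?y = ?y" by (rule g_PiR[OF x])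
    have "G ?y (\<beta> x1 es) = G ?y (Sw 1 (\<lambda>e1 e2. G e1 (\<beta> (rP x1 e2) es)))" by (simp only: BB_N[OF b x1(1)])
    also have "\<dots> = Sw 1 (\<lambda>e1 e2. G (?y * e1) (\<beta> (rP x1 (\<Pi>R e2)) es))"
      unfolding P1 CA.G_Sw using CA.G_PiR_left[of ?y] y by simp
    also have "\<dots> = Sw ?y (\<lambda>a b. G a (\<beta> (rP x1 (\<Pi>R b)) es))"
      by (rule Sw_PiR_right[OF RB.vsM, symmetric, where T="\<lambda>a b. G a (\<beta> (rP x1 b) es)"]) (intro lF)
    also have "\<dots> = Sw (\<Pi>R ?y) (\<lambda>a b. G a (\<beta> (rP x1 (\<Pi>R b)) es))" unfolding y ..
    also have "\<dots> = Sw 1 (\<lambda>e1 e2. G e1 (\<beta> (rP x1 (\<Pi>R (\<Pi>R ?y * e2))) es))"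
      by (rule Sw_PiR(2)[OF RB.vsM]) (intro lF)
    also have "\<dots> = Sw 1 (\<lambda>e1 e2. G e1 (\<beta> (rP (rP x1 ?y) e2) es))"
      unfolding P1 y rP_mult[OF x1(1)] ..
    also have "\<dots> = \<beta> (rP x1 ?y) es" by (rule BB_N[OF b rP_in[OF x1(1)]])
    also have "\<dots> = \<beta> x es" by (rule dep) (use x x1 y in \<open>simp_all add: rP_in g_act\<close>)
    finally show ?thesis by simp
  qed
  then have "\<beta> = epsB p (\<beta> x1)" using BB_off[OF b] by (auto simp: fun_eq_iff epsB_def)
  then show ?thesis using BB_HC[OF b x1(1)] by blast
qed

text \<open>A linear section of d need not respect H, so the averaging condition can fail for its
  composite with \<open>\<beta>\<close>. The average satisfies it and keeps the required values on
  the image of d: there the section may be dropped, and averaging fixes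
  \<open>\<beta>\<close>.\<close>

lemma col:
  assumes b: "\<beta> \<in> BB p (Suc q)" and v: "vB p (Suc q) \<beta> = 0"
  shows "\<exists>\<beta>'\<in>BB p q. \<beta> = vB p q \<beta>'"
proof -
  interpret vector_space sM by (rule RB.vsM)
  have d0: "\<beta> (d (Suc q) x) es = 0" if "x \<in> P (Suc (Suc q))" for x es
    using fun_cong[OF fun_cong[OF v], of x es] that sg_sg[of p "\<beta> (d (Suc q) x) es"] by (simp add: vB_def klin_zero[OF sg_klin])
  obtain \<sigma> where \<sigma>: "\<And>z. \<sigma> z \<in> P (Suc q)" "klin sP sP \<sigma>" "\<And>x. x \<in> P (Suc q) \<Longrightarrow> d q (\<sigma> (d q x)) = d q x"
    using linear_section[OF vsP vsP P_sub d_lin[of q]] by blast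
  \<comment> \<open>The two arguments differ by a kernel element of d, hence by an element of the
    next image, where \<open>\<beta>\<close> vanishes.\<close>
  have dep: "\<beta> (\<sigma> (d q x)) es = \<beta> x es" if x: "x \<in> P (Suc q)" for x es
  proof -
    have "d q (\<sigma> (d q x) - x) = 0" using lin_on_diff(3)[OF vsP vsP P_sub d_lin \<sigma>(1) x] \<sigma>(3)[OF x] by simp
    then obtain z where "z \<in> P (Suc (Suc q))" "\<sigma> (d q x) - x = d (Suc q) z" using ker_d[of q] P_closed(5)[OF \<sigma>(1) x] by blast
    then have "\<beta> (\<sigma> (d q x) - x) es = 0" using d0 by simp
    then show ?thesis using BB_diff(3)[OF b \<sigma>(1) x] by simp
  qed
  define F where "F x es h = \<beta> (\<sigma> (rP x h)) es" for x es h
  have F: "klin sH sM (F x es)" if x: "x \<in> P q" for x es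
    unfolding F_def using rP_klin[OF x]
    by (intro klinI) (simp_all add: klin_add klin_scale[of sH sP] klin_add[OF \<sigma>(2)] klin_scale[OF \<sigma>(2)] BB_add[OF b] BB_scale[OF b] \<sigma>(1))
  have F_act: "F (rP x k) es = (\<lambda>h. F x es (k * h))" if "x \<in> P q" for x k es
    by (simp add: F_def fun_eq_iff rP_mult[OF that])
  define A where "A x es = Sw 1 (\<lambda>e1 e2. G e1 (F x es e2))" for x es
  have A_lam: "A x es = lam \<one>\<^bsub>E\<^esub> (F x es)" if "x \<in> P q" for x es
    unfolding A_def by (rule lam_one[OF F[OF that], symmetric])
  define \<beta>' where "\<beta>' x es = (if x \<in> P q then sg p (A x es) else 0)" for x es
  have HC: "A x \<in> RB.HC p" if x: "x \<in> P q" for x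
  proof (rule RB.HC_I)
    note hc = BB_HC[OF b \<sigma>(1)]
    have "RB.RC p (\<lambda>es. A x es)"
      unfolding A_def F_def by (rule RC_Sw, rule RB.RC_map[OF RB.HC_RC[OF hc] RB.lm_lin]) (simp_all add: RB.lm_rm)
    then show "RB.RC p (A x)" .
    show "A x xs = 0" if "\<not> (length xs = p \<and> set xs \<subseteq> carrier E)" for xs
      using RB.HC_zero[OF hc that] by (simp add: A_def F_def G_zero Sw_zero_fun)
    show "A x (c \<otimes>\<^bsub>E\<^esub> y # ys) = lm c (A x (y # ys))"
      if s: "Suc (length ys) = p" "c \<in> K" "y \<in> carrier E" "set ys \<subseteq> carrier E" for c y ys
    proof -
      obtain a where a: "c = j a" using s by auto
      have "F x (c \<otimes>\<^bsub>E\<^esub> y # ys) h = J a (F x (y # ys) h)" for h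
        using RB.HC_left[OF hc s] a by (simp add: F_def)
      then show ?thesis unfolding A_def a J_average[OF F[OF x], symmetric] by simp
    qed
    show "lm c (A x []) = rm (A x []) c" if s: "p = 0" "c \<in> K" for c
    proof -
      obtain a where a: "c = j a" using s by auto
      have "J a (F x [] h) = rm (F x [] h) c" for h
        using RB.HC_cent[of "\<beta> (\<sigma> (rP x h))" c] hc s a by (simp add: F_def)
      then show ?thesis unfolding A_def using J_average[OF F[OF x], of a "[]"] a by (simp add: rm_Sw RB.lm_rm)
    qed
  qed
  have "\<beta>' \<in> BB p q"
    unfolding BB_def mem_Collect_eq
  proof (intro conjI ballI allI impI)
    fix x es
    show "x \<notin> P q \<Longrightarrow> \<beta>' x = (\<lambda>_. 0)" by (simp add: \<beta>'_def fun_eq_iff)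
    assume x: "x \<in> P q"
    have "\<beta>' x = (\<lambda>es. sg p (A x es))" using x by (simp add: \<beta>'_def fun_eq_iff)
    moreover have "(\<lambda>es. sg p (A x es)) \<in> RB.HC p"
      by (rule RB.HC_map[OF HC[OF x] sg_klin]) (simp_all add: sg_def klin_minus[OF RB.lm_lin] klin_minus[OF RB.rm_lin] RB.K_in)
    ultimately show "\<beta>' x \<in> RB.HC p" by simp
    show "\<beta>' (x + y) es = \<beta>' x es + \<beta>' y es" if y: "y \<in> P q" for y
    proof -
      have "F (x + y) es h = F x es h + F y es h" for h
        by (simp add: F_def rP_add[OF x y] klin_add[OF \<sigma>(2)] BB_add[OF b] \<sigma>(1))
      then show ?thesis using x y by (simp add: \<beta>'_def A_def P_closed klin_add[OF RB.lm_lin] Sw_add_fun klin_add[OF sg_klin])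
    qed
    show "\<beta>' (sP c x) es = sM c (\<beta>' x es)" for c
    proof -
      have "F (sP c x) es h = sM c (F x es h)" for h
        by (simp add: F_def rP_scale[OF x] klin_scale[OF \<sigma>(2)] BB_scale[OF b] \<sigma>(1))
      then have "A (sP c x) es = sM c (A x es)"
        by (simp add: A_def klin_scale[OF RB.lm_lin] Sw_pull[OF klin_scale_right[OF RB.vsM klin_id]])
      then show ?thesis using x by (simp add: \<beta>'_def P_closed klin_scale[OF sg_klin])
    qed
    have k: "klin sH sM (\<lambda>h. lam \<one>\<^bsub>E\<^esub> (\<lambda>l. F x es (h * l)))"
      by (rule lam_klin_fun) (intro lin klin_comp[OF F[OF x]])
    have "Sw 1 (\<lambda>e1 e2. G e1 (A (rP x e2) es)) = lam \<one>\<^bsub>E\<^esub> (\<lambda>h. lam \<one>\<^bsub>E\<^esub> (\<lambda>l. F x es (h * l)))"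
      unfolding lam_one[OF k] using x by (simp add: A_lam rP_in F_act)
    \<comment> \<open>Averaging is idempotent, because it is the operator of 1 and
      \<open>1 1 = 1\<close>.\<close>
    also have "\<dots> = A x es"
      unfolding lam_mult[OF F[OF x] E_closed(4) E_closed(4), symmetric] E_one[OF E_closed(4)] A_lam[OF x] ..
    finally have "Sw 1 (\<lambda>e1 e2. G e1 (A (rP x e2) es)) = A x es" .
    then show "Sw 1 (\<lambda>e1 e2. G e1 (\<beta>' (rP x e2) es)) = \<beta>' x es"
      using x by (simp add: \<beta>'_def rP_in sg_commute[OF RB.lm_lin] Sw_pull[OF sg_klin, symmetric])
  qed
  moreover have "\<beta> x es = vB p q \<beta>' x es" for x es
  proof (cases "x \<in> P (Suc q)")
    case True
    have "F (d q x) es h = \<beta> (rP x h) es" for h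
      using dep[OF rP_in[OF True]] by (simp add: F_def d_act[OF True])
    then have "A (d q x) es = \<beta> x es" using BB_N[OF b True] by (simp add: A_def)
    then show ?thesis using True by (simp add: vB_def \<beta>'_def d_in sg_sg)
  qed (simp add: vB_def BB_off[OF b])
  ultimately show ?thesis by (intro bexI[of _ \<beta>']) (auto simp: fun_eq_iff)
qed

lemma hochschild_iso: "cohomology_iso (fun_scale sM) RB.HC (hochschild_diff E sM lm rm) (fun_scale sM) XX (hom_diff P d) n"
proof -
  interpret vector_space sM by (rule RB.vsM)
  interpret exact_bicomplex "\<lambda>c \<beta> x es. sM c (\<beta> x es)" BB hB vB "fun_scale sM" XX "hom_diff P d" etaB
      "fun_scale sM" RB.HC "hochschild_diff E sM lm rm" epsB
  proof (rule exact_bicomplex.intro)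
    show "lin_on (fun_scale sM) (\<lambda>c \<beta> x es. sM c (\<beta> x es)) (XX n) (etaB n)" for n
      by (auto simp: lin_on_def etaB_def fun_eq_iff fun_scale_def)
    show "lin_on (fun_scale sM) (\<lambda>c \<beta> x es. sM c (\<beta> x es)) (RB.HC n) (epsB n)" for n
      by (auto simp: lin_on_def epsB_def fun_eq_iff fun_scale_def klin_add[OF RB.lm_lin] klin_scale[OF RB.lm_lin])
    show "lin_on (fun_scale sM) (fun_scale sM) (XX n) (hom_diff P d n)" for n
      by (auto simp: lin_on_def hom_diff_def fun_eq_iff fun_scale_def)
    show "lin_on (fun_scale sM) (fun_scale sM) (RB.HC n) (hochschild_diff E sM lm rm n)" for n
    proof -
      have t: "RB.tau (fun_scale sM c \<phi>) xs = sM c (RB.tau \<phi> xs)" if "set xs \<subseteq> carrier E" for c \<phi> xs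
        using RB.tau_klin[OF klin_scale_right[OF RB.vsM klin_id] _ that, of c \<phi>]
        by (simp add: fun_scale_def[abs_def] klin_scale[OF RB.rm_lin])
      have t': "RB.tau (\<phi> + \<psi>) xs = RB.tau \<phi> xs + RB.tau \<psi> xs" if "set xs \<subseteq> carrier E" for \<phi> \<psi> xs
        using RB.tau_add[OF that, of \<phi> \<psi>] by (simp add: plus_fun_def)
      have hd: "hd xs \<in> carrier E" if "length xs = Suc n" "set xs \<subseteq> carrier E" for xs
        using that by (cases xs) auto
      show ?thesis unfolding RB.hochschild_diff_with lin_on_def
        by (auto simp: fun_eq_iff RB.diff_with_def t t' hd fun_scale_def klin_add[OF RB.lm_lin] klin_scale[OF RB.lm_lin] scale_right_distrib)
    qed
  qed ((rule vsB vs_fun_scale BB_sub XX_sub HC_sub hB_lin vB_lin hB_in vB_in etaB_in epsB_in etaB_inj epsB_inj hom_diff_in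
        RB.hochschild_diff_in hB_etaB vB_epsB vB_etaB hB_epsB hB_hB vB_vB hB_vB row0 row col0 col; assumption)+)
  show ?thesis by (rule cohomology_iso_edges)
qed

end

theorem mainTheorem7:
  fixes sH :: "'k::field \<Rightarrow> 'h::{ring,monoid_mult} \<Rightarrow> 'h"
    and \<Delta> :: "'h \<Rightarrow> ('h \<times> 'h) list set"
    and \<epsilon> :: "'h \<Rightarrow> 'k"
    and S :: "'h \<Rightarrow> 'h"
    and sA :: "'k \<Rightarrow> 'a::{ring,monoid_mult} \<Rightarrow> 'a"
    and act :: "'h \<Rightarrow> 'a \<Rightarrow> 'a"
    and f finv :: "'h \<Rightarrow> 'h \<Rightarrow> 'a"
    and E :: "('k, ('a \<times> 'h) list set) module"
    and K :: "('a \<times> 'h) list set set"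
    and sM :: "'k \<Rightarrow> 'm::ab_group_add \<Rightarrow> 'm"
    and lm :: "('a \<times> 'h) list set \<Rightarrow> 'm \<Rightarrow> 'm"
    and rm :: "'m \<Rightarrow> ('a \<times> 'h) list set \<Rightarrow> 'm"
    and MK :: "'m set"
    and rMK :: "'m \<Rightarrow> 'h \<Rightarrow> 'm"
    and sP :: "'k \<Rightarrow> 'p::ab_group_add \<Rightarrow> 'p"
    and P :: "nat \<Rightarrow> 'p set"
    and rP :: "'p \<Rightarrow> 'h \<Rightarrow> 'p"
    and d :: "nat \<Rightarrow> 'p \<Rightarrow> 'p"
    and g :: "'p \<Rightarrow> 'h"
  assumes H: "weak_hopf_algebra sH \<Delta> \<epsilon> S"
    and A: "weak_module_algebra sH \<Delta> sA act"
    and f: "cocycle_conditions sH \<Delta> sA act f"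
    and f_inv: "convolution_inverse sH \<Delta> sA act f finv"
    and E: "E = crossed_product sH \<Delta> sA act f"
    and K: "K = range (jnu sH \<Delta> sA act)"
    and M: "bimodule E sM lm rm"
    and MK: "MK = centralizer K lm rm"
    and rMK: "rMK = M_action sH \<Delta> S sA act f finv lm rm"
    and P: "projective_resolution sH sP P rP d g
              sH (range (PiR sH \<Delta> \<epsilon>)) (HR_action sH \<Delta> \<epsilon>)"
  shows "right_module sH sM MK rMK
    \<and> (\<forall>n. cohomology_iso
          (fun_scale sM) (hochschild_cochains E K lm rm) (hochschild_diff E sM lm rm)
          (fun_scale sM) (hom_cochains sP P rP sM MK rMK) (hom_diff P d) n)"
proof -
  interpret crossed_resolution sH \<Delta> \<epsilon> S sA act f finv sM lm rm sP P rP d g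
    using H A f f_inv M P unfolding E
    by (intro crossed_resolution.intro crossed_bimodule.intro weak_cocycle.intro weak_cocycle_axioms.intro
        crossed_bimodule_axioms.intro crossed_resolution_axioms.intro)
  show ?thesis unfolding E K MK rMK using right_module_MK hochschild_iso by blast
qed

end
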